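(* Assume that: (i) for each $i\in\mathbb{Z}_+$ there is a positive constant $L_i$ such that $|b(x,i)-b(y,i)|+|\sigma(x,i)-\sigma(y,i)|\le L_i|x-y|$ for all $x,y\in\mathbb{R}^n$; (ii) $q_{ij}(\phi)$ is measurable in $\phi\in\mathcal{C}$ for all $i,j\in\mathbb{Z}_+$, $i\neq j$, and $M:=\sup_{\phi\in\mathcal{C},\,i\in\mathbb{Z}_+} q_i(\phi)<\infty$. Then for each initial data $(\xi,i_0)$ (a $\mathcal{C}\times\mathbb{Z}_+$-valued, $\mathcal{F}_0$-measurable random variable) there exists a unique strong solution $(X(t),\alpha(t))$, $t\ge 0$, with initial data $(\xi,i_0)$ to $$dX(t)=b(X(t),\alpha(t))\,dt+\sigma(X(t),\alpha(t))\,dW(t),\qquad d\alpha(t)=\int_{\mathbb{R}}h(X_t,\alpha(t-),z)\,\mathfrak{p}(dt,dz).$$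
   Context: Fix $r>0$ and positive integers $n,d$. $\mathbb{Z}_+=\{1,2,\dots\}$; $\mathcal{C}=C([-r,0],\mathbb{R}^n)$ is the space of continuous functions with $\|\phi\|=\sup_{t\in[-r,0]}|\phi(t)|$. For a continuous $y:[-r,\infty)\to\mathbb{R}^n$ and $t\ge0$, $y_t\in\mathcal{C}$ is the segment $y_t(s)=y(t+s)$, $s\in[-r,0]$. $(\Omega,\mathcal{F},\{\mathcal{F}_t\}_{t\ge0},\mathbb{P})$ is a complete filtered probability space satisfying the usual conditions, $W$ is an $\mathbb{R}^d$-valued $\mathcal{F}_t$-Brownian motion, and $\mathfrak{p}(dt,dz)$ is an $\mathcal{F}_t$-Poisson random measure on $[0,\infty)\times\mathbb{R}$ with intensity $dt\times\mathfrak{m}(dz)$, $\mathfrak{m}$ being Lebesgue measure, independent of $W$. (Both are adapted, with increments after time $t$ independent of $\mathcal{F}_t$.) The coefficients are $b:\mathbb{R}^n\times\mathbb{Z}_+\to\mathbb{R}^n$, $\sigma:\mathbb{R}^n\times\mathbb{Z}_+\to\mathbb{R}^{n\times d}$. The switching intensities are functions $q_{ij}:\mathcal{C}\to[0,\infty)$, $i\ne j$, with $q_i(\phi):=\sum_{j\ne i}q_{ij}(\phi)$. For $i\in\mathbb{Z}_+$ and $j\neq i$ let $\Delta_{ij}(\phi)=\Big[\sum_{k=1,k\ne i}^{j-1}q_{ik}(\phi),\ \sum_{k=1,k\ne i}^{j}q_{ik}(\phi)\Big)$ (consecutive left-closed right-open intervals starting at $0$, of lengths $q_{ij}(\phi)$),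 and $h(\phi,i,z)=\sum_{j\ne i}(j-i)\mathbf{1}_{\{z\in\Delta_{ij}(\phi)\}}$. A strong solution on $[0,T]$ with initial data $(\xi,i_0)$ is an $\mathcal{F}_t$-adapted process $(X(t),\alpha(t))$, with values in $\mathbb{R}^n\times\mathbb{Z}_+$, such that a.s. $X$ is continuous, $\alpha$ is cadlag, $X(t)=\xi(t)$ for $t\in[-r,0]$, $\alpha(0)=i_0$, and the system holds for all $t\in[0,T]$. A solution for $t\ge0$ is one on $[0,T]$ for every $T>0$; uniqueness is pathwise (up to indistinguishability). *)

theory Defs
  imports "HOL-Probability.Probability"
begin

section \<open>Filtered probability spaces and the driving noise\<close>

text \<open>
  Time is the half-line \<open>t \<ge> 0\<close> inside the type \<^typ>\<open>real\<close>; nothing is assumed about \<open>F t\<close>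
  or \<open>W t\<close> for negative \<open>t\<close>.
\<close>

definition usual_conditions :: "'a measure \<Rightarrow> (real \<Rightarrow> 'a measure) \<Rightarrow> bool" where
  "usual_conditions P F \<longleftrightarrow>
     prob_space P \<and> complete_measure P \<and>
     filtration (space P) (\<lambda>t. F (max 0 t)) \<and>
     (\<forall>t\<ge>0. subalgebra P (F t)) \<and>
     null_sets P \<subseteq> sets (F 0) \<and>
     (\<forall>t\<ge>0. sets (F t) = (\<Inter>s\<in>{t<..}. sets (F s)))"

definition generated_sets ::
  "'a set \<Rightarrow> ('i \<Rightarrow> 'a \<Rightarrow> 'b::topological_space) \<Rightarrow> 'i set \<Rightarrow> 'a set set" where
  "generated_sets \<Omega> Z I = sigma_sets \<Omega> {Z i -` A \<inter> \<Omega> | i A. i \<in> I \<and> A \<in> sets borel}"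

definition brownian_motion ::
  "'a measure \<Rightarrow> (real \<Rightarrow> 'a measure) \<Rightarrow> (real \<Rightarrow> 'a \<Rightarrow> real ^ 'd) \<Rightarrow> bool" where
  "brownian_motion P F W \<longleftrightarrow>
     (\<forall>t\<ge>0. W t \<in> borel_measurable (F t)) \<and>
     (AE \<omega> in P. W 0 \<omega> = 0) \<and>
     (AE \<omega> in P. continuous_on {0..} (\<lambda>t. W t \<omega>)) \<and>
     (\<forall>s t. 0 \<le> s \<and> s < t \<longrightarrow>
        distributed P lborel (\<lambda>\<omega>. W t \<omega> - W s \<omega>)
          (\<lambda>x. ennreal (\<Prod>k\<in>UNIV. normal_density 0 (sqrt (t - s)) (x $ k)))) \<and>
     (\<forall>t\<ge>0. prob_space.indep_set P (sets (F t))
        (generated_sets (space P) (\<lambda>u \<omega>. W u \<omega> - W t \<omega>) {t..}))"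

text \<open>
  Only sets of finite intensity need a Poisson law: a set of infinite intensity is a countable disjoint
  union of such sets, so independence forces its mass to be \<open>\<infinity>\<close> almost surely.
\<close>

definition poisson_random_measure ::
  "'a measure \<Rightarrow> 'b measure \<Rightarrow> ('a \<Rightarrow> 'b measure) \<Rightarrow> bool" where
  "poisson_random_measure P I p \<longleftrightarrow>
     (\<forall>\<omega>\<in>space P. sets (p \<omega>) = sets I) \<and>
     (\<forall>B\<in>sets I. (\<lambda>\<omega>. emeasure (p \<omega>) B) \<in> borel_measurable P) \<and>
     (AE \<omega> in P. \<forall>B\<in>sets I. emeasure (p \<omega>) B \<in> insert \<infinity> (range of_nat)) \<and>
     (\<forall>B\<in>sets I. emeasure I B < \<infinity> \<longrightarrow>
        (\<forall>k::nat. measure P {\<omega>\<in>space P. emeasure (p \<omega>) B = of_nat k}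
           = measure I B ^ k / fact k * exp (- measure I B))) \<and>
     (\<forall>(m::nat) B. (\<forall>j<m. B j \<in> sets I) \<and> disjoint_family_on B {..<m} \<longrightarrow>
        prob_space.indep_vars P (\<lambda>_. borel) (\<lambda>j \<omega>. emeasure (p \<omega>) (B j)) {..<m})"

text \<open>The measure \<open>dt \<times> dz\<close> on \<open>[0,\<infinity>) \<times> \<real>\<close>.\<close>

definition jump_intensity :: "(real \<times> real) measure" where
  "jump_intensity = restrict_space (lborel \<Otimes>\<^sub>M lborel) ({0..} \<times> UNIV)"

definition adapted_poisson_random_measure ::
  "'a measure \<Rightarrow> (real \<Rightarrow> 'a measure) \<Rightarrow> ('a \<Rightarrow> (real \<times> real) measure) \<Rightarrow> bool" where
  "adapted_poisson_random_measure P F p \<longleftrightarrow>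
     poisson_random_measure P jump_intensity p \<and>
     (\<forall>t\<ge>0. \<forall>B\<in>sets jump_intensity. B \<subseteq> {0..t} \<times> UNIV \<longrightarrow>
        (\<lambda>\<omega>. emeasure (p \<omega>) B) \<in> borel_measurable (F t)) \<and>
     (\<forall>t\<ge>0. prob_space.indep_set P (sets (F t))
        (generated_sets (space P) (\<lambda>B \<omega>. emeasure (p \<omega>) B)
           {B \<in> sets jump_intensity. B \<subseteq> {t<..} \<times> UNIV}))"

definition independent_noises ::
  "'a measure \<Rightarrow> (real \<Rightarrow> 'a \<Rightarrow> real ^ 'd) \<Rightarrow> ('a \<Rightarrow> (real \<times> real) measure) \<Rightarrow> bool" where
  "independent_noises P W p \<longleftrightarrow>
     prob_space.indep_set P
       (generated_sets (space P) W {0..})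
       (generated_sets (space P) (\<lambda>B \<omega>. emeasure (p \<omega>) B) (sets jump_intensity))"

section \<open>The Ito integral\<close>

text \<open>
  A simple process is \<open>\<Sum>j<m. \<eta> j \<cdot> 1(\<tau> j, \<tau> (j+1)]\<close> with \<open>\<eta> j\<close> bounded and
  \<open>F (\<tau> j)\<close>-measurable; it takes \<open>n \<times> d\<close> matrices as values.
\<close>

definition simple_process ::
  "'a measure \<Rightarrow> (real \<Rightarrow> 'a measure) \<Rightarrow> nat \<Rightarrow> (nat \<Rightarrow> real) \<Rightarrow> (nat \<Rightarrow> 'a \<Rightarrow> real ^ 'd ^ 'n) \<Rightarrow> bool"
  where
  "simple_process P F m \<tau> \<eta> \<longleftrightarrow>
     0 \<le> \<tau> 0 \<and> (\<forall>j<m. \<tau> j < \<tau> (Suc j)) \<and>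
     (\<forall>j<m. \<eta> j \<in> borel_measurable (F (\<tau> j)) \<and> bounded (\<eta> j ` space P))"

definition simple_value ::
  "nat \<Rightarrow> (nat \<Rightarrow> real) \<Rightarrow> (nat \<Rightarrow> 'a \<Rightarrow> real ^ 'd ^ 'n) \<Rightarrow> real \<Rightarrow> 'a \<Rightarrow> real ^ 'd ^ 'n" where
  "simple_value m \<tau> \<eta> s \<omega> = (\<Sum>j<m. indicator {\<tau> j<..\<tau> (Suc j)} s *\<^sub>R \<eta> j \<omega>)"

definition simple_integral ::
  "(real \<Rightarrow> 'a \<Rightarrow> real ^ 'd) \<Rightarrow> nat \<Rightarrow> (nat \<Rightarrow> real) \<Rightarrow> (nat \<Rightarrow> 'a \<Rightarrow> real ^ 'd ^ 'n)
     \<Rightarrow> real \<Rightarrow> 'a \<Rightarrow> real ^ 'n" where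
  "simple_integral W m \<tau> \<eta> t \<omega> =
     (\<Sum>j<m. \<eta> j \<omega> *v (W (min t (\<tau> (Suc j))) \<omega> - W (min t (\<tau> j)) \<omega>))"

text \<open>
  Measurability is part of the definition because \<^const>\<open>measure\<close> is \<open>0\<close> on non-measurable sets.
\<close>

definition tends_to_zero_in_probability ::
  "'a measure \<Rightarrow> (nat \<Rightarrow> 'a \<Rightarrow> ennreal) \<Rightarrow> bool" where
  "tends_to_zero_in_probability P Z \<longleftrightarrow>
     (\<forall>k. Z k \<in> borel_measurable P) \<and>
     (\<forall>\<epsilon>>0. (\<lambda>k. measure P {\<omega>\<in>space P. Z k \<omega> > ennreal \<epsilon>}) \<longlonglongrightarrow> 0)"

text \<open>
  \<open>Y\<close> is the process \<open>\<integral>\<^sub>0\<^sup>t H(s) dW(s)\<close>, \<open>0 \<le> t \<le> T\<close>, for an adapted integrand \<open>H\<close> with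
  \<open>\<integral>\<^sub>0\<^sup>T |H(s)|\<^sup>2 ds < \<infinity>\<close> almost surely: \<open>H\<close> is approximated by simple processes with respect to
  \<open>\<integral>\<^sub>0\<^sup>T |\<cdot>|\<^sup>2 ds\<close> in probability, and their integrals converge to \<open>Y\<close> uniformly on
  \<open>[0,T]\<close> in probability. The integral is only determined up to indistinguishability, hence the
  relational form. The norm of \<^typ>\<open>real ^ 'd ^ 'n\<close> is the Frobenius norm.
\<close>

definition ito_integral_on ::
  "'a measure \<Rightarrow> (real \<Rightarrow> 'a measure) \<Rightarrow> (real \<Rightarrow> 'a \<Rightarrow> real ^ 'd) \<Rightarrow> real
     \<Rightarrow> (real \<Rightarrow> 'a \<Rightarrow> real ^ 'd ^ 'n) \<Rightarrow> (real \<Rightarrow> 'a \<Rightarrow> real ^ 'n) \<Rightarrow> bool" where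
  "ito_integral_on P F W T H Y \<longleftrightarrow>
     (\<forall>t\<in>{0..T}. H t \<in> borel_measurable (F t)) \<and>
     (AE \<omega> in P. set_borel_measurable lborel {0..T} (\<lambda>s. H s \<omega>) \<and>
        (\<integral>\<^sup>+s\<in>{0..T}. ennreal ((norm (H s \<omega>))\<^sup>2) \<partial>lborel) < \<infinity>) \<and>
     (\<forall>t\<in>{0..T}. Y t \<in> borel_measurable (F t)) \<and>
     (AE \<omega> in P. continuous_on {0..T} (\<lambda>t. Y t \<omega>)) \<and>
     (\<exists>m \<tau> \<eta>.
        (\<forall>k. simple_process P F (m k) (\<tau> k) (\<eta> k)) \<and>
        tends_to_zero_in_probability P
          (\<lambda>k \<omega>. \<integral>\<^sup>+s\<in>{0..T}.
             ennreal ((norm (simple_value (m k) (\<tau> k) (\<eta> k) s \<omega> - H s \<omega>))\<^sup>2) \<partial>lborel) \<and>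
        tends_to_zero_in_probability P
          (\<lambda>k \<omega>. SUP t\<in>{0..T}.
             ennreal (norm (simple_integral W (m k) (\<tau> k) (\<eta> k) t \<omega> - Y t \<omega>))))"

section \<open>Segments and switching intensities\<close>

text \<open>
  \<open>C([-r,0], \<real>\<^sup>n)\<close> with the supremum metric; its elements are extensional functions, i.e. equal to
  \<^const>\<open>undefined\<close> off \<open>[-r,0]\<close>.
\<close>

definition path_space :: "real \<Rightarrow> (real \<Rightarrow> real ^ 'n) metric" where
  "path_space r = cfunspace (top_of_set {-r..0}) euclidean_metric"

definition path_borel :: "real \<Rightarrow> (real \<Rightarrow> real ^ 'n) measure" where
  "path_borel r = sigma (mspace (path_space r)) {U. openin (mtopology_of (path_space r)) U}"

lemma mspace_path_space:
  "mspace (path_space r) = {\<phi> \<in> extensional {-r..0}. continuous_on {-r..0} \<phi>}"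
  by (auto simp: path_space_def intro!: compact_imp_bounded compact_continuous_image)

lemma mdist_path_space:
  assumes "r \<ge> 0" "\<phi> \<in> mspace (path_space r)" "\<psi> \<in> mspace (path_space r)"
  shows "mdist (path_space r) \<phi> \<psi> = (SUP s\<in>{-r..0}. norm (\<phi> s - \<psi> s))"
proof -
  have "\<phi> \<in> Metric_space.fspace UNIV dist {-r..0}" "\<psi> \<in> Metric_space.fspace UNIV dist {-r..0}"
    using assms by (auto simp: path_space_def Met_TC.fspace_def)
  then show ?thesis
    using assms(1) by (simp add: path_space_def cfunspace_def Met_TC.fdist_def dist_norm)
qed

definition segment :: "real \<Rightarrow> (real \<Rightarrow> real ^ 'n) \<Rightarrow> real \<Rightarrow> (real \<Rightarrow> real ^ 'n)" where
  "segment r y t = restrict (\<lambda>s. y (t + s)) {-r..0}"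

text \<open>
  The set of positive integers is \<open>{1..} :: nat set\<close>; values of \<open>q\<close> and of the coefficients at
  index \<open>0\<close> play no role.
\<close>

type_synonym 'n intensities = "nat \<Rightarrow> nat \<Rightarrow> (real \<Rightarrow> real ^ 'n) \<Rightarrow> real"

definition total_rate :: "'n intensities \<Rightarrow> nat \<Rightarrow> (real \<Rightarrow> real ^ 'n) \<Rightarrow> ennreal" where
  "total_rate q i \<phi> = (\<Sum>\<^sub>\<infinity>j\<in>{1..} - {i}. ennreal (q i j \<phi>))"

definition switch_interval :: "'n intensities \<Rightarrow> nat \<Rightarrow> nat \<Rightarrow> (real \<Rightarrow> real ^ 'n) \<Rightarrow> real set" where
  "switch_interval q i j \<phi> =
     {(\<Sum>k\<in>{1..<j} - {i}. q i k \<phi>) ..< (\<Sum>k\<in>{1..j} - {i}. q i k \<phi>)}"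

text \<open>The intervals are pairwise disjoint, so at most one term of the sum is nonzero.\<close>

definition jump_height :: "'n intensities \<Rightarrow> (real \<Rightarrow> real ^ 'n) \<Rightarrow> nat \<Rightarrow> real \<Rightarrow> real" where
  "jump_height q \<phi> i z =
     (\<Sum>\<^sub>\<infinity>j\<in>{1..} - {i}. (real j - real i) * indicator (switch_interval q i j \<phi>) z)"

section \<open>Strong solutions\<close>

definition left_limit :: "(real \<Rightarrow> 'b::t2_space) \<Rightarrow> real \<Rightarrow> 'b" where
  "left_limit f t = Lim (at_left t) f"

definition cadlag_on :: "real \<Rightarrow> (real \<Rightarrow> 'b::t2_space) \<Rightarrow> bool" where
  "cadlag_on T f \<longleftrightarrow>
     (\<forall>t\<in>{0..<T}. (f \<longlongrightarrow> f t) (at_right t)) \<and>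
     (\<forall>t\<in>{0<..T}. \<exists>l. (f \<longlongrightarrow> l) (at_left t))"

text \<open>
  The Bochner integral is \<open>0\<close> for non-integrable functions, hence the explicit integrability
  requirements.
\<close>

definition strong_solution_on ::
  "'a measure \<Rightarrow> (real \<Rightarrow> 'a measure) \<Rightarrow> (real \<Rightarrow> 'a \<Rightarrow> real ^ 'd) \<Rightarrow> ('a \<Rightarrow> (real \<times> real) measure)
     \<Rightarrow> real \<Rightarrow> (real ^ 'n \<Rightarrow> nat \<Rightarrow> real ^ 'n) \<Rightarrow> (real ^ 'n \<Rightarrow> nat \<Rightarrow> real ^ 'd ^ 'n) \<Rightarrow> 'n intensities
     \<Rightarrow> ('a \<Rightarrow> real \<Rightarrow> real ^ 'n) \<Rightarrow> ('a \<Rightarrow> nat)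
     \<Rightarrow> real \<Rightarrow> (real \<Rightarrow> 'a \<Rightarrow> real ^ 'n) \<Rightarrow> (real \<Rightarrow> 'a \<Rightarrow> nat) \<Rightarrow> bool" where
  "strong_solution_on P F W p r b \<sigma> q \<xi> i\<^sub>0 T X \<alpha> \<longleftrightarrow>
     (\<forall>t\<in>{0..T}. X t \<in> borel_measurable (F t)) \<and>
     (\<forall>t\<in>{0..T}. \<alpha> t \<in> measurable (F t) (count_space {1..})) \<and>
     (AE \<omega> in P. continuous_on {-r..T} (\<lambda>t. X t \<omega>)) \<and>
     (AE \<omega> in P. cadlag_on T (\<lambda>t. \<alpha> t \<omega>)) \<and>
     (AE \<omega> in P. \<forall>t\<in>{-r..0}. X t \<omega> = \<xi> \<omega> t) \<and>
     (AE \<omega> in P. \<alpha> 0 \<omega> = i\<^sub>0 \<omega>) \<and>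
     (AE \<omega> in P. set_integrable lborel {0..T} (\<lambda>s. b (X s \<omega>) (\<alpha> s \<omega>))) \<and>
     (\<exists>Y. ito_integral_on P F W T (\<lambda>s \<omega>. \<sigma> (X s \<omega>) (\<alpha> s \<omega>)) Y \<and>
        (AE \<omega> in P. \<forall>t\<in>{0..T}.
           X t \<omega> = X 0 \<omega> + (LINT s:{0..t}|lborel. b (X s \<omega>) (\<alpha> s \<omega>)) + Y t \<omega>)) \<and>
     (AE \<omega> in P.
        let g = (\<lambda>(s, z). jump_height q (segment r (\<lambda>u. X u \<omega>) s) (left_limit (\<lambda>u. \<alpha> u \<omega>) s) z)
        in set_integrable (p \<omega>) ({0<..T} \<times> UNIV) g \<and>
           (\<forall>t\<in>{0..T}. real (\<alpha> t \<omega>) = real (\<alpha> 0 \<omega>) + (LINT x:{0<..t} \<times> UNIV|p \<omega>. g x)))"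

definition strong_solution ::
  "'a measure \<Rightarrow> (real \<Rightarrow> 'a measure) \<Rightarrow> (real \<Rightarrow> 'a \<Rightarrow> real ^ 'd) \<Rightarrow> ('a \<Rightarrow> (real \<times> real) measure)
     \<Rightarrow> real \<Rightarrow> (real ^ 'n \<Rightarrow> nat \<Rightarrow> real ^ 'n) \<Rightarrow> (real ^ 'n \<Rightarrow> nat \<Rightarrow> real ^ 'd ^ 'n) \<Rightarrow> 'n intensities
     \<Rightarrow> ('a \<Rightarrow> real \<Rightarrow> real ^ 'n) \<Rightarrow> ('a \<Rightarrow> nat)
     \<Rightarrow> (real \<Rightarrow> 'a \<Rightarrow> real ^ 'n) \<Rightarrow> (real \<Rightarrow> 'a \<Rightarrow> nat) \<Rightarrow> bool" where
  "strong_solution P F W p r b \<sigma> q \<xi> i\<^sub>0 X \<alpha> \<longleftrightarrow>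
     (\<forall>T>0. strong_solution_on P F W p r b \<sigma> q \<xi> i\<^sub>0 T X \<alpha>)"

end

theory Submission
 imports Defs
begin

text \<open>
 Since \<open>q\<^sub>i \<le> M\<close>, only the points of \<open>p\<close> in \<open>[0, \<infinity>) \<times> [0, M]\<close> can make \<open>\<alpha>\<close> jump, and almost surely
 these are finitely many up to every time. For a given switching path the equation for \<open>X\<close> is
 a diffusion with coefficients that are uniformly Lipschitz as long as \<open>\<alpha>\<close> stays below a given level,
 and is solved by Picard iteration and localisation in the level; call the result the flow of \<open>\<alpha>\<close>.
 Existence: iterate "solve for \<open>X\<close> along the current \<open>\<alpha>\<close>, then let \<open>h\<close> jump along that \<open>X\<close>".
 The integrals only look at the past, so the \<open>k\<close>-th iterate is already final before the \<open>k\<close>-th point, and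
 the iteration becomes stationary. Uniqueness: two switching processes agree up to their first
 difference, hence so do the diffusions driven by them, and then the next jumps agree as well.
 The stochastic integral is built from left-point Riemann sums; all estimates are in probability,
 truncated at a bound for the energy, since nothing is assumed about moments of the initial data.
\<close>

text \<open>The coupling has a useful asymmetry: by locality of the integrals, X up to and including
  time t is determined by the switching path strictly before t, while a jump at t is determined by
  the segment of X at t, the left limit of \<alpha> and the points of p. This turns the circular
  system into a recursion. The Lipschitz constants need not be bounded in i, but a path with
  one-sided limits in a discrete space takes finitely many values on a bounded interval, so each
  path meets finitely many of them there. No stopping times are used: events such as "both solutions
  have agreed and stayed below m so far" are read off at rational times and built into the
  integrand. Likewise the points of p are never enumerated: the measure is integer valued, so a set
  of mass below 1 is null, and arguments along jump times become inductions on counts or real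
  induction. Stochastic integrals are determined only almost surely, so processes are repeatedly
  redefined on null sets; completeness and the null sets in \<open>F 0\<close> keep them
  adapted.\<close>

abbreviation tint :: "real => (real => ennreal) => ennreal" where
 "tint t f \<equiv> (\<integral>\<^sup>+s\<in>{0..t}. f s \<partial>lborel)"

abbreviation sqnorm :: "'b::real_normed_vector => ennreal" where "sqnorm x \<equiv> ennreal ((norm x)\<^sup>2)"

section \<open>Filtered spaces under the usual conditions\<close>

locale filtered_space = prob_space P for P :: "'a measure" +
 fixes F :: "real => 'a measure"
 assumes usual: "usual_conditions P F"
begin

abbreviation nn_expectation :: "('a => ennreal) => ennreal" (binder "EE" 10) where
 "nn_expectation f \<equiv> \<integral>\<^sup>+w. f w \<partial>P"

lemma usualD:
 shows "complete_measure P"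
  and "filtration (space P) (\<lambda>t. F (max 0 t))"
  and "\<And>t. 0 \<le> t ==> subalgebra P (F t)"
  and "null_sets P \<subseteq> sets (F 0)"
 using usual unfolding usual_conditions_def by blast+

sublocale complete_measure P
 by (rule usualD)

lemma space_F [simp]: "0 \<le> t ==> space (F t) = space P"
 using usualD(3) by (auto simp: subalgebra_def)

lemma sets_F_subset: "0 \<le> t ==> sets (F t) \<subseteq> sets P"
 using usualD(3) by (auto simp: subalgebra_def)

lemma sets_F_mono: "0 \<le> s ==> s \<le> t ==> sets (F s) \<subseteq> sets (F t)"
 using filtration.sets_F_mono[OF usualD(2), of s t] by (simp add: max_def split: if_splits)

lemma null_sets_F: "0 \<le> t ==> N \<in> null_sets P ==> N \<in> sets (F t)"
 using sets_F_mono[of 0 t] usualD(4) by blast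

lemma measurable_F_mono:
 assumes "f \<in> measurable (F s) N" "0 \<le> s" "s \<le> t"
 shows "f \<in> measurable (F t) N"
 using assms sets_F_mono[of s t] by (auto simp: measurable_def)

lemma measurable_F_imp_P:
 assumes "f \<in> measurable (F s) N" "0 \<le> s"
 shows "f \<in> measurable P N"
 using assms sets_F_subset[of s] by (auto simp: measurable_def)

text \<open>By completeness every subset of the exceptional set is null, hence belongs to
  \<open>G\<close>, and a preimage under \<open>g\<close> differs from one under \<open>f\<close> by
  such subsets only. This is what allows limits and processes to be redefined off a null event
  without losing adaptedness.\<close>

lemma measurable_AE_cong:
 assumes f: "f \<in> measurable G N" and G: "space G = space P" "sets G \<subseteq> sets P" "null_sets P \<subseteq> sets G"
  and eq: "AE w in P. f w = g w" and g: "\<And>w. w \<in> space P ==> g w \<in> space N"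
 shows "g \<in> measurable G N"
proof (rule measurableI)
 fix w assume "w \<in> space G" thus "g w \<in> space N" using g G by simp
next
 fix A assume A: "A \<in> sets N"
 have null: "{w\<in>space P. f w \<noteq> g w} \<in> null_sets P"
  using eq by (simp add: AE_iff_null_sets)
 have "{w\<in>space P. f w \<noteq> g w} \<inter> (g -` A) \<in> null_sets P"
  "{w\<in>space P. f w \<noteq> g w} - (g -` A) \<in> null_sets P"
  by (rule complete2[OF _ null], blast)+
 hence "{w\<in>space P. f w \<noteq> g w} \<inter> (g -` A) \<in> sets G"
  "{w\<in>space P. f w \<noteq> g w} - (g -` A) \<in> sets G"
  using G by auto
 moreover have "f -` A \<inter> space P \<in> sets G"
  using measurable_sets[OF f A] G by simp
 ultimately have "(f -` A \<inter> space P) - ({w\<in>space P. f w \<noteq> g w} - (g -` A))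
   \<union> ({w\<in>space P. f w \<noteq> g w} \<inter> (g -` A)) \<in> sets G" by blast
 moreover have "(f -` A \<inter> space P) - ({w\<in>space P. f w \<noteq> g w} - (g -` A))
   \<union> ({w\<in>space P. f w \<noteq> g w} \<inter> (g -` A)) = g -` A \<inter> space G"
  using G by auto
 ultimately show "g -` A \<inter> space G \<in> sets G" by simp
qed

lemma measurable_P_AE_cong:
 assumes "f \<in> measurable P N" "AE w in P. f w = g w" "\<And>w. w \<in> space P ==> g w \<in> space N"
 shows "g \<in> measurable P N"
 using measurable_AE_cong[OF assms(1) _ _ _ assms(2,3)] by auto

lemma measurable_F_AE_cong:
 assumes "f \<in> measurable (F t) N" "0 \<le> t" "AE w in P. f w = g w" "\<And>w. w \<in> space P ==> g w \<in> space N"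
 shows "g \<in> measurable (F t) N"
 using measurable_AE_cong[OF assms(1) _ _ _ assms(3,4)] assms(2) sets_F_subset null_sets_F by auto

lemma AE_in_sets_F:
 assumes "AE w in P. Q w" "0 \<le> t"
 shows "{w\<in>space P. Q w} \<in> sets (F t)"
proof -
 have "{w\<in>space P. \<not> Q w} \<in> sets (F t)"
  using assms null_sets_F by (simp add: AE_iff_null_sets)
 hence "space (F t) - {w\<in>space P. \<not> Q w} \<in> sets (F t)" by blast
 moreover have "space (F t) - {w\<in>space P. \<not> Q w} = {w\<in>space P. Q w}" using assms by auto
 ultimately show ?thesis by simp
qed

end

section \<open>The law of a Brownian increment\<close>

lemma borel_measurable_vec_nth [measurable (raw)]:
 fixes f :: "'a => ('b::topological_space) ^ 'n"
 shows "f \<in> borel_measurable M ==> (\<lambda>x. f x $ k) \<in> borel_measurable M"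
 by (rule borel_measurable_continuous_on[of "\<lambda>x. x $ k"]) (auto intro!: continuous_intros)

text \<open>Tonelli's formula for \<open>lborel\<close> multiplies over \<open>Basis\<close>; the
  description \<open>THE k. b = axis k 1\<close> inverts \<open>axis\<close>, so that each factor
  may depend on its coordinate index.\<close>

lemma prod_Basis_vec:
 fixes f :: "real => 'd::finite => 'b::comm_monoid_mult"
 shows "(\<Prod>b\<in>Basis. f (x \<bullet> b) (THE k. b = axis k 1)) = (\<Prod>k\<in>UNIV. f (x $ k) k)"
proof -
 have "(\<Prod>b\<in>Basis. f (x \<bullet> b) (THE k. b = axis k 1)) =
  (\<Prod>b\<in>(\<lambda>k. axis k (1::real)) ` (UNIV::'d set). f (x \<bullet> b) (THE k. b = axis k 1))"
  by (rule prod.cong) (auto simp: Basis_vec_def)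
 also have "\<dots> = (\<Prod>k\<in>UNIV. f (x \<bullet> axis k 1) (THE k'. axis k 1 = (axis k' 1::real^'d)))"
  by (subst prod.reindex) (auto simp: inj_on_def axis_eq_axis)
 also have "\<dots> = (\<Prod>k\<in>UNIV. f (x $ k) k)"
  by (simp add: axis_eq_axis inner_axis)
 finally show ?thesis .
qed

lemma nn_integral_lborel_prod_vec:
 fixes g :: "'d::finite => real => ennreal"
 assumes [measurable]: "\<And>k. g k \<in> borel_measurable borel"
 shows "(\<integral>\<^sup>+x. (\<Prod>k\<in>UNIV. g k (x $ k)) \<partial>(lborel :: (real^'d) measure)) = (\<Prod>k\<in>UNIV. \<integral>\<^sup>+x. g k x \<partial>lborel)"
proof -
 define i where "i b = (THE k. b = axis k (1::real))" for b :: "real^'d"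
 have "(\<integral>\<^sup>+x. (\<Prod>k\<in>UNIV. g k (x $ k)) \<partial>(lborel :: (real^'d) measure)) =
   (\<integral>\<^sup>+x. (\<Prod>b\<in>Basis. g (i b) (x \<bullet> b)) \<partial>(lborel :: (real^'d) measure))"
  unfolding i_def using prod_Basis_vec[of "\<lambda>x k. g k x"] by (intro nn_integral_cong) simp
 also have "\<dots> = (\<Prod>b\<in>(Basis::(real^'d) set). \<integral>\<^sup>+x. g (i b) x \<partial>lborel)"
  by (rule nn_integral_lborel_prod) auto
 also have "\<dots> = (\<Prod>k\<in>UNIV. \<integral>\<^sup>+x. g k x \<partial>lborel)"
  unfolding i_def using prod_Basis_vec[of "\<lambda>x k. \<integral>\<^sup>+x. g k x \<partial>lborel" 0] by simp
 finally show ?thesis .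
qed

locale brownian_space = filtered_space P F for P :: "'a measure" and F +
 fixes W :: "real => 'a => real ^ 'd"
 assumes bm: "brownian_motion P F W"
begin

lemma W_measurable_F: "0 \<le> s ==> s \<le> t ==> W s \<in> borel_measurable (F t)"
 using bm measurable_F_mono[of "W s" s borel t] by (auto simp: brownian_motion_def)

lemma W_measurable_P: "0 \<le> s ==> W s \<in> borel_measurable P"
 using W_measurable_F[of s s] measurable_F_imp_P by auto

lemma W_continuous: "AE w in P. continuous_on {0..} (\<lambda>t. W t w)"
 using bm by (auto simp: brownian_motion_def)

text \<open>Product test functions suffice for what follows: with all factors but one equal to 1
  they give the law of a component, with all but two equal to 1 the pairwise independence of the
  components.\<close>

lemma nn_integral_increment:
 assumes s: "0 \<le> s" "s < t" and [measurable]: "\<And>k. g k \<in> borel_measurable borel"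
 shows "(EE w. (\<Prod>k\<in>UNIV. g k ((W t w - W s w) $ k))) =
  (\<Prod>k\<in>UNIV. \<integral>\<^sup>+x. ennreal (normal_density 0 (sqrt (t - s)) x) * g k x \<partial>lborel)"
proof -
 have d: "distributed P lborel (\<lambda>w. W t w - W s w)
     (\<lambda>x. ennreal (\<Prod>k\<in>UNIV. normal_density 0 (sqrt (t - s)) (x $ k)))"
  using bm s by (auto simp: brownian_motion_def)
 have "(EE w. (\<Prod>k\<in>UNIV. g k ((W t w - W s w) $ k))) =
  (\<integral>\<^sup>+x. ennreal (\<Prod>k\<in>UNIV. normal_density 0 (sqrt (t - s)) (x $ k)) * (\<Prod>k\<in>UNIV. g k (x $ k)) \<partial>lborel)"
  by (rule distributed_nn_integral[OF d, symmetric]) measurable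
 also have "\<dots> = (\<integral>\<^sup>+x. (\<Prod>k\<in>UNIV. ennreal (normal_density 0 (sqrt (t - s)) (x $ k)) * g k (x $ k)) \<partial>(lborel :: (real^'d) measure))"
  by (intro nn_integral_cong) (simp add: prod_ennreal prod.distrib)
 also have "\<dots> = (\<Prod>k\<in>UNIV. \<integral>\<^sup>+x. ennreal (normal_density 0 (sqrt (t - s)) x) * g k x \<partial>lborel)"
  by (rule nn_integral_lborel_prod_vec) measurable
 finally show ?thesis .
qed

lemma increment_component_distributed:
 assumes s: "0 \<le> s" "s < t"
 shows "distributed P lborel (\<lambda>w. (W t w - W s w) $ k) (\<lambda>x. ennreal (normal_density 0 (sqrt (t - s)) x))"
proof -
 have one: "(\<integral>\<^sup>+x. ennreal (normal_density 0 (sqrt (t - s)) x) \<partial>lborel) = 1"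
  using prob_space.emeasure_space_1[OF prob_space_normal_density[of "sqrt (t - s)" 0]] s
  by (simp add: emeasure_density)
 have [measurable]: "W t \<in> borel_measurable P" "W s \<in> borel_measurable P" using s W_measurable_P by auto
 show ?thesis
  unfolding distributed_def
 proof (intro conjI)
  show "distr P lborel (\<lambda>w. (W t w - W s w) $ k) = density lborel (\<lambda>x. ennreal (normal_density 0 (sqrt (t - s)) x))"
  proof (rule measure_eqI)
   fix A assume "A \<in> sets (distr P lborel (\<lambda>w. (W t w - W s w) $ k))"
   hence A[measurable]: "A \<in> sets borel" by simp
   have "emeasure (distr P lborel (\<lambda>w. (W t w - W s w) $ k)) A =
     (EE w. (\<Prod>l\<in>UNIV. (if l = k then indicator A else (\<lambda>_. 1)) ((W t w - W s w) $ l)))"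
    by (subst nn_integral_indicator[symmetric], simp, subst nn_integral_distr)
     (auto intro!: nn_integral_cong simp: if_distrib[where f = "\<lambda>f. f _"] prod.delta)
   also have "\<dots> = (\<Prod>l\<in>UNIV. \<integral>\<^sup>+x. ennreal (normal_density 0 (sqrt (t - s)) x) * (if l = k then indicator A else (\<lambda>_. 1)) x \<partial>lborel)"
    by (rule nn_integral_increment[OF s]) simp
   also have "\<dots> = (\<Prod>l\<in>UNIV. if l = k then \<integral>\<^sup>+x. ennreal (normal_density 0 (sqrt (t - s)) x) * indicator A x \<partial>lborel else 1)"
    by (rule prod.cong) (auto simp: one)
   also have "\<dots> = emeasure (density lborel (\<lambda>x. ennreal (normal_density 0 (sqrt (t - s)) x))) A"
    by (simp add: prod.delta emeasure_density)
   finally show "emeasure (distr P lborel (\<lambda>w. (W t w - W s w) $ k)) A = \<dots>" .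
  qed simp
 qed auto
qed

end

section \<open>The stochastic integral\<close>

context brownian_space
begin

lemma increment_measurable [measurable]:
 assumes "0 \<le> s" "s \<le> t"
 shows "(\<lambda>w. W t w - W s w) \<in> borel_measurable P"
 using W_measurable_P assms by simp

lemma increment_indep_var:
 assumes s: "0 \<le> s" "s < t" and X: "X \<in> borel_measurable (F s)" and f: "f \<in> borel_measurable borel"
 shows "indep_var borel X borel (\<lambda>w. f (W t w - W s w) :: real)"
proof -
 have ind: "indep_set (sets (F s)) (generated_sets (space P) (\<lambda>u w. W u w - W s w) {s..})"
  using bm s by (simp add: brownian_motion_def)
 have X': "X \<in> borel_measurable P" using measurable_F_imp_P[OF X] s by simp
 have f': "(\<lambda>w. f (W t w - W s w)) \<in> borel_measurable P"
  using f s increment_measurable[of s t] by simp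
 have 1: "sigma_sets (space P) {X -` A \<inter> space P |A. A \<in> sets borel} \<subseteq> sets (F s)"
 proof -
  have "{X -` A \<inter> space P |A. A \<in> sets borel} \<subseteq> sets (F s)"
   using measurable_sets[OF X] s by auto
  from sets.sigma_sets_subset[OF this] show ?thesis using s by simp
 qed
 have "(\<lambda>w. f (W t w - W s w)) -` A \<inter> space P \<in> generated_sets (space P) (\<lambda>u w. W u w - W s w) {s..}"
  if "A \<in> sets borel" for A
 proof -
  have "(\<lambda>w. f (W t w - W s w)) -` A \<inter> space P = (\<lambda>w. W t w - W s w) -` (f -` A) \<inter> space P" by auto
  moreover have "f -` A \<in> sets borel" using measurable_sets[OF f that] by simp
  ultimately show ?thesis
   unfolding generated_sets_def using s by (auto intro!: sigma_sets.Basic exI[of _ t] exI[of _ "f -` A"])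
 qed
 hence 2: "sigma_sets (space P) {(\<lambda>w. f (W t w - W s w)) -` A \<inter> space P |A. A \<in> sets borel}
  \<subseteq> generated_sets (space P) (\<lambda>u w. W u w - W s w) {s..}"
  unfolding generated_sets_def by (intro sigma_sets_mono) auto
 show ?thesis
  unfolding indep_var_eq using X' f' ind 1 2 unfolding indep_sets2_eq by blast
qed

lemma increment_product_integral:
 assumes s: "0 \<le> s" "s < t" and X: "X \<in> borel_measurable (F s)" "integrable P X"
  and f: "f \<in> borel_measurable borel" "integrable P (\<lambda>w. f (W t w - W s w))"
 shows "has_bochner_integral P (\<lambda>w. X w * f (W t w - W s w) :: real)
  (expectation X * expectation (\<lambda>w. f (W t w - W s w)))"
 using indep_var_lebesgue_integral[OF increment_indep_var[OF s X(1) f(1)] X(2) f(2)]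
  indep_var_integrable[OF increment_indep_var[OF s X(1) f(1)] X(2) f(2)]
 by (simp add: has_bochner_integral_iff)

lemma increment_component_indep:
 assumes s: "0 \<le> s" "s < t" and kl: "k \<noteq> l"
 shows "indep_var borel (\<lambda>w. (W t w - W s w) $ k) borel (\<lambda>w. (W t w - W s w) $ l)"
proof -
 let ?D = "\<lambda>k w. (W t w - W s w) $ k"
 have [measurable]: "?D k \<in> borel_measurable P" for k
  using W_measurable_P[of s] W_measurable_P[of t] s by simp
 have one: "(\<integral>\<^sup>+x. ennreal (normal_density 0 (sqrt (t - s)) x) \<partial>lborel) = 1"
  using prob_space.emeasure_space_1[OF prob_space_normal_density[of "sqrt (t - s)" 0]] s
  by (simp add: emeasure_density)
 have *: "prob ((?D k -` A \<inter> space P) \<inter> (?D l -` B \<inter> space P)) = prob (?D k -` A \<inter> space P) * prob (?D l -` B \<inter> space P)"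
  if [measurable]: "A \<in> sets borel" "B \<in> sets borel" for A B
 proof -
  let ?n = "\<lambda>A. \<integral>\<^sup>+x. ennreal (normal_density 0 (sqrt (t - s)) x) * indicator A x \<partial>lborel"
  have one_set: "emeasure P (?D k -` A \<inter> space P) = ?n A" if [measurable]: "A \<in> sets borel" for A k
   using distributed_emeasure[OF increment_component_distributed[OF s, of k], of A] by simp
  have "emeasure P ((?D k -` A \<inter> space P) \<inter> (?D l -` B \<inter> space P)) =
   (EE w. (\<Prod>j\<in>UNIV. (if j = k then indicator A else if j = l then indicator B else (\<lambda>_. 1)) (?D j w)))"
  proof (subst nn_integral_indicator[symmetric], measurable, intro nn_integral_cong)
   fix w assume "w \<in> space P"
   have "(\<Prod>j\<in>UNIV. (if j = k then indicator A else if j = l then indicator B else (\<lambda>_. 1)) (?D j w)) =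
    (\<Prod>j\<in>UNIV. (if j = k then indicator A (?D k w) else 1) * (if j = l then indicator B (?D l w) else 1 :: ennreal))"
    using kl by (intro prod.cong) auto
   also have "\<dots> = indicator A (?D k w) * indicator B (?D l w)"
    by (simp add: prod.distrib prod.delta)
   also have "\<dots> = indicator ((?D k -` A \<inter> space P) \<inter> (?D l -` B \<inter> space P)) w"
    using \<open>w \<in> space P\<close> unfolding indicator_def by auto
   finally show "indicator ((?D k -` A \<inter> space P) \<inter> (?D l -` B \<inter> space P)) w =
    (\<Prod>j\<in>UNIV. (if j = k then indicator A else if j = l then indicator B else (\<lambda>_. 1)) (?D j w) :: ennreal)" by (rule sym)
  qed
  also have "\<dots> = (\<Prod>j\<in>UNIV. \<integral>\<^sup>+x. ennreal (normal_density 0 (sqrt (t - s)) x) *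
    (if j = k then indicator A else if j = l then indicator B else (\<lambda>_. 1)) x \<partial>lborel)"
   by (rule nn_integral_increment[OF s]) simp
  also have "\<dots> = (\<Prod>j\<in>UNIV. (if j = k then ?n A else 1) * (if j = l then ?n B else 1))"
   using kl one by (intro prod.cong) auto
  also have "\<dots> = ?n A * ?n B" by (simp add: prod.distrib prod.delta)
  also have "\<dots> = emeasure P (?D k -` A \<inter> space P) * emeasure P (?D l -` B \<inter> space P)"
   using one_set by simp
  finally show ?thesis
   by (simp add: measure_def enn2real_mult)
 qed
 \<comment> \<open>The preimages of Borel sets already form a sigma algebra, so independence only
   has to be checked on preimages of single sets.\<close>
 have st: "sigma_sets (space P) {?D k -` A \<inter> space P |A. A \<in> sets borel} = {?D k -` A \<inter> space P |A. A \<in> sets borel}" for k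
 proof -
  have "{?D k -` A \<inter> space P |A. A \<in> sigma_sets UNIV (sets borel)} =
   sigma_sets (space P) {?D k -` A \<inter> space P |A. A \<in> sets borel}"
   by (rule sigma_sets_vimage_commute) simp
  moreover have "sigma_sets UNIV (sets borel) = (sets borel :: real set set)"
   using sets.sigma_sets_eq[of "borel :: real measure"] by (simp only: space_borel)
  ultimately show ?thesis by (simp only:)
 qed
 have ev: "?D k -` A \<inter> space P \<in> events" if "A \<in> sets borel" for A k
  using that by measurable
 show ?thesis
  unfolding indep_var_eq st indep_sets2_eq
 proof (intro conjI ballI)
  show "{?D k -` A \<inter> space P |A. A \<in> sets borel} \<subseteq> events" "{?D l -` A \<inter> space P |A. A \<in> sets borel} \<subseteq> events"
   using ev by blast+
  fix a b assume "a \<in> {?D k -` A \<inter> space P |A. A \<in> sets borel}" "b \<in> {?D l -` A \<inter> space P |A. A \<in> sets borel}"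
  then obtain A B where "A \<in> sets borel" "B \<in> sets borel" "a = ?D k -` A \<inter> space P" "b = ?D l -` B \<inter> space P"
   by blast
  thus "prob (a \<inter> b) = prob a * prob b" using * by blast
 qed measurable
qed

lemma increment_first_moment:
 assumes s: "0 \<le> s" "s < t"
 shows "has_bochner_integral P (\<lambda>w. (W t w - W s w) $ k) 0"
proof -
 have "integrable P (\<lambda>w. (W t w - W s w) $ k)"
 proof (rule distributed_integrable_var[OF increment_component_distributed[OF s, of k]])
  show "integrable lborel (\<lambda>x. normal_density 0 (sqrt (t - s)) x * x)"
   using s by (intro integrable_normal_moment_nz_1) simp
 qed simp
 moreover have "expectation (\<lambda>w. (W t w - W s w) $ k) = 0"
  using s by (intro normal_distributed_expectation[OF _ increment_component_distributed[OF s, of k]]) simp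
 ultimately show ?thesis by (simp add: has_bochner_integral_iff)
qed

lemma increment_second_moment:
 assumes s: "0 \<le> s" "s < t"
 shows "has_bochner_integral P (\<lambda>w. (W t w - W s w) $ k * (W t w - W s w) $ l) (if k = l then t - s else 0)"
proof (cases "k = l")
 case False
 note m = increment_first_moment[OF s, unfolded has_bochner_integral_iff]
 show ?thesis
  using indep_var_lebesgue_integral[OF increment_component_indep[OF s False]]
   indep_var_integrable[OF increment_component_indep[OF s False]] m False
  by (simp add: has_bochner_integral_iff)
next
 case True
 have "integrable P (\<lambda>w. ((W t w - W s w) $ k)^2)"
  using distributed_integrable[OF increment_component_distributed[OF s, of k], of "\<lambda>x. x^2"] s
   integrable_normal_moment[of "sqrt (t-s)" 0 2] by simp
 moreover have "expectation (\<lambda>w. ((W t w - W s w) $ k)^2) = t - s"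
  using normal_distributed_variance[OF _ increment_component_distributed[OF s, of k]]
   increment_first_moment[OF s, of k] s by (simp add: has_bochner_integral_iff)
 ultimately show ?thesis using True by (simp add: has_bochner_integral_iff power2_eq_square)
qed

end

lemma norm_vec_sum_power2: "(norm (x :: real^'n))\<^sup>2 = (\<Sum>i\<in>UNIV. (x $ i)\<^sup>2)"
 unfolding power2_norm_eq_inner inner_vec_def by (simp add: power2_eq_square)

lemma norm_matrix_sum_power2: "(norm (A :: real^'d^'n))\<^sup>2 = (\<Sum>i\<in>UNIV. \<Sum>k\<in>UNIV. (A $ i $ k)\<^sup>2)"
 unfolding power2_norm_eq_inner inner_vec_def by (simp add: power2_eq_square)

text \<open>The square is expanded into coordinates because independence is applied to each product
  of an \<open>F s\<close>-measurable factor with one or two components of the increment.\<close>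

lemma norm_add_matrix_vector_power2:
 fixes S :: "real^'n" and A :: "real^'d^'n"
 shows "(norm (S + A *v x))\<^sup>2 = (norm S)\<^sup>2 + (\<Sum>i\<in>UNIV. \<Sum>k\<in>UNIV. 2 * (S $ i * A $ i $ k) * x $ k)
  + (\<Sum>i\<in>UNIV. \<Sum>k\<in>UNIV. \<Sum>l\<in>UNIV. A $ i $ k * A $ i $ l * (x $ k * x $ l))"
proof -
 have "((S + A *v x) $ i)\<^sup>2 = (S $ i)\<^sup>2 + (\<Sum>k\<in>UNIV. 2 * (S $ i * A $ i $ k) * x $ k)
   + (\<Sum>k\<in>UNIV. \<Sum>l\<in>UNIV. A $ i $ k * A $ i $ l * (x $ k * x $ l))" for i
  by (simp add: matrix_vector_mult_def power2_eq_square algebra_simps sum_distrib_left sum_product)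
 thus ?thesis
  unfolding norm_vec_sum_power2 by (simp add: sum.distrib)
qed

context brownian_space
begin

text \<open>The increment is centred and independent of \<open>F s\<close>, so the mixed terms have
  mean zero; among the quadratic terms its uncorrelated components leave only the diagonal, each
  with the factor \<open>t - s\<close>.\<close>

lemma isometry_step:
 fixes S :: "'a => real^'n" and V :: "'a => real^'d^'n"
 assumes s: "0 \<le> s" "s < t"
  and S: "S \<in> borel_measurable (F s)" "integrable P (\<lambda>w. (norm (S w))\<^sup>2)"
  and V: "V \<in> borel_measurable (F s)" "bounded (V ` space P)"
 shows "has_bochner_integral P (\<lambda>w. (norm (S w + V w *v (W t w - W s w)))\<^sup>2)
  (expectation (\<lambda>w. (norm (S w))\<^sup>2) + (t - s) * expectation (\<lambda>w. (norm (V w))\<^sup>2))"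
proof -
 note [measurable] = S(1) V(1) measurable_F_imp_P[OF S(1) s(1)] measurable_F_imp_P[OF V(1) s(1)]
 obtain c where c: "\<And>w. w \<in> space P ==> norm (V w) \<le> c" using V(2) by (auto simp: bounded_iff)
 have Vc: "\<bar>V w $ i $ k\<bar> \<le> c" if "w \<in> space P" for w i k
  using c[OF that] component_le_norm_cart[of "V w $ i" k] Finite_Cartesian_Product.norm_nth_le[of "V w" i] by simp
 have Si: "integrable P (\<lambda>w. S w $ i)" for i
 proof (rule square_integrable_imp_integrable)
  show "integrable P (\<lambda>w. (S w $ i)\<^sup>2)"
  proof (rule Bochner_Integration.integrable_bound[OF S(2)])
   show "AE x in P. norm ((S x $ i)\<^sup>2) \<le> norm ((norm (S x))\<^sup>2)"
    using component_le_norm_cart by (auto intro!: AE_I2 simp: abs_le_square_iff[symmetric])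
  qed measurable
 qed measurable
 have SV: "integrable P (\<lambda>w. 2 * (S w $ i * V w $ i $ k))" for i k
 proof (intro integrable_mult_right, rule Bochner_Integration.integrable_bound[OF integrable_mult_right[OF Si[of i], of c]])
  show "AE x in P. norm (S x $ i * V x $ i $ k) \<le> norm (c * S x $ i)"
  proof (rule AE_I2)
   fix x assume "x \<in> space P"
   hence "\<bar>V x $ i $ k\<bar> * \<bar>S x $ i\<bar> \<le> \<bar>c\<bar> * \<bar>S x $ i\<bar>"
    using Vc[of x i k] by (intro mult_right_mono) auto
   thus "norm (S x $ i * V x $ i $ k) \<le> norm (c * S x $ i)" by (simp add: abs_mult mult.commute)
  qed
 qed measurable
 have VV: "integrable P (\<lambda>w. V w $ i $ k * V w $ i $ l)" for i k l
 proof (rule integrable_const_bound[where B = "c * c"])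
  show "AE x in P. norm (V x $ i $ k * V x $ i $ l) \<le> c * c"
  proof (rule AE_I2)
   fix x assume "x \<in> space P"
   thus "norm (V x $ i $ k * V x $ i $ l) \<le> c * c"
    using Vc[of x i k] Vc[of x i l] by (auto simp: abs_mult intro!: mult_mono)
  qed
 qed measurable
 have 1: "has_bochner_integral P (\<lambda>w. 2 * (S w $ i * V w $ i $ k) * (W t w - W s w) $ k) 0" for i k
  using increment_product_integral[OF s _ SV, of i k "\<lambda>x. x $ k"] increment_first_moment[OF s, of k]
  by (simp add: has_bochner_integral_iff)
 have 2: "has_bochner_integral P (\<lambda>w. V w $ i $ k * V w $ i $ l * ((W t w - W s w) $ k * (W t w - W s w) $ l))
   (if k = l then (t - s) * expectation (\<lambda>w. (V w $ i $ k)\<^sup>2) else 0)" for i k l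
 proof -
  note m = increment_second_moment[OF s, of k l, unfolded has_bochner_integral_iff]
  have "has_bochner_integral P (\<lambda>w. V w $ i $ k * V w $ i $ l * ((W t w - W s w) $ k * (W t w - W s w) $ l))
   (expectation (\<lambda>w. V w $ i $ k * V w $ i $ l) * (if k = l then t - s else 0))"
   using increment_product_integral[OF s _ VV, of i k l "\<lambda>x. x $ k * x $ l", OF _ _ m[THEN conjunct1]]
   unfolding m[THEN conjunct2] by measurable
  thus ?thesis by (cases "k = l") (simp_all only: if_True if_False power2_eq_square mult.commute[of "t - s"] mult_zero_right refl)
 qed
 have eq: "(\<Sum>i\<in>UNIV. \<Sum>k\<in>UNIV. (t - s) * expectation (\<lambda>w. (V w $ i $ k)\<^sup>2)) = (t - s) * expectation (\<lambda>w. (norm (V w))\<^sup>2)"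
  unfolding norm_matrix_sum_power2 using VV
  by (simp add: Bochner_Integration.integral_sum sum_distrib_left power2_eq_square)
 have "has_bochner_integral P (\<lambda>w. (norm (S w + V w *v (W t w - W s w)))\<^sup>2)
  (expectation (\<lambda>w. (norm (S w))\<^sup>2) + (\<Sum>i\<in>(UNIV::'n set). \<Sum>k\<in>(UNIV::'d set). 0) +
   (\<Sum>i\<in>UNIV. \<Sum>k\<in>UNIV. \<Sum>l\<in>UNIV. (if k = l then (t - s) * expectation (\<lambda>w. (V w $ i $ k)\<^sup>2) else 0)))"
  unfolding norm_add_matrix_vector_power2
  by (intro has_bochner_integral_add has_bochner_integral_sum 1 2 has_bochner_integral_integrable S)
 thus ?thesis using eq by (simp add: sum.delta)
qed

end

lemma borel_measurable_matrix_vector_mult [measurable (raw)]: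
 fixes A :: "'a => real^'d^'n"
 assumes [measurable]: "A \<in> borel_measurable M" "x \<in> borel_measurable M"
 shows "(\<lambda>w. A w *v x w) \<in> borel_measurable M"
 by (rule borel_measurable_continuous_Pair[OF assms])
  (simp add: matrix_vector_mult_def case_prod_beta' continuous_intros)

section \<open>Grids and the discrete maximal inequality\<close>

definition energy :: "real => (real => 'a => 'b::real_normed_vector) => 'a => ennreal" where
 "energy T V w = (tint T (\<lambda>u. sqnorm (V u w)))"

definition grid :: "real => real set => nat => (nat => real) => bool" where
 "grid T S N s \<longleftrightarrow> s 0 = 0 \<and> s N = T \<and> (\<forall>i<N. s i < s (Suc i)) \<and> S \<inter> {0..T} \<subseteq> s ` {..N}"

lemma grid_exists:
 assumes "finite S" "0 \<le> T"
 shows "\<exists>N s. grid T S N s"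
proof -
 define A where "A = insert 0 (insert T (S \<inter> {0..T}))"
 define xs where "xs = sorted_list_of_set A"
 have fin: "finite A" "A \<noteq> {}" using assms by (auto simp: A_def)
 have set: "set xs = A" and sd: "sorted_wrt (<) xs" and ne: "xs \<noteq> []"
  using fin by (auto simp: xs_def strict_sorted_list_of_set)
 have hd: "xs ! 0 = 0"
 proof -
  have "0 \<in> set xs" using set by (auto simp: A_def)
  then obtain i where i: "i < length xs" "xs ! i = 0" by (auto simp: in_set_conv_nth)
  have "xs ! 0 \<in> A" using set ne by (metis length_greater_0_conv nth_mem)
  hence "0 \<le> xs ! 0" using assms by (auto simp: A_def)
  moreover have "i \<noteq> 0 ==> xs ! 0 < xs ! i" using sorted_wrt_nth_less[OF sd, of 0 i] i by simp
  ultimately show ?thesis using i by (cases "i = 0") auto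
 qed
 have last: "xs ! (length xs - 1) = T"
 proof -
  have "T \<in> set xs" using set by (auto simp: A_def)
  then obtain i where i: "i < length xs" "xs ! i = T" by (auto simp: in_set_conv_nth)
  have "xs ! (length xs - 1) \<in> A" using set ne by (metis diff_less length_greater_0_conv nth_mem zero_less_one)
  hence "xs ! (length xs - 1) \<le> T" using assms by (auto simp: A_def)
  moreover have "i \<noteq> length xs - 1 ==> xs ! i < xs ! (length xs - 1)"
   using sorted_wrt_nth_less[OF sd, of i "length xs - 1"] i by auto
  ultimately show ?thesis using i by (cases "i = length xs - 1") auto
 qed
 have "S \<inter> {0..T} \<subseteq> (\<lambda>i. xs ! i) ` {..length xs - 1}"
 proof
  fix x assume "x \<in> S \<inter> {0..T}"
  hence "x \<in> set xs" using set by (auto simp: A_def)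
  then obtain i where "i < length xs" "xs ! i = x" by (auto simp: in_set_conv_nth)
  thus "x \<in> (\<lambda>i. xs ! i) ` {..length xs - 1}" by (auto intro!: image_eqI[of _ _ i])
 qed
 hence "grid T S (length xs - 1) (\<lambda>i. xs ! i)"
  using hd last sorted_wrt_nth_less[OF sd] by (auto simp: grid_def)
 thus ?thesis by blast
qed

lemma grid_less:
 assumes "grid T S N s" "i < j" "j \<le> N"
 shows "s i < s j"
 using assms(2,3)
proof (induction j)
 case (Suc j)
 hence "s j < s (Suc j)" using assms(1) by (auto simp: grid_def)
 with Suc show ?case by (cases "i = j") auto
qed simp

lemma grid_le:
 assumes "grid T S N s" "i \<le> j" "j \<le> N"
 shows "s i \<le> s j"
 using grid_less[OF assms(1), of i j] assms by (cases "i = j") auto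

lemma grid_nonneg: "grid T S N s ==> i \<le> N ==> 0 \<le> s i"
 using grid_le[of T S N s 0 i] by (simp add: grid_def)

lemma grid_le_T: "grid T S N s ==> i \<le> N ==> s i \<le> T"
 using grid_le[of T S N s i N] by (simp add: grid_def)

lemma grid_subset: "grid T S N s ==> S' \<subseteq> S ==> grid T S' N s"
 by (auto simp: grid_def)

lemma nn_integral_grid:
 assumes g: "grid T S N s"
  and const: "\<And>l u. l < N ==> s l < u ==> u \<le> s (Suc l) ==> f u = f (s (Suc l))"
 shows "(tint T (\<lambda>u. ennreal (f u))) = (\<Sum>l<N. ennreal (f (s (Suc l))) * ennreal (s (Suc l) - s l))"
proof -
 have cover: "(\<Sum>l<N. indicator {s l<..s (Suc l)} u) = (indicator {0<..T} u :: ennreal)" for u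
 proof -
  have "(\<Sum>l<n. indicator {s l<..s (Suc l)} u) = (indicator {s 0<..s n} u :: ennreal)" if "n \<le> N" for n
   using that
  proof (induction n)
   case (Suc n)
   have "s 0 \<le> s n" "s n < s (Suc n)" using grid_le[OF g, of 0 n] grid_less[OF g, of n "Suc n"] Suc by auto
   with Suc show ?case by (auto simp: indicator_def)
  qed simp
  from this[of N] g show ?thesis by (simp add: grid_def)
 qed
 have "(tint T (\<lambda>u. ennreal (f u))) = (\<integral>\<^sup>+u. (\<Sum>l<N. ennreal (f (s (Suc l))) * indicator {s l<..s (Suc l)} u) \<partial>lborel)"
 proof (rule nn_integral_cong_AE)
  show "AE u in lborel. ennreal (f u) * indicator {0..T} u = (\<Sum>l<N. ennreal (f (s (Suc l))) * indicator {s l<..s (Suc l)} u)"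
   using AE_lborel_singleton[of 0]
  proof eventually_elim
   case (elim u)
   have "(\<Sum>l<N. ennreal (f (s (Suc l))) * indicator {s l<..s (Suc l)} u) = (\<Sum>l<N. ennreal (f u) * indicator {s l<..s (Suc l)} u)"
   proof (rule sum.cong)
    fix l assume "l \<in> {..<N}"
    thus "ennreal (f (s (Suc l))) * indicator {s l<..s (Suc l)} u = ennreal (f u) * indicator {s l<..s (Suc l)} u"
     using const[of l u] by (cases "u \<in> {s l<..s (Suc l)}") simp_all
   qed simp
   also have "\<dots> = ennreal (f u) * indicator {0<..T} u"
    by (simp add: sum_distrib_left[symmetric] cover)
   finally show ?case using elim by (auto simp: indicator_def)
  qed
 qed
 also have "\<dots> = (\<Sum>l<N. ennreal (f (s (Suc l))) * ennreal (s (Suc l) - s l))"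
 proof (subst nn_integral_sum)
  show "(\<Sum>l<N. \<integral>\<^sup>+u. ennreal (f (s (Suc l))) * indicator {s l<..s (Suc l)} u \<partial>lborel) =
   (\<Sum>l<N. ennreal (f (s (Suc l))) * ennreal (s (Suc l) - s l))"
  proof (rule sum.cong)
   fix l assume "l \<in> {..<N}"
   hence "s l \<le> s (Suc l)" using grid_le[OF g, of l "Suc l"] by simp
   thus "(\<integral>\<^sup>+u. ennreal (f (s (Suc l))) * indicator {s l<..s (Suc l)} u \<partial>lborel) =
    ennreal (f (s (Suc l))) * ennreal (s (Suc l) - s l)"
    by (subst nn_integral_cmult_indicator) simp_all
  qed simp
 qed measurable
 finally show ?thesis .
qed

context brownian_space
begin

text \<open>One induction carries the sign of the times, the adaptedness of the partial sums and the
  isometry, because \<open>isometry_step\<close> needs the first two in order to extend the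
  third.\<close>

lemma discrete_isometry_aux:
 fixes v :: "nat => 'a => real^'d^'n"
 assumes s: "0 \<le> s 0" "\<And>l. l < N ==> s l < s (Suc l)"
  and v: "\<And>l. l < N ==> v l \<in> borel_measurable (F (s l))" "\<And>l. l < N ==> bounded (v l ` space P)"
 shows "0 \<le> s N \<and> (\<lambda>w. \<Sum>l<N. v l w *v (W (s (Suc l)) w - W (s l) w)) \<in> borel_measurable (F (s N))
  \<and> has_bochner_integral P (\<lambda>w. (norm (\<Sum>l<N. v l w *v (W (s (Suc l)) w - W (s l) w)))\<^sup>2)
   (\<Sum>l<N. (s (Suc l) - s l) * expectation (\<lambda>w. (norm (v l w))\<^sup>2))"
 using s v
proof (induction N)
 case 0
 thus ?case by (simp add: has_bochner_integral_zero)
next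
 case (Suc N)
 let ?S = "\<lambda>w. \<Sum>l<N. v l w *v (W (s (Suc l)) w - W (s l) w)"
 have S: "?S \<in> borel_measurable (F (s N))" and s': "0 \<le> s N"
  and I: "has_bochner_integral P (\<lambda>w. (norm (?S w))\<^sup>2)
   (\<Sum>l<N. (s (Suc l) - s l) * expectation (\<lambda>w. (norm (v l w))\<^sup>2))"
  using Suc by auto
 have s'': "s N < s (Suc N)" "0 \<le> s (Suc N)" "s N \<le> s (Suc N)" using Suc.prems(2)[of N] s' by auto
 have [measurable]: "v N \<in> borel_measurable (F (s (Suc N)))" "?S \<in> borel_measurable (F (s (Suc N)))"
  "W (s N) \<in> borel_measurable (F (s (Suc N)))" "W (s (Suc N)) \<in> borel_measurable (F (s (Suc N)))"
  using measurable_F_mono[OF S s' s''(3)] measurable_F_mono[OF Suc.prems(3)[of N] s' s''(3)] s' s'' W_measurable_F by auto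
 show ?case
  using isometry_step[OF s' s''(1) S _ Suc.prems(3,4)[of N]] I s''
  by (simp add: has_bochner_integral_iff)
qed

lemmas discrete_isometry = discrete_isometry_aux[THEN conjunct2, THEN conjunct1]
 discrete_isometry_aux[THEN conjunct2, THEN conjunct2]

lemma nn_integral_discrete_isometry:
 fixes v :: "nat => 'a => real^'d^'n"
 assumes s: "0 \<le> s 0" "\<And>l. l < N ==> s l < s (Suc l)"
  and v: "\<And>l. l < N ==> v l \<in> borel_measurable P" "\<And>l. l < N ==> v l \<in> borel_measurable (F (s l))" "\<And>l. l < N ==> bounded (v l ` space P)"
 shows "(EE w. sqnorm (\<Sum>l<N. v l w *v (W (s (Suc l)) w - W (s l) w)))
   = (EE w. ennreal (\<Sum>l<N. (s (Suc l) - s l) * (norm (v l w))\<^sup>2))"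
proof -
 have I: "has_bochner_integral P (\<lambda>w. (norm (v l w))\<^sup>2) (expectation (\<lambda>w. (norm (v l w))\<^sup>2))" if l: "l < N" for l
 proof (rule has_bochner_integral_integrable)
  note [measurable] = v(1)[OF l]
  obtain c where "\<And>w. w \<in> space P ==> norm (v l w) \<le> c" using v(3)[OF l] by (auto simp: bounded_iff)
  thus "integrable P (\<lambda>w. (norm (v l w))\<^sup>2)"
   by (intro integrable_const_bound[where B = "c\<^sup>2"]) (auto intro!: AE_I2 power_mono)
 qed
 have "has_bochner_integral P (\<lambda>w. \<Sum>l<N. (s (Suc l) - s l) * (norm (v l w))\<^sup>2)
   (\<Sum>l<N. (s (Suc l) - s l) * expectation (\<lambda>w. (norm (v l w))\<^sup>2))"
  by (intro has_bochner_integral_sum has_bochner_integral_mult_right I) auto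
 moreover have "0 \<le> (\<Sum>l<N. (s (Suc l) - s l) * (norm (v l w))\<^sup>2)" for w
  using s(2) by (intro sum_nonneg) (simp add: less_imp_le)
 ultimately show ?thesis
  using discrete_isometry(2)[OF s v(2,3)]
  by (subst (1 2) nn_integral_eq_integral) (auto simp: has_bochner_integral_iff)
qed

text \<open>
 Setting the coefficients to zero as soon as the accumulated energy exceeds \<open>\<delta>\<close>, or the partial
 sums have reached \<open>\<epsilon>\<close>, keeps them adapted; the isometry for the truncated sums then bounds the
 untruncated ones on the event that the energy is at most \<open>\<delta>\<close>.
\<close>

lemma discrete_truncation:
 fixes v :: "nat => 'a => real^'d^'n" and s :: "nat => real" and C :: "nat => 'a => bool"
 defines "A \<equiv> \<lambda>n w. \<Sum>l<n. (s (Suc l) - s l) * (norm (v l w))\<^sup>2"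
 assumes s: "0 \<le> s 0" "\<And>l. l < N ==> s l < s (Suc l)"
  and v: "\<And>l. l < N ==> v l \<in> borel_measurable (F (s l))" "\<And>l. l < N ==> bounded (v l ` space P)"
  and C: "\<And>l. l < N ==> Measurable.pred (F (s l)) (C l)"
  and v': "v' = (\<lambda>l w. if A (Suc l) w \<le> \<delta> \<and> C l w then v l w else 0)"
  and "0 \<le> \<delta>"
 shows "(EE w. sqnorm (\<Sum>l<N. v' l w *v (W (s (Suc l)) w - W (s l) w)))
   \<le> (EE w. ennreal (min \<delta> (A N w)))"
proof -
 have mono: "s i \<le> s j" if "i \<le> j" "j \<le> N" for i j
  using that
 proof (induction j)
  case (Suc j) thus ?case using s(2)[of j] by (cases "i = Suc j") auto
 qed simp
 hence nn: "0 \<le> s l" if "l \<le> N" for l using s(1) that by (metis le0 order_trans)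
 have m: "v j \<in> borel_measurable (F (s l))" if "j \<le> l" "l < N" for j l
  using measurable_F_mono[OF v(1)[of j], of "s l"] that mono[of j l] nn[of j] by auto
 have m': "v' l \<in> borel_measurable (F (s l))" if "l < N" for l
 proof -
  \<comment> \<open>\<open>A (Suc l)\<close> involves \<open>v 0, ..., v l\<close> only: the
    accumulated energy is known one step ahead, which keeps the truncated coefficients
    adapted.\<close>
  have [measurable]: "A (Suc l) \<in> borel_measurable (F (s l))"
   unfolding A_def using m[OF _ that] by (intro borel_measurable_sum borel_measurable_times borel_measurable_power borel_measurable_norm) auto
  note [measurable] = C[OF that] v(1)[OF that]
  show ?thesis unfolding v' by measurable
 qed
 have b': "bounded (v' l ` space P)" if l: "l < N" for l
 proof -
  obtain c where "\<And>w. w \<in> space P ==> norm (v l w) \<le> c" using v(2)[OF l] by (auto simp: bounded_iff)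
  hence "norm (v' l w) \<le> max 0 c" if "w \<in> space P" for w using that by (auto simp: v' le_max_iff_disj)
  thus ?thesis by (auto simp: bounded_iff)
 qed
 \<comment> \<open>If the next term is kept, then \<open>A (Suc n) w\<close> itself is at most
   \<delta> and bounds the new sum; if it is dropped, the left side stands still while the right
   side can only grow.\<close>
 have le: "(\<Sum>l<n. (s (Suc l) - s l) * (norm (v' l w))\<^sup>2) \<le> min \<delta> (A n w)" if "n \<le> N" for n w
  using that
 proof (induction n)
  case 0 thus ?case using \<open>0 \<le> \<delta>\<close> by (simp add: A_def)
 next
  case (Suc n)
  have nn: "0 \<le> (s (Suc n) - s n) * (norm (v n w))\<^sup>2" using s(2)[of n] Suc by simp
  have A: "A (Suc n) w = A n w + (s (Suc n) - s n) * (norm (v n w))\<^sup>2" by (simp add: A_def)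
  show ?case
  proof (cases "A (Suc n) w \<le> \<delta> \<and> C n w")
   case True
   thus ?thesis using Suc A by (simp add: v')
  next
   case False
   hence "v' n w = 0" by (auto simp: v')
   thus ?thesis using Suc A nn by simp
  qed
 qed
 have "(EE w. sqnorm (\<Sum>l<N. v' l w *v (W (s (Suc l)) w - W (s l) w)))
   = (EE w. ennreal (\<Sum>l<N. (s (Suc l) - s l) * (norm (v' l w))\<^sup>2))"
  using m' b' nn by (intro nn_integral_discrete_isometry s) (auto intro!: measurable_F_imp_P[OF m'])
 also have "\<dots> \<le> (EE w. ennreal (min \<delta> (A N w)))"
  using le[of N] by (intro nn_integral_mono ennreal_leI) auto
 finally show ?thesis .
qed

lemma discrete_maximal_inequality:
 fixes v :: "nat => 'a => real^'d^'n" and s :: "nat => real"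
 defines "A \<equiv> \<lambda>n w. \<Sum>l<n. (s (Suc l) - s l) * (norm (v l w))\<^sup>2"
  and "S \<equiv> \<lambda>n w. \<Sum>l<n. v l w *v (W (s (Suc l)) w - W (s l) w)"
 assumes s: "0 \<le> s 0" "\<And>l. l < N ==> s l < s (Suc l)"
  and v: "\<And>l. l < N ==> v l \<in> borel_measurable (F (s l))" "\<And>l. l < N ==> bounded (v l ` space P)"
  and "0 \<le> \<delta>" "0 < \<epsilon>"
 shows "emeasure P {w\<in>space P. (\<exists>k\<le>N. \<epsilon> \<le> norm (S k w)) \<and> A N w \<le> \<delta>} * ennreal (\<epsilon>\<^sup>2)
   \<le> (EE w. ennreal (min \<delta> (A N w)))" (is "emeasure P ?E * _ \<le> _")
  and "(EE w. sqnorm (S N w) * indicator {w. A N w \<le> \<delta>} w)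
   \<le> (EE w. ennreal (min \<delta> (A N w)))"
proof -
 have Amono: "A i w \<le> A j w" if "i \<le> j" "j \<le> N" for i j w
  unfolding A_def using s(2) that by (intro sum_mono2) (auto simp: less_imp_le)
 have mono: "s i \<le> s j" if "i \<le> j" "j \<le> N" for i j
  using that
 proof (induction j)
  case (Suc j) thus ?case using s(2)[of j] by (cases "i = Suc j") auto
 qed simp
 hence nn: "0 \<le> s l" if "l \<le> N" for l using s(1) that by (metis le0 order_trans)
 have Sm: "S k \<in> borel_measurable (F (s k))" if "k \<le> N" for k
  unfolding S_def using that by (intro discrete_isometry(1) s v) auto
 have Sm': "S k \<in> borel_measurable (F (s l))" if "k \<le> l" "l \<le> N" for k l
  using measurable_F_mono[OF Sm[of k], of "s l"] that mono[of k l] nn[of k] by auto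
 show "(EE w. sqnorm (S N w) * indicator {w. A N w \<le> \<delta>} w)
   \<le> (EE w. ennreal (min \<delta> (A N w)))"
 proof -
  define v' where "v' = (\<lambda>l w. if A (Suc l) w \<le> \<delta> \<and> True then v l w else 0)"
  have "(EE w. sqnorm (S N w) * indicator {w. A N w \<le> \<delta>} w) \<le>
   (EE w. sqnorm (\<Sum>l<N. v' l w *v (W (s (Suc l)) w - W (s l) w)))"
  proof (intro nn_integral_mono)
   fix w
   show "sqnorm (S N w) * indicator {w. A N w \<le> \<delta>} w \<le>
    sqnorm (\<Sum>l<N. v' l w *v (W (s (Suc l)) w - W (s l) w))"
   proof (cases "A N w \<le> \<delta>")
    case True
    hence "A (Suc l) w \<le> \<delta>" if "l < N" for l using Amono[of "Suc l" N w] that by auto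
    thus ?thesis using True by (simp add: v'_def S_def)
   qed simp
  qed
  also have "\<dots> \<le> (EE w. ennreal (min \<delta> (A N w)))"
   unfolding A_def by (rule discrete_truncation[OF s v _ v'_def[unfolded A_def]]) (use \<open>0 \<le> \<delta>\<close> in auto)
  finally show ?thesis .
 qed
 define v' where "v' = (\<lambda>l w. if A (Suc l) w \<le> \<delta> \<and> (\<forall>k\<le>l. norm (S k w) < \<epsilon>) then v l w else 0)"
 let ?S' = "\<lambda>n w. \<Sum>l<n. v' l w *v (W (s (Suc l)) w - W (s l) w)"
 have SmP[measurable]: "S k \<in> borel_measurable P" if "k \<le> N" for k
  using measurable_F_imp_P[OF Sm[OF that] nn[OF that]] .
 have vmP: "v l \<in> borel_measurable P" if "l < N" for l
  using measurable_F_imp_P[OF v(1)[OF that] nn[of l]] that by simp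
 have AmP[measurable]: "A N \<in> borel_measurable P"
  unfolding A_def using vmP by (intro borel_measurable_sum borel_measurable_times borel_measurable_power borel_measurable_norm) auto
 have E[measurable]: "?E \<in> sets P"
 proof -
  have "?E = (\<Union>k\<in>{..N}. {w\<in>space P. \<epsilon> \<le> norm (S k w) \<and> A N w \<le> \<delta>})" by auto
  also have "\<dots> \<in> sets P" by (intro sets.finite_UN) auto
  finally show ?thesis .
 qed
 \<comment> \<open>On \<open>?E\<close> the new coefficients agree with \<open>v\<close> before the
   first index \<open>k\<close> at which the level \<epsilon> is reached and vanish from
   \<open>k\<close> on, so the truncated sum is frozen at \<open>S k w\<close>. This takes the place
   of optional stopping.\<close>
 have large: "\<epsilon> \<le> norm (?S' N w)" if "w \<in> ?E" for w
 proof -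
  have AN: "A N w \<le> \<delta>" and "\<exists>k. k \<le> N \<and> \<epsilon> \<le> norm (S k w)" using that by auto
  then obtain k where k: "k \<le> N" "\<epsilon> \<le> norm (S k w)" and least: "\<And>j. j < k ==> \<not> (j \<le> N \<and> \<epsilon> \<le> norm (S j w))"
   using exists_least_iff[of "\<lambda>k. k \<le> N \<and> \<epsilon> \<le> norm (S k w)"] by blast
  have "v' l w = v l w" if "l < k" for l
   using least[of l] least that k(1) Amono[of "Suc l" N w] AN by (auto simp: v'_def not_le)
  hence 1: "?S' k w = S k w" by (simp add: S_def)
  have "v' l w = 0" if "k \<le> l" for l
   using k that by (auto simp: v'_def not_less)
  hence "?S' N w = ?S' k w"
   using k(1) by (intro sum.mono_neutral_right) auto
  thus ?thesis using 1 k by simp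
 qed
 have "emeasure P ?E * ennreal (\<epsilon>\<^sup>2) = (EE w. ennreal (\<epsilon>\<^sup>2) * indicator ?E w)"
  by (simp add: nn_integral_cmult_indicator mult.commute)
 also have "\<dots> \<le> (EE w. sqnorm (?S' N w))"
 proof (intro nn_integral_mono)
  fix w
  show "ennreal (\<epsilon>\<^sup>2) * indicator ?E w \<le> sqnorm (?S' N w)"
   using large[of w] \<open>0 < \<epsilon>\<close> by (cases "w \<in> ?E") (auto intro!: ennreal_leI power_mono)
 qed
 also have "\<dots> \<le> (EE w. ennreal (min \<delta> (A N w)))"
  unfolding A_def
 proof (rule discrete_truncation[OF s v _ v'_def[unfolded A_def]])
  fix l assume l: "l < N"
  show "Measurable.pred (F (s l)) (\<lambda>w. \<forall>k\<le>l. norm (S k w) < \<epsilon>)"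
  proof -
   have "Measurable.pred (F (s l)) (\<lambda>w. \<forall>k\<in>{..l}. norm (S k w) < \<epsilon>)"
    using Sm'[of _ l] l by (intro pred_intros_finite) (auto intro!: borel_measurable_pred_less borel_measurable_norm)
   moreover have "(\<lambda>w. \<forall>k\<in>{..l}. norm (S k w) < \<epsilon>) = (\<lambda>w. \<forall>k\<le>l. norm (S k w) < \<epsilon>)" by auto
   ultimately show ?thesis by (simp only:)
  qed
 qed (use \<open>0 \<le> \<delta>\<close> in auto)
 finally show "emeasure P ?E * ennreal (\<epsilon>\<^sup>2) \<le> (EE w. ennreal (min \<delta> (A N w)))" .
qed

end

section \<open>Step processes and their integrals\<close>

text \<open>The points of \<open>S\<close> are grid points, so none lies strictly inside a cell: the
  position of \<open>x\<close> relative to every time of a cell is decided at its left end.\<close>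

lemma grid_point_le_iff:
 assumes g: "grid T S N s" and x: "x \<in> S" "0 \<le> x" and l: "l < N" and u: "s l < u" "u \<le> s (Suc l)"
 shows "x < u \<longleftrightarrow> x \<le> s l" "u \<le> x \<longleftrightarrow> \<not> x \<le> s l" "s (Suc l) \<le> x \<longleftrightarrow> \<not> x \<le> s l"
proof -
 have "s (Suc l) \<le> x" if "s l < x"
 proof (cases "x \<le> T")
  case True
  hence "x \<in> s ` {..N}" using g x by (auto simp: grid_def)
  then obtain i where i: "i \<le> N" "x = s i" by auto
  hence "\<not> i \<le> l" using grid_le[OF g, of i l] that l by auto
  thus ?thesis using grid_le[OF g, of "Suc l" i] i by auto
 next
  case False
  thus ?thesis using grid_le_T[OF g, of "Suc l"] l by simp
 qed
 thus "x < u \<longleftrightarrow> x \<le> s l" "u \<le> x \<longleftrightarrow> \<not> x \<le> s l" "s (Suc l) \<le> x \<longleftrightarrow> \<not> x \<le> s l"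
  using u by (cases "s l < x"; force)+
qed

lemma bounded_sum_comp:
 fixes f :: "'i => 'a => 'b::real_normed_vector"
 assumes "\<And>j. j \<in> A ==> bounded (f j ` S)"
 shows "bounded ((\<lambda>x. \<Sum>j\<in>A. f j x) ` S)"
 using assms
proof (induction A rule: infinite_finite_induct)
 case (insert j A)
 hence "bounded ((\<lambda>x. f j x + (\<Sum>j\<in>A. f j x)) ` S)" by (intro bounded_plus_comp) auto
 with insert show ?case by simp
qed (auto simp: image_def)

context brownian_space
begin

text \<open>Cells are open on the left, and the value on a cell, represented by that at its right
  end, is measurable at its left end: this is predictability. Quantifying over all grids that refine
  \<open>S\<close>, instead of fixing one, lets two step processes and finitely many further times
  share a grid.\<close>

definition step_at :: "real => real set => (real => 'a => real^'d^'n) => (real => 'a => real^'n) => bool" where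
 "step_at T S V I \<longleftrightarrow> (\<forall>N s. grid T S N s -->
   (\<forall>l<N. V (s (Suc l)) \<in> borel_measurable (F (s l)) \<and> bounded (V (s (Suc l)) ` space P)
    \<and> (\<forall>u w. s l < u --> u \<le> s (Suc l) --> V u w = V (s (Suc l)) w)) \<and>
   (\<forall>k\<le>N. \<forall>w. I (s k) w = (\<Sum>l<k. V (s (Suc l)) w *v (W (s (Suc l)) w - W (s l) w))))"

definition step_pair :: "real => (real => 'a => real^'d^'n) => (real => 'a => real^'n) => bool" where
 "step_pair T V I \<longleftrightarrow> (\<exists>S. finite S \<and> step_at T S V I)
  \<and> (AE w in P. continuous_on {0..T} (\<lambda>t. I t w))"

lemma step_atD:
 assumes "step_at T S V I" "grid T S N s"
 shows "\<And>l. l < N ==> V (s (Suc l)) \<in> borel_measurable (F (s l))"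
  "\<And>l. l < N ==> bounded (V (s (Suc l)) ` space P)"
  "\<And>l u w. l < N ==> s l < u ==> u \<le> s (Suc l) ==> V u w = V (s (Suc l)) w"
  "\<And>k w. k \<le> N ==> I (s k) w = (\<Sum>l<k. V (s (Suc l)) w *v (W (s (Suc l)) w - W (s l) w))"
 using assms unfolding step_at_def by blast+

lemma step_pair_continuous: "step_pair T V I ==> AE w in P. continuous_on {0..T} (\<lambda>t. I t w)"
 by (simp add: step_pair_def)

lemma step_pair_diff:
 assumes "step_pair T V I" "step_pair T V' I'"
 shows "step_pair T (\<lambda>u w. V u w - V' u w) (\<lambda>t w. I t w - I' t w)"
proof -
 obtain S S' where S: "finite S" "step_at T S V I" and S': "finite S'" "step_at T S' V' I'"
  using assms unfolding step_pair_def by blast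
 show ?thesis unfolding step_pair_def step_at_def
 proof (intro conjI exI[of _ "S \<union> S'"] allI impI)
  show "finite (S \<union> S')" using S S' by simp
  fix N s assume "grid T (S \<union> S') N s"
  hence g: "grid T S N s" and g': "grid T S' N s" using grid_subset by blast+
  { fix l assume l: "l < N"
   show "(\<lambda>w. V (s (Suc l)) w - V' (s (Suc l)) w) \<in> borel_measurable (F (s l))"
    using step_atD(1)[OF S(2) g l] step_atD(1)[OF S'(2) g' l] by measurable
   show "bounded ((\<lambda>w. V (s (Suc l)) w - V' (s (Suc l)) w) ` space P)"
    using step_atD(2)[OF S(2) g l] step_atD(2)[OF S'(2) g' l] by (rule bounded_minus_comp)
   fix u w assume "s l < u" "u \<le> s (Suc l)"
   thus "V u w - V' u w = V (s (Suc l)) w - V' (s (Suc l)) w"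
    using step_atD(3)[OF S(2) g l] step_atD(3)[OF S'(2) g' l] by metis }
  fix k w assume "k \<le> N"
  thus "I (s k) w - I' (s k) w = (\<Sum>l<k. (V (s (Suc l)) w - V' (s (Suc l)) w) *v (W (s (Suc l)) w - W (s l) w))"
   by (simp add: step_atD(4)[OF S(2) g] step_atD(4)[OF S'(2) g'] sum_subtractf matrix_vector_mult_diff_rdistrib)
 next
  show "AE w in P. continuous_on {0..T} (\<lambda>t. I t w - I' t w)"
   using step_pair_continuous[OF assms(1)] step_pair_continuous[OF assms(2)]
   by eventually_elim (rule continuous_on_diff)
 qed
qed

lemma simple_process_step_pair:
 assumes sp: "simple_process P F m \<tau> \<eta>"
 shows "step_pair T (simple_value m \<tau> \<eta>) (simple_integral W m \<tau> \<eta>)"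
proof -
 have inc: "\<tau> j < \<tau> (Suc j)" if "j < m" for j using sp that by (auto simp: simple_process_def)
 have nonneg: "0 \<le> \<tau> j" if "j \<le> m" for j
  using that
 proof (induction j)
  case 0 thus ?case using sp by (simp add: simple_process_def)
 next
  case (Suc j) thus ?case using inc[of j] by simp
 qed
 have meas: "\<eta> j \<in> borel_measurable (F (\<tau> j))" "bounded (\<eta> j ` space P)" if "j < m" for j
  using sp that by (auto simp: simple_process_def)
 show ?thesis unfolding step_pair_def step_at_def
 proof (intro conjI exI[of _ "\<tau> ` {..m}"] allI impI)
  fix N s assume g: "grid T (\<tau> ` {..m}) N s"
  have iff: "\<tau> j < u \<longleftrightarrow> \<tau> j \<le> s l" "u \<le> \<tau> j \<longleftrightarrow> \<not> \<tau> j \<le> s l" "s (Suc l) \<le> \<tau> j \<longleftrightarrow> \<not> \<tau> j \<le> s l"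
   if "j \<le> m" "l < N" "s l < u" "u \<le> s (Suc l)" for j l u
   using grid_point_le_iff[OF g, of "\<tau> j" l u] that nonneg[of j] by auto
  have val: "simple_value m \<tau> \<eta> u w = (\<Sum>j<m. (if \<tau> j \<le> s l \<and> \<not> \<tau> (Suc j) \<le> s l then \<eta> j w else 0))"
   if "l < N" "s l < u" "u \<le> s (Suc l)" for l u w
   unfolding simple_value_def
  proof (rule sum.cong)
   fix j assume "j \<in> {..<m}"
   thus "indicator {\<tau> j<..\<tau> (Suc j)} u *\<^sub>R \<eta> j w = (if \<tau> j \<le> s l \<and> \<not> \<tau> (Suc j) \<le> s l then \<eta> j w else 0)"
    using iff[of j l u] iff[of "Suc j" l u] that by (auto simp: indicator_def)
  qed simp
  { fix l assume l: "l < N"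
   hence sl: "s l < s (Suc l)" using grid_less[OF g] by simp
   have v: "simple_value m \<tau> \<eta> (s (Suc l)) = (\<lambda>w. \<Sum>j<m. (if \<tau> j \<le> s l \<and> \<not> \<tau> (Suc j) \<le> s l then \<eta> j w else 0))"
    using val[OF l sl] by auto
   have mj: "(\<lambda>w. if \<tau> j \<le> s l \<and> \<not> \<tau> (Suc j) \<le> s l then \<eta> j w else 0) \<in> borel_measurable (F (s l))" if "j < m" for j
    using measurable_F_mono[OF meas(1)[OF that]] nonneg[of j] that by (cases "\<tau> j \<le> s l") auto
   show "simple_value m \<tau> \<eta> (s (Suc l)) \<in> borel_measurable (F (s l))"
    unfolding v using mj by (intro borel_measurable_sum) auto
   show "bounded (simple_value m \<tau> \<eta> (s (Suc l)) ` space P)"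
    unfolding v
   proof (rule bounded_sum_comp)
    fix j assume "j \<in> {..<m}"
    thus "bounded ((\<lambda>w. if \<tau> j \<le> s l \<and> \<not> \<tau> (Suc j) \<le> s l then \<eta> j w else 0) ` space P)"
     using meas(2)[of j] by (cases "\<tau> j \<le> s l \<and> \<not> \<tau> (Suc j) \<le> s l") (auto simp: image_def)
   qed
   fix u w assume "s l < u" "u \<le> s (Suc l)"
   thus "simple_value m \<tau> \<eta> u w = simple_value m \<tau> \<eta> (s (Suc l)) w"
    using val[OF l, of u w] val[OF l sl, of w] by simp }
  fix k w assume "k \<le> N"
  thus "simple_integral W m \<tau> \<eta> (s k) w =
   (\<Sum>l<k. simple_value m \<tau> \<eta> (s (Suc l)) w *v (W (s (Suc l)) w - W (s l) w))"
  proof (induction k)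
   case 0
   have "min 0 (\<tau> j) = 0" if "j \<le> m" for j using nonneg[OF that] by simp
   thus ?case using g by (simp add: grid_def simple_integral_def)
  next
   case (Suc k)
   hence k: "k < N" "s k < s (Suc k)" using grid_less[OF g, of k "Suc k"] by auto
   \<comment> \<open>No \<open>\<tau> j\<close> lies inside the cell, so the stopped time
     \<open>min t (\<tau> j)\<close> is either frozen or runs through the whole cell.\<close>
   have W: "W (min (s (Suc k)) (\<tau> j)) w = W (min (s k) (\<tau> j)) w + (if \<tau> j \<le> s k then 0 else W (s (Suc k)) w - W (s k) w)"
    if "j \<le> m" for j
    using iff(3)[OF that k(1) k(2)] k by (auto simp: min_def)
   have "simple_integral W m \<tau> \<eta> (s (Suc k)) w = (\<Sum>j<m. \<eta> j w *v (W (min (s k) (\<tau> (Suc j))) w - W (min (s k) (\<tau> j)) w)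
     + (if \<tau> j \<le> s k \<and> \<not> \<tau> (Suc j) \<le> s k then \<eta> j w else 0) *v (W (s (Suc k)) w - W (s k) w))"
    unfolding simple_integral_def
   proof (rule sum.cong)
    fix j assume "j \<in> {..<m}"
    thus "\<eta> j w *v (W (min (s (Suc k)) (\<tau> (Suc j))) w - W (min (s (Suc k)) (\<tau> j)) w) =
     \<eta> j w *v (W (min (s k) (\<tau> (Suc j))) w - W (min (s k) (\<tau> j)) w)
     + (if \<tau> j \<le> s k \<and> \<not> \<tau> (Suc j) \<le> s k then \<eta> j w else 0) *v (W (s (Suc k)) w - W (s k) w)"
     using W[of j] W[of "Suc j"] inc[of j] by (auto simp: matrix_vector_right_distrib matrix_vector_mult_diff_distrib)
   qed simp
   also have "\<dots> = simple_integral W m \<tau> \<eta> (s k) w +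
     simple_value m \<tau> \<eta> (s (Suc k)) w *v (W (s (Suc k)) w - W (s k) w)"
    using val[of k "s (Suc k)" w] k
    by (simp add: sum.distrib simple_integral_def matrix_vector_mult_def sum_distrib_right vec_eq_iff sum.swap[of _ _ UNIV])
   finally show ?case using Suc by simp
  qed
 next
  show "AE w in P. continuous_on {0..T} (\<lambda>t. simple_integral W m \<tau> \<eta> t w)"
   using W_continuous
  proof eventually_elim
   case (elim w)
   have c: "continuous_on {0..T} (\<lambda>t. W (min t (\<tau> j)) w)" if "j \<le> m" for j
    using nonneg[OF that] by (intro continuous_on_compose2[OF elim] continuous_intros) auto
   show ?case
    unfolding simple_integral_def matrix_vector_mult_def using c
    by (intro continuous_on_sum continuous_on_vec_lambda continuous_intros) auto
  qed
 qed simp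
qed

lemma step_pair_energy:
 assumes "step_pair T V I" "0 \<le> T"
 shows "\<exists>S. finite S \<and> (\<forall>N s w. grid T S N s -->
  energy T V w = ennreal (\<Sum>l<N. (s (Suc l) - s l) * (norm (V (s (Suc l)) w))\<^sup>2))"
proof -
 obtain S where S: "finite S" "step_at T S V I" using assms(1) unfolding step_pair_def by blast
 have "energy T V w = ennreal (\<Sum>l<N. (s (Suc l) - s l) * (norm (V (s (Suc l)) w))\<^sup>2)" if g: "grid T S N s" for N s w
 proof -
  have "energy T V w = (\<Sum>l<N. sqnorm (V (s (Suc l)) w) * ennreal (s (Suc l) - s l))"
   unfolding energy_def
  proof (rule nn_integral_grid[OF g])
   fix l u assume "l < N" "s l < u" "u \<le> s (Suc l)"
   from step_atD(3)[OF S(2) g this] show "(norm (V u w))\<^sup>2 = (norm (V (s (Suc l)) w))\<^sup>2" by (rule arg_cong)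
  qed
  also have "\<dots> = (\<Sum>l<N. ennreal ((s (Suc l) - s l) * (norm (V (s (Suc l)) w))\<^sup>2))"
   using grid_le[OF g] by (intro sum.cong) (auto simp: ennreal_mult[symmetric] mult.commute)
  also have "\<dots> = ennreal (\<Sum>l<N. (s (Suc l) - s l) * (norm (V (s (Suc l)) w))\<^sup>2)"
   using grid_le[OF g] by (intro sum_ennreal) auto
  finally show ?thesis .
 qed
 thus ?thesis using S by blast
qed

lemma step_pair_measurable:
 assumes sp: "step_pair T V I" and t: "t \<in> {0..T}"
 shows "I t \<in> borel_measurable (F t)"
proof -
 obtain S where S: "finite S" "step_at T S V I" using sp unfolding step_pair_def by blast
 obtain N s where g: "grid T (S \<union> {t}) N s" using grid_exists[of "S \<union> {t}" T] S t by auto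
 hence g': "grid T S N s" using grid_subset by blast
 obtain k where k: "k \<le> N" "t = s k" using g t by (auto simp: grid_def)
 have "(\<lambda>w. \<Sum>l<k. V (s (Suc l)) w *v (W (s (Suc l)) w - W (s l) w)) \<in> borel_measurable (F (s k))"
  using step_atD(1,2)[OF S(2) g'] k grid_less[OF g] g by (intro discrete_isometry(1)) (auto simp: grid_def)
 moreover have "I t = (\<lambda>w. \<Sum>l<k. V (s (Suc l)) w *v (W (s (Suc l)) w - W (s l) w))"
  using step_atD(4)[OF S(2) g' k(1)] k by auto
 ultimately show ?thesis using k by simp
qed

lemma step_pair_inequalities:
 assumes sp: "step_pair T V I" and T: "0 \<le> T" and D: "finite D" "D \<subseteq> {0..T}" and "0 \<le> \<delta>" "0 < \<epsilon>"
 shows "emeasure P {w\<in>space P. (\<exists>t\<in>D. \<epsilon> \<le> norm (I t w)) \<and> energy T V w \<le> ennreal \<delta>} * ennreal (\<epsilon>\<^sup>2)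
   \<le> (EE w. min (ennreal \<delta>) (energy T V w))"
  and "(EE w. sqnorm (I T w) * indicator {w. energy T V w \<le> ennreal \<delta>} w)
   \<le> (EE w. min (ennreal \<delta>) (energy T V w))"
  and "energy T V \<in> borel_measurable P"
  and "set_borel_measurable borel {0..T} (\<lambda>u. V u w)"
proof -
 obtain S where S: "finite S" "step_at T S V I" using sp unfolding step_pair_def by blast
 obtain S2 where S2: "finite S2" "\<And>N s w. grid T S2 N s ==>
  energy T V w = ennreal (\<Sum>l<N. (s (Suc l) - s l) * (norm (V (s (Suc l)) w))\<^sup>2)"
  using step_pair_energy[OF sp T] by blast
 obtain N s where g: "grid T (S \<union> S2 \<union> D) N s" using grid_exists[of "S \<union> S2 \<union> D" T] S(1) S2(1) D T by auto
 hence g': "grid T S N s" "grid T S2 N s" using grid_subset by blast+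
 let ?A = "\<lambda>w. \<Sum>l<N. (s (Suc l) - s l) * (norm (V (s (Suc l)) w))\<^sup>2"
 have e: "energy T V = (\<lambda>w. ennreal (?A w))" using S2(2)[OF g'(2)] by auto
 have A0: "0 \<le> ?A w" for w using grid_le[OF g] by (intro sum_nonneg) auto
 have eq: "min (ennreal \<delta>) (energy T V w) = ennreal (min \<delta> (?A w))" for w
  unfolding e min_def using A0[of w] \<open>0 \<le> \<delta>\<close> by (simp add: ennreal_le_iff2 split: if_splits)
 have le: "energy T V w \<le> ennreal \<delta> \<longleftrightarrow> ?A w \<le> \<delta>" for w
  unfolding e using \<open>0 \<le> \<delta>\<close> by (simp add: ennreal_le_iff)
 have s: "0 \<le> s 0" "\<And>l. l < N ==> s l < s (Suc l)" using g by (auto simp: grid_def)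
 have IT: "I T w = (\<Sum>l<N. V (s (Suc l)) w *v (W (s (Suc l)) w - W (s l) w))" for w
  using step_atD(4)[OF S(2) g'(1), of N w] g by (simp add: grid_def)
 show "(EE w. sqnorm (I T w) * indicator {w. energy T V w \<le> ennreal \<delta>} w)
   \<le> (EE w. min (ennreal \<delta>) (energy T V w))"
  unfolding eq le IT
  by (rule discrete_maximal_inequality(2)[OF s step_atD(1,2)[OF S(2) g'(1)] \<open>0 \<le> \<delta>\<close> \<open>0 < \<epsilon>\<close>])
 have vP: "V (s (Suc l)) \<in> borel_measurable P" if "l < N" for l
  using measurable_F_imp_P[OF step_atD(1)[OF S(2) g'(1) that]] grid_nonneg[OF g] that by auto
 hence AP: "?A \<in> borel_measurable P"
  by (intro borel_measurable_sum borel_measurable_times borel_measurable_power borel_measurable_norm) auto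
 thus eP: "energy T V \<in> borel_measurable P" unfolding e by measurable
 have IP: "I (s k) \<in> borel_measurable P" if "k \<le> N" for k
  using measurable_F_imp_P[OF step_pair_measurable[OF sp]] grid_nonneg[OF g that] grid_le_T[OF g that] by auto
 have "emeasure P {w\<in>space P. (\<exists>t\<in>D. \<epsilon> \<le> norm (I t w)) \<and> energy T V w \<le> ennreal \<delta>} \<le>
  emeasure P {w\<in>space P. (\<exists>k\<le>N. \<epsilon> \<le> norm (I (s k) w)) \<and> energy T V w \<le> ennreal \<delta>}"
 proof (rule emeasure_mono)
  have "t \<in> s ` {..N}" if "t \<in> D" for t using g D that by (auto simp: grid_def)
  thus "{w\<in>space P. (\<exists>t\<in>D. \<epsilon> \<le> norm (I t w)) \<and> energy T V w \<le> ennreal \<delta>} \<subseteq>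
    {w\<in>space P. (\<exists>k\<le>N. \<epsilon> \<le> norm (I (s k) w)) \<and> energy T V w \<le> ennreal \<delta>}" by fastforce
  have "{w\<in>space P. (\<exists>k\<le>N. \<epsilon> \<le> norm (I (s k) w)) \<and> energy T V w \<le> ennreal \<delta>} =
   (\<Union>k\<in>{..N}. {w\<in>space P. \<epsilon> \<le> norm (I (s k) w) \<and> energy T V w \<le> ennreal \<delta>})" by auto
  also have "\<dots> \<in> sets P" using IP eP by (intro sets.finite_UN) auto
  finally show "{w\<in>space P. (\<exists>k\<le>N. \<epsilon> \<le> norm (I (s k) w)) \<and> energy T V w \<le> ennreal \<delta>} \<in> sets P" .
 qed
 also have "{w\<in>space P. (\<exists>k\<le>N. \<epsilon> \<le> norm (I (s k) w)) \<and> energy T V w \<le> ennreal \<delta>} =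
  {w\<in>space P. (\<exists>k\<le>N. \<epsilon> \<le> norm (\<Sum>l<k. V (s (Suc l)) w *v (W (s (Suc l)) w - W (s l) w))) \<and> ?A w \<le> \<delta>}"
  unfolding le using step_atD(4)[OF S(2) g'(1)] by auto
 finally have "emeasure P {w\<in>space P. (\<exists>t\<in>D. \<epsilon> \<le> norm (I t w)) \<and> energy T V w \<le> ennreal \<delta>} * ennreal (\<epsilon>\<^sup>2) \<le>
  emeasure P {w\<in>space P. (\<exists>k\<le>N. \<epsilon> \<le> norm (\<Sum>l<k. V (s (Suc l)) w *v (W (s (Suc l)) w - W (s l) w))) \<and> ?A w \<le> \<delta>} * ennreal (\<epsilon>\<^sup>2)"
  by (rule mult_right_mono) simp
 also have "\<dots> \<le> (EE w. ennreal (min \<delta> (?A w)))"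
  by (rule discrete_maximal_inequality(1)[OF s step_atD(1,2)[OF S(2) g'(1)] \<open>0 \<le> \<delta>\<close> \<open>0 < \<epsilon>\<close>])
 finally show "emeasure P {w\<in>space P. (\<exists>t\<in>D. \<epsilon> \<le> norm (I t w)) \<and> energy T V w \<le> ennreal \<delta>} * ennreal (\<epsilon>\<^sup>2)
   \<le> (EE w. min (ennreal \<delta>) (energy T V w))" unfolding eq .
 show "set_borel_measurable borel {0..T} (\<lambda>u. V u w)"
 proof -
  have "indicator {0..T} u *\<^sub>R V u w = indicator {0} u *\<^sub>R V 0 w + (\<Sum>l<N. indicator {s l<..s (Suc l)} u *\<^sub>R V (s (Suc l)) w)" for u
  proof -
   have "(\<Sum>l<n. indicator {s l<..s (Suc l)} u *\<^sub>R V (s (Suc l)) w) = indicator {0<..s n} u *\<^sub>R V u w" if "n \<le> N" for n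
    using that
   proof (induction n)
    case 0 thus ?case using g by (simp add: grid_def)
   next
    case (Suc n)
    have "indicator {s n<..s (Suc n)} u *\<^sub>R V (s (Suc n)) w = indicator {s n<..s (Suc n)} u *\<^sub>R V u w"
     using step_atD(3)[OF S(2) g'(1), of n u w] Suc.prems by (auto simp: indicator_def)
    moreover have "0 \<le> s n" "s n \<le> s (Suc n)" using grid_nonneg[OF g, of n] grid_le[OF g, of n "Suc n"] Suc.prems by auto
    ultimately show ?case using Suc by (auto simp: indicator_def)
   qed
   from this[of N] g T show ?thesis by (auto simp: grid_def indicator_def)
  qed
  thus ?thesis unfolding set_borel_measurable_def by (simp only:) measurable
 qed
qed

end

section \<open>Continuity of the energy, and convergence in probability\<close>

text \<open>Young's inequality with a free weight: \<open>c = 1\<close> gives the usual factor 2,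
  while weights tending to 0 give the sharp constant 1 that convergence of energies
  requires.\<close>

lemma norm_add_power2_le:
 fixes x y :: "'b::real_normed_vector"
 assumes "0 < c"
 shows "(norm (x + y))\<^sup>2 \<le> (1 + c) * (norm x)\<^sup>2 + (1 + 1 / c) * (norm y)\<^sup>2"
proof -
 have "(norm (x + y))\<^sup>2 \<le> (norm x + norm y)\<^sup>2"
  by (intro power_mono norm_triangle_ineq) simp
 also have "\<dots> \<le> (1 + c) * (norm x)\<^sup>2 + (1 + 1 / c) * (norm y)\<^sup>2"
 proof -
  have "0 \<le> (c * norm x - norm y)\<^sup>2 / c" using assms by simp
  also have "(c * norm x - norm y)\<^sup>2 / c = c * (norm x)\<^sup>2 - 2 * norm x * norm y + (norm y)\<^sup>2 / c"
   using assms by (simp add: power2_eq_square field_simps)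
  finally show ?thesis by (simp add: power2_eq_square algebra_simps)
 qed
 finally show ?thesis .
qed

lemma energy_indicator:
 "energy T H w = (\<integral>\<^sup>+u. sqnorm (indicator {0..T} u *\<^sub>R H u w) \<partial>lborel)"
 unfolding energy_def by (intro nn_integral_cong) (simp add: indicator_def)

lemma energy_add_le:
 fixes H G :: "real => 'a => 'b::{second_countable_topology, real_normed_vector}"
 assumes "set_borel_measurable lborel {0..T} (\<lambda>u. H u w)" "set_borel_measurable lborel {0..T} (\<lambda>u. G u w)" "0 < c"
 shows "energy T (\<lambda>u w. H u w + G u w) w \<le> ennreal (1 + c) * energy T H w + ennreal (1 + 1 / c) * energy T G w"
proof -
 let ?h = "\<lambda>u. indicator {0..T} u *\<^sub>R H u w" and ?g = "\<lambda>u. indicator {0..T} u *\<^sub>R G u w"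
 have [measurable]: "?h \<in> borel_measurable lborel" "?g \<in> borel_measurable lborel"
  using assms unfolding set_borel_measurable_def by auto
 have "energy T (\<lambda>u w. H u w + G u w) w = (\<integral>\<^sup>+u. sqnorm (?h u + ?g u) \<partial>lborel)"
  unfolding energy_indicator by (simp add: scaleR_add_right)
 also have "\<dots> \<le> (\<integral>\<^sup>+u. ennreal (1 + c) * sqnorm (?h u) + ennreal (1 + 1 / c) * sqnorm (?g u) \<partial>lborel)"
 proof (rule nn_integral_mono)
  fix u
  have "sqnorm (?h u + ?g u) \<le> ennreal ((1 + c) * (norm (?h u))\<^sup>2 + (1 + 1 / c) * (norm (?g u))\<^sup>2)"
   by (intro ennreal_leI norm_add_power2_le assms)
  also have "\<dots> = ennreal (1 + c) * sqnorm (?h u) + ennreal (1 + 1 / c) * sqnorm (?g u)"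
   using assms by (simp add: ennreal_plus ennreal_mult)
  finally show "sqnorm (?h u + ?g u) \<le>
   ennreal (1 + c) * sqnorm (?h u) + ennreal (1 + 1 / c) * sqnorm (?g u)" .
 qed
 also have "\<dots> = ennreal (1 + c) * energy T H w + ennreal (1 + 1 / c) * energy T G w"
 proof -
  have "(\<integral>\<^sup>+u. ennreal (1 + c) * sqnorm (?h u) \<partial>lborel) = ennreal (1 + c) * energy T H w"
   unfolding energy_indicator by (rule nn_integral_cmult) measurable
  moreover have "(\<integral>\<^sup>+u. ennreal (1 + 1 / c) * sqnorm (?g u) \<partial>lborel) = ennreal (1 + 1 / c) * energy T G w"
   unfolding energy_indicator by (rule nn_integral_cmult) measurable
  moreover have "(\<integral>\<^sup>+u. ennreal (1 + c) * sqnorm (?h u) + ennreal (1 + 1 / c) * sqnorm (?g u) \<partial>lborel)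
   = (\<integral>\<^sup>+u. ennreal (1 + c) * sqnorm (?h u) \<partial>lborel) + (\<integral>\<^sup>+u. ennreal (1 + 1 / c) * sqnorm (?g u) \<partial>lborel)"
   by (rule nn_integral_add) measurable
  ultimately show ?thesis by (simp only:)
 qed
 finally show ?thesis .
qed

lemma energy_minus: "energy T (\<lambda>u w. G u w - H u w) w = energy T (\<lambda>u w. H u w - G u w) w"
 unfolding energy_def by (simp add: norm_minus_commute)

lemma energy_diff_le:
 fixes H G :: "real => 'a => 'b::{second_countable_topology, real_normed_vector}"
 assumes "set_borel_measurable lborel {0..T} (\<lambda>u. H u w)" "set_borel_measurable lborel {0..T} (\<lambda>u. G u w)"
 shows "energy T (\<lambda>u w. H u w - G u w) w \<le> 2 * energy T H w + 2 * energy T G w"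
proof -
 have "set_borel_measurable lborel {0..T} (\<lambda>u. - G u w)"
  using assms(2) unfolding set_borel_measurable_def by simp
 from energy_add_le[of T H w "\<lambda>u w. - G u w" 1, OF assms(1) this] show ?thesis
  by (simp add: energy_def)
qed

lemma set_borel_measurable_minus:
 assumes "set_borel_measurable M A f" "set_borel_measurable M A g"
 shows "set_borel_measurable M A (\<lambda>x. f x - g x :: 'b::{second_countable_topology, real_normed_vector})"
 using assms unfolding set_borel_measurable_def scaleR_diff_right by (rule borel_measurable_diff)

lemma energy_tendsto:
 fixes H :: "real => 'a => 'b::{second_countable_topology, real_normed_vector}"
 assumes V: "\<And>k. set_borel_measurable lborel {0..T} (\<lambda>u. V k u w)"
  and H: "set_borel_measurable lborel {0..T} (\<lambda>u. H u w)" "energy T H w < \<infinity>"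
  and lim: "(\<lambda>k. energy T (\<lambda>u w. V k u w - H u w) w) \<longlonglongrightarrow> 0"
 shows "(\<lambda>k. energy T (V k) w) \<longlonglongrightarrow> energy T H w"
proof -
 define e where "e k = energy T (\<lambda>u w. V k u w - H u w) w" for k
 define r where "r k = enn2real (e k)" for k
 define h where "h = enn2real (energy T H w)"
 \<comment> \<open>The weight tends to 0, and so does \<open>r k / c k\<close>, which is at most
   \<open>sqrt (r k)\<close>; the summand \<open>1 / Suc k\<close> keeps the weight positive when
   \<open>r k\<close> vanishes.\<close>
 define c where "c k = sqrt (r k) + 1 / Suc k" for k
 define v where "v k = enn2real (energy T (V k) w)" for k
 have h: "energy T H w = ennreal h" using H(2) by (simp add: h_def less_top)
 have fin: "eventually (\<lambda>k. e k < \<infinity>) sequentially"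
  using order_tendstoD(2)[OF lim, of \<infinity>] by (simp add: e_def)
 have r0: "r \<longlonglongrightarrow> 0"
  using tendsto_enn2real[of e 0 sequentially] lim unfolding r_def e_def by simp
 have c0: "c \<longlonglongrightarrow> 0" unfolding c_def
  using tendsto_add[OF tendsto_real_sqrt[OF r0] lim_1_over_n[THEN LIMSEQ_Suc]] by simp
 have cpos: "0 < c k" for k unfolding c_def r_def by (intro add_nonneg_pos) auto
 have rn: "0 \<le> r k" for k by (simp add: r_def)
 have bnd: "(1 + 1 / c k) * r k \<le> r k + sqrt (r k)" for k
 proof -
  have "r k = sqrt (r k) * sqrt (r k)" using rn by simp
  also have "\<dots> \<le> sqrt (r k) * c k" using rn[of k] by (intro mult_left_mono) (auto simp: c_def)
  finally show ?thesis using cpos[of k] by (simp add: field_simps)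
 qed
 have up: "eventually (\<lambda>k. energy T (V k) w = ennreal (v k) \<and> v k \<le> (1 + c k) * h + (r k + sqrt (r k))) sequentially"
  using fin
 proof eventually_elim
  case (elim k)
  have "energy T (V k) w \<le> ennreal (1 + c k) * ennreal h + ennreal (1 + 1 / c k) * ennreal (r k)"
   using energy_add_le[of T H w "\<lambda>u w. V k u w - H u w", OF H(1) set_borel_measurable_minus[OF V[of k] H(1)] cpos[of k]] elim
   by (simp add: h e_def r_def)
  also have "\<dots> = ennreal ((1 + c k) * h + (1 + 1 / c k) * r k)"
   using cpos[of k] rn[of k] by (simp add: ennreal_mult ennreal_plus h_def)
  finally have 1: "energy T (V k) w \<le> ennreal ((1 + c k) * h + (1 + 1 / c k) * r k)" .
  hence 2: "energy T (V k) w = ennreal (v k)"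
   unfolding v_def by (metis ennreal_enn2real ennreal_less_top le_less_trans)
  have "0 \<le> (1 + c k) * h + (1 + 1 / c k) * r k" using cpos[of k] rn[of k] by (simp add: h_def)
  hence "v k \<le> (1 + c k) * h + (1 + 1 / c k) * r k" using 1 2 by (simp add: ennreal_le_iff)
  thus ?case using 2 bnd[of k] by auto
 qed
 have lo: "eventually (\<lambda>k. (h - (r k + sqrt (r k))) / (1 + c k) \<le> v k) sequentially"
  using fin up
 proof eventually_elim
  case (elim k)
  have "energy T H w = energy T (\<lambda>u w. V k u w + (H u w - V k u w)) w" by simp
  also have "\<dots> \<le> ennreal (1 + c k) * energy T (V k) w + ennreal (1 + 1 / c k) * e k"
   using energy_add_le[of T "V k" w "\<lambda>u w. H u w - V k u w", OF V[of k] set_borel_measurable_minus[OF H(1) V[of k]] cpos[of k]]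
   unfolding energy_minus[of T H] e_def .
  also have "\<dots> = ennreal (1 + c k) * ennreal (v k) + ennreal (1 + 1 / c k) * ennreal (r k)"
   using elim by (simp add: r_def)
  also have "\<dots> = ennreal ((1 + c k) * v k + (1 + 1 / c k) * r k)"
   using cpos[of k] rn[of k] by (simp add: ennreal_mult ennreal_plus v_def)
  finally have "h \<le> (1 + c k) * v k + (1 + 1 / c k) * r k"
   using cpos[of k] rn[of k] unfolding h by (subst (asm) ennreal_le_iff) (auto simp: v_def)
  hence "h - (r k + sqrt (r k)) \<le> v k * (1 + c k)" using bnd[of k] by (simp add: mult.commute)
  thus ?case using cpos[of k] by (subst pos_divide_le_eq) auto
 qed
 have "v \<longlonglongrightarrow> h"
 proof (rule tendsto_sandwich[OF lo])
  show "eventually (\<lambda>k. v k \<le> (1 + c k) * h + (r k + sqrt (r k))) sequentially"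
   using up by eventually_elim simp
  have "(\<lambda>k. (h - (r k + sqrt (r k))) / (1 + c k)) \<longlonglongrightarrow> (h - (0 + sqrt 0)) / (1 + 0)"
   by (intro tendsto_intros c0 r0) simp
  thus "(\<lambda>k. (h - (r k + sqrt (r k))) / (1 + c k)) \<longlonglongrightarrow> h" by simp
  have "(\<lambda>k. (1 + c k) * h + (r k + sqrt (r k))) \<longlonglongrightarrow> (1 + 0) * h + (0 + sqrt 0)"
   by (intro tendsto_intros c0 r0)
  thus "(\<lambda>k. (1 + c k) * h + (r k + sqrt (r k))) \<longlonglongrightarrow> h" by simp
 qed
 hence "(\<lambda>k. ennreal (v k)) \<longlonglongrightarrow> ennreal h" by (rule tendsto_ennrealI)
 moreover have "eventually (\<lambda>k. ennreal (v k) = energy T (V k) w) sequentially"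
  using up by eventually_elim simp
 ultimately show ?thesis unfolding h by (rule Lim_transform_eventually)
qed

lemma (in prob_space) tends_to_zero_subseq_AE:
 assumes "tends_to_zero_in_probability M Z"
 shows "\<exists>\<phi>. strict_mono \<phi> \<and> (AE w in M. (\<lambda>k. Z (\<phi> k) w) \<longlonglongrightarrow> 0)"
proof -
 have [measurable]: "Z k \<in> borel_measurable M" for k
  using assms by (simp add: tends_to_zero_in_probability_def)
 have "\<exists>N. \<forall>n\<ge>N. prob {w\<in>space M. Z n w > ennreal ((1/2)^k)} < (1/2)^k" for k :: nat
 proof -
  have "(\<lambda>n. prob {w\<in>space M. Z n w > ennreal ((1/2)^k)}) \<longlonglongrightarrow> 0"
   using assms unfolding tends_to_zero_in_probability_def by simp
  from order_tendstoD(2)[OF this, of "(1/2)^k"] show ?thesis by (simp add: eventually_sequentially)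
 qed
 then obtain N where N: "\<And>k n. N k \<le> n ==> prob {w\<in>space M. Z n w > ennreal ((1/2)^k)} < (1/2)^k" by metis
 \<comment> \<open>Sums of successors are strictly increasing and still dominate \<open>N k\<close>,
   so this index sequence is a subsequence to which the bounds on the probabilities apply.\<close>
 define \<phi> where "\<phi> k = (\<Sum>i\<le>k. Suc (N i))" for k
 have sm: "strict_mono \<phi>" by (simp add: strict_mono_Suc_iff \<phi>_def)
 have le: "N k \<le> \<phi> k" for k
  unfolding \<phi>_def using member_le_sum[of k "{..k}" "\<lambda>i. Suc (N i)"] by simp
 have "AE w in M. eventually (\<lambda>k. w \<in> space M - {w\<in>space M. Z (\<phi> k) w > ennreal ((1/2)^k)}) sequentially"
 proof (rule borel_cantelli_AE1)
  show "emeasure M {w\<in>space M. Z (\<phi> k) w > ennreal ((1/2)^k)} < \<infinity>" for k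
   by (simp add: emeasure_eq_measure)
  show "summable (\<lambda>k. prob {w\<in>space M. Z (\<phi> k) w > ennreal ((1/2)^k)})"
   by (rule summable_comparison_test[OF _ summable_geometric[of "1/2"]])
    (use N[OF le] in \<open>auto intro!: exI[of _ 0] simp: less_imp_le\<close>)
 qed auto
 hence "AE w in M. (\<lambda>k. Z (\<phi> k) w) \<longlonglongrightarrow> 0"
 proof eventually_elim
  case (elim w)
  have "(\<lambda>k. ennreal ((1/2)^k)) \<longlonglongrightarrow> ennreal 0"
   by (intro tendsto_ennrealI LIMSEQ_realpow_zero) auto
  hence l: "(\<lambda>k. ennreal ((1/2)^k)) \<longlonglongrightarrow> 0" by (simp only: ennreal_0)
  have u: "\<forall>\<^sub>F k in sequentially. Z (\<phi> k) w \<le> ennreal ((1/2)^k)"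
   using elim by (rule eventually_mono) (auto simp: not_less)
  show ?case
   by (rule tendsto_sandwich[OF always_eventually[OF allI[OF zero_le]] u tendsto_const l])
 qed
 with sm show ?thesis by blast
qed

lemma tends_to_zero_in_probability_subseq:
 assumes "tends_to_zero_in_probability M Z" "strict_mono \<phi>"
 shows "tends_to_zero_in_probability M (\<lambda>k. Z (\<phi> k))"
 using assms LIMSEQ_subseq_LIMSEQ[OF _ assms(2)] unfolding tends_to_zero_in_probability_def o_def by blast

section \<open>Integrals as almost sure limits of step integrals\<close>

context brownian_space
begin

text \<open>The form in which the integral relation is used: after passing to subsequences,
  convergence holds almost surely, and pointwise in time is enough. The relation is stable under
  differences and under shrinking the interval, and all estimates are proved for it.\<close>

definition approx :: "real => (real => 'a => real^'d^'n) => (real => 'a => real^'n) => bool" where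
 "approx T H Y \<longleftrightarrow>
  (\<exists>V I. (\<forall>k. step_pair T (V k) (I k)) \<and>
   (AE w in P. (\<lambda>k. energy T (\<lambda>u w. V k u w - H u w) w) \<longlonglongrightarrow> 0) \<and>
   (AE w in P. \<forall>t\<in>{0..T}. (\<lambda>k. I k t w) \<longlonglongrightarrow> Y t w)) \<and>
  (\<forall>t\<in>{0..T}. Y t \<in> borel_measurable P) \<and>
  (AE w in P. set_borel_measurable lborel {0..T} (\<lambda>u. H u w) \<and> energy T H w < \<infinity>) \<and>
  (AE w in P. continuous_on {0..T} (\<lambda>t. Y t w))"

lemma approxD:
 assumes "approx T H Y"
 shows "\<And>t. t \<in> {0..T} ==> Y t \<in> borel_measurable P"
  "AE w in P. set_borel_measurable lborel {0..T} (\<lambda>u. H u w)"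
  "AE w in P. energy T H w < \<infinity>"
  "AE w in P. continuous_on {0..T} (\<lambda>t. Y t w)"
 using assms unfolding approx_def by (auto elim: eventually_mono)

text \<open>Two successive subsequences make first the energies and then the integrals converge
  almost surely; both convergences survive restriction to a shorter interval.\<close>

lemma ito_integral_on_approx:
 assumes "ito_integral_on P F W T H Y" "0 \<le> t" "t \<le> T"
 shows "approx t H Y"
proof -
 obtain m \<tau> \<eta> where sp: "\<And>k. simple_process P F (m k) (\<tau> k) (\<eta> k)"
  and e: "tends_to_zero_in_probability P
     (\<lambda>k w. \<integral>\<^sup>+s\<in>{0..T}. sqnorm (simple_value (m k) (\<tau> k) (\<eta> k) s w - H s w) \<partial>lborel)"
  and s: "tends_to_zero_in_probability P
     (\<lambda>k w. SUP t\<in>{0..T}. ennreal (norm (simple_integral W (m k) (\<tau> k) (\<eta> k) t w - Y t w)))"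
  using assms(1) unfolding ito_integral_on_def by blast
 obtain \<phi> where \<phi>: "strict_mono \<phi>" and e1: "AE w in P. (\<lambda>k. \<integral>\<^sup>+s\<in>{0..T}.
    sqnorm (simple_value (m (\<phi> k)) (\<tau> (\<phi> k)) (\<eta> (\<phi> k)) s w - H s w) \<partial>lborel) \<longlonglongrightarrow> 0"
  using tends_to_zero_subseq_AE[OF e] by blast
 obtain \<psi> where \<psi>: "strict_mono \<psi>" and s1: "AE w in P. (\<lambda>k. SUP t\<in>{0..T}.
    ennreal (norm (simple_integral W (m (\<phi> (\<psi> k))) (\<tau> (\<phi> (\<psi> k))) (\<eta> (\<phi> (\<psi> k))) t w - Y t w))) \<longlonglongrightarrow> 0"
  using tends_to_zero_subseq_AE[OF tends_to_zero_in_probability_subseq[OF s \<phi>]] by blast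
 let ?n = "\<lambda>k. \<phi> (\<psi> k)"
 let ?V = "\<lambda>k. simple_value (m (?n k)) (\<tau> (?n k)) (\<eta> (?n k))"
 let ?I = "\<lambda>k. simple_integral W (m (?n k)) (\<tau> (?n k)) (\<eta> (?n k))"
 show ?thesis unfolding approx_def
 proof (intro conjI exI[of _ ?V] exI[of _ ?I] allI ballI)
  show "step_pair t (?V k) (?I k)" for k by (rule simple_process_step_pair[OF sp])
  show "AE w in P. (\<lambda>k. energy t (\<lambda>u w. ?V k u w - H u w) w) \<longlonglongrightarrow> 0"
   using e1
  proof eventually_elim
   case (elim w)
   have 1: "(\<lambda>k. \<integral>\<^sup>+s\<in>{0..T}. sqnorm (?V k s w - H s w) \<partial>lborel) \<longlonglongrightarrow> 0"
    using LIMSEQ_subseq_LIMSEQ[OF elim \<psi>] by (simp add: o_def)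
   show ?case
   proof (rule tendsto_sandwich[OF _ _ tendsto_const 1])
    show "\<forall>\<^sub>F k in sequentially. energy t (\<lambda>u w. ?V k u w - H u w) w \<le>
      (tint T (\<lambda>s. sqnorm (?V k s w - H s w)))"
     unfolding energy_def using assms by (intro always_eventually allI nn_integral_mono) (auto simp: indicator_def)
   qed simp
  qed
  show "AE w in P. \<forall>t\<in>{0..t}. (\<lambda>k. ?I k t w) \<longlonglongrightarrow> Y t w"
   using s1
  proof (eventually_elim, intro ballI)
   fix w u assume l: "(\<lambda>k. SUP t\<in>{0..T}. ennreal (norm (?I k t w - Y t w))) \<longlonglongrightarrow> 0" and u: "u \<in> {0..t}"
   have "(\<lambda>k. ennreal (norm (?I k u w - Y u w))) \<longlonglongrightarrow> ennreal 0"
   proof (rule tendsto_sandwich[OF _ _ tendsto_const])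
    show "(\<lambda>k. SUP t\<in>{0..T}. ennreal (norm (?I k t w - Y t w))) \<longlonglongrightarrow> ennreal 0" using l by simp
    show "\<forall>\<^sub>F k in sequentially. ennreal (norm (?I k u w - Y u w)) \<le> (SUP t\<in>{0..T}. ennreal (norm (?I k t w - Y t w)))"
     using u assms by (intro always_eventually allI SUP_upper) auto
   qed simp
   hence "(\<lambda>k. norm (?I k u w - Y u w)) \<longlonglongrightarrow> 0"
    by (subst (asm) tendsto_ennreal_iff) auto
   thus "(\<lambda>k. ?I k u w) \<longlonglongrightarrow> Y u w"
    by (rule LIM_zero_cancel[OF tendsto_norm_zero_cancel])
  qed
  show "Y u \<in> borel_measurable P" if "u \<in> {0..t}" for u
   using assms that measurable_F_imp_P[of "Y u" u] by (auto simp: ito_integral_on_def)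
  have "AE w in P. set_borel_measurable lborel {0..T} (\<lambda>s. H s w) \<and> energy T H w < \<infinity>"
   using assms(1) by (simp add: ito_integral_on_def energy_def)
  thus "AE w in P. set_borel_measurable lborel {0..t} (\<lambda>u. H u w) \<and> energy t H w < \<infinity>"
  proof eventually_elim
   case (elim w)
   have "set_borel_measurable lborel {0..t} (\<lambda>u. H u w)"
    by (rule set_borel_measurable_subset[OF elim[THEN conjunct1]]) (use assms in auto)
   moreover have "energy t H w \<le> energy T H w"
    unfolding energy_def using assms by (intro nn_integral_mono) (auto simp: indicator_def)
   ultimately show ?case using elim by (auto intro: le_less_trans)
  qed
  have "AE w in P. continuous_on {0..T} (\<lambda>t. Y t w)"
   using assms(1) by (simp add: ito_integral_on_def)
  thus "AE w in P. continuous_on {0..t} (\<lambda>t. Y t w)"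
   by eventually_elim (rule continuous_on_subset, use assms in auto)
 qed
qed

lemma approx_diff:
 assumes a: "approx T H Y" "approx T H' Y'" and T: "0 \<le> T"
 shows "approx T (\<lambda>u w. H u w - H' u w) (\<lambda>t w. Y t w - Y' t w)"
proof -
 obtain V I where V: "\<And>k. step_pair T (V k) (I k)"
   "AE w in P. (\<lambda>k. energy T (\<lambda>u w. V k u w - H u w) w) \<longlonglongrightarrow> 0"
   "AE w in P. \<forall>t\<in>{0..T}. (\<lambda>k. I k t w) \<longlonglongrightarrow> Y t w"
  using a(1) unfolding approx_def by blast
 obtain V' I' where V': "\<And>k. step_pair T (V' k) (I' k)"
   "AE w in P. (\<lambda>k. energy T (\<lambda>u w. V' k u w - H' u w) w) \<longlonglongrightarrow> 0"
   "AE w in P. \<forall>t\<in>{0..T}. (\<lambda>k. I' k t w) \<longlonglongrightarrow> Y' t w"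
  using a(2) unfolding approx_def by blast
 have meas: "set_borel_measurable lborel {0..T} (\<lambda>u. V k u w)" "set_borel_measurable lborel {0..T} (\<lambda>u. V' k u w)" for k w
  using step_pair_inequalities(4)[OF V(1) T, of "{}" 0 1] step_pair_inequalities(4)[OF V'(1) T, of "{}" 0 1]
  by (auto simp: set_borel_measurable_def)
 let ?V = "\<lambda>k u w. V k u w - V' k u w" and ?I = "\<lambda>k u w. I k u w - I' k u w"
 show ?thesis unfolding approx_def
 proof (intro conjI exI[of _ ?V] exI[of _ ?I] allI ballI)
  show "step_pair T (?V k) (?I k)" for k by (rule step_pair_diff[OF V(1) V'(1)])
  show "AE w in P. (\<lambda>k. energy T (\<lambda>u w. ?V k u w - (H u w - H' u w)) w) \<longlonglongrightarrow> 0"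
   using V(2) V'(2) approxD(2)[OF a(1)] approxD(2)[OF a(2)]
  proof eventually_elim
   case (elim w)
   have 1: "(\<lambda>k. 2 * energy T (\<lambda>u w. V k u w - H u w) w + 2 * energy T (\<lambda>u w. V' k u w - H' u w) w) \<longlonglongrightarrow> 2 * 0 + 2 * 0"
    by (intro tendsto_add ennreal_tendsto_cmult elim) auto
   have "energy T (\<lambda>u w. ?V k u w - (H u w - H' u w)) w \<le>
     2 * energy T (\<lambda>u w. V k u w - H u w) w + 2 * energy T (\<lambda>u w. V' k u w - H' u w) w" for k
    using energy_diff_le[of T "\<lambda>u w. V k u w - H u w" w "\<lambda>u w. V' k u w - H' u w",
      OF set_borel_measurable_minus[OF meas(1) elim(3)] set_borel_measurable_minus[OF meas(2) elim(4)]]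
    by (simp add: algebra_simps)
   thus ?case using 1
    by (intro tendsto_sandwich[OF _ _ tendsto_const 1[simplified]]) auto
  qed
  show "AE w in P. \<forall>t\<in>{0..T}. (\<lambda>k. ?I k t w) \<longlonglongrightarrow> Y t w - Y' t w"
   using V(3) V'(3) by eventually_elim (auto intro: tendsto_diff)
  show "(\<lambda>w. Y t w - Y' t w) \<in> borel_measurable P" if "t \<in> {0..T}" for t
   using approxD(1)[OF a(1) that] approxD(1)[OF a(2) that] by measurable
  show "AE w in P. set_borel_measurable lborel {0..T} (\<lambda>u. H u w - H' u w) \<and> energy T (\<lambda>u w. H u w - H' u w) w < \<infinity>"
   using approxD(2)[OF a(1)] approxD(2)[OF a(2)] approxD(3)[OF a(1)] approxD(3)[OF a(2)]
  proof eventually_elim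
   case (elim w)
   have "2 * energy T H w + 2 * energy T H' w < \<infinity>" using elim by (simp add: ennreal_mult_less_top)
   thus ?case
    using energy_diff_le[of T H w H', OF elim(1,2)] set_borel_measurable_minus[OF elim(1,2)] by (auto intro: le_less_trans)
  qed
  show "AE w in P. continuous_on {0..T} (\<lambda>t. Y t w - Y' t w)"
   using approxD(4)[OF a(1)] approxD(4)[OF a(2)] by eventually_elim (rule continuous_on_diff)
 qed
qed

end

text \<open>Turns countably many almost sure statements, one for each rational time, into a
  statement about the whole path.\<close>

lemma closed_dense_extend:
 fixes f :: "real => 'b::topological_space"
 assumes f: "continuous_on {0..T} f" and "0 < T" "closed C" and D: "\<And>t. t \<in> \<rat> ==> 0 < t ==> t < T ==> f t \<in> C"
  and t: "t \<in> {0..T}"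
 shows "f t \<in> C"
proof -
 have cl: "closure ({0<..<T} \<inter> \<rat>) = {0..T}"
  using closure_open_Int_superset[of "{0<..<T}" "\<rat>"] Rats_closure_real \<open>0 < T\<close> by simp
 have "f ` closure ({0<..<T} \<inter> \<rat>) \<subseteq> C"
  using f D by (intro image_closure_subset \<open>closed C\<close>) (auto simp: cl)
 with t show ?thesis by (auto simp: cl)
qed

lemma nn_integral_fatou_bound:
 assumes [measurable]: "\<And>k. g k \<in> borel_measurable M" "f \<in> borel_measurable M"
  and le: "AE x in M. f x \<le> liminf (\<lambda>k. g k x)"
  and b: "\<And>k. (\<integral>\<^sup>+x. g k x \<partial>M) \<le> c k" and c: "c \<longlonglongrightarrow> C"
 shows "(\<integral>\<^sup>+x. f x \<partial>M) \<le> C"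
proof -
 have "(\<integral>\<^sup>+x. f x \<partial>M) \<le> (\<integral>\<^sup>+x. liminf (\<lambda>k. g k x) \<partial>M)"
  using le by (rule nn_integral_mono_AE)
 also have "\<dots> \<le> liminf (\<lambda>k. \<integral>\<^sup>+x. g k x \<partial>M)" by (rule nn_integral_liminf) measurable
 also have "\<dots> \<le> liminf c" using b by (intro Liminf_mono always_eventually) auto
 also have "\<dots> = C" by (rule lim_imp_Liminf[OF _ c]) simp
 finally show ?thesis .
qed

context brownian_space
begin

text \<open>From finite to countable sets of times by monotone convergence along an
  enumeration.\<close>

lemma step_pair_maximal:
 assumes sp: "step_pair T V I" and T: "0 \<le> T" and D: "countable D" "D \<subseteq> {0..T}" and \<delta>: "0 \<le> \<delta>" "0 < \<epsilon>"
 shows "{w\<in>space P. (\<exists>t\<in>D. \<epsilon> \<le> norm (I t w)) \<and> energy T V w \<le> ennreal \<delta>} \<in> sets P" (is "?E D \<in> _")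
  "emeasure P {w\<in>space P. (\<exists>t\<in>D. \<epsilon> \<le> norm (I t w)) \<and> energy T V w \<le> ennreal \<delta>} * ennreal (\<epsilon>\<^sup>2)
   \<le> (EE w. min (ennreal \<delta>) (energy T V w))"
proof -
 note [measurable] = step_pair_inequalities(3)[OF sp T, of "{}" 0 1, simplified]
 have I[measurable]: "I t \<in> borel_measurable P" if "t \<in> {0..T}" for t
  using measurable_F_imp_P[OF step_pair_measurable[OF sp that]] that by simp
 have ms: "?E D' \<in> sets P" if "countable D'" "D' \<subseteq> {0..T}" for D'
 proof -
  have "{w\<in>space P. \<exists>t\<in>D'. \<epsilon> \<le> norm (I t w)} \<in> sets P"
  proof (rule sets.sets_Collect_countable_Ex'[OF _ that(1)])
   fix t assume "t \<in> D'"
   hence [measurable]: "I t \<in> borel_measurable P" using that I by blast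
   show "{w\<in>space P. \<epsilon> \<le> norm (I t w)} \<in> sets P" by measurable
  qed
  thus ?thesis by measurable
 qed
 thus "?E D \<in> sets P" using D by blast
 show "emeasure P (?E D) * ennreal (\<epsilon>\<^sup>2) \<le> (EE w. min (ennreal \<delta>) (energy T V w))"
 proof (cases "D = {}")
  case False
  define A where "A n = ?E (from_nat_into D ` {..n})" for n
  have sub: "from_nat_into D ` {..n} \<subseteq> D" for n using from_nat_into[OF False] by auto
  have "emeasure P (?E D) = (SUP n. emeasure P (A n))"
  proof -
   have "(\<Union>n. A n) = ?E D"
   proof
    show "(\<Union>n. A n) \<subseteq> ?E D" using sub by (fastforce simp: A_def)
    show "?E D \<subseteq> (\<Union>n. A n)"
    proof
     fix w assume "w \<in> ?E D"
     then obtain t where t: "t \<in> D" "\<epsilon> \<le> norm (I t w)" "w \<in> space P" "energy T V w \<le> ennreal \<delta>" by auto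
     obtain n where n: "from_nat_into D n = t" using from_nat_into_surj[OF D(1) t(1)] by blast
     thus "w \<in> (\<Union>n. A n)" using t unfolding A_def by (auto intro!: exI[of _ n] bexI[of _ n])
    qed
   qed
   moreover have "(SUP n. emeasure P (A n)) = emeasure P (\<Union>n. A n)"
   proof (rule SUP_emeasure_incseq)
    have "A n \<in> sets P" for n unfolding A_def
     by (rule ms[OF countable_subset[OF sub D(1)] order_trans[OF sub D(2)]])
    thus "range A \<subseteq> sets P" by blast
    show "incseq A" unfolding A_def incseq_def by fastforce
   qed
   ultimately show ?thesis by simp
  qed
  also have "\<dots> * ennreal (\<epsilon>\<^sup>2) = (SUP n. emeasure P (A n) * ennreal (\<epsilon>\<^sup>2))"
   by (rule SUP_mult_right_ennreal)
  also have "\<dots> \<le> (EE w. min (ennreal \<delta>) (energy T V w))"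
  proof (rule SUP_least)
   fix n show "emeasure P (A n) * ennreal (\<epsilon>\<^sup>2) \<le> (EE w. min (ennreal \<delta>) (energy T V w))"
    unfolding A_def using sub[of n] D by (intro step_pair_inequalities(1)[OF sp T _ _ \<delta>]) auto
  qed
  finally show ?thesis .
 qed simp
qed

text \<open>For the limit the level and the energy bound are strict: these are open conditions, so
  the approximants satisfy them eventually and Fatou's lemma transfers the bounds. The right-hand
  sides converge by domination, because the energy is cut at \<delta>.\<close>

lemma approx_inequalities:
 assumes a: "approx T H Y" and T: "0 \<le> T"
 shows "energy T H \<in> borel_measurable P"
  and "countable D ==> D \<subseteq> {0..T} ==> 0 \<le> \<delta> ==> 0 < \<epsilon> ==>
   emeasure P {w\<in>space P. (\<exists>t\<in>D. \<epsilon> < norm (Y t w)) \<and> energy T H w < ennreal \<delta>} * ennreal (\<epsilon>\<^sup>2)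
   \<le> (EE w. min (ennreal \<delta>) (energy T H w))"
  and "(EE w. sqnorm (Y T w)) \<le> (EE w. energy T H w)"
proof -
 obtain V I where sp: "\<And>k. step_pair T (V k) (I k)"
   and V: "AE w in P. (\<lambda>k. energy T (\<lambda>u w. V k u w - H u w) w) \<longlonglongrightarrow> 0"
   and I: "AE w in P. \<forall>t\<in>{0..T}. (\<lambda>k. I k t w) \<longlonglongrightarrow> Y t w"
  using a unfolding approx_def by blast
 have Vm: "set_borel_measurable lborel {0..T} (\<lambda>u. V k u w)" for k w
  using step_pair_inequalities(4)[OF sp T, of "{}" 0 1] by (auto simp: set_borel_measurable_def)
 have Q: "AE w in P. (\<lambda>k. energy T (V k) w) \<longlonglongrightarrow> energy T H w"
  using V approxD(2,3)[OF a] by eventually_elim (rule energy_tendsto[OF Vm])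
 have QV[measurable]: "energy T (V k) \<in> borel_measurable P" for k
  using step_pair_inequalities(3)[OF sp T, of "{}" 0 1] by simp
 show QH[measurable]: "energy T H \<in> borel_measurable P"
 proof (rule measurable_P_AE_cong)
  show "(\<lambda>w. liminf (\<lambda>k. energy T (V k) w)) \<in> borel_measurable P" by measurable
  show "AE w in P. liminf (\<lambda>k. energy T (V k) w) = energy T H w"
   using Q by eventually_elim (rule lim_imp_Liminf, simp)
 qed simp
 have min_lim: "(\<lambda>k. \<integral>\<^sup>+w. min (ennreal \<delta>) (energy T (V k) w) \<partial>P) \<longlonglongrightarrow> (EE w. min (ennreal \<delta>) (energy T H w))" for \<delta>
 proof (rule nn_integral_dominated_convergence[where w = "\<lambda>_. ennreal \<delta>"])
  show "AE w in P. (\<lambda>k. min (ennreal \<delta>) (energy T (V k) w)) \<longlonglongrightarrow> min (ennreal \<delta>) (energy T H w)"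
   using Q by eventually_elim (rule tendsto_min[OF tendsto_const])
  show "(\<integral>\<^sup>+x. ennreal \<delta> \<partial>P) < \<infinity>" by (simp add: emeasure_space_1)
 qed auto
 have IP[measurable]: "I k t \<in> borel_measurable P" if "t \<in> {0..T}" for t k
  using measurable_F_imp_P[OF step_pair_measurable[OF sp that]] that by simp
 note Ym = approxD(1)[OF a]
 show "emeasure P {w\<in>space P. (\<exists>t\<in>D. \<epsilon> < norm (Y t w)) \<and> energy T H w < ennreal \<delta>} * ennreal (\<epsilon>\<^sup>2)
   \<le> (EE w. min (ennreal \<delta>) (energy T H w))" (is "emeasure P ?B * _ \<le> _")
  if D: "countable D" "D \<subseteq> {0..T}" and \<delta>: "0 \<le> \<delta>" "0 < \<epsilon>"
 proof -
  have B[measurable]: "?B \<in> sets P"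
  proof -
   have "{w\<in>space P. \<exists>t\<in>D. \<epsilon> < norm (Y t w)} \<in> sets P"
   proof (rule sets.sets_Collect_countable_Ex'[OF _ D(1)])
    fix t assume "t \<in> D"
    hence [measurable]: "Y t \<in> borel_measurable P" using D Ym by blast
    show "{w\<in>space P. \<epsilon> < norm (Y t w)} \<in> sets P" by measurable
   qed
   thus ?thesis by measurable
  qed
  define E where "E k = {w\<in>space P. (\<exists>t\<in>D. \<epsilon> \<le> norm (I k t w)) \<and> energy T (V k) w \<le> ennreal \<delta>}" for k
  have E[measurable]: "E k \<in> sets P" for k
   unfolding E_def by (rule step_pair_maximal(1)[OF sp T D \<delta>])
  have "(EE w. ennreal (\<epsilon>\<^sup>2) * indicator ?B w) \<le> (EE w. min (ennreal \<delta>) (energy T H w))"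
  proof (rule nn_integral_fatou_bound[OF _ _ _ _ min_lim])
   show "AE w in P. ennreal (\<epsilon>\<^sup>2) * indicator ?B w \<le> liminf (\<lambda>k. ennreal (\<epsilon>\<^sup>2) * indicator (E k) w)"
    using I Q
   proof eventually_elim
    case (elim w)
    show ?case
    proof (cases "w \<in> ?B")
     case True
     then obtain t where t: "t \<in> D" "\<epsilon> < norm (Y t w)" "energy T H w < ennreal \<delta>" "w \<in> space P" by auto
     have "eventually (\<lambda>k. \<epsilon> < norm (I k t w)) sequentially"
      using order_tendstoD(1)[OF tendsto_norm t(2)] elim(1) t(1) D by blast
     moreover have "eventually (\<lambda>k. energy T (V k) w < ennreal \<delta>) sequentially"
      using order_tendstoD(2)[OF elim(2) t(3)] .
     ultimately have "eventually (\<lambda>k. w \<in> E k) sequentially"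
      by eventually_elim (use t in \<open>auto simp: E_def intro!: bexI[of _ t]\<close>)
     hence "eventually (\<lambda>k. ennreal (\<epsilon>\<^sup>2) * indicator ?B w \<le> ennreal (\<epsilon>\<^sup>2) * indicator (E k) w) sequentially"
      by eventually_elim (auto simp: indicator_def)
     thus ?thesis by (rule Liminf_bounded)
    qed simp
   qed
   show "(EE w. ennreal (\<epsilon>\<^sup>2) * indicator (E k) w) \<le> (EE w. min (ennreal \<delta>) (energy T (V k) w))" for k
    using step_pair_maximal(2)[OF sp T D \<delta>, of k]
    by (subst nn_integral_cmult_indicator[OF E]) (simp only: E_def mult.commute)
  qed measurable
  thus ?thesis by (subst (asm) nn_integral_cmult_indicator[OF B]) (simp only: mult.commute)
 qed
 show "(EE w. sqnorm (Y T w)) \<le> (EE w. energy T H w)"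
 proof -
  have [measurable]: "Y T \<in> borel_measurable P" "I k T \<in> borel_measurable P" for k using Ym IP T by auto
  have trunc: "(EE w. sqnorm (Y T w) * indicator {w\<in>space P. energy T H w < ennreal \<delta>} w)
   \<le> (EE w. min (ennreal \<delta>) (energy T H w))" if "0 \<le> \<delta>" for \<delta>
  proof (rule nn_integral_fatou_bound[OF _ _ _ _ min_lim])
   show "(EE w. sqnorm (I k T w) * indicator {w\<in>space P. energy T (V k) w \<le> ennreal \<delta>} w)
    \<le> (EE w. min (ennreal \<delta>) (energy T (V k) w))" for k
   proof -
    have "(EE w. sqnorm (I k T w) * indicator {w\<in>space P. energy T (V k) w \<le> ennreal \<delta>} w) =
     (EE w. sqnorm (I k T w) * indicator {w. energy T (V k) w \<le> ennreal \<delta>} w)"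
     by (intro nn_integral_cong) (simp add: indicator_def)
    thus ?thesis using step_pair_inequalities(2)[OF sp T _ _ that, of "{}" 1 k] by simp
   qed
   show "AE w in P. sqnorm (Y T w) * indicator {w\<in>space P. energy T H w < ennreal \<delta>} w \<le>
     liminf (\<lambda>k. sqnorm (I k T w) * indicator {w\<in>space P. energy T (V k) w \<le> ennreal \<delta>} w)"
    using I Q
   proof eventually_elim
    case (elim w)
    show ?case
    proof (cases "w \<in> space P \<and> energy T H w < ennreal \<delta>")
     case True
     have "(\<lambda>k. sqnorm (I k T w)) \<longlonglongrightarrow> sqnorm (Y T w)"
      using elim(1) T by (intro tendsto_ennrealI tendsto_intros) auto
     moreover have "eventually (\<lambda>k. energy T (V k) w < ennreal \<delta>) sequentially"
      using order_tendstoD(2)[OF elim(2)] True by blast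
     hence "eventually (\<lambda>k. sqnorm (I k T w) =
       sqnorm (I k T w) * indicator {w\<in>space P. energy T (V k) w \<le> ennreal \<delta>} w) sequentially"
      by eventually_elim (use True in \<open>auto simp: indicator_def\<close>)
     ultimately have "(\<lambda>k. sqnorm (I k T w) * indicator {w\<in>space P. energy T (V k) w \<le> ennreal \<delta>} w)
      \<longlonglongrightarrow> sqnorm (Y T w)" by (rule Lim_transform_eventually)
     from lim_imp_Liminf[OF _ this] show ?thesis using True by simp
    qed simp
   qed
  qed measurable
  \<comment> \<open>Removal of the cut: the energy is finite almost surely, so the indicators are
    eventually 1, and Fatou's lemma applies once more.\<close>
  show ?thesis
  proof (rule nn_integral_fatou_bound[where c = "\<lambda>_. \<integral>\<^sup>+w. energy T H w \<partial>P", OF _ _ _ _ tendsto_const])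
   fix n :: nat
   show "(EE w. sqnorm (Y T w) * indicator {w\<in>space P. energy T H w < ennreal (real n)} w) \<le> (EE w. energy T H w)"
    using trunc[of "real n"] by (rule order_trans) (auto intro!: nn_integral_mono)
  next
   show "AE w in P. sqnorm (Y T w) \<le>
    liminf (\<lambda>n. sqnorm (Y T w) * indicator {w\<in>space P. energy T H w < ennreal (real n)} w)"
    using approxD(3)[OF a] AE_space
   proof eventually_elim
    case (elim w)
    then obtain h where h: "energy T H w = ennreal h" "0 \<le> h" by (cases "energy T H w") auto
    obtain N where N: "h < real N" using reals_Archimedean2 by blast
    have "eventually (\<lambda>n. sqnorm (Y T w) \<le>
      sqnorm (Y T w) * indicator {w\<in>space P. energy T H w < ennreal (real n)} w) sequentially"
     using eventually_ge_at_top[of N]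
    proof eventually_elim
     case (elim n)
     hence "h < real n" using N by simp
     thus ?case using h \<open>w \<in> space P\<close> by (simp add: ennreal_less_iff)
    qed
    thus ?case by (rule Liminf_bounded)
   qed
  qed measurable
 qed
qed

lemma approx_sup_sets:
 assumes a: "approx T H Y" and T: "0 < T" and b: "\<And>t. t \<in> {0..T} ==> 0 \<le> \<epsilon>"
 shows "{w\<in>space P. \<exists>t\<in>{0..T}. \<epsilon> < norm (Y t w)} \<in> sets P"
  "AE w in P. (\<exists>t\<in>{0..T}. \<epsilon> < norm (Y t w)) \<longleftrightarrow> (\<exists>t\<in>\<rat> \<inter> {0<..<T}. \<epsilon> < norm (Y t w))"
  "{w\<in>space P. \<exists>t\<in>\<rat> \<inter> {0<..<T}. \<epsilon> < norm (Y t w)} \<in> sets P"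
proof -
 show ae: "AE w in P. (\<exists>t\<in>{0..T}. \<epsilon> < norm (Y t w)) \<longleftrightarrow> (\<exists>t\<in>\<rat> \<inter> {0<..<T}. \<epsilon> < norm (Y t w))"
  using approxD(4)[OF a]
 proof eventually_elim
  case (elim w)
  have "norm (Y t w) \<in> {..\<epsilon>}" if "\<not> (\<exists>t\<in>\<rat> \<inter> {0<..<T}. \<epsilon> < norm (Y t w))" "t \<in> {0..T}" for t
  proof (rule closed_dense_extend[OF continuous_on_norm[OF elim] T closed_atMost _ that(2)])
   fix s :: real assume "s \<in> \<rat>" "0 < s" "s < T"
   hence "s \<in> \<rat> \<inter> {0<..<T}" by simp
   thus "norm (Y s w) \<in> {..\<epsilon>}" using that(1) not_less by blast
  qed
  moreover have "\<rat> \<inter> {0<..<T} \<subseteq> {0..T}" by auto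
  ultimately show ?case by (meson atMost_iff not_less subsetD)
 qed
 show rat: "{w\<in>space P. \<exists>t\<in>\<rat> \<inter> {0<..<T}. \<epsilon> < norm (Y t w)} \<in> sets P"
 proof (rule sets.sets_Collect_countable_Ex')
  show "countable (\<rat> \<inter> {0<..<T})" using countable_rat by (rule countable_Int1)
  fix t assume "t \<in> \<rat> \<inter> {0<..<T}"
  hence [measurable]: "Y t \<in> borel_measurable P" using approxD(1)[OF a, of t] by auto
  show "{w\<in>space P. \<epsilon> < norm (Y t w)} \<in> sets P" by measurable
 qed
 show "{w\<in>space P. \<exists>t\<in>{0..T}. \<epsilon> < norm (Y t w)} \<in> sets P"
 proof (rule in_sets_AE[OF _ rat])
  show "AE w in P. w \<in> {w\<in>space P. \<exists>t\<in>\<rat> \<inter> {0<..<T}. \<epsilon> < norm (Y t w)} \<longleftrightarrow> w \<in> {w\<in>space P. \<exists>t\<in>{0..T}. \<epsilon> < norm (Y t w)}"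
   using ae by eventually_elim auto
 qed auto
qed

lemma approx_maximal:
 assumes a: "approx T H Y" and T: "0 < T" and \<delta>: "0 \<le> \<delta>" "0 < \<epsilon>"
 shows "emeasure P {w\<in>space P. (\<exists>t\<in>{0..T}. \<epsilon> < norm (Y t w)) \<and> energy T H w < ennreal \<delta>} * ennreal (\<epsilon>\<^sup>2)
   \<le> (EE w. min (ennreal \<delta>) (energy T H w))"
proof -
 note [measurable] = approx_inequalities(1)[OF a less_imp_le[OF T]] approx_sup_sets(1,3)[OF a T less_imp_le[OF \<delta>(2)]]
 let ?B = "{w\<in>space P. (\<exists>t\<in>\<rat> \<inter> {0<..<T}. \<epsilon> < norm (Y t w)) \<and> energy T H w < ennreal \<delta>}"
 have B: "?B \<in> sets P" by measurable
 have "emeasure P {w\<in>space P. (\<exists>t\<in>{0..T}. \<epsilon> < norm (Y t w)) \<and> energy T H w < ennreal \<delta>} \<le> emeasure P ?B"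
  using approx_sup_sets(2)[OF a T less_imp_le[OF \<delta>(2)]] B
  by (intro emeasure_mono_AE) (auto elim: eventually_mono)
 hence "emeasure P {w\<in>space P. (\<exists>t\<in>{0..T}. \<epsilon> < norm (Y t w)) \<and> energy T H w < ennreal \<delta>} * ennreal (\<epsilon>\<^sup>2)
  \<le> emeasure P ?B * ennreal (\<epsilon>\<^sup>2)" by (rule mult_right_mono) simp
 also have "\<dots> \<le> (EE w. min (ennreal \<delta>) (energy T H w))"
  using T countable_rat by (intro approx_inequalities(2)[OF a _ _ _ \<delta>]) (auto intro: countable_Int1)
 finally show ?thesis .
qed

end

lemma continuous_on_halfline:
 fixes f :: "real => 'b::topological_space"
 assumes "\<And>T. 0 < T ==> continuous_on {0..T} f"
 shows "continuous_on {0..} f"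
 unfolding continuous_on_eq_continuous_within
proof
 fix t :: real assume t: "t \<in> {0..}"
 have "continuous (at t within {0..t + 1}) f"
  using assms[of "t + 1"] t by (simp add: continuous_on_eq_continuous_within)
 moreover have "at t within {0..} = at t within {0..t + 1}" by (rule at_within_nhd[of t "{..<t + 1}"]) auto
 ultimately show "continuous (at t within {0..}) f" by simp
qed

lemma geometric_uniform_limit:
 fixes f :: "nat => 'c::topological_space => 'b::banach"
 assumes d: "\<And>n t. n0 \<le> n ==> t \<in> A ==> norm (f n t - f (Suc n) t) \<le> (1/2)^n"
  and c: "\<And>n. continuous_on A (f n)"
 shows "\<And>n t. n0 \<le> n ==> t \<in> A ==> norm (f n t - lim (\<lambda>n. f n t)) \<le> 2 * (1/2)^n"
  and "continuous_on A (\<lambda>t. lim (\<lambda>n. f n t))"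
proof -
 \<comment> \<open>The subtracted tail makes the induction close: a step of size
   \<open>(1/2)^(n + k)\<close> uses up exactly half of it.\<close>
 have tel: "norm (f n t - f (n + k) t) \<le> 2 * (1/2)^n - 2 * (1/2)^(n + k)" if "n0 \<le> n" "t \<in> A" for n t k
 proof (induction k)
  case (Suc k)
  have "norm (f n t - f (n + Suc k) t) \<le> norm (f n t - f (n + k) t) + norm (f (n + k) t - f (Suc (n + k)) t)"
   using norm_triangle_ineq[of "f n t - f (n + k) t" "f (n + k) t - f (Suc (n + k)) t"] by simp
  also have "norm (f (n + k) t - f (Suc (n + k)) t) \<le> (1/2)^(n + k)" using that by (intro d) auto
  finally show ?case using Suc by simp
 qed simp
 have small: "\<forall>\<^sub>F n in sequentially. 2 * (1/2::real)^n < e" if "0 < e" for e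
 proof -
  have "(\<lambda>n. 2 * (1/2::real)^n) \<longlonglongrightarrow> 2 * 0" by (intro tendsto_intros LIMSEQ_realpow_zero) auto
  thus ?thesis using order_tendstoD(2)[of "\<lambda>n. 2 * (1/2::real)^n" 0 sequentially e] that by simp
 qed
 have conv: "convergent (\<lambda>n. f n t)" if t: "t \<in> A" for t
 proof (rule Cauchy_convergent, rule CauchyI)
  fix e :: real assume "0 < e"
  from eventually_conj[OF small[of "e / 2"] eventually_ge_at_top[of n0]] this
  obtain N where N: "2 * (1/2)^N < e / 2" "n0 \<le> N" by (auto simp: eventually_sequentially)
  have b: "norm (f N t - f m t) < e / 2" if "N \<le> m" for m
  proof -
   have "norm (f N t - f m t) \<le> 2 * (1/2)^N - 2 * (1/2)^m" using tel[OF N(2) t, of "m - N"] that by simp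
   moreover have "0 < (1/2::real)^m" by simp
   ultimately show ?thesis using N(1) by linarith
  qed
  show "\<exists>M. \<forall>m\<ge>M. \<forall>n\<ge>M. norm (f m t - f n t) < e"
  proof (intro exI[of _ N] allI impI)
   fix m n assume mn: "N \<le> m" "N \<le> n"
   show "norm (f m t - f n t) < e"
    using norm_triangle_ineq4[of "f N t - f n t" "f N t - f m t"] b[OF mn(1)] b[OF mn(2)] by simp
  qed
 qed
 show b: "norm (f n t - lim (\<lambda>n. f n t)) \<le> 2 * (1/2)^n" if "n0 \<le> n" "t \<in> A" for n t
 proof -
  have "(\<lambda>k. norm (f n t - f (k + n) t)) \<longlonglongrightarrow> norm (f n t - lim (\<lambda>n. f n t))"
   using conv[OF that(2)] by (intro tendsto_intros LIMSEQ_ignore_initial_segment) (simp add: convergent_LIMSEQ_iff)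
  thus ?thesis
  proof (rule LIMSEQ_le_const2, intro exI[of _ 0] allI impI)
   fix k :: nat
   have "norm (f n t - f (k + n) t) \<le> 2 * (1/2)^n - 2 * (1/2)^(n + k)" using tel[OF that, of k] by (simp add: add.commute)
   also have "\<dots> \<le> 2 * (1/2)^n" by simp
   finally show "norm (f n t - f (k + n) t) \<le> 2 * (1/2)^n" .
  qed
 qed
 show "continuous_on A (\<lambda>t. lim (\<lambda>n. f n t))"
 proof (rule uniform_limit_theorem[of _ f])
  show "uniform_limit A f (\<lambda>t. lim (\<lambda>n. f n t)) sequentially"
  proof (rule uniform_limitI)
   fix e :: real assume "0 < e"
   from small[OF this] eventually_ge_at_top[of n0]
   show "\<forall>\<^sub>F n in sequentially. \<forall>t\<in>A. dist (f n t) (lim (\<lambda>n. f n t)) < e"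
    by eventually_elim (auto simp: dist_norm intro: le_less_trans[OF b])
  qed
 qed (use c in auto)
qed

text \<open>Serves both the stochastic integral and the Picard iterates. Off the good event the
  limit is replaced by 0, which makes every single path continuous; adaptedness survives because the
  event is almost sure.\<close>

lemma (in filtered_space) limit_process:
 fixes f :: "nat => real => 'a => 'b::{banach, second_countable_topology}"
 assumes f: "\<And>n t. 0 \<le> t ==> f n t \<in> borel_measurable (F t)"
  and c: "AE w in P. \<forall>n. continuous_on {0..} (\<lambda>t. f n t w)"
  and d: "AE w in P. \<forall>T::nat. \<exists>n0. \<forall>n\<ge>n0. \<forall>t\<in>{0..real T}. norm (f n t w - f (Suc n) t w) \<le> (1/2)^n"
 shows "\<exists>X. (\<forall>t\<ge>0. X t \<in> borel_measurable (F t)) \<and> (\<forall>w. continuous_on {0..} (\<lambda>t. X t w)) \<and>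
  (AE w in P. \<forall>T::nat. \<exists>n0. \<forall>n\<ge>n0. \<forall>t\<in>{0..real T}. norm (f n t w - X t w) \<le> 2 * (1/2)^n)"
proof -
 define G where "G w \<longleftrightarrow> (\<forall>n. continuous_on {0..} (\<lambda>t. f n t w)) \<and>
  (\<forall>T::nat. \<exists>n0. \<forall>n\<ge>n0. \<forall>t\<in>{0..real T}. norm (f n t w - f (Suc n) t w) \<le> (1/2)^n)" for w
 have G: "AE w in P. G w" using c d by eventually_elim (simp add: G_def)
 define X where "X t w = (if G w then lim (\<lambda>n. f n t w) else 0)" for t w
 have lim: "\<exists>n0. \<forall>n\<ge>n0. \<forall>t\<in>{0..real T}. norm (f n t w - X t w) \<le> 2 * (1/2)^n"
  and lim_cont: "continuous_on {0..real T} (\<lambda>t. X t w)" if g: "G w" for T :: nat and w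
 proof -
  obtain n0 where n0: "\<And>n t. n0 \<le> n ==> t \<in> {0..real T} ==> norm (f n t w - f (Suc n) t w) \<le> (1/2)^n"
   using g unfolding G_def by blast
  have c: "continuous_on {0..real T} (\<lambda>t. f n t w)" for n
   using g unfolding G_def by (intro continuous_on_subset[of "{0..}" _ "{0..real T}"]) auto
  have "norm (f n t w - lim (\<lambda>n. f n t w)) \<le> 2 * (1/2)^n" if "n0 \<le> n" "t \<in> {0..real T}" for n t
   by (rule geometric_uniform_limit(1)[where f="\<lambda>n t. f n t w", OF _ c that]) (rule n0)
  thus "\<exists>n0. \<forall>n\<ge>n0. \<forall>t\<in>{0..real T}. norm (f n t w - X t w) \<le> 2 * (1/2)^n"
   using g unfolding X_def by (intro exI[of _ n0]) auto
  have "continuous_on {0..real T} (\<lambda>t. lim (\<lambda>n. f n t w))"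
   by (rule geometric_uniform_limit(2)[where f="\<lambda>n t. f n t w", OF _ c]) (rule n0)
  thus "continuous_on {0..real T} (\<lambda>t. X t w)" using g unfolding X_def by simp
 qed
 have "continuous_on {0..} (\<lambda>t. X t w)" for w
 proof (cases "G w")
  case True
  show ?thesis
  proof (rule continuous_on_halfline)
   fix T :: real
   obtain n where "T \<le> real n" using real_arch_simple by blast
   thus "continuous_on {0..T} (\<lambda>t. X t w)" by (intro continuous_on_subset[OF lim_cont[OF True, of n]]) auto
  qed
 qed (simp add: X_def)
 moreover have "X t \<in> borel_measurable (F t)" if t: "0 \<le> t" for t
 proof (rule measurable_F_AE_cong[OF _ t])
  show "(\<lambda>w. lim (\<lambda>n. f n t w)) \<in> borel_measurable (F t)" by (rule borel_measurable_lim_metric) (rule f[OF t])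
  show "AE w in P. lim (\<lambda>n. f n t w) = X t w" using G by eventually_elim (simp add: X_def)
 qed simp
 moreover have "AE w in P. \<forall>T::nat. \<exists>n0. \<forall>n\<ge>n0. \<forall>t\<in>{0..real T}. norm (f n t w - X t w) \<le> 2 * (1/2)^n"
  using G by eventually_elim (use lim in blast)
 ultimately show ?thesis by blast
qed

lemma (in prob_space) AE_tends_to_zero_in_probability:
 assumes [measurable]: "\<And>k. Z k \<in> borel_measurable M" and lim: "AE w in M. (\<lambda>k. Z k w) \<longlonglongrightarrow> 0"
 shows "tends_to_zero_in_probability M Z"
 unfolding tends_to_zero_in_probability_def
proof (intro conjI allI impI)
 fix e :: real assume "0 < e"
 have "(\<lambda>k. \<integral>\<^sup>+w. indicator {w\<in>space M. Z k w > ennreal e} w \<partial>M) \<longlonglongrightarrow> (\<integral>\<^sup>+w. 0 \<partial>M)"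
 proof (rule nn_integral_dominated_convergence[where w = "\<lambda>_. 1"])
  show "AE w in M. (\<lambda>k. indicator {w\<in>space M. Z k w > ennreal e} w) \<longlonglongrightarrow> (0::ennreal)"
   using lim
  proof eventually_elim
   case (elim w)
   have "eventually (\<lambda>k. Z k w < ennreal e) sequentially"
    using order_tendstoD(2)[OF elim] \<open>0 < e\<close> by simp
   hence "eventually (\<lambda>k. 0 = (indicator {w\<in>space M. Z k w > ennreal e} w :: ennreal)) sequentially"
    by eventually_elim (auto simp: indicator_def)
   thus ?case by (rule Lim_transform_eventually[OF tendsto_const])
  qed
  show "AE w in M. indicator {w\<in>space M. Z k w > ennreal e} w \<le> (1::ennreal)" for k
   by (simp add: indicator_def)
 qed (auto simp: emeasure_space_1)
 hence "(\<lambda>k. ennreal (prob {w\<in>space M. Z k w > ennreal e})) \<longlonglongrightarrow> ennreal 0"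
  by (simp add: emeasure_eq_measure)
 thus "(\<lambda>k. prob {w\<in>space M. Z k w > ennreal e}) \<longlonglongrightarrow> 0"
  by (subst (asm) tendsto_ennreal_iff) auto
qed measurable

text \<open>\<open>Q\<close> is the event to which the conclusion is restricted. The left side of
  \<open>small\<close> does not depend on \<open>d\<close>, so it vanishes for every level
  \<open>e\<close>.\<close>

lemma (in prob_space) AE_zero_if_small:
 assumes Q: "\<And>e. 0 < e ==> {w\<in>space M. Q w \<and> e < (f w :: real)} \<in> sets M"
  and small: "\<And>e d. 0 < e ==> 0 < d ==> emeasure M {w\<in>space M. Q w \<and> e < f w} * ennreal (e\<^sup>2) \<le> ennreal d"
 shows "AE w in M. Q w --> f w \<le> 0"
proof -
 have "AE w in M. Q w --> f w \<le> 1 / Suc n" for n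
 proof -
  let ?B = "{w\<in>space M. Q w \<and> 1 / Suc n < f w}"
  have "emeasure M ?B * ennreal ((1 / Suc n)\<^sup>2) \<le> 0"
   by (rule ennreal_le_epsilon) (unfold add_0, rule small, simp_all)
  hence "emeasure M ?B = 0" by (simp del: of_nat_Suc)
  hence "AE w in M. w \<notin> ?B" using Q[of "1 / Suc n"] by (intro AE_not_in) (simp add: null_sets_def)
  thus ?thesis using AE_space by eventually_elim (auto simp: not_less)
 qed
 hence "AE w in M. \<forall>n. Q w --> f w \<le> 1 / Suc n" unfolding AE_all_countable by blast
 thus ?thesis
  by (rule eventually_mono) (auto intro!: LIMSEQ_le_const[OF lim_1_over_n[THEN LIMSEQ_Suc]])
qed

context brownian_space
begin

lemma approx_maximal_energy:
 assumes a: "approx T H Y" and T: "0 < T" and \<epsilon>: "0 < \<epsilon>"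
 shows "emeasure P {w\<in>space P. \<exists>t\<in>{0..T}. \<epsilon> < norm (Y t w)} * ennreal (\<epsilon>\<^sup>2) \<le> (EE w. energy T H w)"
proof -
 note [measurable] = approx_inequalities(1)[OF a less_imp_le[OF T]] approx_sup_sets(1)[OF a T less_imp_le[OF \<epsilon>]]
 define E where "E n = {w\<in>space P. (\<exists>t\<in>{0..T}. \<epsilon> < norm (Y t w)) \<and> energy T H w < ennreal (real n)}" for n
 have E[measurable]: "E n \<in> sets P" for n
 proof -
  have "E n = {w\<in>space P. \<exists>t\<in>{0..T}. \<epsilon> < norm (Y t w)} \<inter> {w\<in>space P. energy T H w < ennreal (real n)}"
   by (auto simp: E_def)
  thus ?thesis by simp
 qed
 have inc: "incseq E"
  unfolding E_def incseq_def by (auto elim!: order.strict_trans2 intro!: ennreal_leI)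
 have "emeasure P {w\<in>space P. \<exists>t\<in>{0..T}. \<epsilon> < norm (Y t w)} \<le> emeasure P (\<Union>n. E n)"
 proof (rule emeasure_mono_AE)
  show "AE w in P. w \<in> {w\<in>space P. \<exists>t\<in>{0..T}. \<epsilon> < norm (Y t w)} --> w \<in> (\<Union>n. E n)"
   using approxD(3)[OF a]
  proof eventually_elim
   case (elim w)
   then obtain h where h: "energy T H w = ennreal h" "0 \<le> h" by (cases "energy T H w") auto
   obtain N where "h < real N" using reals_Archimedean2 by blast
   thus ?case using h by (auto simp: E_def ennreal_less_iff)
  qed
 qed simp
 also have "\<dots> = (SUP n. emeasure P (E n))" by (rule SUP_emeasure_incseq[symmetric]) (use inc in auto)
 finally have "emeasure P {w\<in>space P. \<exists>t\<in>{0..T}. \<epsilon> < norm (Y t w)} * ennreal (\<epsilon>\<^sup>2) \<le> (SUP n. emeasure P (E n)) * ennreal (\<epsilon>\<^sup>2)"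
  by (rule mult_right_mono) simp
 also have "\<dots> = (SUP n. emeasure P (E n) * ennreal (\<epsilon>\<^sup>2))" by (rule SUP_mult_right_ennreal)
 also have "\<dots> \<le> (EE w. energy T H w)"
 proof (rule SUP_least)
  fix n
  have "emeasure P (E n) * ennreal (\<epsilon>\<^sup>2) \<le> (EE w. min (ennreal (real n)) (energy T H w))"
   unfolding E_def by (rule approx_maximal[OF a T _ \<epsilon>]) simp
  also have "\<dots> \<le> (EE w. energy T H w)" by (intro nn_integral_mono) simp
  finally show "emeasure P (E n) * ennreal (\<epsilon>\<^sup>2) \<le> (EE w. energy T H w)" .
 qed
 finally show ?thesis .
qed

text \<open>Where the energy is 0 it lies below every \<delta>, so the maximal inequality bounds the
  probability that \<open>Y\<close> exceeds a fixed level by a multiple of an arbitrary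
  \<delta>.\<close>

lemma approx_zero:
 assumes a: "approx T H Y" and T: "0 < T"
 shows "AE w in P. energy T H w = 0 --> (\<forall>t\<in>{0..T}. Y t w = 0)"
proof -
 note [measurable] = approx_inequalities(1)[OF a less_imp_le[OF T]]
 let ?R = "\<rat> \<inter> {0<..<T}"
 have "AE w in P. \<forall>t\<in>?R. energy T H w = 0 --> norm (Y t w) \<le> 0"
 proof (subst AE_ball_countable)
  show "countable ?R" using countable_rat by (rule countable_Int1)
  show "\<forall>t\<in>?R. AE w in P. energy T H w = 0 --> norm (Y t w) \<le> 0"
  proof
   fix t assume t: "t \<in> ?R"
   hence [measurable]: "Y t \<in> borel_measurable P" using approxD(1)[OF a, of t] by auto
   show "AE w in P. energy T H w = 0 --> norm (Y t w) \<le> 0"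
   proof (rule AE_zero_if_small)
    show "{w\<in>space P. energy T H w = 0 \<and> e < norm (Y t w)} \<in> sets P" for e by measurable
    fix e d :: real assume e: "0 < e" and d: "0 < d"
    let ?A = "{w\<in>space P. (\<exists>t\<in>{t}. e < norm (Y t w)) \<and> energy T H w < ennreal d}"
    have "emeasure P {w\<in>space P. energy T H w = 0 \<and> e < norm (Y t w)} \<le> emeasure P ?A"
     using d by (intro emeasure_mono) auto
    hence "emeasure P {w\<in>space P. energy T H w = 0 \<and> e < norm (Y t w)} * ennreal (e\<^sup>2) \<le> emeasure P ?A * ennreal (e\<^sup>2)"
     by (rule mult_right_mono) simp
    also have "\<dots> \<le> (EE w. min (ennreal d) (energy T H w))"
     using t e d by (intro approx_inequalities(2)[OF a less_imp_le[OF T]]) auto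
    also have "\<dots> \<le> (EE w. ennreal d)" by (intro nn_integral_mono) simp
    finally show "emeasure P {w\<in>space P. energy T H w = 0 \<and> e < norm (Y t w)} * ennreal (e\<^sup>2) \<le> ennreal d"
     by (simp add: emeasure_space_1)
   qed
  qed
 qed
 thus ?thesis using approxD(4)[OF a]
 proof (eventually_elim, intro impI ballI)
  fix w t assume *: "\<forall>t\<in>?R. energy T H w = 0 --> norm (Y t w) \<le> 0" "energy T H w = 0" "t \<in> {0..T}"
   and c: "continuous_on {0..T} (\<lambda>t. Y t w)"
  have "Y t w \<in> {0}" by (rule closed_dense_extend[OF c T _ _ *(3)]) (use * in auto)
  thus "Y t w = 0" by simp
 qed
qed

lemma approx_at_zero:
 assumes a: "approx 0 H Y"
 shows "AE w in P. Y 0 w = 0"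
proof -
 have [measurable]: "Y 0 \<in> borel_measurable P" using approxD(1)[OF a, of 0] by simp
 have "energy 0 H w = 0" for w
  unfolding energy_def by (rule nn_integral_null_set) (simp add: finite_imp_null_set_lborel)
 hence "(EE w. sqnorm (Y 0 w)) = 0"
  using approx_inequalities(3)[OF a] by simp
 thus ?thesis by (subst (asm) nn_integral_0_iff_AE) auto
qed

text \<open>Locality for a time \<open>t\<close> that may depend on the path. For each rational
  \<open>q\<close> the difference of the integrals vanishes almost surely where the energy of the
  difference up to \<open>q\<close> does; if the integrands agree before \<open>t\<close> this
  covers every \<open>q < t\<close>, and continuity reaches \<open>t\<close> itself.\<close>

lemma ito_integral_local:
 assumes i: "\<And>T. 0 \<le> T ==> T \<le> S ==> approx T H Y" "\<And>T. 0 \<le> T ==> T \<le> S ==> approx T H' Y'" and S: "0 < S"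
 shows "AE w in P. \<forall>t\<in>{0..S}. (\<forall>u. 0 \<le> u --> u < t --> H u w = H' u w) --> Y t w = Y' t w"
proof -
 let ?R = "\<rat> \<inter> {0<..S}"
 have "AE w in P. \<forall>q\<in>?R. energy q (\<lambda>u w. H u w - H' u w) w = 0 --> (\<forall>t\<in>{0..q}. Y t w - Y' t w = 0)"
 proof (subst AE_ball_countable)
  show "countable ?R" using countable_rat by (rule countable_Int1)
  show "\<forall>q\<in>?R. AE w in P. energy q (\<lambda>u w. H u w - H' u w) w = 0 --> (\<forall>t\<in>{0..q}. Y t w - Y' t w = 0)"
  proof
   fix q assume q: "q \<in> ?R"
   hence a: "approx q (\<lambda>u w. H u w - H' u w) (\<lambda>t w. Y t w - Y' t w)"
    by (intro approx_diff i) auto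
   show "AE w in P. energy q (\<lambda>u w. H u w - H' u w) w = 0 --> (\<forall>t\<in>{0..q}. Y t w - Y' t w = 0)"
    using q by (intro approx_zero[OF a]) auto
  qed
 qed
 moreover have "AE w in P. continuous_on {0..S} (\<lambda>t. Y t w)" "AE w in P. continuous_on {0..S} (\<lambda>t. Y' t w)"
  using approxD(4)[OF i(1)[OF less_imp_le[OF S] order_refl]] approxD(4)[OF i(2)[OF less_imp_le[OF S] order_refl]] by auto
 moreover have "AE w in P. Y 0 w - Y' 0 w = 0"
  using S by (intro approx_at_zero[of "\<lambda>u w. H u w - H' u w" "\<lambda>t w. Y t w - Y' t w"] approx_diff i) auto
 ultimately show ?thesis
 proof (eventually_elim, intro ballI impI)
  fix w t
  assume e: "\<forall>q\<in>?R. energy q (\<lambda>u w. H u w - H' u w) w = 0 --> (\<forall>t\<in>{0..q}. Y t w - Y' t w = 0)"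
   and c: "continuous_on {0..S} (\<lambda>t. Y t w)" "continuous_on {0..S} (\<lambda>t. Y' t w)" and z: "Y 0 w - Y' 0 w = 0"
   and t: "t \<in> {0..S}" and eq: "\<forall>u. 0 \<le> u --> u < t --> H u w = H' u w"
  show "Y t w = Y' t w"
  proof (cases "t = 0")
   case False
   hence t0: "0 < t" using t by simp
   have "Y t w - Y' t w \<in> {0}"
   proof (rule closed_dense_extend[of t "\<lambda>t. Y t w - Y' t w"])
    show "continuous_on {0..t} (\<lambda>t. Y t w - Y' t w)"
     using c t by (intro continuous_on_diff) (auto elim: continuous_on_subset)
    fix q assume q: "q \<in> \<rat>" "0 < q" "q < t"
    have "energy q (\<lambda>u w. H u w - H' u w) w = (\<integral>\<^sup>+u. 0 \<partial>(lborel :: real measure))"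
     unfolding energy_def using q eq by (intro nn_integral_cong) (auto simp: indicator_def)
    thus "Y q w - Y' q w \<in> {0}" using e q t by auto
   qed (use t0 in auto)
   thus ?thesis by simp
  qed (use z in simp)
 qed
qed

end

section \<open>Left-point approximation and existence of the integral\<close>

text \<open>
 Left-continuity outside a countable set is all that is needed for the approximation by
 left-point step processes, and it covers left- as well as right-continuous processes.
\<close>

definition reg_path :: "(real => 'b::real_normed_vector) => bool" where
 "reg_path f \<longleftrightarrow> (\<lambda>u. indicator {0..} u *\<^sub>R f u) \<in> borel_measurable borel \<and>
   (\<forall>T. bounded (f ` {0..T})) \<and>
   (\<exists>C. countable C \<and> (\<forall>t>0. t \<notin> C --> (f \<longlongrightarrow> f t) (at_left t)))"

text \<open>Cutting to 0 rather than projecting onto the ball: only boundedness of the coefficients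
  is wanted, and on a bounded path the cut is inactive from some level on.\<close>

definition clip :: "real => 'b::real_normed_vector => 'b" where
 "clip c x = (if norm x \<le> c then x else 0)"

text \<open>The number of the dyadic cell, open on the left and closed on the right, that contains
  \<open>u\<close>. Hence \<open>left_point k u\<close> lies strictly before a positive
  \<open>u\<close>, even a dyadic one, and approaches it from the left.\<close>

definition left_index :: "nat => real => nat" where
 "left_index k u = nat (\<lceil>u * 2 ^ k\<rceil> - 1)"

definition left_point :: "nat => real => real" where
 "left_point k u = real (left_index k u) / 2 ^ k"

lemma left_index_iff:
 assumes "0 < u"
 shows "real j / 2 ^ k < u \<and> u \<le> real (Suc j) / 2 ^ k \<longleftrightarrow> j = left_index k u"
proof -
 have "real j / 2 ^ k < u \<and> u \<le> real (Suc j) / 2 ^ k \<longleftrightarrow> real j < u * 2 ^ k \<and> u * 2 ^ k \<le> real j + 1"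
  by (auto simp: field_simps)
 also have "\<dots> \<longleftrightarrow> \<lceil>u * 2 ^ k\<rceil> = int j + 1"
  by (auto simp: ceiling_eq_iff)
 also have "\<dots> \<longleftrightarrow> j = left_index k u"
 proof -
  have "0 < \<lceil>u * 2 ^ k\<rceil>" using assms by simp
  thus ?thesis by (auto simp: left_index_def)
 qed
 finally show ?thesis .
qed

lemma left_point_bounds:
 assumes "0 < u"
 shows "left_point k u < u" "u - 1 / 2 ^ k \<le> left_point k u" "0 \<le> left_point k u"
proof -
 have "real (left_index k u) / 2 ^ k < u \<and> u \<le> real (Suc (left_index k u)) / 2 ^ k"
  using left_index_iff[OF assms, of "left_index k u" k] by simp
 thus "left_point k u < u" "u - 1 / 2 ^ k \<le> left_point k u"
  by (auto simp: left_point_def add_divide_distrib)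
qed (simp add: left_point_def)

lemma left_point_tendsto: "0 < u ==> filterlim (\<lambda>k. left_point k u) (at_left u) sequentially"
proof (rule filterlim_at_withinI)
 assume u: "0 < u"
 have "(\<lambda>k. u - (1/2)^k) \<longlonglongrightarrow> u - 0" by (intro tendsto_intros LIMSEQ_realpow_zero) auto
 hence l: "(\<lambda>k. u - (1/2)^k) \<longlonglongrightarrow> u" by simp
 show "(\<lambda>k. left_point k u) \<longlonglongrightarrow> u"
 proof (rule tendsto_sandwich[OF _ _ l tendsto_const])
  show "\<forall>\<^sub>F k in sequentially. u - (1/2)^k \<le> left_point k u"
   using left_point_bounds(2)[OF u] by (intro always_eventually allI) (simp add: power_one_over)
  show "\<forall>\<^sub>F k in sequentially. left_point k u \<le> u"
   using left_point_bounds(1)[OF u] by (intro always_eventually allI less_imp_le)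
 qed
 show "\<forall>\<^sub>F k in sequentially. left_point k u \<in> {..<u} - {u}"
  using left_point_bounds(1)[OF u] by (intro always_eventually allI) auto
qed

lemma simple_value_left_point:
 assumes "0 < u" "u \<le> real k"
 shows "simple_value (k * 2 ^ k) (\<lambda>j. real j / 2 ^ k) \<eta> u w = \<eta> (left_index k u) w"
proof -
 have "left_index k u < k * 2 ^ k"
 proof -
  have "real (left_index k u) / 2 ^ k < u"
   using left_index_iff[OF assms(1), of "left_index k u" k] by simp
  hence "real (left_index k u) < u * 2 ^ k" by (simp add: field_simps)
  also have "\<dots> \<le> real k * 2 ^ k" using assms by simp
  finally have "real (left_index k u) < real (k * 2 ^ k)" by simp
  thus ?thesis by (simp only: of_nat_less_iff)
 qed
 moreover have "indicator {real j / 2 ^ k<..real (Suc j) / 2 ^ k} u = (if j = left_index k u then 1 else 0 :: real)" for j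
  using left_index_iff[OF assms(1), of j k] by (auto simp: indicator_def simp del: of_nat_Suc)
 ultimately show ?thesis unfolding simple_value_def
  by (simp add: if_distrib[of "\<lambda>x. x *\<^sub>R _"] sum.delta cong: if_cong del: of_nat_Suc)
qed

definition left_process :: "(real => 'a => real^'d^'n) => nat => nat => 'a => real^'d^'n" where
 "left_process H k j w = clip (real k) (H (real j / 2 ^ k) w)"

text \<open>Dominated convergence along one path: the left-point values converge wherever the path
  is left-continuous, the countable set of other times is Lebesgue null, and the path is bounded on
  \<open>{0..T}\<close>.\<close>

lemma left_process_energy_tendsto:
 assumes reg: "reg_path (\<lambda>t. H t w)" and T: "0 \<le> T"
  and meas: "\<And>k. set_borel_measurable lborel {0..T} (\<lambda>u. simple_value (k * 2 ^ k) (\<lambda>j. real j / 2 ^ k) (left_process H k) u w)"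
 shows "(\<lambda>k. energy T (\<lambda>u w. simple_value (k * 2 ^ k) (\<lambda>j. real j / 2 ^ k) (left_process H k) u w - H u w) w) \<longlonglongrightarrow> 0"
  and "set_borel_measurable lborel {0..T} (\<lambda>u. H u w)" and "energy T H w < \<infinity>"
proof -
 let ?V = "\<lambda>k u. simple_value (k * 2 ^ k) (\<lambda>j. real j / 2 ^ k) (left_process H k) u w"
 obtain B where B: "\<And>u. u \<in> {0..T} ==> norm (H u w) \<le> B"
  using reg unfolding reg_path_def bounded_iff by (meson image_eqI)
 have B0: "0 \<le> B" using B[of 0] T by (auto intro: order_trans[OF norm_ge_zero])
 obtain C where C: "countable C" "\<And>t. 0 < t ==> t \<notin> C ==> ((\<lambda>t. H t w) \<longlongrightarrow> H t w) (at_left t)"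
  using reg unfolding reg_path_def by blast
 have Hm: "(\<lambda>u. indicator {0..} u *\<^sub>R H u w) \<in> borel_measurable borel"
  using reg by (simp add: reg_path_def)
 show Hb: "set_borel_measurable lborel {0..T} (\<lambda>u. H u w)"
 proof -
  have "(\<lambda>u. indicator {0..T} u *\<^sub>R (indicator {0..} u *\<^sub>R H u w)) \<in> borel_measurable lborel"
   using Hm by measurable
  also have "(\<lambda>u. indicator {0..T} u *\<^sub>R (indicator {0..} u *\<^sub>R H u w)) = (\<lambda>u. indicator {0..T} u *\<^sub>R H u w)"
   by (auto simp: indicator_def)
  finally show ?thesis by (simp add: set_borel_measurable_def)
 qed
 have fin: "(\<integral>\<^sup>+u. ennreal c * indicator {0..T} u \<partial>lborel) < \<infinity>" for c
  using T by (subst nn_integral_cmult_indicator) (auto simp: ennreal_mult_less_top)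
 have "energy T H w \<le> (\<integral>\<^sup>+u. ennreal (B\<^sup>2) * indicator {0..T} u \<partial>lborel)"
  unfolding energy_def using B by (intro nn_integral_mono) (auto simp: indicator_def intro!: ennreal_leI power_mono)
 thus "energy T H w < \<infinity>" using fin by (rule le_less_trans)
 \<comment> \<open>From index \<open>K\<close> on, neither the clipping at level \<open>k\<close>
   nor the end \<open>k\<close> of the time range of the k-th simple process is felt on
   \<open>{0..T}\<close>.\<close>
 obtain K where K: "max B T \<le> real K" using real_arch_simple by blast
 have val: "?V k u = H (left_point k u) w" if "K \<le> k" "0 < u" "u \<le> T" for k u
 proof -
  have k: "u \<le> real k" "B \<le> real k" using that K by auto
  have "left_point k u \<in> {0..T}" using left_point_bounds[OF that(2), of k] that by auto
  hence "norm (H (left_point k u) w) \<le> real k" using B k by (meson order_trans)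
  thus ?thesis
   using simple_value_left_point[OF that(2) k(1), of "left_process H k" w]
   by (simp add: left_process_def clip_def left_point_def)
 qed
 have "(\<lambda>k. \<integral>\<^sup>+u. sqnorm (indicator {0..T} u *\<^sub>R (?V (k + K) u - H u w)) \<partial>lborel) \<longlonglongrightarrow> (\<integral>\<^sup>+u. 0 \<partial>(lborel :: real measure))"
 proof (rule nn_integral_dominated_convergence[where w = "\<lambda>u. ennreal ((2 * B)\<^sup>2) * indicator {0..T} u"])
  show "(\<lambda>u. sqnorm (indicator {0..T} u *\<^sub>R (?V (k + K) u - H u w))) \<in> borel_measurable lborel" for k
   using set_borel_measurable_minus[OF meas[of "k + K"] Hb] unfolding set_borel_measurable_def by measurable
  show "AE u in lborel. sqnorm (indicator {0..T} u *\<^sub>R (?V (k + K) u - H u w)) \<le> ennreal ((2 * B)\<^sup>2) * indicator {0..T} u" for k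
   using AE_lborel_singleton[of 0]
  proof eventually_elim
   case (elim u)
   show ?case
   proof (cases "u \<in> {0..T}")
    case True
    hence u: "0 < u" "u \<le> T" using elim by auto
    hence "left_point (k + K) u \<in> {0..T}" using left_point_bounds[OF u(1), of "k + K"] by auto
    hence "norm (?V (k + K) u - H u w) \<le> 2 * B"
     using val[of "k + K" u] u B[of "left_point (k + K) u"] B[OF True] norm_triangle_ineq4[of "?V (k + K) u" "H u w"] by simp
    from power_mono[OF this norm_ge_zero, of 2] show ?thesis using True by (simp add: ennreal_leI)
   qed simp
  qed
  have "AE u in lborel. u \<notin> C" by (rule AE_not_in[OF countable_imp_null_set_lborel[OF C(1)]])
  thus "AE u in lborel. (\<lambda>k. sqnorm (indicator {0..T} u *\<^sub>R (?V (k + K) u - H u w))) \<longlonglongrightarrow> 0"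
   using AE_lborel_singleton[of 0]
  proof eventually_elim
   case (elim u)
   show ?case
   proof (cases "u \<in> {0..T}")
    case True
    hence u: "0 < u" "u \<le> T" using elim by auto
    have "(\<lambda>k. H (left_point k u) w) \<longlonglongrightarrow> H u w"
     by (rule filterlim_compose[OF C(2)[OF u(1) elim(1)] left_point_tendsto[OF u(1)]])
    hence "(\<lambda>k. H (left_point (k + K) u) w) \<longlonglongrightarrow> H u w" by (rule LIMSEQ_ignore_initial_segment)
    hence "(\<lambda>k. ?V (k + K) u) \<longlonglongrightarrow> H u w" using val[OF _ u] by simp
    hence "(\<lambda>k. sqnorm (indicator {0..T} u *\<^sub>R (?V (k + K) u - H u w))) \<longlonglongrightarrow> sqnorm (indicator {0..T} u *\<^sub>R (H u w - H u w))"
     by (intro tendsto_ennrealI tendsto_intros)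
    thus ?thesis by simp
   qed simp
  qed
 qed (use fin in auto)
 thus "(\<lambda>k. energy T (\<lambda>u w. simple_value (k * 2 ^ k) (\<lambda>j. real j / 2 ^ k) (left_process H k) u w - H u w) w) \<longlonglongrightarrow> 0"
  unfolding energy_indicator nn_integral_const mult_zero_left by (rule LIMSEQ_offset)
qed

context brownian_space
begin

lemma sup_norm_measurable:
 fixes A :: "real => 'a => real^'n"
 assumes m: "\<And>t. t \<in> {0..T} ==> A t \<in> borel_measurable P" and c: "AE w in P. continuous_on {0..T} (\<lambda>t. A t w)" and T: "0 < T"
 shows "(\<lambda>w. SUP t\<in>{0..T}. ennreal (norm (A t w))) \<in> borel_measurable P"
proof (rule measurable_P_AE_cong)
 let ?D = "\<rat> \<inter> {0<..<T}"
 have D: "countable ?D" using countable_rat by (rule countable_Int1)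
 show "(\<lambda>w. SUP t\<in>?D. ennreal (norm (A t w))) \<in> borel_measurable P"
 proof (rule borel_measurable_SUP[OF D])
  fix t assume "t \<in> ?D"
  hence "A t \<in> borel_measurable P" by (intro m) auto
  thus "(\<lambda>w. ennreal (norm (A t w))) \<in> borel_measurable P" by measurable
 qed
 show "AE w in P. (SUP t\<in>?D. ennreal (norm (A t w))) = (SUP t\<in>{0..T}. ennreal (norm (A t w)))"
  using c
 proof eventually_elim
  case (elim w)
  show ?case
  proof (rule antisym)
   show "(SUP t\<in>?D. ennreal (norm (A t w))) \<le> (SUP t\<in>{0..T}. ennreal (norm (A t w)))"
    by (rule SUP_subset_mono) auto
   show "(SUP t\<in>{0..T}. ennreal (norm (A t w))) \<le> (SUP t\<in>?D. ennreal (norm (A t w)))"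
   proof (rule SUP_least)
    fix t assume t: "t \<in> {0..T}"
    have "continuous_on {0..T} (\<lambda>t. ennreal (norm (A t w)))"
     by (intro continuous_on_ennreal continuous_on_norm elim)
    hence "ennreal (norm (A t w)) \<in> {..(SUP t\<in>?D. ennreal (norm (A t w)))}"
    proof (rule closed_dense_extend[OF _ T _ _ t])
     fix s :: real assume "s \<in> \<rat>" "0 < s" "s < T"
     thus "ennreal (norm (A s w)) \<in> {..(SUP t\<in>?D. ennreal (norm (A t w)))}"
      by (auto intro: SUP_upper)
    qed simp
    thus "ennreal (norm (A t w)) \<le> (SUP t\<in>?D. ennreal (norm (A t w)))" by simp
   qed
  qed
 qed
qed simp

definition regular :: "(real => 'a => 'b::real_normed_vector) => bool" where
 "regular H \<longleftrightarrow> (\<forall>t\<ge>0. H t \<in> borel_measurable (F t)) \<and> (AE w in P. reg_path (\<lambda>t. H t w))"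

lemma left_process_simple:
 assumes "regular H"
 shows "simple_process P F (k * 2 ^ k) (\<lambda>j. real j / 2 ^ k) (left_process H k)"
 unfolding simple_process_def
proof (intro conjI allI impI)
 fix j assume "j < k * 2 ^ k"
 have [measurable]: "H (real j / 2 ^ k) \<in> borel_measurable (F (real j / 2 ^ k))"
  using assms by (auto simp: regular_def)
 show "left_process H k j \<in> borel_measurable (F (real j / 2 ^ k))"
  unfolding left_process_def[abs_def] clip_def by measurable
 show "bounded (left_process H k j ` space P)"
  by (auto simp: bounded_iff left_process_def clip_def intro!: exI[of _ "real k"])
qed (auto simp: divide_strict_right_mono)

text \<open>No moments of \<open>H\<close> are available, so the integrals of the approximations are
  Cauchy in probability only: energies of differences are small with high probability, and the
  truncated maximal inequality makes the integrals uniformly close. Along a subsequence with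
  summable error probabilities they converge locally uniformly.\<close>

theorem ito_integral_exists:
 fixes H :: "real => 'a => real^'d^'n"
 assumes H: "regular H"
 shows "\<exists>Y. (\<forall>t\<ge>0. Y t \<in> borel_measurable (F t)) \<and> (\<forall>w. continuous_on {0..} (\<lambda>t. Y t w)) \<and>
  (\<forall>T>0. ito_integral_on P F W T H Y)"
proof -
 define \<tau> where "\<tau> k j = real j / 2 ^ k" for k j :: nat
 define m where "m k = k * 2 ^ k" for k :: nat
 define V where "V k = simple_value (m k) (\<tau> k) (left_process H k)" for k
 define I where "I k = simple_integral W (m k) (\<tau> k) (left_process H k)" for k
 have simple: "simple_process P F (m k) (\<tau> k) (left_process H k)" for k
  using left_process_simple[OF H, of k] unfolding m_def \<tau>_def[abs_def] by simp
 have sp: "step_pair T (V k) (I k)" for T k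
  unfolding V_def I_def by (rule simple_process_step_pair[OF simple])
 have Vm: "set_borel_measurable lborel {0..T} (\<lambda>u. V k u w)" if "0 \<le> T" for T k w
  using step_pair_inequalities(4)[OF sp that, of "{}" 0 1] by (auto simp: set_borel_measurable_def)
 have path: "AE w in P. reg_path (\<lambda>t. H t w)" using H by (simp add: regular_def)
 define e where "e T k w = energy T (\<lambda>u w. V k u w - H u w) w" for T k w
 have e0: "AE w in P. (\<lambda>k. e T k w) \<longlonglongrightarrow> 0 \<and> set_borel_measurable lborel {0..T} (\<lambda>u. H u w) \<and> energy T H w < \<infinity>"
  if T: "0 \<le> T" for T
  using path
 proof eventually_elim
  case (elim w)
  have Vm': "set_borel_measurable lborel {0..T} (\<lambda>u. simple_value (k * 2 ^ k) (\<lambda>j. real j / 2 ^ k) (left_process H k) u w)" for k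
   using Vm[OF T, of k w] unfolding V_def m_def \<tau>_def[abs_def] .
  show ?case
   using left_process_energy_tendsto[OF elim T Vm']
   unfolding e_def V_def m_def \<tau>_def[abs_def] by blast
 qed
 have eVV: "energy T (\<lambda>u w. V k u w - V l u w) \<in> borel_measurable P" if "0 \<le> T" for T k l
  using step_pair_inequalities(3)[OF step_pair_diff[OF sp sp] that, of "{}" 0 1] by simp
 \<comment> \<open>The adapted integrand \<open>H\<close> is not known to be jointly measurable; its
   distance to \<open>V k\<close> is obtained as a limit of distances between step
   processes.\<close>
 have em[measurable]: "e T k \<in> borel_measurable P" if T: "0 \<le> T" for T k
 proof (rule measurable_P_AE_cong)
  show "(\<lambda>w. liminf (\<lambda>l. energy T (\<lambda>u w. V k u w - V l u w) w)) \<in> borel_measurable P"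
   using eVV[OF T] by measurable
  show "AE w in P. liminf (\<lambda>l. energy T (\<lambda>u w. V k u w - V l u w) w) = e T k w"
   using e0[OF T]
  proof eventually_elim
   case (elim w)
   have Hm: "set_borel_measurable lborel {0..T} (\<lambda>u. H u w)" using elim by blast
   have Vfin: "energy T (V k) w < \<infinity>"
    using step_pair_energy[OF sp T, of k] grid_exists[OF _ T] by fastforce
   have "2 * energy T (V k) w + 2 * energy T H w < \<infinity>" using elim Vfin by (simp add: ennreal_mult_less_top)
   hence fin: "energy T (\<lambda>u w. V k u w - H u w) w < \<infinity>"
    using energy_diff_le[of T "V k" w H, OF Vm[OF T] Hm] by (rule le_less_trans[rotated])
   have "(\<lambda>l. energy T (\<lambda>u w. V k u w - V l u w) w) \<longlonglongrightarrow> energy T (\<lambda>u w. V k u w - H u w) w"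
   proof (rule energy_tendsto[of T "\<lambda>l u w. V k u w - V l u w" w "\<lambda>u w. V k u w - H u w"])
    show "set_borel_measurable lborel {0..T} (\<lambda>u. V k u w - V l u w)" for l
     by (intro set_borel_measurable_minus Vm T)
    show "set_borel_measurable lborel {0..T} (\<lambda>u. V k u w - H u w)"
     by (intro set_borel_measurable_minus Vm T Hm)
    have "energy T (\<lambda>u w. V k u w - V l u w - (V k u w - H u w)) w = e T l w" for l
     unfolding e_def by (subst energy_minus) simp
    thus "(\<lambda>l. energy T (\<lambda>u w. V k u w - V l u w - (V k u w - H u w)) w) \<longlonglongrightarrow> 0"
     using elim by simp
   qed (rule fin)
   thus ?case unfolding e_def by (intro lim_imp_Liminf) simp_all
  qed
 qed simp
 have etz: "tends_to_zero_in_probability P (e T)" if T: "0 \<le> T" for T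
  by (rule AE_tends_to_zero_in_probability[OF em[OF T]]) (use e0[OF T] in eventually_elim, blast)
 let ?D = "\<lambda>n. \<rat> \<inter> {0<..<real n}"
 have D: "countable (?D n)" "?D n \<subseteq> {0..real n}" for n using countable_rat by (auto intro: countable_Int1)
 have IP: "I k t \<in> borel_measurable P" if "0 \<le> t" for k t
  using measurable_F_imp_P[OF step_pair_measurable[OF sp[of t k]]] that by simp
 \<comment> \<open>The n-th comparison is made on \<open>[0, n]\<close>, so one subsequence serves
   all time horizons.\<close>
 define B where "B n k l = {w\<in>space P. \<exists>t\<in>?D n. (1/2)^n \<le> norm (I k t w - I l t w)}" for n k l
 have B[measurable]: "B n k l \<in> sets P" for n k l
 proof -
  show ?thesis unfolding B_def
  proof (rule sets.sets_Collect_countable_Ex'[OF _ D(1)])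
   fix t assume "t \<in> ?D n"
   hence [measurable]: "I k t \<in> borel_measurable P" "I l t \<in> borel_measurable P" using IP by auto
   show "{w\<in>space P. (1/2)^n \<le> norm (I k t w - I l t w)} \<in> sets P" by measurable
  qed
 qed
 have "\<exists>N. \<forall>k\<ge>N. \<forall>l\<ge>N. prob (B n k l) \<le> 3 * (1/2)^n" for n
 proof -
  \<comment> \<open>The maximal inequality divides by the squared level \<open>(1/4)^n\<close>,
    which leaves the summable \<open>(1/2)^n\<close>. The two further events, where an approximation
    is not yet good, cost \<open>(1/2)^n\<close> each.\<close>
  define \<delta> :: real where "\<delta> = (1/8)^n"
  have \<delta>: "0 < \<delta>" by (simp add: \<delta>_def)
  have "(\<lambda>k. prob {w\<in>space P. e (real n) k w > ennreal (\<delta> / 4)}) \<longlonglongrightarrow> 0"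
   using etz[of "real n"] \<delta> by (simp add: tends_to_zero_in_probability_def)
  from order_tendstoD(2)[OF this, of "(1/2)^n"]
  obtain N where N: "\<And>k. N \<le> k ==> prob {w\<in>space P. e (real n) k w > ennreal (\<delta> / 4)} < (1/2)^n"
   by (auto simp: eventually_sequentially)
  have "prob (B n k l) \<le> 3 * (1/2)^n" if kl: "N \<le> k" "N \<le> l" for k l
  proof -
   let ?E = "\<lambda>k. {w\<in>space P. e (real n) k w > ennreal (\<delta> / 4)}"
   let ?S = "{w\<in>space P. (\<exists>t\<in>?D n. (1/2)^n \<le> norm (I k t w - I l t w)) \<and> energy (real n) (\<lambda>u w. V k u w - V l u w) w \<le> ennreal \<delta>}"
   have Em: "?E k \<in> sets P" for k using em[of "real n" k] by measurable
   have S: "?S \<in> sets P"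
    by (rule step_pair_maximal(1)[OF step_pair_diff[OF sp sp] _ D]) (use \<delta> in auto)
   have "prob (B n k l) \<le> prob (?E k \<union> ?E l \<union> ?S)"
   proof (rule finite_measure_mono_AE)
    show "AE w in P. w \<in> B n k l --> w \<in> ?E k \<union> ?E l \<union> ?S"
     using e0[OF of_nat_0_le_iff[of n]]
    proof (eventually_elim, intro impI)
     fix w assume h: "(\<lambda>k. e (real n) k w) \<longlonglongrightarrow> 0 \<and> set_borel_measurable lborel {0..real n} (\<lambda>u. H u w) \<and> energy (real n) H w < \<infinity>"
      and w: "w \<in> B n k l"
     have Hm: "set_borel_measurable lborel {0..real n} (\<lambda>u. H u w)" using h by blast
     show "w \<in> ?E k \<union> ?E l \<union> ?S"
     proof (cases "w \<in> ?E k \<union> ?E l")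
      case False
      hence "e (real n) k w \<le> ennreal (\<delta> / 4)" "e (real n) l w \<le> ennreal (\<delta> / 4)"
       using w by (auto simp: B_def not_less)
      have "energy (real n) (\<lambda>u w. (V k u w - H u w) - (V l u w - H u w)) w \<le> 2 * e (real n) k w + 2 * e (real n) l w"
       unfolding e_def
       by (rule energy_diff_le) (intro set_borel_measurable_minus Vm Hm of_nat_0_le_iff)+
      also have "\<dots> \<le> 2 * ennreal (\<delta> / 4) + 2 * ennreal (\<delta> / 4)"
       by (intro add_mono mult_left_mono) (use \<open>e (real n) k w \<le> _\<close> \<open>e (real n) l w \<le> _\<close> in auto)
      also have "\<dots> = ennreal \<delta>"
      proof -
       have "2 * ennreal (\<delta> / 4) = ennreal (\<delta> / 2)"
        using ennreal_mult[of 2 "\<delta> / 4"] \<delta> by simp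
       thus ?thesis using ennreal_plus[of "\<delta> / 2" "\<delta> / 2"] \<delta> by simp
      qed
      finally show ?thesis using w by (simp add: B_def)
     qed simp
    qed
   qed (use Em S in auto)
   also have "\<dots> \<le> prob (?E k) + prob (?E l) + prob ?S"
    using measure_Un_le[OF sets.Un[OF Em[of k] Em[of l]] S] measure_Un_le[OF Em[of k] Em[of l]] by linarith
   also have "prob ?S \<le> (1/2)^n"
   proof -
    have "emeasure P ?S * ennreal (((1/2)^n)\<^sup>2) \<le> (EE w. min (ennreal \<delta>) (energy (real n) (\<lambda>u w. V k u w - V l u w) w))"
     by (rule step_pair_maximal(2)[OF step_pair_diff[OF sp sp] _ D]) (use \<delta> in auto)
    also have "\<dots> \<le> (EE w. ennreal \<delta>)" by (intro nn_integral_mono) simp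
    also have "\<dots> = ennreal \<delta>" by (simp add: emeasure_space_1)
    finally have "ennreal (prob ?S * ((1/2)^n)\<^sup>2) \<le> ennreal \<delta>" by (simp add: emeasure_eq_measure ennreal_mult)
    hence "prob ?S * ((1/2)^n)\<^sup>2 \<le> \<delta>" using \<delta> by (simp add: ennreal_le_iff)
    also have "\<delta> = (1/2)^n * ((1/2)^n)\<^sup>2"
     unfolding \<delta>_def power2_eq_square power_mult_distrib[symmetric] by simp
    finally show ?thesis by simp
   qed
   finally show ?thesis using N[OF kl(1)] N[OF kl(2)] by simp
  qed
  thus ?thesis by blast
 qed
 then obtain N where N: "\<And>n k l. N n \<le> k ==> N n \<le> l ==> prob (B n k l) \<le> 3 * (1/2)^n" by metis
 \<comment> \<open>Strictly increasing, and both \<open>\<kappa> n\<close> and its successor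
   \<open>\<kappa> (Suc n)\<close> lie beyond \<open>N n\<close>.\<close>
 define \<kappa> where "\<kappa> n = (\<Sum>i\<le>n. Suc (N i))" for n
 have sm: "strict_mono \<kappa>" by (simp add: strict_mono_Suc_iff \<kappa>_def)
 have le: "N n \<le> \<kappa> n" "N n \<le> \<kappa> (Suc n)" for n
  unfolding \<kappa>_def using member_le_sum[of n "{..n}" "\<lambda>i. Suc (N i)"] member_le_sum[of n "{..Suc n}" "\<lambda>i. Suc (N i)"] by auto
 have good1: "AE w in P. eventually (\<lambda>n. w \<in> space P - B n (\<kappa> n) (\<kappa> (Suc n))) sequentially"
 proof (rule borel_cantelli_AE1)
  show "emeasure P (B n (\<kappa> n) (\<kappa> (Suc n))) < \<infinity>" for n by (simp add: emeasure_eq_measure)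
  show "summable (\<lambda>n. prob (B n (\<kappa> n) (\<kappa> (Suc n))))"
   by (rule summable_comparison_test[OF _ summable_mult[OF summable_geometric[of "1/2::real"], of 3]])
    (use N[OF le] in \<open>auto intro!: exI[of _ 0]\<close>)
 qed (rule B)
 have cont: "AE w in P. \<forall>k. continuous_on {0..} (\<lambda>t. I k t w)"
 proof (subst AE_all_countable, intro allI)
  fix k
  have "AE w in P. \<forall>n. continuous_on {0..real n} (\<lambda>t. I k t w)"
   by (subst AE_all_countable, intro allI step_pair_continuous[OF sp])
  thus "AE w in P. continuous_on {0..} (\<lambda>t. I k t w)"
  proof eventually_elim
   case (elim w)
   show ?case
   proof (rule continuous_on_halfline)
    fix T :: real
    obtain n where "T \<le> real n" using real_arch_simple by blast
    thus "continuous_on {0..T} (\<lambda>t. I k t w)" by (intro continuous_on_subset[OF elim[rule_format, of n]]) auto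
   qed
  qed
 qed
 have "AE w in P. \<forall>T::nat. \<exists>n0. \<forall>n\<ge>n0. \<forall>t\<in>{0..real T}. norm (I (\<kappa> n) t w - I (\<kappa> (Suc n)) t w) \<le> (1/2)^n"
  using good1 cont
 proof eventually_elim
  case (elim w)
  then obtain n1 where n1: "\<And>n. n1 \<le> n ==> w \<in> space P - B n (\<kappa> n) (\<kappa> (Suc n))"
   by (auto simp: eventually_sequentially)
  have "norm (I (\<kappa> n) t w - I (\<kappa> (Suc n)) t w) \<le> (1/2)^n" if n: "max 1 n1 \<le> n" and t: "t \<in> {0..real n}" for n t
  proof -
   have "norm (I (\<kappa> n) t w - I (\<kappa> (Suc n)) t w) \<in> {..(1/2)^n}"
   proof (rule closed_dense_extend[of "real n" "\<lambda>t. norm (I (\<kappa> n) t w - I (\<kappa> (Suc n)) t w)"])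
    show "continuous_on {0..real n} (\<lambda>t. norm (I (\<kappa> n) t w - I (\<kappa> (Suc n)) t w))"
     by (intro continuous_on_norm continuous_on_diff continuous_on_subset[OF elim(2)[rule_format]]) auto
    fix s :: real assume "s \<in> \<rat>" "0 < s" "s < real n"
    hence "s \<in> ?D n" by simp
    moreover have "w \<in> space P - B n (\<kappa> n) (\<kappa> (Suc n))" using n by (intro n1) simp
    ultimately have "\<not> (1/2)^n \<le> norm (I (\<kappa> n) s w - I (\<kappa> (Suc n)) s w)" unfolding B_def by blast
    thus "norm (I (\<kappa> n) s w - I (\<kappa> (Suc n)) s w) \<in> {..(1/2)^n}" by simp
   qed (use n t in auto)
   thus ?thesis by simp
  qed
  note b = this
  show ?case
  proof
   fix T
   show "\<exists>n0. \<forall>n\<ge>n0. \<forall>t\<in>{0..real T}. norm (I (\<kappa> n) t w - I (\<kappa> (Suc n)) t w) \<le> (1/2)^n"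
    by (rule exI[of _ "max T (max 1 n1)"]) (use b in auto)
  qed
 qed
 moreover have "I (\<kappa> n) t \<in> borel_measurable (F t)" if "0 \<le> t" for n t
  using step_pair_measurable[OF sp[of t]] that by simp
 moreover have "AE w in P. \<forall>n. continuous_on {0..} (\<lambda>t. I (\<kappa> n) t w)" using cont by eventually_elim blast
 ultimately obtain Y where YF: "\<And>t. 0 \<le> t ==> Y t \<in> borel_measurable (F t)" and Ycont: "\<And>w. continuous_on {0..} (\<lambda>t. Y t w)"
  and Ylim: "AE w in P. \<forall>T::nat. \<exists>n0. \<forall>n\<ge>n0. \<forall>t\<in>{0..real T}. norm (I (\<kappa> n) t w - Y t w) \<le> 2 * (1/2)^n"
  using limit_process[of "\<lambda>n. I (\<kappa> n)"] by blast
 have "ito_integral_on P F W T H Y" if T: "0 < T" for T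
  unfolding ito_integral_on_def
 proof (intro conjI ballI)
  show "H t \<in> borel_measurable (F t)" if "t \<in> {0..T}" for t using H that by (simp add: regular_def)
  show "AE w in P. set_borel_measurable lborel {0..T} (\<lambda>s. H s w) \<and>
    (tint T (\<lambda>s. sqnorm (H s w))) < \<infinity>"
   using e0[OF less_imp_le[OF T]] by eventually_elim (simp add: energy_def)
  show "Y t \<in> borel_measurable (F t)" if "t \<in> {0..T}" for t using YF that by simp
  show "AE w in P. continuous_on {0..T} (\<lambda>t. Y t w)"
   using Ycont by (intro AE_I2 continuous_on_subset[OF Ycont]) auto
  show "\<exists>m \<tau> \<eta>. (\<forall>k. simple_process P F (m k) (\<tau> k) (\<eta> k)) \<and>
    tends_to_zero_in_probability P
     (\<lambda>k w. \<integral>\<^sup>+s\<in>{0..T}. sqnorm (simple_value (m k) (\<tau> k) (\<eta> k) s w - H s w) \<partial>lborel) \<and>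
    tends_to_zero_in_probability P
     (\<lambda>k w. SUP t\<in>{0..T}. ennreal (norm (simple_integral W (m k) (\<tau> k) (\<eta> k) t w - Y t w)))"
  proof (intro exI conjI allI)
   show "simple_process P F (m (\<kappa> k)) (\<tau> (\<kappa> k)) (left_process H (\<kappa> k))" for k by (rule simple)
   show "tends_to_zero_in_probability P
     (\<lambda>k w. \<integral>\<^sup>+s\<in>{0..T}. sqnorm (simple_value (m (\<kappa> k)) (\<tau> (\<kappa> k)) (left_process H (\<kappa> k)) s w - H s w) \<partial>lborel)"
    using tends_to_zero_in_probability_subseq[OF etz[OF less_imp_le[OF T]] sm]
    unfolding e_def[abs_def] energy_def V_def .
   show "tends_to_zero_in_probability P
     (\<lambda>k w. SUP t\<in>{0..T}. ennreal (norm (simple_integral W (m (\<kappa> k)) (\<tau> (\<kappa> k)) (left_process H (\<kappa> k)) t w - Y t w)))"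
    unfolding I_def[symmetric]
   proof (rule AE_tends_to_zero_in_probability)
    show "(\<lambda>w. SUP t\<in>{0..T}. ennreal (norm (I (\<kappa> k) t w - Y t w))) \<in> borel_measurable P" for k
    proof (rule sup_norm_measurable[OF _ _ T])
     show "(\<lambda>w. I (\<kappa> k) t w - Y t w) \<in> borel_measurable P" if "t \<in> {0..T}" for t
      using IP[of t "\<kappa> k"] measurable_F_imp_P[OF YF[of t]] that by simp
     show "AE w in P. continuous_on {0..T} (\<lambda>t. I (\<kappa> k) t w - Y t w)"
      using cont
     proof eventually_elim
      case (elim w)
      have "{0..T} \<subseteq> {0..}" by auto
      thus ?case
       by (intro continuous_on_diff continuous_on_subset[OF elim[rule_format]] continuous_on_subset[OF Ycont])
     qed
    qed
    show "AE w in P. (\<lambda>k. SUP t\<in>{0..T}. ennreal (norm (I (\<kappa> k) t w - Y t w))) \<longlonglongrightarrow> 0"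
     using Ylim
    proof eventually_elim
     case (elim w)
     obtain N where N: "T \<le> real N" using real_arch_simple by blast
     obtain n0 where n0: "\<And>n t. n0 \<le> n ==> t \<in> {0..real N} ==> norm (I (\<kappa> n) t w - Y t w) \<le> 2 * (1/2)^n"
      using elim by blast
     have "(\<lambda>n. ennreal (2 * (1/2)^n)) \<longlonglongrightarrow> ennreal (2 * 0)"
      by (intro tendsto_ennrealI tendsto_intros LIMSEQ_realpow_zero) auto
     hence lim: "(\<lambda>n. ennreal (2 * (1/2)^n)) \<longlonglongrightarrow> 0" by simp
     have up: "\<forall>\<^sub>F n in sequentially. (SUP t\<in>{0..T}. ennreal (norm (I (\<kappa> n) t w - Y t w))) \<le> ennreal (2 * (1/2)^n)"
      using eventually_ge_at_top[of n0]
     proof eventually_elim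
      case (elim n)
      show ?case
       by (rule SUP_least, rule ennreal_leI, rule n0) (use elim N in auto)
     qed
     show ?case
      by (rule tendsto_sandwich[OF always_eventually[OF allI[OF zero_le]] up tendsto_const lim])
    qed
   qed
  qed
 qed
 thus ?thesis using YF Ycont by blast
qed

end

section \<open>Piecewise constant paths and joint measurability\<close>

text \<open>Both one-sided limits exist in the discrete sense; nothing is assumed about the value itself.\<close>

definition pwc :: "(real => 'c) => bool" where
 "pwc a \<longleftrightarrow> (\<forall>t\<ge>0. \<exists>l. \<forall>\<^sub>F s in at_right t. a s = l) \<and> (\<forall>t>0. \<exists>l. \<forall>\<^sub>F s in at_left t. a s = l)"

lemma pwc_comp: "pwc a ==> pwc (\<lambda>t. f (a t))"
 unfolding pwc_def
proof (intro conjI allI impI)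
 fix t :: real assume a: "(\<forall>t\<ge>0. \<exists>l. \<forall>\<^sub>F s in at_right t. a s = l) \<and> (\<forall>t>0. \<exists>l. \<forall>\<^sub>F s in at_left t. a s = l)"
 { assume "0 \<le> t"
  then obtain l where "\<forall>\<^sub>F s in at_right t. a s = l" using a by blast
  hence "\<forall>\<^sub>F s in at_right t. f (a s) = f l" by eventually_elim simp
  thus "\<exists>l. \<forall>\<^sub>F s in at_right t. f (a s) = l" .. }
 { assume "0 < t"
  then obtain l where "\<forall>\<^sub>F s in at_left t. a s = l" using a by blast
  hence "\<forall>\<^sub>F s in at_left t. f (a s) = f l" by eventually_elim simp
  thus "\<exists>l. \<forall>\<^sub>F s in at_left t. f (a s) = l" .. }
qed

lemma pwc_Pair:
 assumes "pwc a" "pwc a'"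
 shows "pwc (\<lambda>t. (a t, a' t))"
 unfolding pwc_def
proof (intro conjI allI impI)
 fix t :: real assume "0 \<le> t"
 then obtain l l' where "\<forall>\<^sub>F s in at_right t. a s = l" "\<forall>\<^sub>F s in at_right t. a' s = l'"
  using assms unfolding pwc_def by blast
 hence "\<forall>\<^sub>F s in at_right t. (a s, a' s) = (l, l')" by eventually_elim simp
 thus "\<exists>l. \<forall>\<^sub>F s in at_right t. (a s, a' s) = l" ..
next
 fix t :: real assume "0 < t"
 then obtain l l' where "\<forall>\<^sub>F s in at_left t. a s = l" "\<forall>\<^sub>F s in at_left t. a' s = l'"
  using assms unfolding pwc_def by blast
 hence "\<forall>\<^sub>F s in at_left t. (a s, a' s) = (l, l')" by eventually_elim simp
 thus "\<exists>l. \<forall>\<^sub>F s in at_left t. (a s, a' s) = l" ..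
qed

text \<open>Applied to conditions of the form "so far", which hold up to some time and never
  return.\<close>

lemma pwc_antimono:
 assumes "\<And>s t. s \<le> t ==> J t ==> J s"
 shows "pwc J"
 unfolding pwc_def
proof (intro conjI allI impI)
 fix t :: real
 show "\<exists>l. \<forall>\<^sub>F s in at_right t. J s = l"
 proof (cases "\<exists>u>t. J u")
  case True
  then obtain u where "t < u" "J u" by blast
  hence "\<forall>\<^sub>F s in at_right t. J s = True"
   unfolding eventually_at_right_field using assms by (metis less_imp_le)
  thus ?thesis ..
 next
  case False
  hence "\<forall>\<^sub>F s in at_right t. J s = False"
   unfolding eventually_at_right_field by (metis gt_ex)
  thus ?thesis ..
 qed
next
 fix t :: real
 show "\<exists>l. \<forall>\<^sub>F s in at_left t. J s = l"
 proof (cases "\<forall>u<t. J u")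
  case True
  hence "\<forall>\<^sub>F s in at_left t. J s = True"
   unfolding eventually_at_left_field by (metis lt_ex)
  thus ?thesis ..
 next
  case False
  then obtain u where "u < t" "\<not> J u" by blast
  hence "\<forall>\<^sub>F s in at_left t. J s = False"
   unfolding eventually_at_left_field using assms by (metis less_imp_le)
  thus ?thesis ..
 qed
qed

lemma pwc_isolated:
 assumes "pwc a" "0 \<le> z"
 shows "\<exists>e>0. \<exists>l r. (\<forall>s. z < s --> s < z + e --> a s = r) \<and> (\<forall>s. 0 \<le> s --> z - e < s --> s < z --> a s = l)"
proof -
 obtain r where "\<forall>\<^sub>F s in at_right z. a s = r" using assms unfolding pwc_def by blast
 then obtain b where b: "z < b" "\<And>s. z < s ==> s < b ==> a s = r" unfolding eventually_at_right_field by blast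
 obtain l c where c: "c < z" "\<And>s. 0 \<le> s ==> c < s ==> s < z ==> a s = l"
 proof (cases "z = 0")
  case True thus ?thesis using that[of "-1"] by auto
 next
  case False
  then obtain l where "\<forall>\<^sub>F s in at_left z. a s = l" using assms unfolding pwc_def by (metis order_le_less)
  then obtain c where "c < z" "\<And>s. c < s ==> s < z ==> a s = l" unfolding eventually_at_left_field by blast
  thus ?thesis using that by blast
 qed
 show ?thesis
  by (rule exI[of _ "min (b - z) (z - c)"]) (use b c in auto)
qed

definition pwc_jumps :: "(real => 'c) => real set" where
 "pwc_jumps a = {t. 0 < t \<and> \<not> (\<forall>\<^sub>F s in at t. a s = a t)}"

text \<open>One-sided limits keep the exceptional times from accumulating anywhere, and a set of
  reals without limit points is countable.\<close>

lemma countable_pwc_jumps: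
 assumes "pwc a"
 shows "countable (pwc_jumps a)"
proof (rule no_limpt_imp_countable)
 fix z :: real
 show "\<not> z islimpt pwc_jumps a"
 proof
  assume l: "z islimpt pwc_jumps a"
  show False
  proof (cases "z < 0")
   case True
   then obtain y where "y \<in> pwc_jumps a" "y \<in> {..<0}" using islimptE[OF l, of "{..<0}"] by auto
   thus False by (simp add: pwc_jumps_def)
  next
   case False
   then obtain e l r where e: "0 < e" "\<And>s. z < s ==> s < z + e ==> a s = r"
    "\<And>s. 0 \<le> s ==> z - e < s ==> s < z ==> a s = l"
    using pwc_isolated[OF assms, of z] by force
   obtain y where y: "y \<in> pwc_jumps a" "y \<in> {z - e<..<z + e}" "y \<noteq> z"
    using islimptE[OF l, of "{z - e<..<z + e}"] e by auto
   have y0: "0 < y" using y by (simp add: pwc_jumps_def)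
   have "\<forall>\<^sub>F s in at y. a s = a y"
   proof (cases "z < y")
    case True
    have "\<forall>\<^sub>F s in at y. s \<in> {z<..<z + e}"
     using True y by (intro eventually_at_in_open') auto
    thus ?thesis by eventually_elim (use e(2) True y in auto)
   next
    case False
    have "\<forall>\<^sub>F s in at y. s \<in> {max 0 (z - e)<..<z}"
     using False y y0 by (intro eventually_at_in_open') auto
    thus ?thesis by eventually_elim (use e(3) False y y0 in auto)
   qed
   thus False using y by (simp add: pwc_jumps_def)
  qed
 qed
qed

text \<open>Near each time at most three values occur, and compactness does the rest. This bounds
  \<open>L\<close> along a path on bounded intervals, although \<open>L\<close> itself may be
  unbounded.\<close>

lemma pwc_finite_range:
 assumes "pwc a"
 shows "finite (a ` {0..T})"
proof -
 have "\<forall>z\<in>{0..T}. \<exists>e>0. finite (a ` ({0..} \<inter> {z - e<..<z + e}))"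
 proof
  fix z assume z: "z \<in> {0..T}"
  then obtain e l r where e: "0 < e" "\<And>s. z < s ==> s < z + e ==> a s = r"
    "\<And>s. 0 \<le> s ==> z - e < s ==> s < z ==> a s = l"
   using pwc_isolated[OF assms, of z] by force
  have "a ` ({0..} \<inter> {z - e<..<z + e}) \<subseteq> {l, r, a z}"
  proof
   fix x assume "x \<in> a ` ({0..} \<inter> {z - e<..<z + e})"
   then obtain s where "0 \<le> s" "z - e < s" "s < z + e" "x = a s" by auto
   thus "x \<in> {l, r, a z}" using e(2)[of s] e(3)[of s] by (cases s z rule: linorder_cases) auto
  qed
  thus "\<exists>e>0. finite (a ` ({0..} \<inter> {z - e<..<z + e}))" using e(1) finite_subset by blast
 qed
 then obtain e where e: "\<And>z. z \<in> {0..T} ==> 0 < e z" "\<And>z. z \<in> {0..T} ==> finite (a ` ({0..} \<inter> {z - e z<..<z + e z}))"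
  by metis
 have "compact {0..T}" by simp
 then obtain C where C: "C \<subseteq> {0..T}" "finite C" "{0..T} \<subseteq> (\<Union>z\<in>C. {z - e z<..<z + e z})"
 proof (rule compactE_image)
  show "{0..T} \<subseteq> (\<Union>z\<in>{0..T}. {z - e z<..<z + e z})" using e(1) by fastforce
 qed auto
 have "a ` {0..T} \<subseteq> (\<Union>z\<in>C. a ` ({0..} \<inter> {z - e z<..<z + e z}))"
  using C(3) by fastforce
 thus ?thesis
 proof (rule finite_subset)
  show "finite (\<Union>z\<in>C. a ` ({0..} \<inter> {z - e z<..<z + e z}))"
   using C(1) e(2) by (intro finite_UN_I C(2)) blast
 qed
qed

text \<open>Up to a countable set of times, a preimage consists of times around which the path is
  locally constant, and these form an open set.\<close>

lemma pwc_borel_measurable: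
 fixes a :: "real => 'c"
 assumes a: "pwc a"
 shows "(\<lambda>u. if 0 \<le> u then a u else c) \<in> borel \<rightarrow>\<^sub>M count_space UNIV"
proof (rule measurableI)
 fix A :: "'c set"
 define U where "U = {t. 0 < t \<and> a t \<in> A \<and> (\<forall>\<^sub>F s in at t. a s = a t)}"
 have "open U"
 proof (subst open_subopen, intro ballI)
  fix t assume "t \<in> U"
  hence t: "0 < t" "a t \<in> A" "\<forall>\<^sub>F s in at t. a s = a t" by (auto simp: U_def)
  then obtain S where S: "open S" "t \<in> S" "\<And>s. s \<in> S ==> s \<noteq> t ==> a s = a t"
   unfolding eventually_at_topological by blast
  have S': "s \<in> S ==> a s = a t" for s using S(3)[of s] by (cases "s = t") auto
  show "\<exists>T. open T \<and> t \<in> T \<and> T \<subseteq> U"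
  proof (intro exI[of _ "S \<inter> {0<..}"] conjI subsetI)
   show "open (S \<inter> {0<..})" using S by auto
   fix s assume s: "s \<in> S \<inter> {0<..}"
   have "\<forall>\<^sub>F u in at s. u \<in> S" using s S by (intro eventually_at_in_open') auto
   hence "\<forall>\<^sub>F u in at s. a u = a s" by eventually_elim (use S' s in auto)
   thus "s \<in> U" using s S' t by (auto simp: U_def)
  qed (use S t in auto)
 qed
 have eq: "(\<lambda>u. if 0 \<le> u then a u else c) -` A = U \<union> ({t. 0 \<le> t \<and> a t \<in> A} \<inter> ({0} \<union> pwc_jumps a)) \<union> (if c \<in> A then {..<0} else {})"
  by (auto simp: U_def pwc_jumps_def split: if_splits)
 have "countable ({t. 0 \<le> t \<and> a t \<in> A} \<inter> ({0} \<union> pwc_jumps a))"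
  using countable_pwc_jumps[OF a] by (intro countable_Int2) auto
 hence c: "{t. 0 \<le> t \<and> a t \<in> A} \<inter> ({0} \<union> pwc_jumps a) \<in> sets borel"
  by (rule sets.countable[rotated]) simp
 have "(if c \<in> A then {..<0::real} else {}) \<in> sets borel" by simp
 from sets.Un[OF sets.Un[OF borel_open[OF \<open>open U\<close>] c] this]
 show "(\<lambda>u. if 0 \<le> u then a u else c) -` A \<inter> space borel \<in> sets borel"
  by (simp only: eq space_borel Int_UNIV_right)
qed simp

lemma pwc_left_eventually: "t \<notin> pwc_jumps a ==> 0 < t ==> \<forall>\<^sub>F s in at_left t. a s = a t"
 by (auto simp: pwc_jumps_def eventually_at_split)

lemma at_left_le: "0 < t ==> at_left (t::real) \<le> at t within {0..}"
proof -
 assume "0 < t"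
 hence "at_left t = at t within {0..<t}" by (intro at_within_nhd[of t "{0<..}"]) auto
 also have "\<dots> \<le> at t within {0..}" by (rule at_le) auto
 finally show ?thesis .
qed

lemma reg_path_pwc_continuous:
 fixes x :: "real => 'e::topological_space" and a :: "real => 'c::countable" and G :: "'e => 'c => 'b::{real_normed_vector, second_countable_topology}"
 assumes x: "continuous_on {0..} x" and a: "pwc a" and G: "\<And>i. continuous_on UNIV (\<lambda>y. G y i)"
 shows "reg_path (\<lambda>t. G (x t) (a t))"
 unfolding reg_path_def
proof (intro conjI allI exI[of _ "pwc_jumps a"] impI)
 have Gx: "continuous_on {0..} (\<lambda>t. G (x t) i)" for i
  by (rule continuous_on_compose2[OF G x]) simp
 obtain c :: 'c where True by blast
 have "(\<lambda>u. indicator {0..} u *\<^sub>R G (x u) (if 0 \<le> u then a u else c)) \<in> borel_measurable borel"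
  by (rule measurable_compose_countable[OF _ pwc_borel_measurable[OF a], of "\<lambda>i u. indicator {0..} u *\<^sub>R G (x u) i"])
   (intro borel_measurable_continuous_on_indicator Gx, simp)
 also have "(\<lambda>u. indicator {0..} u *\<^sub>R G (x u) (if 0 \<le> u then a u else c)) = (\<lambda>u. indicator {0..} u *\<^sub>R G (x u) (a u))"
  by (auto simp: indicator_def)
 finally show "(\<lambda>u. indicator {0..} u *\<^sub>R G (x u) (a u)) \<in> borel_measurable borel" .
 fix T :: real
 have "bounded (\<Union>i\<in>a ` {0..T}. (\<lambda>t. G (x t) i) ` {0..T})"
  using pwc_finite_range[OF a]
  by (intro bounded_UN) (auto intro!: compact_imp_bounded compact_continuous_image continuous_on_subset[OF Gx])
 thus "bounded ((\<lambda>t. G (x t) (a t)) ` {0..T})"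
  by (rule bounded_subset) auto
 show "countable (pwc_jumps a)" by (rule countable_pwc_jumps[OF a])
 fix t :: real assume t: "0 < t" "t \<notin> pwc_jumps a"
 have "((\<lambda>s. G (x s) (a t)) \<longlongrightarrow> G (x t) (a t)) (at t within {0..})"
  using Gx t by (auto simp: continuous_on_def)
 hence l: "((\<lambda>s. G (x s) (a t)) \<longlongrightarrow> G (x t) (a t)) (at_left t)" by (rule tendsto_mono[OF at_left_le[OF t(1)]])
 have "\<forall>\<^sub>F s in at_left t. G (x s) (a t) = G (x s) (a s)"
  using pwc_left_eventually[OF t(2,1)] by eventually_elim simp
 with l show "((\<lambda>s. G (x s) (a s)) \<longlongrightarrow> G (x t) (a t)) (at_left t)" by (rule Lim_transform_eventually)
qed

lemma left_point_0: "u \<le> 0 ==> left_point k u = 0"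
proof -
 assume "u \<le> 0"
 hence "u * 2 ^ k \<le> 0" by (simp add: mult_nonpos_nonneg)
 hence "\<lceil>u * 2 ^ k\<rceil> \<le> 0" by (simp add: ceiling_le_iff)
 thus ?thesis by (simp add: left_point_def left_index_def)
qed

lemma left_point_measurable [measurable]: "(\<lambda>u. left_point k u) \<in> borel_measurable borel"
 unfolding left_point_def left_index_def by measurable

lemma joint_measurable_left_point:
 assumes "\<And>t. 0 \<le> t ==> Z t \<in> measurable G N"
 shows "(\<lambda>(u, w). Z (left_point k u) w) \<in> measurable (borel \<Otimes>\<^sub>M G) N"
proof -
 have "(\<lambda>x. Z (real (left_index k (fst x)) / 2 ^ k) (snd x)) \<in> measurable (borel \<Otimes>\<^sub>M G) N"
 proof (rule measurable_compose_countable[where f = "\<lambda>j x. Z (real j / 2 ^ k) (snd x)"])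
  show "(\<lambda>x. Z (real j / 2 ^ k) (snd x)) \<in> measurable (borel \<Otimes>\<^sub>M G) N" for j
   using assms[of "real j / 2 ^ k"] by measurable
  show "(\<lambda>x. left_index k (fst x)) \<in> measurable (borel \<Otimes>\<^sub>M G) (count_space UNIV)"
   unfolding left_index_def by measurable
 qed
 thus ?thesis by (simp add: left_point_def case_prod_beta')
qed

lemma left_point_lim:
 assumes "\<And>t. 0 < t ==> (f \<longlongrightarrow> f t) (at_left t)"
 shows "(\<lambda>k. f (left_point k u)) \<longlonglongrightarrow> f (max 0 u)"
proof (cases "0 < u")
 case True
 thus ?thesis using filterlim_compose[OF assms[OF True] left_point_tendsto[OF True]] by simp
next
 case False
 thus ?thesis by (simp add: left_point_0)
qed

text \<open>A left-point discretisation reads the process at countably many times and is therefore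
  jointly measurable; left-continuity carries this to the limit. \<open>max 0 u\<close> continues
  the process constantly to negative times, where nothing is known about \<open>Z\<close>.\<close>

lemma joint_measurable_left_continuous:
 fixes Z :: "real => 'a => 'b::metric_space"
 assumes Z: "\<And>t. 0 \<le> t ==> Z t \<in> borel_measurable G"
  and l: "\<And>w t. w \<in> space G ==> 0 < t ==> ((\<lambda>s. Z s w) \<longlongrightarrow> Z t w) (at_left t)"
 shows "(\<lambda>(u, w). Z (max 0 u) w) \<in> borel_measurable (borel \<Otimes>\<^sub>M G)"
proof (rule borel_measurable_LIMSEQ_metric)
 show "(\<lambda>(u, w). Z (left_point k u) w) \<in> borel_measurable (borel \<Otimes>\<^sub>M G)" for k
  by (rule joint_measurable_left_point[OF Z])
 show "(\<lambda>k. (\<lambda>(u, w). Z (left_point k u) w) x) \<longlonglongrightarrow> (\<lambda>(u, w). Z (max 0 u) w) x" if "x \<in> space (borel \<Otimes>\<^sub>M G)" for x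
  using left_point_lim[of "\<lambda>t. Z t (snd x)" "fst x"] l that by (auto simp: space_pair_measure case_prod_beta')
qed

lemma joint_measurable_continuous:
 fixes Z :: "real => 'a => 'b::metric_space"
 assumes Z: "\<And>t. 0 \<le> t ==> Z t \<in> borel_measurable G"
  and c: "\<And>w. w \<in> space G ==> continuous_on {0..} (\<lambda>t. Z t w)"
 shows "(\<lambda>(u, w). Z (max 0 u) w) \<in> borel_measurable (borel \<Otimes>\<^sub>M G)"
proof (rule joint_measurable_left_continuous[OF Z])
 fix w and t :: real assume "w \<in> space G" and t: "0 < t"
 hence "((\<lambda>s. Z s w) \<longlongrightarrow> Z t w) (at t within {0..})" using c by (auto simp: continuous_on_def)
 thus "((\<lambda>s. Z s w) \<longlongrightarrow> Z t w) (at_left t)" by (rule tendsto_mono[OF at_left_le[OF t]])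
qed

lemma reg_path_set_integrable:
 fixes f :: "real => 'b::{banach, second_countable_topology}"
 assumes "reg_path f"
 shows "set_integrable lborel {0..t} f"
proof -
 obtain B where B: "\<And>u. u \<in> {0..t} ==> norm (f u) \<le> B"
  using assms unfolding reg_path_def bounded_iff by (meson image_eqI)
 have m: "(\<lambda>u. indicator {0..} u *\<^sub>R f u) \<in> borel_measurable borel" using assms by (simp add: reg_path_def)
 have "(\<lambda>u. indicator {0..t} u *\<^sub>R (indicator {0..} u *\<^sub>R f u)) \<in> borel_measurable lborel"
  using m by measurable
 also have "(\<lambda>u. indicator {0..t} u *\<^sub>R (indicator {0..} u *\<^sub>R f u)) = (\<lambda>u. indicator {0..t} u *\<^sub>R f u)"
  by (auto simp: indicator_def)
 finally have m': "(\<lambda>u. indicator {0..t} u *\<^sub>R f u) \<in> borel_measurable lborel" .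
 show ?thesis unfolding set_integrable_def
 proof (rule Bochner_Integration.integrable_bound[OF _ m'])
  show "integrable lborel (\<lambda>u. indicator {0..t} u * B)"
   by (intro integrable_mult_left integrable_real_indicator) (auto simp: emeasure_lborel_Icc_eq)
  show "AE u in lborel. norm (indicator {0..t} u *\<^sub>R f u) \<le> norm (indicator {0..t} u * B)"
   using B by (intro AE_I2) (fastforce simp: indicator_def intro: order_trans[OF _ abs_ge_self])
 qed
qed

lemma reg_path_integral_continuous:
 fixes f :: "real => real^'n"
 assumes "reg_path f"
 shows "continuous_on {0..} (\<lambda>t. LINT s:{0..t}|lborel. f s)"
proof -
 have eq: "(LINT s:{0..t}|lborel. f s) = integral {0..t} f" for t
  using set_borel_integral_eq_integral(2)[OF reg_path_set_integrable[OF assms]] .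
 show ?thesis unfolding eq
  by (rule continuous_on_halfline, rule indefinite_integral_continuous_1)
   (rule set_borel_integral_eq_integral(1)[OF reg_path_set_integrable[OF assms]])
qed

section \<open>Gronwall estimates with exponential weights\<close>

lemma exp_weight_step:
 assumes t: "0 \<le> t" and C: "0 \<le> C" "0 < c" and K: "0 \<le> K" and g: "\<And>s. s \<in> {0..t} ==> g s \<le> ennreal (K * exp (c * s))"
  and h: "h \<le> ennreal C * (tint t g)"
 shows "h \<le> ennreal (C / c * K * exp (c * t))"
proof -
 have "(tint t g) \<le> (tint t (\<lambda>s. ennreal (K * exp (c * s))))"
  using g by (intro nn_integral_mono) (auto simp: indicator_def)
 also have "\<dots> = ennreal (K / c * exp (c * t) - K / c * exp (c * 0))"
 proof (rule nn_integral_FTC_Icc)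
  fix x assume "x \<in> {0..t}"
  show "((\<lambda>x. K / c * exp (c * x)) has_real_derivative K * exp (c * x)) (at x)"
   using C by (auto intro!: derivative_eq_intros)
 qed (use K t in auto)
 also have "\<dots> \<le> ennreal (K / c * exp (c * t))" using C K by (intro ennreal_leI) simp
 finally have "h \<le> ennreal C * ennreal (K / c * exp (c * t))"
  using h by (meson mult_left_mono order_trans zero_le)
 also have "\<dots> = ennreal (C / c * K * exp (c * t))" using C K by (simp add: ennreal_mult[symmetric] field_simps)
 finally show ?thesis .
qed

text \<open>In the sup norm weighted by \<open>exp (c * t)\<close> the operator on the right has
  norm at most \<open>C / c\<close>, because integrating the weight gains \<open>1 / c\<close>. The
  choice \<open>c = (C + 1) / \<rho>\<close> pushes this below any prescribed rate \<rho>, so the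
  decay is geometric with a ratio at will.\<close>

lemma iterated_gronwall:
 fixes u :: "nat => real => ennreal"
 assumes C: "0 \<le> C" and \<rho>: "0 < \<rho>" and B: "\<And>t. t \<in> {0..T} ==> u 0 t \<le> ennreal B" "0 \<le> B"
  and u: "\<And>j t. t \<in> {0..T} ==> u (Suc j) t \<le> ennreal C * (tint t (\<lambda>s. u j s))" and t: "t \<in> {0..T}"
 shows "u j t \<le> ennreal (B * \<rho>^j * exp ((C + 1) / \<rho> * t))"
 using t
proof (induction j arbitrary: t)
 case 0
 have "B \<le> B * exp ((C + 1) / \<rho> * t)"
  using 0 B(2) C \<rho> by (intro mult_left_mono[of 1 "exp _" B, simplified]) auto
 thus ?case using B(1)[OF 0] by (simp add: order_trans ennreal_leI)
next
 case (Suc j)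
 let ?c = "(C + 1) / \<rho>"
 have c: "0 < ?c" using C \<rho> by simp
 have "u (Suc j) t \<le> ennreal (C / ?c * (B * \<rho>^j) * exp (?c * t))"
  using Suc.IH Suc.prems B(2) C c \<rho> by (intro exp_weight_step[OF _ _ _ _ _ u[OF Suc.prems]]) auto
 also have "\<dots> \<le> ennreal (B * \<rho>^Suc j * exp (?c * t))"
 proof (rule ennreal_leI)
  have "C / ?c \<le> \<rho>" using C \<rho> by (simp add: field_simps)
  hence "C / ?c * (B * \<rho>^j * exp (?c * t)) \<le> \<rho> * (B * \<rho>^j * exp (?c * t))"
   using B(2) \<rho> by (intro mult_right_mono) auto
  thus "C / ?c * (B * \<rho>^j) * exp (?c * t) \<le> B * \<rho>^Suc j * exp (?c * t)" by (simp add: mult_ac)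
 qed
 finally show ?case .
qed

lemma gronwall_zero:
 fixes f :: "real => ennreal"
 assumes C: "0 \<le> C" and B: "\<And>t. t \<in> {0..T} ==> f t \<le> ennreal B" "0 \<le> B"
  and f: "\<And>t. t \<in> {0..T} ==> f t \<le> ennreal C * (tint t f)" and t: "t \<in> {0..T}"
 shows "f t = 0"
proof -
 have le: "f t \<le> ennreal (B * (1/2)^j * exp ((C + 1) / (1/2) * t))" for j
  by (rule iterated_gronwall[where u="\<lambda>_. f", OF C _ B f t]) auto
 have "(\<lambda>j. ennreal (B * (1/2)^j * exp ((C + 1) / (1/2) * t))) \<longlonglongrightarrow> ennreal (B * 0 * exp ((C + 1) / (1/2) * t))"
  by (intro tendsto_ennrealI tendsto_intros LIMSEQ_realpow_zero) auto
 from LIMSEQ_le_const[OF this, of "f t"] le show ?thesis by simp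
qed

context filtered_space
begin

text \<open>Adaptedness alone does not make the integral measurable; left-point approximations of
  the integrand are jointly measurable and converge boundedly off a null set of times.
  \<open>min s t\<close> keeps all evaluations inside \<open>F t\<close> and does nothing to left
  points of times in \<open>{0..t}\<close>.\<close>

lemma drift_measurable:
 fixes H :: "real => 'a => real^'n"
 assumes H: "\<And>t. 0 \<le> t ==> H t \<in> borel_measurable (F t)" and path: "AE w in P. reg_path (\<lambda>t. H t w)" and t: "0 \<le> t"
 shows "(\<lambda>w. LINT s:{0..t}|lborel. H s w) \<in> borel_measurable (F t)"
proof (rule measurable_F_AE_cong[OF _ t])
 let ?H = "\<lambda>s. H (min s t)"
 let ?I = "\<lambda>k w. \<integral>s. indicator {0..t} s *\<^sub>R ?H (left_point k s) w \<partial>lborel"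
 have m: "?H s \<in> borel_measurable (F t)" if "0 \<le> s" for s
  using measurable_F_mono[OF H[of "min s t"], of t] that t by auto
 have "(\<lambda>(u, w). ?H (left_point k u) w) \<in> borel_measurable (borel \<Otimes>\<^sub>M F t)" for k
  by (rule joint_measurable_left_point[of ?H, OF m])
 from measurable_pair_swap[OF this]
 have [measurable]: "(\<lambda>x. ?H (left_point k (snd x)) (fst x)) \<in> borel_measurable (F t \<Otimes>\<^sub>M lborel)" for k
  by (simp add: case_prod_beta' cong: measurable_cong_sets)
 have I: "?I k \<in> borel_measurable (F t)" for k
  by (rule lborel.borel_measurable_lebesgue_integral) (simp add: case_prod_beta')
 thus "(\<lambda>w. lim (\<lambda>k. ?I k w)) \<in> borel_measurable (F t)" by (rule borel_measurable_lim_metric)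
 show "AE w in P. lim (\<lambda>k. ?I k w) = (LINT s:{0..t}|lborel. H s w)"
  using path
 proof eventually_elim
  case (elim w)
  obtain B where B: "\<And>u. u \<in> {0..t} ==> norm (H u w) \<le> B"
   using elim unfolding reg_path_def bounded_iff by (meson image_eqI)
  obtain C where C: "countable C" "\<And>t. 0 < t ==> t \<notin> C ==> ((\<lambda>t. H t w) \<longlongrightarrow> H t w) (at_left t)"
   using elim unfolding reg_path_def by blast
  have "(\<lambda>k. ?I k w) \<longlonglongrightarrow> (\<integral>s. indicator {0..t} s *\<^sub>R H s w \<partial>lborel)"
  proof (rule integral_dominated_convergence[where w = "\<lambda>s. indicator {0..t} s * B"])
   show "(\<lambda>s. indicator {0..t} s *\<^sub>R H s w) \<in> borel_measurable lborel"
    using reg_path_set_integrable[OF elim, of t] by (simp add: set_integrable_def borel_measurable_integrable)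
   have c: "(\<lambda>u. ?H (real (left_index k u) / 2 ^ k) w) \<in> borel_measurable borel" for k
    by (rule measurable_compose_countable[where f = "\<lambda>j u. ?H (real j / 2 ^ k) w"]) (simp, unfold left_index_def, measurable)
   thus "(\<lambda>s. indicator {0..t} s *\<^sub>R ?H (left_point k s) w) \<in> borel_measurable lborel" for k
    unfolding left_point_def by measurable
   show "integrable lborel (\<lambda>s. indicator {0..t} s * B)"
    by (intro integrable_mult_left integrable_real_indicator) (auto simp: emeasure_lborel_Icc_eq)
   show "AE s in lborel. norm (indicator {0..t} s *\<^sub>R ?H (left_point k s) w) \<le> indicator {0..t} s * B" for k
   proof (rule AE_I2)
    fix s
    have "left_point k s \<ge> 0" by (simp add: left_point_def)
    thus "norm (indicator {0..t} s *\<^sub>R ?H (left_point k s) w) \<le> indicator {0..t} s * B"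
     using B[of "min (left_point k s) t"] t by (auto simp: indicator_def)
   qed
   have "AE s in lborel. s \<notin> C" by (rule AE_not_in[OF countable_imp_null_set_lborel[OF C(1)]])
   thus "AE s in lborel. (\<lambda>k. indicator {0..t} s *\<^sub>R ?H (left_point k s) w) \<longlonglongrightarrow> indicator {0..t} s *\<^sub>R H s w"
    using AE_lborel_singleton[of 0]
   proof eventually_elim
    case (elim s)
    show ?case
    proof (cases "s \<in> {0..t}")
     case True
     hence s: "0 < s" using elim by simp
     have "min (left_point k s) t = left_point k s" for k using left_point_bounds(1)[OF s, of k] True by simp
     thus ?thesis
      using filterlim_compose[OF C(2)[OF s elim(1)] left_point_tendsto[OF s]] True by simp
    qed simp
   qed
  qed
  thus ?case by (simp add: set_lebesgue_integral_def limI)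
 qed
qed simp

end

section \<open>Uniqueness of the diffusion for a given switching path\<close>

lemma set_integral_square_le:
 fixes f :: "real => real^'n"
 assumes f: "set_integrable lborel {0..t} f" and t: "0 \<le> t"
 shows "sqnorm (LINT s:{0..t}|lborel. f s) \<le> ennreal t * (tint t (\<lambda>s. sqnorm (f s)))"
proof -
 let ?f = "\<lambda>s. indicator {0..t} s *\<^sub>R f s"
 have fi: "integrable lborel ?f" using f by (simp add: set_integrable_def)
 have "ennreal (norm (LINT s:{0..t}|lborel. f s)) \<le> (\<integral>\<^sup>+s. ennreal (norm (?f s)) \<partial>lborel)"
  unfolding set_lebesgue_integral_def by (rule integral_norm_bound_ennreal[OF fi])
 also have "\<dots> = (\<integral>\<^sup>+s. ennreal (norm (?f s)) * indicator {0..t} s \<partial>lborel)"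
  by (intro nn_integral_cong) (simp add: indicator_def)
 finally have "(ennreal (norm (LINT s:{0..t}|lborel. f s)))\<^sup>2 \<le> (\<integral>\<^sup>+s. ennreal (norm (?f s)) * indicator {0..t} s \<partial>lborel)\<^sup>2"
  by (rule power_mono) simp
 also have "\<dots> \<le> (\<integral>\<^sup>+s. (ennreal (norm (?f s)))\<^sup>2 \<partial>lborel) * (\<integral>\<^sup>+s. (indicator {0..t} s)\<^sup>2 \<partial>lborel)"
  using integrable_norm[OF fi] by (intro Cauchy_Schwarz_nn_integral measurable_compose[OF borel_measurable_integrable measurable_ennreal]) simp_all
 also have "(\<integral>\<^sup>+s. (indicator {0..t} s)\<^sup>2 \<partial>lborel) = (\<integral>\<^sup>+s. indicator {0..t} s \<partial>lborel)"
  by (intro nn_integral_cong) (simp add: indicator_def)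
 also have "\<dots> = ennreal t" using t by simp
 also have "(\<integral>\<^sup>+s. (ennreal (norm (?f s)))\<^sup>2 \<partial>lborel) = (tint t (\<lambda>s. sqnorm (f s)))"
  by (intro nn_integral_cong) (simp add: indicator_def ennreal_power)
 finally show ?thesis by (simp add: ennreal_power mult.commute)
qed

text \<open>The sizes at the origin are put under the same \<open>L\<close> as the Lipschitz
  constants, so that a level for \<open>L\<close> controls the growth of the coefficients as well
  and \<open>L\<close> is nonnegative.\<close>

locale sde_space = brownian_space P F W for P :: "'a measure" and F and W :: "real => 'a => real^'d" +
 fixes b :: "real^'n => nat => real^'n" and \<sigma> :: "real^'n => nat => real^'d^'n" and L :: "nat => real"
 assumes lip_b: "norm (b x i - b y i) \<le> L i * norm (x - y)"
  and lip_\<sigma>: "norm (\<sigma> x i - \<sigma> y i) \<le> L i * norm (x - y)"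
  and zero_b: "norm (b 0 i) \<le> L i"
  and zero_\<sigma>: "norm (\<sigma> 0 i) \<le> L i"
begin

lemma L_nonneg: "0 \<le> L i"
 using zero_b[of i] norm_ge_zero order_trans by blast

lemma continuous_b: "continuous_on UNIV (\<lambda>y. b y i)"
 by (rule lipschitz_on_continuous_on[of "L i"], rule lipschitz_onI) (use lip_b L_nonneg in \<open>auto simp: dist_norm\<close>)

lemma continuous_\<sigma>: "continuous_on UNIV (\<lambda>y. \<sigma> y i)"
 by (rule lipschitz_on_continuous_on[of "L i"], rule lipschitz_onI) (use lip_\<sigma> L_nonneg in \<open>auto simp: dist_norm\<close>)

lemma reg_path_coeff:
 assumes "continuous_on {0..} x" "pwc a"
 shows "reg_path (\<lambda>t. b (x t) (a t))" "reg_path (\<lambda>t. \<sigma> (x t) (a t))"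
 using reg_path_pwc_continuous[where G = b, OF assms continuous_b]
  reg_path_pwc_continuous[where G = \<sigma>, OF assms continuous_\<sigma>] by auto

lemma coeff_measurable:
 assumes "X \<in> borel_measurable M" "a \<in> measurable M (count_space UNIV)"
 shows "(\<lambda>w. b (X w) (a w)) \<in> borel_measurable M" "(\<lambda>w. \<sigma> (X w) (a w)) \<in> borel_measurable M"
proof -
 show "(\<lambda>w. b (X w) (a w)) \<in> borel_measurable M"
  by (rule measurable_compose_countable[OF _ assms(2), of "\<lambda>i w. b (X w) i"])
   (rule borel_measurable_continuous_on[OF continuous_b assms(1)])
 show "(\<lambda>w. \<sigma> (X w) (a w)) \<in> borel_measurable M"
  by (rule measurable_compose_countable[OF _ assms(2), of "\<lambda>i w. \<sigma> (X w) i"])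
   (rule borel_measurable_continuous_on[OF continuous_\<sigma> assms(1)])
qed

abbreviation drift :: "(real => 'a => real^'n) => (real => 'a => nat) => real => 'a => real^'n" where
 "drift X a t w \<equiv> LINT s:{0..t}|lborel. b (X s w) (a s w)"

definition sde_on :: "real => (real => 'a => nat) => (real => 'a => real^'n) => bool" where
 "sde_on T a X \<longleftrightarrow> (\<forall>t\<in>{0..T}. X t \<in> borel_measurable (F t)) \<and>
   (AE w in P. continuous_on {0..T} (\<lambda>t. X t w)) \<and>
   (\<exists>Y. ito_integral_on P F W T (\<lambda>s w. \<sigma> (X s w) (a s w)) Y \<and>
    (AE w in P. \<forall>t\<in>{0..T}. X t w = X 0 w + drift X a t w + Y t w))"

text \<open>\<open>J\<close> plays the part of a stopping time: it says that the data agreed and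
  everything stayed below \<open>m\<close> up to \<open>t\<close>. Observing rational times strictly
  before \<open>t\<close> makes \<open>J t\<close> measurable at \<open>t\<close> and
  left-continuous in \<open>t\<close>. On \<open>J\<close> the squared difference is at most
  \<open>(2 * m)^2\<close>, hence its mean is finite without any moment assumption and Gronwall's
  argument applies to it.\<close>

lemma sde_local_uniqueness_bounded:
 fixes a a' :: "real => 'a => nat" and X X' :: "real => 'a => real^'n" and m :: real
 defines "J \<equiv> \<lambda>t w. X 0 w = X' 0 w \<and> (\<forall>q::rat. 0 \<le> q --> of_rat q < t -->
   a (of_rat q) w = a' (of_rat q) w \<and> L (a (of_rat q) w) \<le> m \<and> norm (X (of_rat q) w) \<le> m \<and> norm (X' (of_rat q) w) \<le> m)"
 assumes T: "0 < T" and m: "0 \<le> m"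
  and X: "\<And>t. 0 \<le> t ==> X t \<in> borel_measurable (F t)" "AE w in P. continuous_on {0..} (\<lambda>t. X t w)"
  and X': "\<And>t. 0 \<le> t ==> X' t \<in> borel_measurable (F t)" "AE w in P. continuous_on {0..} (\<lambda>t. X' t w)"
  and a: "\<And>t. 0 \<le> t ==> a t \<in> measurable (F t) (count_space UNIV)" "AE w in P. pwc (\<lambda>t. a t w)"
  and a': "\<And>t. 0 \<le> t ==> a' t \<in> measurable (F t) (count_space UNIV)" "AE w in P. pwc (\<lambda>t. a' t w)"
  and Y: "\<And>t. 0 \<le> t ==> t \<le> T ==> approx t (\<lambda>s w. \<sigma> (X s w) (a s w)) Y"
   "AE w in P. \<forall>t\<in>{0..T}. X t w = X 0 w + drift X a t w + Y t w"
  and Y': "\<And>t. 0 \<le> t ==> t \<le> T ==> approx t (\<lambda>s w. \<sigma> (X' s w) (a' s w)) Y'"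
   "AE w in P. \<forall>t\<in>{0..T}. X' t w = X' 0 w + drift X' a' t w + Y' t w"
 shows "AE w in P. \<forall>t\<in>{0..T}. J t w --> X t w = X' t w"
proof -
 have Jmono: "J s w" if "s \<le> t" "J t w" for s t w
  using that unfolding J_def by (meson less_le_trans)
 define c where "c q w \<longleftrightarrow> a q w = a' q w \<and> L (a q w) \<le> m \<and> norm (X q w) \<le> m \<and> norm (X' q w) \<le> m" for q w
 have J: "J t w \<longleftrightarrow> X 0 w = X' 0 w \<and> (\<forall>q::rat. 0 \<le> q --> of_rat q < t --> c (of_rat q) w)" for t w
  by (simp add: J_def c_def)
 have cm: "Measurable.pred (F t) (c q)" if "0 \<le> q" "q \<le> t" for q t
 proof -
  have [measurable]: "a q \<in> measurable (F t) (count_space UNIV)" "a' q \<in> measurable (F t) (count_space UNIV)"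
   "X q \<in> borel_measurable (F t)" "X' q \<in> borel_measurable (F t)"
   using that by (auto intro: measurable_F_mono[OF X(1)[of q]] measurable_F_mono[OF X'(1)[of q]]
     measurable_F_mono[OF a(1)[of q]] measurable_F_mono[OF a'(1)[of q]])
  show ?thesis unfolding c_def
  proof (intro pred_intros_logic)
   show "Measurable.pred (F t) (\<lambda>w. L (a q w) \<le> m)"
    by (rule measurable_compose[of "a q" _ "count_space UNIV"]) auto
   show "Measurable.pred (F t) (\<lambda>w. a q w = a' q w)"
    by (rule measurable_compose_countable[where f = "\<lambda>i w. i = a' q w" and g = "a q"]) measurable
  qed measurable
 qed
 have Jm: "Measurable.pred (F t) (J t)" if t: "0 \<le> t" for t
  unfolding J
 proof -
  have [measurable]: "X 0 \<in> borel_measurable (F t)" "X' 0 \<in> borel_measurable (F t)"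
   using t by (auto intro: measurable_F_mono[OF X(1)[of 0]] measurable_F_mono[OF X'(1)[of 0]])
  have 1: "Measurable.pred (F t) (\<lambda>w. X 0 w = X' 0 w)" by measurable
  have 2: "Measurable.pred (F t) (\<lambda>w. \<forall>q::rat. 0 \<le> q --> of_rat q < t --> c (of_rat q) w)"
  proof (rule pred_intros_countable)
   fix q :: rat
   show "Measurable.pred (F t) (\<lambda>w. 0 \<le> q --> of_rat q < t --> c (of_rat q) w)"
    using cm[of "of_rat q" t] by (cases "0 \<le> q \<and> real_of_rat q < t") auto
  qed
  show "Measurable.pred (F t) (\<lambda>w. X 0 w = X' 0 w \<and> (\<forall>q::rat. 0 \<le> q --> of_rat q < t --> c (of_rat q) w))"
   using 1 2 by (intro pred_intros_logic)
 qed
 define good where "good w \<longleftrightarrow> continuous_on {0..} (\<lambda>t. X t w) \<and> continuous_on {0..} (\<lambda>t. X' t w)" for w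
 have good: "AE w in P. good w" using X(2) X'(2) by eventually_elim (simp add: good_def)
 \<comment> \<open>Set to 0 off the good event so that every path is continuous, as the joint
   measurability of \<open>\<phi>\<close> requires.\<close>
 define D where "D t w = (if good w then X t w - X' t w else 0)" for t w
 have Dm: "D t \<in> borel_measurable P" if t: "0 \<le> t" for t
 proof (rule measurable_P_AE_cong)
  have [measurable]: "X t \<in> borel_measurable P" "X' t \<in> borel_measurable P"
   using t by (auto intro: measurable_F_imp_P[OF X(1)] measurable_F_imp_P[OF X'(1)])
  show "(\<lambda>w. X t w - X' t w) \<in> borel_measurable P" by measurable
  show "AE w in P. X t w - X' t w = D t w" using good by eventually_elim (simp add: D_def)
 qed simp
 have Dc: "continuous_on {0..} (\<lambda>t. D t w)" for w
  by (cases "good w") (auto simp: D_def good_def intro!: continuous_on_diff)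
 define \<phi> where "\<phi> t w = (if J t w then (norm (D t w))\<^sup>2 else 0)" for t w
 have Jleft: "\<forall>\<^sub>F s in at_left t. J s w = J t w" if t: "0 < t" for t w
 proof (cases "J t w")
  case True
  thus ?thesis unfolding eventually_at_left_field using Jmono by (intro exI[of _ "t - 1"]) (auto intro: less_imp_le)
 next
  case False
  then consider "X 0 w \<noteq> X' 0 w" | q :: rat where "0 \<le> q" "of_rat q < t" "\<not> c (of_rat q) w" unfolding J by blast
  thus ?thesis
  proof cases
   case 1
   thus ?thesis by (simp add: J)
  next
   case (2 q)
   thus ?thesis unfolding eventually_at_left_field using False by (intro exI[of _ "of_rat q"]) (auto simp: J)
  qed
 qed
 have phi_joint: "(\<lambda>(u, w). \<phi> (max 0 u) w) \<in> borel_measurable (borel \<Otimes>\<^sub>M P)"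
 proof (rule joint_measurable_left_continuous)
  show "\<phi> t \<in> borel_measurable P" if "0 \<le> t" for t
   unfolding \<phi>_def using measurable_F_imp_P[OF Jm[OF that] that] Dm[OF that] by measurable
  fix w and t :: real assume t: "0 < t"
  have "((\<lambda>s. D s w) \<longlongrightarrow> D t w) (at t within {0..})" using Dc[of w] t by (auto simp: continuous_on_def)
  hence D: "((\<lambda>s. D s w) \<longlongrightarrow> D t w) (at_left t)" by (rule tendsto_mono[OF at_left_le[OF t]])
  have "((\<lambda>s. if J t w then (norm (D s w))\<^sup>2 else 0) \<longlongrightarrow> \<phi> t w) (at_left t)"
   unfolding \<phi>_def by (cases "J t w") (auto intro!: tendsto_intros D)
  moreover have "\<forall>\<^sub>F s in at_left t. (if J t w then (norm (D s w))\<^sup>2 else 0) = \<phi> s w"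
   using Jleft[OF t, of w] by eventually_elim (simp add: \<phi>_def)
  ultimately show "((\<lambda>s. \<phi> s w) \<longlongrightarrow> \<phi> t w) (at_left t)" by (rule Lim_transform_eventually)
 qed
 \<comment> \<open>The difference of the two integrands, switched off together with
   \<open>J\<close>. Its integral \<open>Z\<close> equals \<open>Y - Y'\<close> as long as
   \<open>J\<close> holds, by locality, and its energy is controlled by that of
   \<open>\<phi>\<close>.\<close>
 define \<gamma> where "\<gamma> s w = (if J s w then \<sigma> (X s w) (a s w) - \<sigma> (X' s w) (a' s w) else 0)" for s w
 have "regular \<gamma>"
  unfolding regular_def
 proof (intro conjI allI impI)
  fix t :: real assume t: "0 \<le> t"
  note [measurable] = Jm[OF t] coeff_measurable(2)[OF X(1)[OF t] a(1)[OF t]] coeff_measurable(2)[OF X'(1)[OF t] a'(1)[OF t]]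
  show "\<gamma> t \<in> borel_measurable (F t)" unfolding \<gamma>_def by measurable
 next
  show "AE w in P. reg_path (\<lambda>t. \<gamma> t w)"
   using X(2) X'(2) a(2) a'(2)
  proof eventually_elim
   case (elim w)
   have "reg_path (\<lambda>t. (\<lambda>y i. if snd (snd i) then \<sigma> (fst y) (fst i) - \<sigma> (snd y) (fst (snd i)) else 0) (X t w, X' t w) (a t w, a' t w, J t w))"
   proof (rule reg_path_pwc_continuous[where x = "\<lambda>t. (X t w, X' t w)" and a = "\<lambda>t. (a t w, a' t w, J t w)"
      and G = "\<lambda>y i. if snd (snd i) then \<sigma> (fst y) (fst i) - \<sigma> (snd y) (fst (snd i)) else 0"])
    show "continuous_on {0..} (\<lambda>t. (X t w, X' t w))" using elim by (intro continuous_on_Pair)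
    show "pwc (\<lambda>t. (a t w, a' t w, J t w))"
     using elim Jmono by (intro pwc_Pair pwc_antimono) blast+
    fix i :: "nat \<times> nat \<times> bool"
    have "continuous_on UNIV (\<lambda>y. \<sigma> (fst y) (fst i) - \<sigma> (snd y) (fst (snd i)))"
     by (intro continuous_on_diff continuous_on_compose2[OF continuous_\<sigma>] continuous_on_fst continuous_on_snd continuous_on_id) auto
    thus "continuous_on UNIV (\<lambda>y. if snd (snd i) then \<sigma> (fst y) (fst i) - \<sigma> (snd y) (fst (snd i)) else 0)"
     by (cases "snd (snd i)") auto
   qed
   thus ?case by (simp add: \<gamma>_def cong: if_cong)
  qed
 qed
 then obtain Z where Z: "\<And>t. 0 < t ==> ito_integral_on P F W t \<gamma> Z"
  using ito_integral_exists by blast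
 have Za: "approx t \<gamma> Z" if "0 \<le> t" for t
  using ito_integral_on_approx[OF Z[of "t + 1"]] that by simp
 have loc: "AE w in P. \<forall>t\<in>{0..T}. (\<forall>u. 0 \<le> u --> u < t -->
   \<sigma> (X u w) (a u w) - \<sigma> (X' u w) (a' u w) = \<gamma> u w) --> Y t w - Y' t w = Z t w"
  by (rule ito_integral_local[OF _ _ T]) (intro approx_diff Y(1) Y'(1) Za; assumption)+
 have main: "AE w in P. \<forall>t\<in>{0..T}.
   ennreal (\<phi> t w) \<le> ennreal (2 * T * m\<^sup>2) * (tint t (\<lambda>s. ennreal (\<phi> s w))) + 2 * sqnorm (Z t w) \<and>
   energy t \<gamma> w \<le> ennreal (m\<^sup>2) * (tint t (\<lambda>s. ennreal (\<phi> s w))) \<and> \<phi> t w \<le> (2 * m)\<^sup>2"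
  using loc Y(2) Y'(2) good a(2) a'(2) AE_space
 proof (eventually_elim, intro ballI conjI)
  fix w t
  assume l: "\<forall>t\<in>{0..T}. (\<forall>u. 0 \<le> u --> u < t -->
    \<sigma> (X u w) (a u w) - \<sigma> (X' u w) (a' u w) = \<gamma> u w) --> Y t w - Y' t w = Z t w"
   and eq: "\<forall>t\<in>{0..T}. X t w = X 0 w + drift X a t w + Y t w"
   and eq': "\<forall>t\<in>{0..T}. X' t w = X' 0 w + drift X' a' t w + Y' t w"
   and g: "good w" and p: "pwc (\<lambda>t. a t w)" "pwc (\<lambda>t. a' t w)" and t: "t \<in> {0..T}" and "w \<in> space P"
  let ?C = "{0} \<union> pwc_jumps (\<lambda>t. a t w) \<union> pwc_jumps (\<lambda>t. a' t w)"
  have ctn: "countable ?C" using countable_pwc_jumps p by auto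
  have AEs: "AE s in lborel. s \<notin> ?C" by (rule AE_not_in[OF countable_imp_null_set_lborel[OF ctn]])
  \<comment> \<open>\<open>J\<close> speaks about rational times only. At a time that is no jump,
    both switching paths have the values they take at nearby rational times to the left; the jump
    times form a null set for the time integrals.\<close>
  have Js: "a s w = a' s w \<and> L (a s w) \<le> m" if js: "J s w" "0 < s" "s \<notin> ?C" for s
  proof -
   have "\<forall>\<^sub>F u in at_left s. a u w = a s w" "\<forall>\<^sub>F u in at_left s. a' u w = a' s w"
    using pwc_left_eventually[of s "\<lambda>t. a t w"] pwc_left_eventually[of s "\<lambda>t. a' t w"] js by auto
   hence "\<forall>\<^sub>F u in at_left s. a u w = a s w \<and> a' u w = a' s w" by eventually_elim simp
   then obtain c0 where c0: "c0 < s" "\<And>u. c0 < u ==> u < s ==> a u w = a s w \<and> a' u w = a' s w"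
    unfolding eventually_at_left_field by blast
   obtain q where q: "max 0 c0 < real_of_rat q" "real_of_rat q < s"
    using of_rat_dense[of "max 0 c0" s] c0 js(2) by auto
   hence "c (of_rat q) w" using js(1) unfolding J by (simp add: less_imp_le)
   thus ?thesis using c0(2)[of "of_rat q"] q by (auto simp: c_def)
  qed
  have Db: "norm (X t w) \<le> m \<and> norm (X' t w) \<le> m" if "J t w" "0 < t"
  proof -
   have "norm (x t) \<in> {..m}" if x: "continuous_on {0..} x" and q: "\<And>q::rat. 0 \<le> q ==> of_rat q < t ==> norm (x (of_rat q)) \<le> m" for x :: "real => real^'n"
   proof (rule closed_dense_extend[of t "\<lambda>t. norm (x t)"])
    show "continuous_on {0..t} (\<lambda>t. norm (x t))"
     by (intro continuous_on_norm continuous_on_subset[OF x]) auto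
    fix s :: real assume "s \<in> \<rat>" "0 < s" "s < t"
    thus "norm (x s) \<in> {..m}" using q by (auto elim!: Rats_cases)
   qed (use \<open>0 < t\<close> in auto)
   from this[of "\<lambda>t. X t w"] this[of "\<lambda>t. X' t w"] show ?thesis
    using g that(1) unfolding good_def J c_def by auto
  qed
  show "\<phi> t w \<le> (2 * m)\<^sup>2"
  proof (cases "J t w")
   case True
   show ?thesis
   proof (cases "t = 0")
    case False
    hence "norm (D t w) \<le> 2 * m" using Db True t g norm_triangle_ineq4[of "X t w" "X' t w"] by (auto simp: D_def)
    from power_mono[OF this norm_ge_zero, of 2] show ?thesis using True by (simp add: \<phi>_def)
   next
    case t0: True
    hence "D t w = 0" using True by (simp add: D_def J)
    thus ?thesis by (simp add: \<phi>_def)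
   qed
  qed (simp add: \<phi>_def)
  have gam: "norm (\<gamma> s w) \<le> m * sqrt (\<phi> s w)" if "0 < s" "s \<notin> ?C" for s
  proof (cases "J s w")
   case True
   have "norm (\<gamma> s w) \<le> L (a s w) * norm (X s w - X' s w)"
    using lip_\<sigma>[of "X s w" "a s w" "X' s w"] Js[OF True that] True by (simp add: \<gamma>_def)
   also have "\<dots> \<le> m * norm (X s w - X' s w)" using Js[OF True that] by (intro mult_right_mono) auto
   finally show ?thesis using True g by (simp add: \<phi>_def D_def)
  qed (simp add: \<gamma>_def \<phi>_def)
  have phi0: "0 \<le> \<phi> s w" for s by (simp add: \<phi>_def)
  have sq: "(norm x)\<^sup>2 \<le> m\<^sup>2 * \<phi> s w" if "norm x \<le> m * sqrt (\<phi> s w)" for x :: "'x::real_normed_vector" and s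
  proof -
   have "(norm x)\<^sup>2 \<le> (m * sqrt (\<phi> s w))\<^sup>2" using that by (intro power_mono) auto
   thus ?thesis using phi0 by (simp add: power_mult_distrib)
  qed
  have phi_meas: "(\<lambda>s. indicator {0..t} s * ennreal (\<phi> s w)) \<in> borel_measurable lborel"
  proof -
   have "(\<lambda>u. \<phi> (max 0 u) w) \<in> borel_measurable borel"
    using measurable_compose[OF measurable_Pair2'[OF \<open>w \<in> space P\<close>, of borel] phi_joint] by (simp add: case_prod_beta')
   hence "(\<lambda>s. indicator {0..t} s * ennreal (\<phi> (max 0 s) w)) \<in> borel_measurable lborel" by measurable
   moreover have "(\<lambda>s. indicator {0..t} s * ennreal (\<phi> (max 0 s) w)) = (\<lambda>s. indicator {0..t} s * ennreal (\<phi> s w))"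
    by (auto simp: indicator_def max_def)
   ultimately show ?thesis by simp
  qed
  have scale: "(tint t (\<lambda>s. ennreal (m\<^sup>2 * \<phi> s w))) = ennreal (m\<^sup>2) * (tint t (\<lambda>s. ennreal (\<phi> s w)))"
  proof -
   have "(tint t (\<lambda>s. ennreal (m\<^sup>2 * \<phi> s w))) = (\<integral>\<^sup>+s. ennreal (m\<^sup>2) * (indicator {0..t} s * ennreal (\<phi> s w)) \<partial>lborel)"
    by (intro nn_integral_cong) (simp add: ennreal_mult phi0 mult_ac)
   also have "\<dots> = ennreal (m\<^sup>2) * (\<integral>\<^sup>+s. indicator {0..t} s * ennreal (\<phi> s w) \<partial>lborel)"
    by (rule nn_integral_cmult[OF phi_meas])
   finally show ?thesis by (simp add: mult.commute)
  qed
  show "energy t \<gamma> w \<le> ennreal (m\<^sup>2) * (tint t (\<lambda>s. ennreal (\<phi> s w)))"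
   unfolding energy_def scale[symmetric]
  proof (rule nn_integral_mono_AE)
   show "AE s in lborel. sqnorm (\<gamma> s w) * indicator {0..t} s \<le> ennreal (m\<^sup>2 * \<phi> s w) * indicator {0..t} s"
    using AEs
   proof eventually_elim
    case (elim s)
    thus ?case using sq[OF gam[of s]] by (cases "0 < s") (auto simp: indicator_def intro!: ennreal_leI)
   qed
  qed
  show "ennreal (\<phi> t w) \<le> ennreal (2 * T * m\<^sup>2) * (tint t (\<lambda>s. ennreal (\<phi> s w))) + 2 * sqnorm (Z t w)"
  proof (cases "J t w")
   case True
   let ?f = "\<lambda>s. b (X s w) (a s w) - b (X' s w) (a' s w)"
   have r: "reg_path (\<lambda>s. b (X s w) (a s w))" "reg_path (\<lambda>s. b (X' s w) (a' s w))"
    using g p by (auto simp: good_def intro!: reg_path_coeff)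
   have fi: "set_integrable lborel {0..t} ?f"
    by (intro set_integral_diff(1) reg_path_set_integrable r)
   have Yz: "Y t w - Y' t w = Z t w"
   proof (rule l[rule_format, OF t])
    fix u assume "0 \<le> u" "u < t"
    thus "\<sigma> (X u w) (a u w) - \<sigma> (X' u w) (a' u w) = \<gamma> u w"
     using Jmono[of u t w] True by (simp add: \<gamma>_def)
   qed
   have "D t w = (X 0 w + drift X a t w + Y t w)
     - (X' 0 w + drift X' a' t w + Y' t w)"
    using eq[rule_format, OF t] eq'[rule_format, OF t] g unfolding D_def by simp
   also have "\<dots> = (LINT s:{0..t}|lborel. ?f s) + Z t w"
    using True Yz set_integral_diff(2)[OF reg_path_set_integrable[OF r(1), of t] reg_path_set_integrable[OF r(2), of t]]
    by (simp add: J algebra_simps)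
   finally have Deq: "D t w = (LINT s:{0..t}|lborel. ?f s) + Z t w" .
   have "\<phi> t w = (norm (D t w))\<^sup>2" using True by (simp add: \<phi>_def)
   also have "\<dots> \<le> 2 * (norm (LINT s:{0..t}|lborel. ?f s))\<^sup>2 + 2 * (norm (Z t w))\<^sup>2"
    unfolding Deq using norm_add_power2_le[of 1 "LINT s:{0..t}|lborel. ?f s" "Z t w"] by simp
   finally have "ennreal (\<phi> t w) \<le> ennreal (2 * (norm (LINT s:{0..t}|lborel. ?f s))\<^sup>2 + 2 * (norm (Z t w))\<^sup>2)"
    by (rule ennreal_leI)
   also have "\<dots> = 2 * sqnorm (LINT s:{0..t}|lborel. ?f s) + 2 * sqnorm (Z t w)"
    by (simp add: ennreal_plus ennreal_mult)
   also have "sqnorm (LINT s:{0..t}|lborel. ?f s) \<le> ennreal T * (ennreal (m\<^sup>2) * (tint t (\<lambda>s. ennreal (\<phi> s w))))"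
   proof -
    have "sqnorm (LINT s:{0..t}|lborel. ?f s) \<le> ennreal t * (tint t (\<lambda>s. sqnorm (?f s)))"
     using t by (intro set_integral_square_le fi) auto
    also have "\<dots> \<le> ennreal T * (tint t (\<lambda>s. ennreal (m\<^sup>2 * \<phi> s w)))"
    proof (rule mult_mono)
     show "(tint t (\<lambda>s. sqnorm (?f s))) \<le> (tint t (\<lambda>s. ennreal (m\<^sup>2 * \<phi> s w)))"
     proof (rule nn_integral_mono_AE)
      show "AE s in lborel. sqnorm (?f s) * indicator {0..t} s \<le> ennreal (m\<^sup>2 * \<phi> s w) * indicator {0..t} s"
       using AEs
      proof eventually_elim
       case (elim s)
       show ?case
       proof (cases "0 < s \<and> s \<le> t")
        case s: True
        hence Jss: "J s w" using Jmono True by blast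
        have j: "a s w = a' s w" "L (a s w) \<le> m" using Js[OF Jss _ elim] s by auto
        have "norm (?f s) \<le> L (a s w) * norm (X s w - X' s w)" using lip_b j(1) by simp
        also have "\<dots> \<le> m * norm (X s w - X' s w)" using j(2) by (rule mult_right_mono) simp
        finally have "norm (?f s) \<le> m * sqrt (\<phi> s w)" using Jss g by (simp add: \<phi>_def D_def)
        from sq[OF this] show ?thesis using s by (simp add: ennreal_leI)
       next
        case False
        thus ?thesis using elim by (auto simp: indicator_def)
       qed
      qed
     qed
    qed (use t in \<open>auto intro: ennreal_leI\<close>)
    finally show ?thesis unfolding scale .
   qed
   also have "2 * (ennreal T * (ennreal (m\<^sup>2) * (tint t (\<lambda>s. ennreal (\<phi> s w))))) =
     ennreal (2 * T * m\<^sup>2) * (tint t (\<lambda>s. ennreal (\<phi> s w)))"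
    using T by (simp add: ennreal_mult mult_ac)
   finally show ?thesis by (simp add: mult_left_mono add_right_mono)
  qed (simp add: \<phi>_def)
 qed
 define f where "f t = (EE w. ennreal (\<phi> t w))" for t
 have phiP: "\<phi> t \<in> borel_measurable P" if "0 \<le> t" for t
  unfolding \<phi>_def using measurable_F_imp_P[OF Jm[OF that] that] Dm[OF that] by measurable
 have tonelli: "(EE w. (tint t (\<lambda>s. ennreal (\<phi> s w)))) = (tint t f)"
  and inner_meas: "(\<lambda>w. \<integral>\<^sup>+s\<in>{0..t}. ennreal (\<phi> s w) \<partial>lborel) \<in> borel_measurable P" for t
 proof -
  interpret pair_sigma_finite lborel P ..
  have [measurable]: "(\<lambda>x. \<phi> (max 0 (fst x)) (snd x)) \<in> borel_measurable (lborel \<Otimes>\<^sub>M P)"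
   using phi_joint by (simp add: case_prod_beta' cong: measurable_cong_sets)
  let ?h = "\<lambda>s w. ennreal (\<phi> (max 0 s) w) * indicator {0..t} s"
  have hm: "case_prod ?h \<in> borel_measurable (lborel \<Otimes>\<^sub>M P)" by (simp add: case_prod_beta')
  have e: "(tint t (\<lambda>s. ennreal (\<phi> s w))) = (\<integral>\<^sup>+s. ?h s w \<partial>lborel)" for w
   by (intro nn_integral_cong) (auto simp: indicator_def max_def)
  have "(EE w. (\<integral>\<^sup>+s. ?h s w \<partial>lborel)) = (\<integral>\<^sup>+s. (EE w. ?h s w) \<partial>lborel)"
   by (rule Fubini'[OF hm])
  also have "\<dots> = (tint t f)"
   unfolding f_def by (intro nn_integral_cong) (auto simp: indicator_def max_def)
  finally show "(EE w. (tint t (\<lambda>s. ennreal (\<phi> s w)))) = (tint t f)" unfolding e .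
  show "(\<lambda>w. \<integral>\<^sup>+s\<in>{0..t}. ennreal (\<phi> s w) \<partial>lborel) \<in> borel_measurable P"
   unfolding e by (rule lborel.borel_measurable_nn_integral) (use measurable_pair_swap[OF hm] in \<open>simp add: case_prod_beta'\<close>)
 qed
 have f0: "f t = 0" if t: "t \<in> {0..T}" for t
 proof (rule gronwall_zero[OF _ _ _ _ t])
  \<comment> \<open>With the factor 2 from squaring a sum, the drift contributes
    \<open>2 * T * m^2\<close> by Cauchy-Schwarz and the stochastic integral \<open>2 * m^2\<close>
    by the isometry.\<close>
  show "0 \<le> 2 * T * m\<^sup>2 + 2 * m\<^sup>2" "0 \<le> (2 * m)\<^sup>2" using T by auto
  fix t assume t: "t \<in> {0..T}"
  have "f t \<le> (EE w. ennreal ((2 * m)\<^sup>2))"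
   unfolding f_def using main t by (intro nn_integral_mono_AE) (auto elim!: eventually_mono intro!: ennreal_leI)
  thus "f t \<le> ennreal ((2 * m)\<^sup>2)" by (simp add: emeasure_space_1)
  note [measurable] = inner_meas[of t] approxD(1)[OF Za, of t t]
  have Zt[measurable]: "Z t \<in> borel_measurable P" using approxD(1)[OF Za, of t t] t by auto
  have "f t \<le> (EE w. ennreal (2 * T * m\<^sup>2) * (tint t (\<lambda>s. ennreal (\<phi> s w))) + 2 * sqnorm (Z t w))"
   unfolding f_def using main t by (intro nn_integral_mono_AE) (auto elim!: eventually_mono)
  also have "\<dots> = ennreal (2 * T * m\<^sup>2) * (EE w. (tint t (\<lambda>s. ennreal (\<phi> s w)))) + 2 * (EE w. sqnorm (Z t w))"
   by (subst nn_integral_add) (simp_all add: nn_integral_cmult)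
  also have "(EE w. sqnorm (Z t w)) \<le> (EE w. energy t \<gamma> w)"
   using t by (intro approx_inequalities(3)[OF Za]) auto
  also have "(EE w. energy t \<gamma> w) \<le> (EE w. ennreal (m\<^sup>2) * (tint t (\<lambda>s. ennreal (\<phi> s w))))"
   using main t by (intro nn_integral_mono_AE) (auto elim!: eventually_mono)
  also have "\<dots> = ennreal (m\<^sup>2) * (EE w. (tint t (\<lambda>s. ennreal (\<phi> s w))))"
   by (rule nn_integral_cmult) measurable
  also have "ennreal (2 * T * m\<^sup>2) * (EE w. (tint t (\<lambda>s. ennreal (\<phi> s w)))) +
    2 * (ennreal (m\<^sup>2) * (EE w. (tint t (\<lambda>s. ennreal (\<phi> s w))))) =
    ennreal (2 * T * m\<^sup>2 + 2 * m\<^sup>2) * (tint t f)"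
   unfolding tonelli using T by (simp add: ennreal_plus ennreal_mult algebra_simps)
  finally show "f t \<le> ennreal (2 * T * m\<^sup>2 + 2 * m\<^sup>2) * (tint t f)"
   by (simp add: mult_left_mono add_left_mono)
 qed
 have "AE w in P. \<phi> t w = 0" if "t \<in> {0..T}" for t
 proof -
  have "(\<lambda>w. ennreal (\<phi> t w)) \<in> borel_measurable P" using phiP[of t] that by simp
  hence "AE w in P. ennreal (\<phi> t w) = 0"
   using f0[OF that] unfolding f_def by (subst (asm) nn_integral_0_iff_AE) auto
  thus ?thesis by eventually_elim (simp add: \<phi>_def split: if_splits)
 qed
 hence "AE w in P. \<forall>t\<in>\<rat> \<inter> {0..T}. \<phi> t w = 0"
  using countable_rat by (subst AE_ball_countable) (auto intro: countable_Int1)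
 thus ?thesis
  using good
 proof (eventually_elim, intro ballI impI)
  fix w t assume z: "\<forall>t\<in>\<rat> \<inter> {0..T}. \<phi> t w = 0" and g: "good w" and t: "t \<in> {0..T}" and Jt: "J t w"
  show "X t w = X' t w"
  proof (cases "t = 0")
   case True
   thus ?thesis using Jt by (simp add: J)
  next
   case False
   hence t0: "0 < t" using t by simp
   have "D t w \<in> {0}"
   proof (rule closed_dense_extend[of t "\<lambda>t. D t w"])
    show "continuous_on {0..t} (\<lambda>t. D t w)" by (rule continuous_on_subset[OF Dc]) auto
    fix s :: real assume s: "s \<in> \<rat>" "0 < s" "s < t"
    hence "\<phi> s w = 0" "J s w" using z t Jmono[of s t w] Jt by auto
    thus "D s w \<in> {0}" by (simp add: \<phi>_def)
   qed (use t0 in auto)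
   thus ?thesis using g by (simp add: D_def)
  qed
 qed
qed

end

lemma energy_cong:
 assumes "\<And>u. u \<in> {0..T} ==> H u w = H' u w"
 shows "energy T H w = energy T H' w"
 unfolding energy_def using assms by (intro nn_integral_cong) (auto simp: indicator_def)

context brownian_space
begin

lemma approx_cong:
 fixes H H' :: "real => 'a => real^'d^'n"
 assumes a: "approx T H Y" and eq: "\<And>u w. u \<in> {0..T} ==> H u w = H' u w"
 shows "approx T H' Y"
proof -
 have 1: "energy T (\<lambda>u w. V u w - H u w) w = energy T (\<lambda>u w. V u w - H' u w) w" for V :: "real => 'a => real^'d^'n" and w
  using eq by (intro energy_cong) simp
 have 2: "energy T H w = energy T H' w" for w
  using eq by (intro energy_cong) simp
 have 3: "set_borel_measurable lborel {0..T} (\<lambda>u. H u w) = set_borel_measurable lborel {0..T} (\<lambda>u. H' u w)" for w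
  unfolding set_borel_measurable_def using eq by (intro measurable_cong) (auto simp: indicator_def)
 show ?thesis using a unfolding approx_def 1 2 3 .
qed

text \<open>Continuity of the integral in probability: cutting the energy at \<delta> replaces
  convergence of expected energies, which need not be finite here.\<close>

lemma approx_limit_zero:
 assumes a: "\<And>k. approx T (H k) (Y k)" and T: "0 \<le> T"
  and e: "AE w in P. (\<lambda>k. energy T (H k) w) \<longlonglongrightarrow> 0"
  and R: "R \<in> borel_measurable P" "AE w in P. (\<lambda>k. Y k T w) \<longlonglongrightarrow> R w"
 shows "AE w in P. R w = 0"
proof -
 note [measurable] = R(1) approx_inequalities(1)[OF a T]
 have Ym[measurable]: "Y k T \<in> borel_measurable P" for k using approxD(1)[OF a, of T] T by simp
 have "AE w in P. True --> norm (R w) \<le> 0"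
 proof (rule AE_zero_if_small)
  show "{w\<in>space P. True \<and> e < norm (R w)} \<in> sets P" for e by measurable
  fix \<epsilon> \<delta> :: real assume \<epsilon>: "0 < \<epsilon>" and \<delta>: "0 < \<delta>"
  let ?B = "{w\<in>space P. \<epsilon> < norm (R w)}"
  have B: "?B \<in> sets P" by measurable
  have "emeasure P ?B * ennreal (\<epsilon>\<^sup>2) \<le> ennreal \<delta>"
  proof -
   let ?E = "\<lambda>k. {w\<in>space P. (\<exists>t\<in>{T}. \<epsilon> < norm (Y k t w)) \<and> energy T (H k) w < ennreal \<delta>}"
   have E: "?E k \<in> sets P" for k by simp
   have "(EE w. ennreal (\<epsilon>\<^sup>2) * indicator ?B w) \<le> ennreal \<delta>"
   proof (rule nn_integral_fatou_bound[OF _ _ _ _ tendsto_const])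
    show "(\<lambda>w. ennreal (\<epsilon>\<^sup>2) * indicator (?E k) w) \<in> borel_measurable P" for k
     using E[of k] by measurable
    show "(\<lambda>w. ennreal (\<epsilon>\<^sup>2) * indicator ?B w) \<in> borel_measurable P" using B by measurable
    show "(EE w. ennreal (\<epsilon>\<^sup>2) * indicator (?E k) w) \<le> ennreal \<delta>" for k
    proof -
     have "(EE w. ennreal (\<epsilon>\<^sup>2) * indicator (?E k) w) = emeasure P (?E k) * ennreal (\<epsilon>\<^sup>2)"
      by (subst nn_integral_cmult_indicator[OF E]) (rule mult.commute)
     also have "\<dots> \<le> (EE w. min (ennreal \<delta>) (energy T (H k) w))"
      by (rule approx_inequalities(2)[OF a T]) (use T \<delta> \<epsilon> in auto)
     also have "\<dots> \<le> (EE w. ennreal \<delta>)" by (intro nn_integral_mono) simp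
     finally show ?thesis by (simp add: emeasure_space_1)
    qed
    show "AE w in P. ennreal (\<epsilon>\<^sup>2) * indicator ?B w \<le> liminf (\<lambda>k. ennreal (\<epsilon>\<^sup>2) * indicator (?E k) w)"
     using e R(2)
    proof eventually_elim
     case (elim w)
     show ?case
     proof (cases "w \<in> ?B")
      case True
      have "eventually (\<lambda>k. energy T (H k) w < ennreal \<delta>) sequentially"
       using order_tendstoD(2)[OF elim(1)] \<delta> by simp
      moreover have "eventually (\<lambda>k. \<epsilon> < norm (Y k T w)) sequentially"
       using order_tendstoD(1)[OF tendsto_norm[OF elim(2)]] True by simp
      ultimately have "eventually (\<lambda>k. ennreal (\<epsilon>\<^sup>2) * indicator ?B w \<le> ennreal (\<epsilon>\<^sup>2) * indicator (?E k) w) sequentially"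
       by eventually_elim (use True in \<open>simp add: indicator_def\<close>)
      thus ?thesis by (rule Liminf_bounded)
     qed simp
    qed
   qed
   thus ?thesis by (subst (asm) nn_integral_cmult_indicator[OF B]) (simp only: mult.commute)
  qed
  thus "emeasure P {w\<in>space P. True \<and> \<epsilon> < norm (R w)} * ennreal (\<epsilon>\<^sup>2) \<le> ennreal \<delta>" by simp
 qed
 thus ?thesis by simp
qed

end

context sde_space
begin

text \<open>Both solutions are stopped at \<open>T\<close> to obtain processes on the half-line.
  Paths are continuous and the switching path takes finitely many values on \<open>{0..T}\<close>,
  so every path stays below some natural number \<open>m\<close>, and countably many applications of
  the bounded case cover almost all of them.\<close>

theorem sde_local_uniqueness:
 assumes T: "0 < T" and X: "sde_on T a X" and X': "sde_on T a' X'"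
  and a: "\<And>t. t \<in> {0..T} ==> a t \<in> measurable (F t) (count_space UNIV)" "AE w in P. pwc (\<lambda>t. a (min t T) w)"
  and a': "\<And>t. t \<in> {0..T} ==> a' t \<in> measurable (F t) (count_space UNIV)" "AE w in P. pwc (\<lambda>t. a' (min t T) w)"
 shows "AE w in P. \<forall>t\<in>{0..T}. X 0 w = X' 0 w --> (\<forall>s. 0 \<le> s --> s < t --> a s w = a' s w) --> X t w = X' t w"
proof -
 have stop_meas: "Z (min t T) \<in> measurable (F t) N" if "\<And>t. t \<in> {0..T} ==> Z t \<in> measurable (F t) N" "0 \<le> t" for Z :: "real => 'a => 'z" and N t
  using measurable_F_mono[OF that(1)[of "min t T"], of t] that(2) T by auto
 have stop_cont: "continuous_on {0..} (\<lambda>t. f (min t T))" if "continuous_on {0..T} f" for f :: "real => real^'n"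
  using T by (intro continuous_on_compose2[OF that] continuous_intros) auto
 obtain Y where Y: "ito_integral_on P F W T (\<lambda>s w. \<sigma> (X s w) (a s w)) Y"
  "AE w in P. \<forall>t\<in>{0..T}. X t w = X 0 w + drift X a t w + Y t w"
  using X unfolding sde_on_def by blast
 obtain Y' where Y': "ito_integral_on P F W T (\<lambda>s w. \<sigma> (X' s w) (a' s w)) Y'"
  "AE w in P. \<forall>t\<in>{0..T}. X' t w = X' 0 w + drift X' a' t w + Y' t w"
  using X' unfolding sde_on_def by blast
 have stop_eq: "AE w in P. \<forall>t\<in>{0..T}. X (min t T) w = X (min 0 T) w + (LINT s:{0..t}|lborel. b (X (min s T) w) (a (min s T) w)) + Y t w"
  if "AE w in P. \<forall>t\<in>{0..T}. X t w = X 0 w + drift X a t w + Y t w" for X Y and a :: "real => 'a => nat"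
  using that
 proof (eventually_elim, intro ballI)
  fix w t assume e: "\<forall>t\<in>{0..T}. X t w = X 0 w + drift X a t w + Y t w" and t: "t \<in> {0..T}"
  have l: "(LINT s:{0..t}|lborel. b (X (min s T) w) (a (min s T) w)) = drift X a t w"
   using t by (intro set_lebesgue_integral_cong) auto
  have m: "min t T = t" "min 0 T = 0" using t T by auto
  show "X (min t T) w = X (min 0 T) w + (LINT s:{0..t}|lborel. b (X (min s T) w) (a (min s T) w)) + Y t w"
   unfolding l m by (rule e[rule_format, OF t])
 qed
 have app: "approx t (\<lambda>s w. \<sigma> (X (min s T) w) (a (min s T) w)) Y" "approx t (\<lambda>s w. \<sigma> (X' (min s T) w) (a' (min s T) w)) Y'"
  if t: "0 \<le> t" "t \<le> T" for t
 proof -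
  have e: "min s T = s" if "s \<in> {0..t}" for s using that t by simp
  show "approx t (\<lambda>s w. \<sigma> (X (min s T) w) (a (min s T) w)) Y"
   by (rule approx_cong[OF ito_integral_on_approx[OF Y(1) t]]) (simp add: e)
  show "approx t (\<lambda>s w. \<sigma> (X' (min s T) w) (a' (min s T) w)) Y'"
   by (rule approx_cong[OF ito_integral_on_approx[OF Y'(1) t]]) (simp add: e)
 qed
 have Xc: "AE w in P. continuous_on {0..T} (\<lambda>t. X t w)" "AE w in P. continuous_on {0..T} (\<lambda>t. X' t w)"
  using X X' by (auto simp: sde_on_def)
 have Xc': "AE w in P. continuous_on {0..} (\<lambda>t. X (min t T) w)" "AE w in P. continuous_on {0..} (\<lambda>t. X' (min t T) w)"
  by (rule eventually_mono[OF Xc(1)], rule stop_cont, assumption) (rule eventually_mono[OF Xc(2)], rule stop_cont, assumption)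
 have Xm: "\<And>t. t \<in> {0..T} ==> X t \<in> borel_measurable (F t)" "\<And>t. t \<in> {0..T} ==> X' t \<in> borel_measurable (F t)"
  using X X' by (auto simp: sde_on_def)
 have "AE w in P. \<forall>m::nat. \<forall>t\<in>{0..T}. (X (min 0 T) w = X' (min 0 T) w \<and> (\<forall>q::rat. 0 \<le> q --> of_rat q < t -->
   a (min (of_rat q) T) w = a' (min (of_rat q) T) w \<and> L (a (min (of_rat q) T) w) \<le> real m \<and>
   norm (X (min (of_rat q) T) w) \<le> real m \<and> norm (X' (min (of_rat q) T) w) \<le> real m)) --> X (min t T) w = X' (min t T) w"
 proof (subst AE_all_countable, intro allI)
  fix m :: nat
  show "AE w in P. \<forall>t\<in>{0..T}. (X (min 0 T) w = X' (min 0 T) w \<and> (\<forall>q::rat. 0 \<le> q --> of_rat q < t -->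
   a (min (of_rat q) T) w = a' (min (of_rat q) T) w \<and> L (a (min (of_rat q) T) w) \<le> real m \<and>
   norm (X (min (of_rat q) T) w) \<le> real m \<and> norm (X' (min (of_rat q) T) w) \<le> real m)) --> X (min t T) w = X' (min t T) w"
   by (rule sde_local_uniqueness_bounded[where X = "\<lambda>t. X (min t T)" and X' = "\<lambda>t. X' (min t T)" and a = "\<lambda>t. a (min t T)"
      and a' = "\<lambda>t. a' (min t T)" and Y = Y and Y' = Y', OF T of_nat_0_le_iff stop_meas[OF Xm(1)] Xc'(1) stop_meas[OF Xm(2)] Xc'(2)
      stop_meas[OF a(1)] a(2) stop_meas[OF a'(1)] a'(2) app(1) stop_eq[OF Y(2)] app(2) stop_eq[OF Y'(2)]])
 qed
 thus ?thesis
  using Xc a(2)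
 proof (eventually_elim, intro ballI impI)
  fix w t
  assume u: "\<forall>m::nat. \<forall>t\<in>{0..T}. (X (min 0 T) w = X' (min 0 T) w \<and> (\<forall>q::rat. 0 \<le> q --> of_rat q < t -->
   a (min (of_rat q) T) w = a' (min (of_rat q) T) w \<and> L (a (min (of_rat q) T) w) \<le> real m \<and>
   norm (X (min (of_rat q) T) w) \<le> real m \<and> norm (X' (min (of_rat q) T) w) \<le> real m)) --> X (min t T) w = X' (min t T) w"
   and c: "continuous_on {0..T} (\<lambda>t. X t w)" "continuous_on {0..T} (\<lambda>t. X' t w)" and p: "pwc (\<lambda>t. a (min t T) w)"
   and t: "t \<in> {0..T}" and eq: "X 0 w = X' 0 w" "\<forall>s. 0 \<le> s --> s < t --> a s w = a' s w"
  have "bounded ((\<lambda>t. X t w) ` {0..T})" "bounded ((\<lambda>t. X' t w) ` {0..T})"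
   using c by (auto intro!: compact_imp_bounded compact_continuous_image)
  then obtain B B' where B: "\<And>s. s \<in> {0..T} ==> norm (X s w) \<le> B" "\<And>s. s \<in> {0..T} ==> norm (X' s w) \<le> B'"
   unfolding bounded_iff by (meson image_eqI)
  have "finite ((\<lambda>i. L i) ` ((\<lambda>t. a (min t T) w) ` {0..T}))"
   by (rule finite_imageI[OF pwc_finite_range[OF p]])
  hence "bdd_above ((\<lambda>i. L i) ` ((\<lambda>t. a (min t T) w) ` {0..T}))" by (rule bdd_above_finite)
  then obtain B'' where "\<forall>x\<in>(\<lambda>i. L i) ` ((\<lambda>t. a (min t T) w) ` {0..T}). x \<le> B''" unfolding bdd_above_def by blast
  hence B'': "\<And>s. s \<in> {0..T} ==> L (a (min s T) w) \<le> B''" by blast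
  obtain m :: nat where m: "max B (max B' B'') \<le> real m" using real_arch_simple by blast
  have mm: "B \<le> real m" "B' \<le> real m" "B'' \<le> real m" using m by auto
  have "X (min t T) w = X' (min t T) w"
  proof (rule u[rule_format, OF t, of m], intro conjI allI impI)
   show "X (min 0 T) w = X' (min 0 T) w" using eq(1) T by simp
   fix q :: rat assume q: "0 \<le> q" "real_of_rat q < t"
   hence q': "real_of_rat q \<in> {0..T}" using t by auto
   hence q'': "min (real_of_rat q) T = real_of_rat q" by simp
   show "a (min (real_of_rat q) T) w = a' (min (real_of_rat q) T) w" using eq(2) q q' unfolding q'' by simp
   show "L (a (min (real_of_rat q) T) w) \<le> real m" using B''[OF q'] mm by simp
   show "norm (X (min (real_of_rat q) T) w) \<le> real m" "norm (X' (min (real_of_rat q) T) w) \<le> real m"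
    using B(1)[OF q'] B(2)[OF q'] mm unfolding q'' by auto
  qed
  thus "X t w = X' t w" using t by simp
 qed
qed

end

section \<open>Picard iteration\<close>

context filtered_space
begin

lemma tonelli_continuous:
 fixes Z :: "real => 'a => real^'n"
 assumes Z: "\<And>t. 0 \<le> t ==> Z t \<in> borel_measurable P" and c: "\<And>w. w \<in> space P ==> continuous_on {0..} (\<lambda>t. Z t w)"
 shows "(EE w. energy t Z w) = (tint t (\<lambda>s. (EE w. sqnorm (Z s w))))"
  and "energy t Z \<in> borel_measurable P"
proof -
 interpret pair_sigma_finite lborel P ..
 have [measurable]: "(\<lambda>x. Z (max 0 (fst x)) (snd x)) \<in> borel_measurable (lborel \<Otimes>\<^sub>M P)"
  using joint_measurable_continuous[of Z P, OF Z c] by (simp add: case_prod_beta' cong: measurable_cong_sets)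
 let ?h = "\<lambda>s w. sqnorm (Z (max 0 s) w) * indicator {0..t} s"
 have hm: "case_prod ?h \<in> borel_measurable (lborel \<Otimes>\<^sub>M P)" by (simp add: case_prod_beta')
 have e: "energy t Z = (\<lambda>w. \<integral>\<^sup>+s. ?h s w \<partial>lborel)"
  unfolding energy_def by (intro ext nn_integral_cong) (auto simp: indicator_def max_def)
 have "(EE w. (\<integral>\<^sup>+s. ?h s w \<partial>lborel)) = (\<integral>\<^sup>+s. (EE w. ?h s w) \<partial>lborel)"
  by (rule Fubini'[OF hm])
 also have "\<dots> = (tint t (\<lambda>s. (EE w. sqnorm (Z s w))))"
  by (intro nn_integral_cong) (auto simp: indicator_def max_def)
 finally show "(EE w. energy t Z w) = (tint t (\<lambda>s. (EE w. sqnorm (Z s w))))" unfolding e .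
 show "energy t Z \<in> borel_measurable P"
  unfolding e by (rule lborel.borel_measurable_nn_integral) (use measurable_pair_swap[OF hm] in \<open>simp add: case_prod_beta'\<close>)
qed

end

context sde_space
begin

definition cont_proc :: "(real => 'a => real^'n) => bool" where
 "cont_proc X \<longleftrightarrow> (\<forall>t\<ge>0. X t \<in> borel_measurable (F t)) \<and> (\<forall>w. continuous_on {0..} (\<lambda>t. X t w))"

text \<open>A relation, since the integral \<open>Y\<close> is determined only up to
  indistinguishability. Solutions started at \<open>x\<^sub>0\<close> are its fixed points,
  \<open>X' = X\<close>.\<close>

definition picard_step ::
 "(real => 'a => nat) => ('a => real^'n) => (real => 'a => real^'n) => (real => 'a => real^'n) => (real => 'a => real^'n) => bool" where
 "picard_step a x\<^sub>0 X Y X' \<longleftrightarrow> (\<forall>T>0. ito_integral_on P F W T (\<lambda>s w. \<sigma> (X s w) (a s w)) Y) \<and>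
   (AE w in P. \<forall>t\<ge>0. X' t w = x\<^sub>0 w + drift X a t w + Y t w)"

lemma regular_coeff:
 assumes X: "cont_proc X" and a: "\<And>t. 0 \<le> t ==> a t \<in> measurable (F t) (count_space UNIV)" "AE w in P. pwc (\<lambda>t. a t w)"
 shows "regular (\<lambda>s w. \<sigma> (X s w) (a s w))" "regular (\<lambda>s w. b (X s w) (a s w))"
proof -
 have "AE w in P. reg_path (\<lambda>t. \<sigma> (X t w) (a t w))" "AE w in P. reg_path (\<lambda>t. b (X t w) (a t w))"
  by (rule eventually_mono[OF a(2)], rule reg_path_coeff; use X in \<open>simp add: cont_proc_def\<close>)+
 thus "regular (\<lambda>s w. \<sigma> (X s w) (a s w))" "regular (\<lambda>s w. b (X s w) (a s w))"
  using X a(1) coeff_measurable unfolding regular_def cont_proc_def by blast+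
qed

lemma picard_step_exists:
 assumes X: "cont_proc X" and a: "\<And>t. 0 \<le> t ==> a t \<in> measurable (F t) (count_space UNIV)" "AE w in P. pwc (\<lambda>t. a t w)"
  and x0: "x\<^sub>0 \<in> borel_measurable (F 0)"
 shows "\<exists>X' Y. cont_proc X' \<and> picard_step a x\<^sub>0 X Y X'"
proof -
 obtain Y where Y: "\<And>t. 0 \<le> t ==> Y t \<in> borel_measurable (F t)" "\<And>w. continuous_on {0..} (\<lambda>t. Y t w)"
  "\<And>T. 0 < T ==> ito_integral_on P F W T (\<lambda>s w. \<sigma> (X s w) (a s w)) Y"
  using ito_integral_exists[OF regular_coeff(1)[OF X a]] by blast
 have rb: "AE w in P. reg_path (\<lambda>t. b (X t w) (a t w))"
  using regular_coeff(2)[OF X a] by (simp add: regular_def)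
 \<comment> \<open>On the null event where the drift integrand is irregular the drift is replaced by
   0, so that every path of \<open>X'\<close> is continuous.\<close>
 define X' where "X' t w = x\<^sub>0 w + (if reg_path (\<lambda>t. b (X t w) (a t w)) then LINT s:{0..t}|lborel. b (X s w) (a s w) else 0) + Y t w" for t w
 have X'eq: "AE w in P. \<forall>t\<ge>0. X' t w = x\<^sub>0 w + drift X a t w + Y t w"
  using rb by eventually_elim (simp add: X'_def)
 have "cont_proc X'"
  unfolding cont_proc_def
 proof (intro conjI allI impI)
  fix t :: real assume t: "0 \<le> t"
  have [measurable]: "x\<^sub>0 \<in> borel_measurable (F t)" using measurable_F_mono[OF x0 _ t] by simp
  have [measurable]: "(\<lambda>w. LINT s:{0..t}|lborel. b (X s w) (a s w)) \<in> borel_measurable (F t)"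
   using regular_coeff(2)[OF X a] t by (intro drift_measurable) (auto simp: regular_def)
  note [measurable] = Y(1)[OF t]
  show "X' t \<in> borel_measurable (F t)"
  proof (rule measurable_F_AE_cong[OF _ t])
   show "(\<lambda>w. x\<^sub>0 w + drift X a t w + Y t w) \<in> borel_measurable (F t)" by measurable
   show "AE w in P. x\<^sub>0 w + drift X a t w + Y t w = X' t w"
    using X'eq by (rule eventually_mono) (use t in simp)
  qed simp
 next
  fix w
  show "continuous_on {0..} (\<lambda>t. X' t w)"
   unfolding X'_def
   by (cases "reg_path (\<lambda>t. b (X t w) (a t w))") (auto intro!: continuous_on_add Y(2) reg_path_integral_continuous)
 qed
 thus ?thesis using Y(3) X'eq unfolding picard_step_def by blast
qed

lemma picard_step_approx:
 assumes "picard_step a x\<^sub>0 X Y X'" "0 \<le> t"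
 shows "approx t (\<lambda>s w. \<sigma> (X s w) (a s w)) Y"
 using ito_integral_on_approx[of "t + 1" "\<lambda>s w. \<sigma> (X s w) (a s w)" Y t] assms by (simp add: picard_step_def)

lemma coeff_energy_le:
 assumes "\<And>s. s \<in> {0..t} ==> L (a s w) \<le> m" "0 \<le> m"
  and c: "continuous_on {0..} (\<lambda>s. X1 s w - X2 s w)"
 shows "energy t (\<lambda>s w. \<sigma> (X1 s w) (a s w) - \<sigma> (X2 s w) (a s w)) w \<le> ennreal (m\<^sup>2) * energy t (\<lambda>s w. X1 s w - X2 s w) w" (is ?s)
  and "energy t (\<lambda>s w. b (X1 s w) (a s w) - b (X2 s w) (a s w)) w \<le> ennreal (m\<^sup>2) * energy t (\<lambda>s w. X1 s w - X2 s w) w" (is ?b)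
proof -
 have "continuous_on {0..t} (\<lambda>s. X1 s w - X2 s w)" by (rule continuous_on_subset[OF c]) auto
 hence m: "(\<lambda>s. indicator {0..t} s *\<^sub>R (X1 s w - X2 s w)) \<in> borel_measurable borel"
  by (rule borel_measurable_continuous_on_indicator[rotated]) simp
 have e: "ennreal (m\<^sup>2) * energy t (\<lambda>s w. X1 s w - X2 s w) w =
   (\<integral>\<^sup>+s. ennreal (m\<^sup>2) * sqnorm (indicator {0..t} s *\<^sub>R (X1 s w - X2 s w)) \<partial>lborel)"
  unfolding energy_indicator by (rule nn_integral_cmult[symmetric]) (use m in measurable)
 have sq: "sqnorm y * indicator {0..t} s \<le> ennreal (m\<^sup>2) * sqnorm (indicator {0..t} s *\<^sub>R (X1 s w - X2 s w))"
  if y: "norm y \<le> L (a s w) * norm (X1 s w - X2 s w)" for y :: "'y::real_normed_vector" and s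
 proof (cases "s \<in> {0..t}")
  case True
  have "norm y \<le> m * norm (X1 s w - X2 s w)"
   using y assms(1)[OF True] by (meson mult_right_mono norm_ge_zero order_trans)
  from power_mono[OF this norm_ge_zero, of 2] have "(norm y)\<^sup>2 \<le> m\<^sup>2 * (norm (X1 s w - X2 s w))\<^sup>2"
   by (simp add: power_mult_distrib)
  thus ?thesis using True by (simp add: ennreal_mult[symmetric] ennreal_leI)
 qed simp
 show ?s unfolding e unfolding energy_def by (intro nn_integral_mono sq lip_\<sigma>)
 show ?b unfolding e unfolding energy_def by (intro nn_integral_mono sq lip_b)
qed

text \<open>The first estimate, in mean square at a fixed time, can be iterated. The second is
  uniform in time but only in probability, which is what the maximal inequality yields; it turns the
  decay of the first into almost sure uniform convergence.\<close>

lemma picard_contraction: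
 assumes X: "cont_proc X1" "cont_proc X2" "cont_proc X1'" "cont_proc X2'"
  and s: "picard_step a x\<^sub>0 X1 Y1 X1'" "picard_step a x\<^sub>0 X2 Y2 X2'"
  and a: "\<And>t. 0 \<le> t ==> a t \<in> measurable (F t) (count_space UNIV)" "AE w in P. pwc (\<lambda>t. a t w)"
  and m: "\<And>t w. 0 \<le> t ==> L (a t w) \<le> m" "0 \<le> m"
  and T: "0 < T"
 defines "g \<equiv> \<lambda>s. \<integral>\<^sup>+w. sqnorm (X1 s w - X2 s w) \<partial>P"
 shows "t \<in> {0..T} ==> (EE w. sqnorm (X1' t w - X2' t w)) \<le> ennreal (2 * T * m\<^sup>2 + 2 * m\<^sup>2) * (tint t g)"
  and "0 < \<epsilon> ==> {w\<in>space P. \<exists>t\<in>{0..T}. 2 * \<epsilon> < norm (X1' t w - X2' t w)} \<in> sets P \<and>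
   emeasure P {w\<in>space P. \<exists>t\<in>{0..T}. 2 * \<epsilon> < norm (X1' t w - X2' t w)} * ennreal (\<epsilon>\<^sup>2)
   \<le> ennreal (2 * T * m\<^sup>2 + 2 * m\<^sup>2) * (tint T g)"
proof -
 let ?D = "\<lambda>s w. X1 s w - X2 s w"
 let ?S = "\<lambda>s w. \<sigma> (X1 s w) (a s w) - \<sigma> (X2 s w) (a s w)"
 let ?B = "\<lambda>s w. b (X1 s w) (a s w) - b (X2 s w) (a s w)"
 let ?Z = "\<lambda>t w. Y1 t w - Y2 t w"
 have Dm: "?D s \<in> borel_measurable P" if "0 \<le> s" for s
 proof -
  have [measurable]: "X1 s \<in> borel_measurable P" "X2 s \<in> borel_measurable P"
   using X(1,2) that unfolding cont_proc_def by (blast intro: measurable_F_imp_P)+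
  show ?thesis by measurable
 qed
 have Dc: "continuous_on {0..} (\<lambda>s. ?D s w)" for w
  using X by (auto simp: cont_proc_def intro!: continuous_on_diff)
 have De: "(EE w. energy t ?D w) = (tint t g)" "energy t ?D \<in> borel_measurable P" for t
  unfolding g_def using tonelli_continuous[of ?D, OF Dm Dc] by auto
 note [measurable] = De(2)
 have app: "approx t ?S ?Z" if "0 \<le> t" for t
  by (rule approx_diff[OF picard_step_approx[OF s(1) that] picard_step_approx[OF s(2) that] that])
 have Se: "energy t ?S w \<le> ennreal (m\<^sup>2) * energy t ?D w" for t w
  using m by (intro coeff_energy_le(1) Dc) auto
 have Be: "energy t ?B w \<le> ennreal (m\<^sup>2) * energy t ?D w" for t w
  using m by (intro coeff_energy_le(2) Dc) auto
 have drift: "AE w in P. \<forall>t\<in>{0..T}. X1' t w - X2' t w = (LINT s:{0..t}|lborel. ?B s w) + ?Z t w \<and>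
   sqnorm (LINT s:{0..t}|lborel. ?B s w) \<le> ennreal (T * m\<^sup>2) * energy t ?D w"
 proof -
  have "AE w in P. reg_path (\<lambda>t. b (X1 t w) (a t w))" "AE w in P. reg_path (\<lambda>t. b (X2 t w) (a t w))"
   using regular_coeff(2)[OF X(1) a] regular_coeff(2)[OF X(2) a] by (auto simp: regular_def)
  moreover have "AE w in P. \<forall>t\<ge>0. X1' t w = x\<^sub>0 w + drift X1 a t w + Y1 t w"
   "AE w in P. \<forall>t\<ge>0. X2' t w = x\<^sub>0 w + drift X2 a t w + Y2 t w"
   using s by (auto simp: picard_step_def)
  ultimately show ?thesis
  proof (eventually_elim, intro ballI conjI)
   fix w t assume r: "reg_path (\<lambda>t. b (X1 t w) (a t w))" "reg_path (\<lambda>t. b (X2 t w) (a t w))"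
    and e: "\<forall>t\<ge>0. X1' t w = x\<^sub>0 w + drift X1 a t w + Y1 t w"
     "\<forall>t\<ge>0. X2' t w = x\<^sub>0 w + drift X2 a t w + Y2 t w" and t: "t \<in> {0..T}"
   have t0: "0 \<le> t" using t by simp
   show "X1' t w - X2' t w = (LINT s:{0..t}|lborel. ?B s w) + ?Z t w"
    unfolding e(1)[rule_format, OF t0] e(2)[rule_format, OF t0]
    using set_integral_diff(2)[OF reg_path_set_integrable[OF r(1), of t] reg_path_set_integrable[OF r(2), of t]] by simp
   have "sqnorm (LINT s:{0..t}|lborel. ?B s w) \<le> ennreal t * energy t ?B w"
    unfolding energy_def by (intro set_integral_square_le set_integral_diff(1) reg_path_set_integrable r t0)
   also have "\<dots> \<le> ennreal T * (ennreal (m\<^sup>2) * energy t ?D w)"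
    using t by (intro mult_mono Be ennreal_leI) auto
   finally show "sqnorm (LINT s:{0..t}|lborel. ?B s w) \<le> ennreal (T * m\<^sup>2) * energy t ?D w"
    using T by (simp add: ennreal_mult mult.assoc)
  qed
 qed
 have ES: "(EE w. energy t ?S w) \<le> ennreal (m\<^sup>2) * (tint t g)" for t
 proof -
  have "(EE w. energy t ?S w) \<le> (EE w. ennreal (m\<^sup>2) * energy t ?D w)"
   by (intro nn_integral_mono Se)
  also have "\<dots> = ennreal (m\<^sup>2) * (tint t g)"
   unfolding De(1)[symmetric] by (rule nn_integral_cmult) measurable
  finally show ?thesis .
 qed
 show "(EE w. sqnorm (X1' t w - X2' t w)) \<le> ennreal (2 * T * m\<^sup>2 + 2 * m\<^sup>2) * (tint t g)"
  if t: "t \<in> {0..T}"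
 proof -
  have t0: "0 \<le> t" using t by simp
  have Zm[measurable]: "?Z t \<in> borel_measurable P" using approxD(1)[OF app[OF t0], of t] t by simp
  have "(EE w. sqnorm (X1' t w - X2' t w)) \<le>
   (EE w. 2 * (ennreal (T * m\<^sup>2) * energy t ?D w) + 2 * sqnorm (?Z t w))"
  proof (rule nn_integral_mono_AE)
   show "AE w in P. sqnorm (X1' t w - X2' t w) \<le> 2 * (ennreal (T * m\<^sup>2) * energy t ?D w) + 2 * sqnorm (?Z t w)"
    using drift
   proof eventually_elim
    case (elim w)
    let ?I = "LINT s:{0..t}|lborel. ?B s w"
    have e: "X1' t w - X2' t w = ?I + ?Z t w" and l: "sqnorm ?I \<le> ennreal (T * m\<^sup>2) * energy t ?D w"
     using elim t by auto
    have "sqnorm (X1' t w - X2' t w) \<le> ennreal (2 * (norm ?I)\<^sup>2 + 2 * (norm (?Z t w))\<^sup>2)"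
     unfolding e using norm_add_power2_le[of 1 ?I "?Z t w"] by (intro ennreal_leI) simp
    also have "\<dots> = 2 * sqnorm ?I + 2 * sqnorm (?Z t w)"
     by (simp add: ennreal_plus ennreal_mult)
    also have "\<dots> \<le> 2 * (ennreal (T * m\<^sup>2) * energy t ?D w) + 2 * sqnorm (?Z t w)"
     using l by (intro add_right_mono mult_left_mono) auto
    finally show ?case .
   qed
  qed
  also have "\<dots> = 2 * (ennreal (T * m\<^sup>2) * (EE w. energy t ?D w)) + 2 * (EE w. sqnorm (?Z t w))"
   using Zm by (subst nn_integral_add) (simp_all add: nn_integral_cmult)
  also have "\<dots> \<le> 2 * (ennreal (T * m\<^sup>2) * (tint t g)) + 2 * (ennreal (m\<^sup>2) * (tint t g))"
   unfolding De(1) using order_trans[OF approx_inequalities(3)[OF app[OF t0] t0] ES]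
   by (intro add_left_mono mult_left_mono) auto
  also have "\<dots> = ennreal (2 * T * m\<^sup>2 + 2 * m\<^sup>2) * (tint t g)"
   using T by (simp add: ennreal_plus ennreal_mult algebra_simps)
  finally show ?thesis .
 qed
 show "{w\<in>space P. \<exists>t\<in>{0..T}. 2 * \<epsilon> < norm (X1' t w - X2' t w)} \<in> sets P \<and>
   emeasure P {w\<in>space P. \<exists>t\<in>{0..T}. 2 * \<epsilon> < norm (X1' t w - X2' t w)} * ennreal (\<epsilon>\<^sup>2)
   \<le> ennreal (2 * T * m\<^sup>2 + 2 * m\<^sup>2) * (tint T g)" (is "?E \<in> _ \<and> _") if \<epsilon>: "0 < \<epsilon>"
 proof
  have T0: "0 \<le> T" using T by simp
  have Xm: "(\<lambda>w. X1' t w - X2' t w) \<in> borel_measurable P" if "0 \<le> t" for t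
  proof -
   have [measurable]: "X1' t \<in> borel_measurable P" "X2' t \<in> borel_measurable P"
    using X(3,4) that unfolding cont_proc_def by (blast intro: measurable_F_imp_P)+
   show ?thesis by measurable
  qed
  have "continuous_on {0..T} (\<lambda>t. X1' t w - X2' t w)" for w
   using X(3,4) unfolding cont_proc_def by (intro continuous_on_diff continuous_on_subset[of "{0..}" _ "{0..T}"]) auto
  hence [measurable]: "(\<lambda>w. SUP t\<in>{0..T}. ennreal (norm (X1' t w - X2' t w))) \<in> borel_measurable P"
   using Xm by (intro sup_norm_measurable T) auto
  have "?E = {w\<in>space P. ennreal (2 * \<epsilon>) < (SUP t\<in>{0..T}. ennreal (norm (X1' t w - X2' t w)))}"
   using \<epsilon> by (auto simp: less_SUP_iff ennreal_less_iff)
  also have "\<dots> \<in> sets P" by measurable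
  finally show "?E \<in> sets P" .
  \<comment> \<open>The level \<open>2 * \<epsilon>\<close> is shared: \<open>?A\<close> is the
    event that the drift could exceed \<epsilon>, treated by Markov's inequality, and
    \<open>?C\<close> the event that the stochastic integral does.\<close>
  let ?A = "{w\<in>space P. 1 \<le> ennreal (1 / \<epsilon>\<^sup>2) * (ennreal (T * m\<^sup>2) * energy T ?D w)}"
  let ?C = "{w\<in>space P. \<exists>t\<in>{0..T}. \<epsilon> < norm (?Z t w)}"
  have C: "?C \<in> sets P" by (rule approx_sup_sets(1)[OF app[OF T0] T less_imp_le[OF \<epsilon>]])
  have A: "?A \<in> sets P" by measurable
  have "emeasure P ?E \<le> emeasure P (?A \<union> ?C)"
  proof (rule emeasure_mono_AE)
   show "AE w in P. w \<in> ?E --> w \<in> ?A \<union> ?C"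
    using drift
   proof (eventually_elim, intro impI)
    fix w assume d: "\<forall>t\<in>{0..T}. X1' t w - X2' t w = (LINT s:{0..t}|lborel. ?B s w) + ?Z t w \<and>
     sqnorm (LINT s:{0..t}|lborel. ?B s w) \<le> ennreal (T * m\<^sup>2) * energy t ?D w" and w: "w \<in> ?E"
    then obtain t where t: "t \<in> {0..T}" "2 * \<epsilon> < norm (X1' t w - X2' t w)" by blast
    let ?I = "LINT s:{0..t}|lborel. ?B s w"
    have e: "X1' t w - X2' t w = ?I + ?Z t w" and l: "sqnorm ?I \<le> ennreal (T * m\<^sup>2) * energy t ?D w"
     using d t(1) by auto
    show "w \<in> ?A \<union> ?C"
    proof (cases "\<epsilon> < norm (?Z t w)")
     case True
     thus ?thesis using t(1) w by blast
    next
     case False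
     hence "\<epsilon> \<le> norm ?I" using t(2) norm_triangle_ineq[of ?I "?Z t w"] unfolding e by simp
     hence "\<epsilon>\<^sup>2 \<le> (norm ?I)\<^sup>2" using \<epsilon> by (intro power_mono) auto
     hence "ennreal (\<epsilon>\<^sup>2) \<le> sqnorm ?I" by (rule ennreal_leI)
     also note l
     also have "energy t ?D w \<le> energy T ?D w"
      unfolding energy_def using t by (intro nn_integral_mono) (auto simp: indicator_def)
     finally have "ennreal (\<epsilon>\<^sup>2) \<le> ennreal (T * m\<^sup>2) * energy T ?D w" by (simp add: mult_left_mono)
     hence "ennreal (1 / \<epsilon>\<^sup>2) * ennreal (\<epsilon>\<^sup>2) \<le> ennreal (1 / \<epsilon>\<^sup>2) * (ennreal (T * m\<^sup>2) * energy T ?D w)"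
      by (rule mult_left_mono) simp
     moreover have "ennreal (1 / \<epsilon>\<^sup>2) * ennreal (\<epsilon>\<^sup>2) = 1" using \<epsilon> by (simp add: ennreal_mult[symmetric])
     ultimately show ?thesis using w by simp
    qed
   qed
  qed (use A C in auto)
  also have "\<dots> \<le> emeasure P ?A + emeasure P ?C" by (rule emeasure_subadditive[OF A C])
  finally have "emeasure P ?E * ennreal (\<epsilon>\<^sup>2) \<le> (emeasure P ?A + emeasure P ?C) * ennreal (\<epsilon>\<^sup>2)"
   by (rule mult_right_mono) simp
  also have "\<dots> = emeasure P ?A * ennreal (\<epsilon>\<^sup>2) + emeasure P ?C * ennreal (\<epsilon>\<^sup>2)" by (rule distrib_right)
  also have "\<dots> \<le> ennreal (T * m\<^sup>2) * (tint T g) + ennreal (m\<^sup>2) * (tint T g)"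
  proof (rule add_mono)
   have "emeasure P ?A \<le> ennreal (1 / \<epsilon>\<^sup>2) * (EE w. (ennreal (T * m\<^sup>2) * energy T ?D w) * indicator (space P) w)"
    by (rule nn_integral_Markov_inequality) measurable
   also have "(EE w. (ennreal (T * m\<^sup>2) * energy T ?D w) * indicator (space P) w) = (EE w. ennreal (T * m\<^sup>2) * energy T ?D w)"
    by (intro nn_integral_cong) simp
   also have "\<dots> = ennreal (T * m\<^sup>2) * (tint T g)"
    unfolding De(1)[symmetric] by (rule nn_integral_cmult) measurable
   finally have "emeasure P ?A * ennreal (\<epsilon>\<^sup>2) \<le> (ennreal (1 / \<epsilon>\<^sup>2) * (ennreal (T * m\<^sup>2) * (tint T g))) * ennreal (\<epsilon>\<^sup>2)"
    by (rule mult_right_mono) simp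
   also have "\<dots> = (ennreal (1 / \<epsilon>\<^sup>2) * ennreal (\<epsilon>\<^sup>2)) * (ennreal (T * m\<^sup>2) * (tint T g))"
    by (simp only: mult_ac)
   also have "ennreal (1 / \<epsilon>\<^sup>2) * ennreal (\<epsilon>\<^sup>2) = 1" using \<epsilon> by (simp add: ennreal_mult[symmetric])
   finally show "emeasure P ?A * ennreal (\<epsilon>\<^sup>2) \<le> ennreal (T * m\<^sup>2) * (tint T g)" by simp
   show "emeasure P ?C * ennreal (\<epsilon>\<^sup>2) \<le> ennreal (m\<^sup>2) * (tint T g)"
    by (rule order_trans[OF approx_maximal_energy[OF app[OF T0] T \<epsilon>] ES])
  qed
  also have "\<dots> = ennreal (T * m\<^sup>2 + m\<^sup>2) * (tint T g)"
   using T by (simp add: ennreal_plus distrib_right)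
  also have "\<dots> \<le> ennreal (2 * T * m\<^sup>2 + 2 * m\<^sup>2) * (tint T g)"
   using T by (intro mult_right_mono ennreal_leI) auto
  finally show "emeasure P ?E * ennreal (\<epsilon>\<^sup>2) \<le> ennreal (2 * T * m\<^sup>2 + 2 * m\<^sup>2) * (tint T g)" .
 qed
qed

end

context sde_space
begin

lemma sde_exists_bounded:
 fixes m :: real
 assumes a: "\<And>t. 0 \<le> t ==> a t \<in> measurable (F t) (count_space UNIV)" "AE w in P. pwc (\<lambda>t. a t w)"
  and m: "\<And>t w. 0 \<le> t ==> L (a t w) \<le> m" "0 \<le> m"
  and x0: "x\<^sub>0 \<in> borel_measurable (F 0)" "\<And>w. norm (x\<^sub>0 w) \<le> m"
 shows "\<exists>X Y. cont_proc X \<and> picard_step a x\<^sub>0 X Y X"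
proof -
 have base: "cont_proc (\<lambda>t. x\<^sub>0)"
  using measurable_F_mono[OF x0(1)] by (auto simp: cont_proc_def)
 have "\<exists>Xs. \<forall>n. (cont_proc (Xs n) \<and> (n = 0 --> Xs n = (\<lambda>t. x\<^sub>0))) \<and> (\<exists>Y. picard_step a x\<^sub>0 (Xs n) Y (Xs (Suc n)))"
 proof (rule dependent_nat_choice)
  show "\<exists>X. cont_proc X \<and> (0 = (0::nat) --> X = (\<lambda>t. x\<^sub>0))" using base by blast
  fix X and n :: nat assume "cont_proc X \<and> (n = 0 --> X = (\<lambda>t. x\<^sub>0))"
  thus "\<exists>X'. (cont_proc X' \<and> (Suc n = 0 --> X' = (\<lambda>t. x\<^sub>0))) \<and> (\<exists>Y. picard_step a x\<^sub>0 X Y X')"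
   using picard_step_exists[OF _ a x0(1), of X] by blast
 qed
 then obtain Xs where Xs: "\<And>n. cont_proc (Xs n)" "Xs 0 = (\<lambda>t. x\<^sub>0)" "\<And>n. \<exists>Y. picard_step a x\<^sub>0 (Xs n) Y (Xs (Suc n))"
  by blast
 then obtain Ys where Ys: "\<And>n. picard_step a x\<^sub>0 (Xs n) (Ys n) (Xs (Suc n))" by metis
 define u where "u j t = (EE w. sqnorm (Xs (Suc j) t w - Xs j t w))" for j t
 have XP: "Xs j t \<in> borel_measurable P" if "0 \<le> t" for j t
  using Xs(1)[of j] that unfolding cont_proc_def by (blast intro: measurable_F_imp_P)
 have Xc: "continuous_on {0..} (\<lambda>t. Xs j t w)" for j w
  using Xs(1)[of j] unfolding cont_proc_def by blast
 \<comment> \<open>The size at the origin is at most \<open>m\<close>, and the Lipschitz part at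
   most \<open>m\<close> times the bound \<open>m\<close> of the initial value.\<close>
 define K where "K = m + m * m"
 have K: "0 \<le> K" using m(2) by (simp add: K_def)
 have coeffK: "norm (b (x\<^sub>0 w) (a s w)) \<le> K" "norm (\<sigma> (x\<^sub>0 w) (a s w)) \<le> K" if "0 \<le> s" for s w
 proof -
  have Lx: "L (a s w) * norm (x\<^sub>0 w - 0) \<le> m * m" using m(1)[OF that, of w] x0(2)[of w] L_nonneg m(2) by (intro mult_mono) auto
  show "norm (b (x\<^sub>0 w) (a s w)) \<le> K"
   using norm_triangle_sub[of "b (x\<^sub>0 w) (a s w)" "b 0 (a s w)"] lip_b[of "x\<^sub>0 w" "a s w" 0] zero_b[of "a s w"] Lx m(1)[OF that, of w]
   unfolding K_def by linarith
  show "norm (\<sigma> (x\<^sub>0 w) (a s w)) \<le> K"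
   using norm_triangle_sub[of "\<sigma> (x\<^sub>0 w) (a s w)" "\<sigma> 0 (a s w)"] lip_\<sigma>[of "x\<^sub>0 w" "a s w" 0] zero_\<sigma>[of "a s w"] Lx m(1)[OF that, of w]
   unfolding K_def by linarith
 qed
 have const_energy: "energy t H w \<le> ennreal (t * K\<^sup>2)" if "0 \<le> t" "\<And>s. 0 \<le> s ==> norm (H s w) \<le> K" for t w and H :: "real => 'a => 'z::real_normed_vector"
 proof -
  have "energy t H w \<le> (\<integral>\<^sup>+s. ennreal (K\<^sup>2) * indicator {0..t} s \<partial>lborel)"
   unfolding energy_def using that K by (intro nn_integral_mono) (auto simp: indicator_def intro!: ennreal_leI power_mono)
  also have "\<dots> = ennreal (t * K\<^sup>2)" using that K by (subst nn_integral_cmult_indicator) (auto simp: ennreal_mult[symmetric] mult.commute)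
  finally show ?thesis .
 qed
 have u0: "u 0 t \<le> ennreal (2 * T * T * K\<^sup>2 + 2 * T * K\<^sup>2)" if T: "0 < T" "t \<in> {0..T}" for t T
 proof -
  have t: "0 \<le> t" "t \<le> T" using T by auto
  have app: "approx t (\<lambda>s w. \<sigma> (Xs 0 s w) (a s w)) (Ys 0)" by (rule picard_step_approx[OF Ys t(1)])
  have [measurable]: "Ys 0 t \<in> borel_measurable P" using approxD(1)[OF app, of t] t by simp
  have rb: "AE w in P. reg_path (\<lambda>t. b (Xs 0 t w) (a t w))"
   using regular_coeff(2)[OF Xs(1) a] by (auto simp: regular_def)
  have "u 0 t \<le> (EE w. ennreal (2 * T * T * K\<^sup>2) + 2 * sqnorm (Ys 0 t w))"
   unfolding u_def
  proof (rule nn_integral_mono_AE)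
   have "AE w in P. \<forall>t\<ge>0. Xs (Suc 0) t w = x\<^sub>0 w + drift (Xs 0) a t w + Ys 0 t w"
    using Ys[of 0] by (simp add: picard_step_def)
   thus "AE w in P. sqnorm (Xs (Suc 0) t w - Xs 0 t w) \<le> ennreal (2 * T * T * K\<^sup>2) + 2 * sqnorm (Ys 0 t w)"
    using rb
   proof eventually_elim
    case (elim w)
    let ?I = "LINT s:{0..t}|lborel. b (Xs 0 s w) (a s w)"
    have "Xs (Suc 0) t w - Xs 0 t w = ?I + Ys 0 t w" using elim(1)[rule_format, OF t(1)] Xs(2) by simp
    hence "(norm (Xs (Suc 0) t w - Xs 0 t w))\<^sup>2 \<le> 2 * (norm ?I)\<^sup>2 + 2 * (norm (Ys 0 t w))\<^sup>2"
     using norm_add_power2_le[of 1 ?I "Ys 0 t w"] by simp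
    hence "sqnorm (Xs (Suc 0) t w - Xs 0 t w) \<le> ennreal (2 * (norm ?I)\<^sup>2 + 2 * (norm (Ys 0 t w))\<^sup>2)"
     by (rule ennreal_leI)
    also have "\<dots> = 2 * sqnorm ?I + 2 * sqnorm (Ys 0 t w)"
     by (simp add: ennreal_plus ennreal_mult)
    also have "sqnorm ?I \<le> ennreal t * energy t (\<lambda>s w. b (Xs 0 s w) (a s w)) w"
     unfolding energy_def by (intro set_integral_square_le reg_path_set_integrable elim(2) t(1))
    also have "\<dots> \<le> ennreal T * ennreal (T * K\<^sup>2)"
    proof (rule mult_mono)
     have "energy t (\<lambda>s w. b (Xs 0 s w) (a s w)) w \<le> ennreal (t * K\<^sup>2)"
      by (rule const_energy) (use t coeffK Xs(2) in auto)
     also have "\<dots> \<le> ennreal (T * K\<^sup>2)" using t by (intro ennreal_leI mult_right_mono) auto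
     finally show "energy t (\<lambda>s w. b (Xs 0 s w) (a s w)) w \<le> ennreal (T * K\<^sup>2)" .
    qed (use t in \<open>auto intro: ennreal_leI\<close>)
    also have "2 * (ennreal T * ennreal (T * K\<^sup>2)) = ennreal (2 * T * T * K\<^sup>2)"
     using T by (simp add: ennreal_mult mult.assoc)
    finally show ?case by (simp add: mult_left_mono add_right_mono)
   qed
  qed
  also have "\<dots> = ennreal (2 * T * T * K\<^sup>2) + 2 * (EE w. sqnorm (Ys 0 t w))"
   by (subst nn_integral_add) (simp_all add: nn_integral_cmult emeasure_space_1)
  also have "(EE w. sqnorm (Ys 0 t w)) \<le> (EE w. energy t (\<lambda>s w. \<sigma> (Xs 0 s w) (a s w)) w)"
   by (rule approx_inequalities(3)[OF app t(1)])
  also have "\<dots> \<le> (EE w. ennreal (T * K\<^sup>2))"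
  proof (rule nn_integral_mono)
   fix w
   have "energy t (\<lambda>s w. \<sigma> (Xs 0 s w) (a s w)) w \<le> ennreal (t * K\<^sup>2)"
    by (rule const_energy) (use t coeffK Xs(2) in auto)
   also have "\<dots> \<le> ennreal (T * K\<^sup>2)" using t by (intro ennreal_leI mult_right_mono) auto
   finally show "energy t (\<lambda>s w. \<sigma> (Xs 0 s w) (a s w)) w \<le> ennreal (T * K\<^sup>2)" .
  qed
  also have "\<dots> = ennreal (T * K\<^sup>2)" by (simp add: emeasure_space_1)
  also have "ennreal (2 * T * T * K\<^sup>2) + 2 * ennreal (T * K\<^sup>2) = ennreal (2 * T * T * K\<^sup>2 + 2 * T * K\<^sup>2)"
   using T K by (simp add: ennreal_plus ennreal_mult mult.assoc)
  finally show ?thesis by (simp add: mult_left_mono add_left_mono)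
 qed
 \<comment> \<open>The rate 1/16 is chosen for the maximal estimate below: dividing by the squared
   level \<open>(1/4)^j / 4\<close> leaves a multiple of \<open>(1/4)^j\<close>, which is
   summable.\<close>
 have decay: "u j t \<le> ennreal ((2 * T * T * K\<^sup>2 + 2 * T * K\<^sup>2) * (1/16)^j * exp (((2 * T * m\<^sup>2 + 2 * m\<^sup>2) + 1) / (1/16) * t))"
  if T: "0 < T" "t \<in> {0..T}" for T t j
 proof (rule iterated_gronwall[where u=u, OF _ _ u0[OF T(1)] _ _ T(2)])
  show "u (Suc j) t \<le> ennreal (2 * T * m\<^sup>2 + 2 * m\<^sup>2) * (tint t (\<lambda>s. u j s))" if "t \<in> {0..T}" for j t
   unfolding u_def by (rule picard_contraction(1)[OF Xs(1) Xs(1) Xs(1) Xs(1) Ys Ys a m T(1) that])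
 qed (use T in auto)
 \<comment> \<open>Shifted by one, because the maximal estimate speaks about images of Picard
   steps.\<close>
 define f where "f n = Xs (Suc n)" for n
 define Gd where "Gd T w \<longleftrightarrow> (\<exists>n0. \<forall>n\<ge>n0. \<forall>t\<in>{0..T}. norm (f n t w - f (Suc n) t w) \<le> (1/2)^n)" for T w
 have Gd: "AE w in P. Gd T w" if T: "0 < T" for T
 proof -
  define C where "C = 2 * T * m\<^sup>2 + 2 * m\<^sup>2"
  obtain B c where B: "0 \<le> B" "\<And>j t. t \<in> {0..T} ==> u j t \<le> ennreal (B * (1/16)^j * exp (c * t))"
   using decay[OF T] T by (metis add_nonneg_nonneg less_imp_le mult_nonneg_nonneg zero_le_numeral zero_le_power2)
  have C: "0 \<le> C" using T by (simp add: C_def)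
  define B' where "B' = C * (T * (B * exp (\<bar>c\<bar> * T)))"
  have B': "0 \<le> B'" using C T B by (simp add: B'_def)
  \<comment> \<open>The level is written as twice \<open>(1/2)^j / 2\<close> to match
    \<open>picard_contraction\<close>; it is exactly the bound that \<open>Gd\<close> asks
    for.\<close>
  let ?E = "\<lambda>j. {w\<in>space P. \<exists>t\<in>{0..T}. 2 * ((1/2)^j / 2) < norm (Xs (Suc (Suc j)) t w - Xs (Suc j) t w)}"
  have E: "?E j \<in> sets P \<and> emeasure P (?E j) * ennreal (((1/2)^j / 2)\<^sup>2) \<le> ennreal C * (tint T (\<lambda>s. u j s))" for j
   unfolding u_def C_def
   by (rule picard_contraction(2)[OF Xs(1) Xs(1) Xs(1) Xs(1) Ys Ys a m T]) auto
  have bound: "prob (?E j) \<le> 4 * B' * (1/4)^j" for j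
  proof -
   have "(tint T (\<lambda>s. u j s)) \<le> (\<integral>\<^sup>+s. ennreal (B * exp (\<bar>c\<bar> * T) * (1/16)^j) * indicator {0..T} s \<partial>lborel)"
   proof (rule nn_integral_mono)
    fix s
    show "u j s * indicator {0..T} s \<le> ennreal (B * exp (\<bar>c\<bar> * T) * (1/16)^j) * indicator {0..T} s"
    proof (cases "s \<in> {0..T}")
     case True
     have "c * s \<le> \<bar>c\<bar> * T" using True by (meson abs_ge_self abs_ge_zero atLeastAtMost_iff mult_mono)
     hence "B * (1/16)^j * exp (c * s) \<le> B * exp (\<bar>c\<bar> * T) * (1/16)^j"
      using B(1) by (simp add: mult_ac mult_left_mono)
     thus ?thesis using B(2)[OF True, of j] True by (simp add: order_trans ennreal_leI)
    qed simp
   qed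
   also have "\<dots> = ennreal (T * (B * exp (\<bar>c\<bar> * T)) * (1/16)^j)"
    using T B(1) by (subst nn_integral_cmult_indicator) (auto simp: ennreal_mult[symmetric] mult_ac)
   finally have "ennreal C * (tint T (\<lambda>s. u j s)) \<le> ennreal C * ennreal (T * (B * exp (\<bar>c\<bar> * T)) * (1/16)^j)"
    by (rule mult_left_mono) simp
   also have "\<dots> = ennreal (B' * (1/16)^j)" using C T B(1) by (simp add: B'_def ennreal_mult[symmetric] mult_ac)
   finally have "ennreal (prob (?E j) * ((1/2)^j / 2)\<^sup>2) \<le> ennreal (B' * (1/16)^j)"
    using order_trans[OF E[of j, THEN conjunct2]] by (simp add: emeasure_eq_measure ennreal_mult)
   hence "prob (?E j) * ((1/2)^j / 2)\<^sup>2 \<le> B' * (1/16)^j" using B' by (subst (asm) ennreal_le_iff) auto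
   moreover have "((1/2::real)^j / 2)\<^sup>2 = (1/4)^j / 4"
    by (simp add: power2_eq_square power_mult_distrib[symmetric])
   moreover have "(1/16::real)^j = (1/4)^j * (1/4)^j" by (simp add: power_mult_distrib[symmetric])
   ultimately have "prob (?E j) * (1/4)^j \<le> (4 * B' * (1/4)^j) * (1/4)^j" by (simp add: mult_ac)
   thus ?thesis by (rule mult_right_le_imp_le) simp
  qed
  have "AE w in P. eventually (\<lambda>j. w \<in> space P - ?E j) sequentially"
  proof (rule borel_cantelli_AE1)
   show "?E j \<in> sets P" for j using E by blast
   show "emeasure P (?E j) < \<infinity>" for j by (simp add: emeasure_eq_measure)
   show "summable (\<lambda>j. prob (?E j))"
    by (rule summable_comparison_test[OF _ summable_mult[OF summable_geometric[of "1/4::real"], of "4 * B'"]])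
     (use bound in \<open>auto intro!: exI[of _ 0]\<close>)
  qed
  thus ?thesis
  proof eventually_elim
   case (elim w)
   then obtain n0 where n0: "\<And>n. n0 \<le> n ==> w \<in> space P - ?E n" by (auto simp: eventually_sequentially)
   have "norm (f n t w - f (Suc n) t w) \<le> (1/2)^n" if "n0 \<le> n" "t \<in> {0..T}" for n t
    using n0[OF that(1)] that(2) by (auto simp: f_def not_less norm_minus_commute)
   thus ?case unfolding Gd_def by blast
  qed
 qed
 have G: "AE w in P. \<forall>T::nat. \<exists>n0. \<forall>n\<ge>n0. \<forall>t\<in>{0..real T}. norm (f n t w - f (Suc n) t w) \<le> (1/2)^n"
  unfolding AE_all_countable
 proof
  fix T :: nat
  show "AE w in P. \<exists>n0. \<forall>n\<ge>n0. \<forall>t\<in>{0..real T}. norm (f n t w - f (Suc n) t w) \<le> (1/2)^n"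
  proof (rule eventually_mono[OF Gd[of "real T + 1"]])
   fix w assume "Gd (real T + 1) w"
   then obtain n0 where "\<forall>n\<ge>n0. \<forall>t\<in>{0..real T + 1}. norm (f n t w - f (Suc n) t w) \<le> (1/2)^n" unfolding Gd_def by blast
   thus "\<exists>n0. \<forall>n\<ge>n0. \<forall>t\<in>{0..real T}. norm (f n t w - f (Suc n) t w) \<le> (1/2)^n" by (intro exI[of _ n0]) auto
  qed simp
 qed
 have fc: "continuous_on {0..} (\<lambda>t. f n t w)" for n w unfolding f_def by (rule Xc)
 have "f n t \<in> borel_measurable (F t)" if "0 \<le> t" for n t using Xs(1)[of "Suc n"] that unfolding f_def cont_proc_def by blast
 from limit_process[of f, OF this AE_I2 G] fc
 obtain X where XF: "\<And>t. 0 \<le> t ==> X t \<in> borel_measurable (F t)" and Xcont: "\<And>w. continuous_on {0..} (\<lambda>t. X t w)"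
  and lim: "AE w in P. \<forall>T::nat. \<exists>n0. \<forall>n\<ge>n0. \<forall>t\<in>{0..real T}. norm (f n t w - X t w) \<le> 2 * (1/2)^n"
  by blast
 have Xp: "cont_proc X" using XF Xcont by (simp add: cont_proc_def)
 obtain X' Y where X': "cont_proc X'" "picard_step a x\<^sub>0 X Y X'" using picard_step_exists[OF Xp a x0(1)] by blast
 \<comment> \<open>The limit is compared with its own Picard image \<open>X'\<close>. The drifts
   converge, so \<open>X t w - X' t w\<close> is the limit of \<open>Ys (Suc n) t w - Y t w\<close>;
   these are integrals whose energies tend to 0.\<close>
 have fixpt: "AE w in P. X t w - X' t w = 0" if t: "0 \<le> t" for t
 proof (rule approx_limit_zero[where H = "\<lambda>n s w. \<sigma> (f n s w) (a s w) - \<sigma> (X s w) (a s w)" and Y = "\<lambda>n t w. Ys (Suc n) t w - Y t w", OF _ t])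
  show "approx t (\<lambda>s w. \<sigma> (f n s w) (a s w) - \<sigma> (X s w) (a s w)) (\<lambda>t w. Ys (Suc n) t w - Y t w)" for n
   unfolding f_def by (rule approx_diff[OF picard_step_approx[OF Ys t] picard_step_approx[OF X'(2) t] t])
  have [measurable]: "X t \<in> borel_measurable P" "X' t \<in> borel_measurable P"
   using measurable_F_imp_P[OF XF[OF t] t] X'(1) t unfolding cont_proc_def by (blast intro: measurable_F_imp_P)+
  show "(\<lambda>w. X t w - X' t w) \<in> borel_measurable P" by measurable
  obtain T :: nat where T: "t \<le> real T" using real_arch_simple by blast
  have eb: "AE w in P. \<exists>n0. \<forall>n\<ge>n0. energy t (\<lambda>s w. f n s w - X s w) w \<le> ennreal (t * (2 * (1/2)^n)\<^sup>2)"
   using lim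
  proof eventually_elim
   case (elim w)
   obtain n0 where n0: "\<And>n t. n0 \<le> n ==> t \<in> {0..real T} ==> norm (f n t w - X t w) \<le> 2 * (1/2)^n"
    using elim by blast
   have "energy t (\<lambda>s w. f n s w - X s w) w \<le> ennreal (t * (2 * (1/2)^n)\<^sup>2)" if n: "n0 \<le> n" for n
   proof -
    have "energy t (\<lambda>s w. f n s w - X s w) w \<le> (\<integral>\<^sup>+s. ennreal ((2 * (1/2)^n)\<^sup>2) * indicator {0..t} s \<partial>lborel)"
     unfolding energy_def
    proof (rule nn_integral_mono)
     fix s
     show "sqnorm (f n s w - X s w) * indicator {0..t} s \<le> ennreal ((2 * (1/2)^n)\<^sup>2) * indicator {0..t} s"
     proof (cases "s \<in> {0..t}")
      case True
      hence "norm (f n s w - X s w) \<le> 2 * (1/2)^n" using T by (intro n0 n) auto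
      from power_mono[OF this norm_ge_zero, of 2] show ?thesis using True by (simp add: ennreal_leI)
     qed simp
    qed
    also have "\<dots> = ennreal (t * (2 * (1/2)^n)\<^sup>2)"
     using t by (subst nn_integral_cmult_indicator) (auto simp: ennreal_mult[symmetric] mult_ac)
    finally show ?thesis .
   qed
   thus ?case by blast
  qed
  have zero: "(\<lambda>n. ennreal (c * (t * (2 * (1/2)^n)\<^sup>2))) \<longlonglongrightarrow> 0" for c
  proof -
   have "(\<lambda>n. ennreal (c * (t * (2 * (1/2)^n)\<^sup>2))) \<longlonglongrightarrow> ennreal (c * (t * (2 * 0)\<^sup>2))"
    by (intro tendsto_ennrealI tendsto_intros LIMSEQ_realpow_zero) auto
   thus ?thesis by simp
  qed
  have c: "continuous_on {0..} (\<lambda>s. f n s w - X s w)" for n w by (intro continuous_on_diff fc Xcont)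
  show "AE w in P. (\<lambda>n. energy t (\<lambda>s w. \<sigma> (f n s w) (a s w) - \<sigma> (X s w) (a s w)) w) \<longlonglongrightarrow> 0"
   using eb
  proof eventually_elim
   case (elim w)
   then obtain n0 where n0: "\<And>n. n0 \<le> n ==> energy t (\<lambda>s w. f n s w - X s w) w \<le> ennreal (t * (2 * (1/2)^n)\<^sup>2)" by blast
   have up: "\<forall>\<^sub>F n in sequentially. energy t (\<lambda>s w. \<sigma> (f n s w) (a s w) - \<sigma> (X s w) (a s w)) w \<le> ennreal (m\<^sup>2 * (t * (2 * (1/2)^n)\<^sup>2))"
    using eventually_ge_at_top[of n0]
   proof eventually_elim
    case (elim n)
    have "energy t (\<lambda>s w. \<sigma> (f n s w) (a s w) - \<sigma> (X s w) (a s w)) w \<le> ennreal (m\<^sup>2) * energy t (\<lambda>s w. f n s w - X s w) w"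
     using m by (intro coeff_energy_le(1) c) auto
    also have "\<dots> \<le> ennreal (m\<^sup>2) * ennreal (t * (2 * (1/2)^n)\<^sup>2)" by (intro mult_left_mono n0 elim) simp
    finally show ?case using t by (simp add: ennreal_mult)
   qed
   show ?case
    by (rule tendsto_sandwich[OF always_eventually[OF allI[OF zero_le]] up tendsto_const zero])
  qed
  have ev1: "AE w in P. \<forall>n. \<forall>t\<ge>0. f (Suc n) t w = x\<^sub>0 w + drift (f n) a t w + Ys (Suc n) t w"
   using Ys unfolding f_def picard_step_def by (subst AE_all_countable) blast
  have ev2: "AE w in P. \<forall>t\<ge>0. X' t w = x\<^sub>0 w + drift X a t w + Y t w"
   using X'(2) by (simp add: picard_step_def)
  show "AE w in P. (\<lambda>n. Ys (Suc n) t w - Y t w) \<longlonglongrightarrow> X t w - X' t w"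
   using ev1 ev2 lim eb a(2)
  proof eventually_elim
   case (elim w)
   let ?I = "\<lambda>n. LINT s:{0..t}|lborel. b (f n s w) (a s w) - b (X s w) (a s w)"
   have r: "reg_path (\<lambda>s. b (f n s w) (a s w))" "reg_path (\<lambda>s. b (X s w) (a s w))" for n
    by (rule reg_path_coeff(1)[OF fc elim(5)], rule reg_path_coeff(1)[OF Xcont elim(5)])
   obtain n0 where n0: "\<And>n. n0 \<le> n ==> energy t (\<lambda>s w. f n s w - X s w) w \<le> ennreal (t * (2 * (1/2)^n)\<^sup>2)" using elim(4) by blast
   have up: "\<forall>\<^sub>F n in sequentially. sqnorm (?I n) \<le> ennreal ((t * m\<^sup>2) * (t * (2 * (1/2)^n)\<^sup>2))"
    using eventually_ge_at_top[of n0]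
   proof eventually_elim
    case (elim n)
    have "sqnorm (?I n) \<le> ennreal t * energy t (\<lambda>s w. b (f n s w) (a s w) - b (X s w) (a s w)) w"
     unfolding energy_def by (intro set_integral_square_le set_integral_diff(1) reg_path_set_integrable r t)
    also have "\<dots> \<le> ennreal t * (ennreal (m\<^sup>2) * energy t (\<lambda>s w. f n s w - X s w) w)"
     using m by (intro mult_left_mono coeff_energy_le(2) c) auto
    also have "\<dots> \<le> ennreal t * (ennreal (m\<^sup>2) * ennreal (t * (2 * (1/2)^n)\<^sup>2))" by (intro mult_left_mono n0 elim) auto
    finally show ?case using t by (simp add: ennreal_mult mult.assoc)
   qed
   have "(\<lambda>n. sqnorm (?I n)) \<longlonglongrightarrow> ennreal 0"
    unfolding ennreal_0 by (rule tendsto_sandwich[OF always_eventually[OF allI[OF zero_le]] up tendsto_const zero])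
   hence "(\<lambda>n. (norm (?I n))\<^sup>2) \<longlonglongrightarrow> 0" by (subst (asm) tendsto_ennreal_iff) auto
   hence "(\<lambda>n. sqrt ((norm (?I n))\<^sup>2)) \<longlonglongrightarrow> sqrt 0" by (rule tendsto_real_sqrt)
   hence I0: "?I \<longlonglongrightarrow> 0" by (simp add: tendsto_norm_zero_iff)
   obtain N where N: "\<And>n. N \<le> n ==> norm (f n t w - X t w) \<le> 2 * (1/2)^n" using elim(3) T t by (metis atLeastAtMost_iff)
   have l: "(\<lambda>n. 2 * (1/2::real)^n) \<longlonglongrightarrow> 2 * 0" by (intro tendsto_intros LIMSEQ_realpow_zero) auto
   have "(\<lambda>n. f n t w - X t w) \<longlonglongrightarrow> 0"
    by (rule Lim_null_comparison[OF _ l[unfolded mult_zero_right]]) (use N in \<open>auto simp: eventually_sequentially\<close>)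
   hence "(\<lambda>n. f n t w) \<longlonglongrightarrow> X t w" by (rule LIM_zero_cancel)
   hence "(\<lambda>n. f (Suc n) t w) \<longlonglongrightarrow> X t w" by (rule LIMSEQ_Suc)
   hence "(\<lambda>n. f (Suc n) t w - X' t w - ?I n) \<longlonglongrightarrow> X t w - X' t w - 0"
    by (intro tendsto_diff I0 tendsto_const)
   moreover have alg: "(x + i + y) - (x + j + z) - (i - j) = y - z" for x i y j z :: "real^'n"
    by (simp add: algebra_simps)
   have "f (Suc n) t w - X' t w - ?I n = Ys (Suc n) t w - Y t w" for n
    unfolding elim(1)[rule_format, OF t, of n] elim(2)[rule_format, OF t]
     set_integral_diff(2)[OF reg_path_set_integrable[OF r(1), of t] reg_path_set_integrable[OF r(2), of t], of n]
    by (rule alg)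
   ultimately show ?case by (simp only: diff_zero)
  qed
 qed
 have "AE w in P. \<forall>t\<in>\<rat> \<inter> {0..}. X t w = X' t w"
  using countable_rat fixpt by (subst AE_ball_countable) (auto intro: countable_Int1)
 hence "AE w in P. \<forall>t\<ge>0. X t w = X' t w"
 proof (eventually_elim, intro allI impI)
  fix w t assume q: "\<forall>t\<in>\<rat> \<inter> {0..}. X t w = X' t w" and t: "(0::real) \<le> t"
  have "X t w - X' t w \<in> {0}"
  proof (rule closed_dense_extend[of "t + 1" "\<lambda>t. X t w - X' t w"])
   have "continuous_on {0..} (\<lambda>t. X' t w)" using X'(1) by (simp add: cont_proc_def)
   hence "continuous_on {0..} (\<lambda>t. X t w - X' t w)" by (intro continuous_on_diff Xcont)
   thus "continuous_on {0..t + 1} (\<lambda>t. X t w - X' t w)" by (rule continuous_on_subset) auto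
  qed (use t q in auto)
  thus "X t w = X' t w" by simp
 qed
 hence "AE w in P. \<forall>t\<ge>0. X t w = x\<^sub>0 w + drift X a t w + Y t w"
  using X'(2)[unfolded picard_step_def, THEN conjunct2]
 proof (eventually_elim, intro allI impI)
  fix w and t :: real assume e: "\<forall>t\<ge>0. X t w = X' t w" "\<forall>t\<ge>0. X' t w = x\<^sub>0 w + drift X a t w + Y t w" and t: "0 \<le> t"
  show "X t w = x\<^sub>0 w + drift X a t w + Y t w"
   unfolding e(2)[rule_format, OF t, symmetric] by (rule e(1)[rule_format, OF t])
 qed
 hence "picard_step a x\<^sub>0 X Y X" using X'(2) by (simp add: picard_step_def)
 with Xp show ?thesis by blast
qed

end

section \<open>Localisation in the level\<close>

lemma pwc_stoppedI:
 assumes r: "\<And>t. 0 \<le> t ==> t < T ==> \<exists>l. \<forall>\<^sub>F s in at_right t. a s = l"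
  and l: "\<And>t. 0 < t ==> t \<le> T ==> \<exists>l. \<forall>\<^sub>F s in at_left t. a s = l"
 shows "pwc (\<lambda>t. a (min t T))"
 unfolding pwc_def
proof (intro conjI allI impI)
 fix t :: real
 show "\<exists>l. \<forall>\<^sub>F s in at_right t. a (min s T) = l" if t: "0 \<le> t"
 proof (cases "t < T")
  case True
  obtain l where l: "\<forall>\<^sub>F s in at_right t. a s = l" using r[OF t True] by blast
  have "\<forall>\<^sub>F s in at_right t. s < T" using True unfolding eventually_at_right_field by blast
  with l have "\<forall>\<^sub>F s in at_right t. a (min s T) = l" by eventually_elim simp
  thus ?thesis ..
 next
  case False
  have "\<forall>\<^sub>F s in at_right t. a (min s T) = a T"
   using False unfolding eventually_at_right_field by (intro exI[of _ "t + 1"]) auto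
  thus ?thesis ..
 qed
 show "\<exists>l. \<forall>\<^sub>F s in at_left t. a (min s T) = l" if t: "0 < t"
 proof (cases "t \<le> T")
  case True
  obtain l where l: "\<forall>\<^sub>F s in at_left t. a s = l" using l[OF t True] by blast
  have "\<forall>\<^sub>F s in at_left t. s < t" unfolding eventually_at_left_field by (intro exI[of _ "t - 1"]) auto
  with l have "\<forall>\<^sub>F s in at_left t. a (min s T) = l" using True by (auto elim: eventually_elim2)
  thus ?thesis ..
 next
  case False
  hence "\<forall>\<^sub>F s in at_left t. a (min s T) = a T"
   unfolding eventually_at_left_field by (intro exI[of _ T]) auto
  thus ?thesis ..
 qed
qed

lemma pwc_stopped: "pwc a ==> pwc (\<lambda>t. a (min t T))"
 by (rule pwc_stoppedI) (simp_all add: pwc_def)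

context sde_space
begin

lemma picard_fixpoint:
 assumes X: "cont_proc X" "picard_step a x\<^sub>0 X Y X"
 shows "AE w in P. X 0 w = x\<^sub>0 w" and "0 < T ==> sde_on T a X"
proof -
 have Y0: "AE w in P. Y 0 w = 0"
  by (rule approx_at_zero[OF picard_step_approx[OF X(2)]]) simp
 have eq: "AE w in P. \<forall>t\<ge>0. X t w = x\<^sub>0 w + drift X a t w + Y t w"
  using X(2) by (simp add: picard_step_def)
 show init: "AE w in P. X 0 w = x\<^sub>0 w"
  using Y0 eq
 proof eventually_elim
  case (elim w)
  have "drift X a 0 w = 0"
   unfolding set_lebesgue_integral_def
   by (rule integral_eq_zero_AE) (use AE_lborel_singleton[of 0] in eventually_elim, simp)
  thus ?case using elim(1) elim(2)[rule_format, of 0] by simp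
 qed
 show "sde_on T a X" if T: "0 < T"
  unfolding sde_on_def
 proof (intro conjI ballI exI[of _ Y])
  show "X t \<in> borel_measurable (F t)" if "t \<in> {0..T}" for t using X(1) that by (simp add: cont_proc_def)
  have "continuous_on {0..T} (\<lambda>t. X t w)" for w
  proof -
   have "continuous_on {0..} (\<lambda>t. X t w)" using X(1) by (simp add: cont_proc_def)
   thus ?thesis by (rule continuous_on_subset) auto
  qed
  thus "AE w in P. continuous_on {0..T} (\<lambda>t. X t w)" by simp
  show "ito_integral_on P F W T (\<lambda>s w. \<sigma> (X s w) (a s w)) Y" using X(2) T by (simp add: picard_step_def)
  show "AE w in P. \<forall>t\<in>{0..T}. X t w = X 0 w + drift X a t w + Y t w"
   using init eq
  proof (eventually_elim, intro ballI)
   fix w t assume i: "X 0 w = x\<^sub>0 w" and e: "\<forall>t\<ge>0. X t w = x\<^sub>0 w + drift X a t w + Y t w"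
    and t: "t \<in> {0..T}"
   show "X t w = X 0 w + drift X a t w + Y t w"
    unfolding i by (rule e[rule_format]) (use t in simp)
  qed
 qed
qed

text \<open>The truncated problems are solved by the bounded case. On a bounded interval each path
  stays below some level \<open>M\<close>, so by local uniqueness the solutions with higher levels
  coincide there with that of level \<open>M\<close>: the sequence is eventually constant along each
  path.\<close>

theorem sde_exists:
 assumes a: "\<And>t. 0 \<le> t ==> a t \<in> measurable (F t) (count_space UNIV)" "AE w in P. pwc (\<lambda>t. a t w)"
  and x0: "x\<^sub>0 \<in> borel_measurable (F 0)"
 shows "\<exists>X Y. cont_proc X \<and> picard_step a x\<^sub>0 X Y X"
proof -
 \<comment> \<open>States of too high a level are replaced by state 0, which is why the bound
   becomes \<open>real m + L 0\<close>.\<close>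
 define am where "am m t w = (if L (a t w) \<le> real m then a t w else 0)" for m :: nat and t w
 define xm where "xm m w = (if norm (x\<^sub>0 w) \<le> real m then x\<^sub>0 w else 0)" for m :: nat and w
 have amm: "am m t \<in> measurable (F t) (count_space UNIV)" if "0 \<le> t" for m t
  unfolding am_def by (rule measurable_compose[OF a(1)[OF that]]) simp
 have amp: "AE w in P. pwc (\<lambda>t. am m t w)" for m
  unfolding am_def using a(2) by eventually_elim (rule pwc_comp[of _ "\<lambda>i. if L i \<le> real m then i else 0"])
 have amL: "L (am m t w) \<le> real m + L 0" for m t w
  using L_nonneg[of 0] by (auto simp: am_def)
 have xmm: "xm m \<in> borel_measurable (F 0)" for m
  unfolding xm_def using x0 by measurable
 have xmb: "norm (xm m w) \<le> real m + L 0" for m w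
  using L_nonneg[of 0] by (auto simp: xm_def)
 have "\<forall>m. \<exists>X Y. cont_proc X \<and> picard_step (am m) (xm m) X Y X"
  using sde_exists_bounded[OF amm amp amL _ xmm xmb] L_nonneg[of 0] by simp
 then obtain Xm Ym where Xm: "\<And>m. cont_proc (Xm m)" "\<And>m. picard_step (am m) (xm m) (Xm m) (Ym m) (Xm m)" by metis
 have uniq: "AE w in P. \<forall>m m' n. \<forall>t\<in>{0..real (Suc n)}. Xm m 0 w = Xm m' 0 w -->
  (\<forall>s. 0 \<le> s --> s < t --> am m s w = am m' s w) --> Xm m t w = Xm m' t w"
 proof (intro AE_all_countable[THEN iffD2] allI)
  fix m m' n :: nat
  show "AE w in P. \<forall>t\<in>{0..real (Suc n)}. Xm m 0 w = Xm m' 0 w -->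
   (\<forall>s. 0 \<le> s --> s < t --> am m s w = am m' s w) --> Xm m t w = Xm m' t w"
  proof (rule sde_local_uniqueness[of "real (Suc n)"])
   show T: "0 < real (Suc n)" by simp
   show "sde_on (real (Suc n)) (am m) (Xm m)" "sde_on (real (Suc n)) (am m') (Xm m')"
    by (rule picard_fixpoint(2)[OF Xm T])+
   show "am m t \<in> measurable (F t) (count_space UNIV)" "am m' t \<in> measurable (F t) (count_space UNIV)" if "t \<in> {0..real (Suc n)}" for t
    using amm that by auto
   show "AE w in P. pwc (\<lambda>t. am m (min t (real (Suc n))) w)" "AE w in P. pwc (\<lambda>t. am m' (min t (real (Suc n))) w)"
    by (rule eventually_mono[OF amp[of m]], erule pwc_stopped)
     (rule eventually_mono[OF amp[of m']], erule pwc_stopped)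
  qed
 qed
 have init: "AE w in P. \<forall>m. Xm m 0 w = xm m w"
  by (intro AE_all_countable[THEN iffD2] allI picard_fixpoint(1)[OF Xm])
 have level: "AE w in P. \<forall>n::nat. \<exists>M. norm (x\<^sub>0 w) \<le> real M \<and> (\<forall>t\<in>{0..real (Suc n)}. L (a t w) \<le> real M)"
  using a(2)
 proof (eventually_elim, intro allI)
  fix w and n :: nat assume p: "pwc (\<lambda>t. a t w)"
  have "finite (L ` ((\<lambda>t. a t w) ` {0..real (Suc n)}))" by (rule finite_imageI[OF pwc_finite_range[OF p]])
  hence "bdd_above (L ` ((\<lambda>t. a t w) ` {0..real (Suc n)}))" by (rule bdd_above_finite)
  then obtain B where B: "\<forall>x\<in>L ` ((\<lambda>t. a t w) ` {0..real (Suc n)}). x \<le> B" unfolding bdd_above_def by blast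
  obtain M :: nat where M: "max B (norm (x\<^sub>0 w)) \<le> real M" using real_arch_simple by blast
  hence "norm (x\<^sub>0 w) \<le> real M" "B \<le> real M" by auto
  moreover have "L (a t w) \<le> B" if "t \<in> {0..real (Suc n)}" for t using B that by blast
  ultimately show "\<exists>M. norm (x\<^sub>0 w) \<le> real M \<and> (\<forall>t\<in>{0..real (Suc n)}. L (a t w) \<le> real M)"
   using order_trans by blast
 qed
 have stable: "AE w in P. \<forall>n. \<exists>M. norm (x\<^sub>0 w) \<le> real M \<and> (\<forall>t\<in>{0..real (Suc n)}. L (a t w) \<le> real M) \<and>
   (\<forall>m\<ge>M. \<forall>t\<in>{0..real (Suc n)}. Xm m t w = Xm M t w)"
  using level uniq init
 proof (eventually_elim, intro allI)
  fix w n
  assume l: "\<forall>n::nat. \<exists>M. norm (x\<^sub>0 w) \<le> real M \<and> (\<forall>t\<in>{0..real (Suc n)}. L (a t w) \<le> real M)"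
   and u: "\<forall>m m' n. \<forall>t\<in>{0..real (Suc n)}. Xm m 0 w = Xm m' 0 w -->
    (\<forall>s. 0 \<le> s --> s < t --> am m s w = am m' s w) --> Xm m t w = Xm m' t w"
   and i: "\<forall>m. Xm m 0 w = xm m w"
  obtain M where M: "norm (x\<^sub>0 w) \<le> real M" "\<And>t. t \<in> {0..real (Suc n)} ==> L (a t w) \<le> real M" using l by blast
  have "Xm m t w = Xm M t w" if m: "M \<le> m" and t: "t \<in> {0..real (Suc n)}" for m t
  proof (rule u[rule_format, OF t])
   have mM: "real M \<le> real m" using m by simp
   show "Xm m 0 w = Xm M 0 w" using i M(1) order_trans[OF M(1) mM] by (simp add: xm_def)
   fix s assume "0 \<le> s" "s < t"
   hence "L (a s w) \<le> real M" using t by (intro M(2)) auto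
   thus "am m s w = am M s w" using order_trans[OF _ mM] by (simp add: am_def)
  qed
  thus "\<exists>M. norm (x\<^sub>0 w) \<le> real M \<and> (\<forall>t\<in>{0..real (Suc n)}. L (a t w) \<le> real M) \<and>
   (\<forall>m\<ge>M. \<forall>t\<in>{0..real (Suc n)}. Xm m t w = Xm M t w)" using M by blast
 qed
 define G where "G w \<longleftrightarrow> (\<forall>n. \<exists>M. norm (x\<^sub>0 w) \<le> real M \<and> (\<forall>t\<in>{0..real (Suc n)}. L (a t w) \<le> real M) \<and>
   (\<forall>m\<ge>M. \<forall>t\<in>{0..real (Suc n)}. Xm m t w = Xm M t w))" for w
 have G: "AE w in P. G w" using stable by (simp add: G_def)
 define X where "X t w = (if G w then lim (\<lambda>m. Xm m t w) else 0)" for t w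
 have XM: "\<exists>M. norm (x\<^sub>0 w) \<le> real M \<and> (\<forall>t\<in>{0..real (Suc n)}. L (a t w) \<le> real M) \<and> (\<forall>t\<in>{0..real (Suc n)}. X t w = Xm M t w)" if g: "G w" for w n
 proof -
  obtain M where M: "norm (x\<^sub>0 w) \<le> real M" "\<forall>t\<in>{0..real (Suc n)}. L (a t w) \<le> real M"
   "\<And>m t. M \<le> m ==> t \<in> {0..real (Suc n)} ==> Xm m t w = Xm M t w"
   using g unfolding G_def by blast
  have "X t w = Xm M t w" if t: "t \<in> {0..real (Suc n)}" for t
  proof -
   have "(\<lambda>m. Xm m t w) \<longlonglongrightarrow> Xm M t w"
    using M(3)[OF _ t] by (intro tendsto_eventually eventually_sequentiallyI[of M]) blast
   thus ?thesis using g by (simp add: X_def limI)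
  qed
  thus ?thesis using M by blast
 qed
 have Xmc: "continuous_on {0..} (\<lambda>t. Xm m t w)" for m w using Xm(1)[of m] by (simp add: cont_proc_def)
 have Xcont: "continuous_on {0..} (\<lambda>t. X t w)" for w
 proof (cases "G w")
  case True
  show ?thesis
  proof (rule continuous_on_halfline)
   fix T :: real
   obtain n where "T \<le> real n" using real_arch_simple by blast
   hence sub: "{0..T} \<subseteq> {0..real (Suc n)}" by auto
   obtain M where "\<forall>t\<in>{0..real (Suc n)}. X t w = Xm M t w" using XM[OF True, of n] by blast
   hence "\<forall>t\<in>{0..T}. X t w = Xm M t w" using sub by blast
   moreover have "continuous_on {0..T} (\<lambda>t. Xm M t w)" by (rule continuous_on_subset[OF Xmc]) auto
   ultimately show "continuous_on {0..T} (\<lambda>t. X t w)" by (subst continuous_on_cong[OF refl]) auto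
  qed
 qed (simp add: X_def)
 have XF: "X t \<in> borel_measurable (F t)" if t: "0 \<le> t" for t
 proof (rule measurable_F_AE_cong[OF _ t])
  have [measurable]: "Xm m t \<in> borel_measurable (F t)" for m
   using Xm(1)[of m] t unfolding cont_proc_def by blast
  show "(\<lambda>w. lim (\<lambda>m. Xm m t w)) \<in> borel_measurable (F t)" by (rule borel_measurable_lim_metric) measurable
  show "AE w in P. lim (\<lambda>m. Xm m t w) = X t w" using G by eventually_elim (simp add: X_def)
 qed simp
 have Xp: "cont_proc X" using XF Xcont by (simp add: cont_proc_def)
 obtain X' Y where X': "cont_proc X'" "picard_step a x\<^sub>0 X Y X'" using picard_step_exists[OF Xp a x0] by blast
 \<comment> \<open>Up to a time where the level \<open>m\<close> suffices, the integrand of the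
   limit is that of the m-th problem, so locality identifies the two integrals pathwise.\<close>
 have loc: "AE w in P. \<forall>m n. \<forall>t\<in>{0..real (Suc n)}. (\<forall>u. 0 \<le> u --> u < t --> \<sigma> (X u w) (a u w) = \<sigma> (Xm m u w) (am m u w)) --> Y t w = Ym m t w"
  by (intro AE_all_countable[THEN iffD2] allI ito_integral_local picard_step_approx[OF X'(2)] picard_step_approx[OF Xm(2)]) auto
 have eqm: "AE w in P. \<forall>m. \<forall>t\<ge>0. Xm m t w = xm m w + drift (Xm m) (am m) t w + Ym m t w"
  using Xm(2) unfolding picard_step_def by (subst AE_all_countable) blast
 have "AE w in P. \<forall>t\<ge>0. X t w = x\<^sub>0 w + drift X a t w + Y t w"
  using loc eqm G
 proof (eventually_elim, intro allI impI)
  fix w and t :: real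
  assume l: "\<forall>m n. \<forall>t\<in>{0..real (Suc n)}. (\<forall>u. 0 \<le> u --> u < t --> \<sigma> (X u w) (a u w) = \<sigma> (Xm m u w) (am m u w)) --> Y t w = Ym m t w"
   and e: "\<forall>m. \<forall>t\<ge>0. Xm m t w = xm m w + drift (Xm m) (am m) t w + Ym m t w"
   and g: "G w" and t: "0 \<le> t"
  obtain n where "t < real n" using reals_Archimedean2 by blast
  hence tn: "t \<in> {0..real (Suc n)}" using t by simp
  obtain M where M: "norm (x\<^sub>0 w) \<le> real M" "\<And>t. t \<in> {0..real (Suc n)} ==> L (a t w) \<le> real M"
   "\<And>t. t \<in> {0..real (Suc n)} ==> X t w = Xm M t w"
   using XM[OF g, of n] by blast
  have s: "X s w = Xm M s w" "am M s w = a s w" if "s \<in> {0..t}" for s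
  proof -
   have sn: "s \<in> {0..real (Suc n)}" using that tn by auto
   show "X s w = Xm M s w" by (rule M(3)[OF sn])
   show "am M s w = a s w" using M(2)[OF sn] by (simp add: am_def)
  qed
  have Yt: "Y t w = Ym M t w"
  proof (rule l[rule_format, OF tn])
   fix u assume "0 \<le> u" "u < t"
   hence "u \<in> {0..t}" by simp
   from s[OF this] show "\<sigma> (X u w) (a u w) = \<sigma> (Xm M u w) (am M u w)" by simp
  qed
  have "(LINT s:{0..t}|lborel. b (Xm M s w) (am M s w)) = drift X a t w"
   using s by (intro set_lebesgue_integral_cong) auto
  moreover have "xm M w = x\<^sub>0 w" using M(1) by (simp add: xm_def)
  ultimately show "X t w = x\<^sub>0 w + drift X a t w + Y t w"
   using M(3)[OF tn] e[rule_format, OF t, of M] Yt by (simp only:)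
 qed
 hence "picard_step a x\<^sub>0 X Y X" using X'(2) by (simp add: picard_step_def)
 with Xp show ?thesis by blast
qed

end

section \<open>Segments and jump heights\<close>

lemma space_path_borel [simp]: "space (path_borel r) = mspace (path_space r)"
 by (simp add: path_borel_def space_measure_of_conv)

lemma openin_path_space_subset: "openin (mtopology_of (path_space r)) U ==> U \<subseteq> mspace (path_space r)"
 using openin_subset[of "mtopology_of (path_space r)" U] by simp

lemma mdist_path_space_le:
 assumes "0 < r" "\<phi> \<in> mspace (path_space r)" "\<psi> \<in> mspace (path_space r)"
  and "\<And>s. s \<in> {-r..0} ==> norm (\<phi> s - \<psi> s) \<le> c"
 shows "mdist (path_space r) \<phi> \<psi> \<le> c"
 using assms by (subst mdist_path_space) (auto intro!: cSUP_least)

lemma norm_le_mdist_path_space: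
 assumes r: "0 < r" and m: "\<phi> \<in> mspace (path_space r)" "\<psi> \<in> mspace (path_space r)" and s: "s \<in> {-r..0}"
 shows "norm (\<phi> s - \<psi> s) \<le> mdist (path_space r) \<phi> \<psi>"
proof -
 have "compact ((\<lambda>s. norm (\<phi> s - \<psi> s)) ` {-r..0})"
  using m by (intro compact_continuous_image continuous_intros) (auto simp: mspace_path_space)
 hence "bdd_above ((\<lambda>s. norm (\<phi> s - \<psi> s)) ` {-r..0})"
  by (intro bounded_imp_bdd_above compact_imp_bounded)
 thus ?thesis using r m s by (subst mdist_path_space) (auto intro!: cSUP_upper)
qed

lemma openin_path_space_iff:
 "openin (mtopology_of (path_space r)) U \<longleftrightarrow> U \<subseteq> mspace (path_space r) \<and>
  (\<forall>\<phi>\<in>U. \<exists>\<epsilon>>0. \<forall>\<psi>\<in>mspace (path_space r). mdist (path_space r) \<phi> \<psi> < \<epsilon> --> \<psi> \<in> U)"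
proof -
 interpret Metric_space "mspace (path_space r)" "mdist (path_space r)" by (rule Metric_space_mspace_mdist)
 have "mball \<phi> \<epsilon> \<subseteq> U \<longleftrightarrow> (\<forall>\<psi>\<in>mspace (path_space r). mdist (path_space r) \<phi> \<psi> < \<epsilon> --> \<psi> \<in> U)"
  if "\<phi> \<in> mspace (path_space r)" for \<phi> \<epsilon>
  unfolding subset_iff in_mball using that by blast
 thus ?thesis unfolding mtopology_of_def openin_mtopology by blast
qed

lemma openin_in_path_borel: "openin (mtopology_of (path_space r)) U ==> U \<in> sets (path_borel r)"
 unfolding path_borel_def using openin_path_space_subset by (intro in_measure_of) blast+

lemma measurable_path_evaluation:
 assumes r: "0 < r" and s: "s \<in> {-r..0}"
 shows "(\<lambda>\<phi> :: real => real^'n. \<phi> s) \<in> borel_measurable (path_borel r)"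
proof (rule borel_measurableI)
 fix V :: "(real^'n) set" assume V: "open V"
 have "openin (mtopology_of (path_space r)) ((\<lambda>\<phi>. \<phi> s) -` V \<inter> mspace (path_space r))"
  unfolding openin_path_space_iff
 proof (intro conjI ballI)
  fix \<phi> :: "real => real^'n" assume "\<phi> \<in> (\<lambda>\<phi>. \<phi> s) -` V \<inter> mspace (path_space r)"
  hence \<phi>: "\<phi> s \<in> V" "\<phi> \<in> mspace (path_space r)" by auto
  obtain \<epsilon> where e: "\<epsilon> > 0" "\<forall>y. dist y (\<phi> s) < \<epsilon> --> y \<in> V" using V \<phi>(1) unfolding open_dist by blast
  have "\<psi> s \<in> V" if p: "\<psi> \<in> mspace (path_space r)" "mdist (path_space r) \<phi> \<psi> < \<epsilon>" for \<psi>
   using e(2) norm_le_mdist_path_space[OF r \<phi>(2) p(1) s] p(2) by (simp add: dist_norm norm_minus_commute)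
  thus "\<exists>\<epsilon>>0. \<forall>\<psi>\<in>mspace (path_space r). mdist (path_space r) \<phi> \<psi> < \<epsilon> --> \<psi> \<in> (\<lambda>\<phi>. \<phi> s) -` V \<inter> mspace (path_space r)"
   using e(1) by blast
 qed auto
 thus "(\<lambda>\<phi>. \<phi> s) -` V \<inter> space (path_borel r) \<in> sets (path_borel r)"
  unfolding space_path_borel by (rule openin_in_path_borel)
qed

text \<open>By uniform continuity the path stays close to its value at the left point of an
  equidistant cell, and that value is moved into the dense set \<open>D\<close>. Encoding the step
  function by its number of cells and a list over \<open>D\<close> leaves countably many of them
  when \<open>D\<close> is countable.\<close>

lemma path_step_cover:
 fixes \<phi> :: "real => real^'n"
 assumes r: "0 < r" and \<phi>: "\<phi> \<in> mspace (path_space r)" and e: "0 < \<epsilon>"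
  and D: "\<And>X. open X ==> X \<noteq> {} ==> \<exists>d\<in>D. d \<in> X"
 shows "\<exists>m v. v \<in> lists D \<and> (\<forall>s\<in>{-r..0}. dist (\<phi> s) (v ! nat \<lfloor>(s + r) / r * real m\<rfloor>) \<le> \<epsilon>)"
proof -
 have "uniformly_continuous_on {-r..0} \<phi>"
  using \<phi> by (intro compact_uniformly_continuous) (auto simp: mspace_path_space)
 then obtain \<delta> where d: "\<delta> > 0" "\<And>s t. s \<in> {-r..0} ==> t \<in> {-r..0} ==> dist t s < \<delta> ==> dist (\<phi> t) (\<phi> s) < \<epsilon> / 2"
  unfolding uniformly_continuous_on_def using e by (metis half_gt_zero)
 obtain m where m: "r / \<delta> < real m" using reals_Archimedean2 by blast
 hence m0: "0 < real m" using r d(1) by (meson divide_pos_pos less_trans)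
 have md: "r / real m < \<delta>" using m m0 d(1) by (simp add: field_simps)
 define u where "u j = - r + r * real j / real m" for j
 have "\<exists>d. d \<in> D \<and> dist d (\<phi> (u j)) < \<epsilon> / 2" for j
  using D[of "ball (\<phi> (u j)) (\<epsilon> / 2)"] e by (auto simp: dist_commute)
 then obtain vv where vv: "\<And>j. vv j \<in> D" "\<And>j. dist (vv j) (\<phi> (u j)) < \<epsilon> / 2" by metis
 \<comment> \<open>\<open>m + 1\<close> entries for \<open>m\<close> cells: at \<open>s = 0\<close>
   the index is \<open>m\<close>.\<close>
 define v where "v = map vv [0..<Suc m]"
 have "dist (\<phi> s) (v ! nat \<lfloor>(s + r) / r * real m\<rfloor>) \<le> \<epsilon>" if s: "s \<in> {-r..0}" for s
 proof -
  define y where "y = (s + r) / r * real m"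
  have y: "0 \<le> y" "y \<le> real m" unfolding y_def using s r m0 by (simp, intro mult_left_le_one_le) auto
  define j where "j = nat \<lfloor>y\<rfloor>"
  have j: "real j \<le> y" "y < real j + 1" using y by (auto simp: j_def)
  have jm: "j \<le> m" using j(1) y(2) by linarith
  have sy: "s = - r + r * y / real m" using r m0 by (simp add: y_def)
  have "s - u j = r / real m * (y - real j)" by (simp add: sy u_def algebra_simps diff_divide_distrib)
  moreover have "r / real m * (y - real j) \<le> r / real m * 1" using r m0 j by (intro mult_left_mono) auto
  moreover have "0 \<le> r / real m * (y - real j)" using r m0 j by (intro mult_nonneg_nonneg) auto
  ultimately have us: "u j \<le> s" "dist s (u j) < \<delta>" using md by (auto simp: dist_real_def)
  have uj: "u j \<in> {-r..0}" using us(1) s r m0 by (auto simp: u_def)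
  have "dist (\<phi> s) (vv j) \<le> dist (\<phi> s) (\<phi> (u j)) + dist (vv j) (\<phi> (u j))" by (rule dist_triangle2)
  hence "dist (\<phi> s) (vv j) \<le> \<epsilon>" using d(2)[OF uj s us(2)] vv(2)[of j] by linarith
  moreover have "v ! j = vv j" using jm by (simp add: v_def del: upt_Suc)
  ultimately show ?thesis by (simp add: j_def y_def)
 qed
 moreover have "v \<in> lists D" using vv(1) by (auto simp: v_def)
 ultimately show ?thesis by blast
qed

text \<open>
 Every open set is a countable union of sets \<open>A k m v\<close> of paths that are uniformly \<open>1/(k+1)\<close>-close,
 on a countable dense set of times, to a step function with values in a countable dense set; such
 sets are determined by countably many evaluations.
\<close>

lemma measurable_path_borelI:
 fixes f :: "'a => real => real^'n"
 assumes r: "0 < r" and sp: "\<And>w. w \<in> space N ==> f w \<in> mspace (path_space r)"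
  and m: "\<And>s. s \<in> {-r..0} ==> (\<lambda>w. f w s) \<in> borel_measurable N"
 shows "f \<in> measurable N (path_borel r)"
 unfolding path_borel_def
proof (rule measurable_measure_of)
 show "{U. openin (mtopology_of (path_space r)) U} \<subseteq> Pow (mspace (path_space r) :: (real => real^'n) set)"
  using openin_path_space_subset by blast
 show "f \<in> space N \<rightarrow> mspace (path_space r)" using sp by blast
 fix U :: "(real => real^'n) set" assume "U \<in> {U. openin (mtopology_of (path_space r)) U}"
 hence U: "openin (mtopology_of (path_space r)) U" by simp
 obtain D :: "(real^'n) set" where D: "countable D" "\<And>X. open X ==> X \<noteq> {} ==> \<exists>d\<in>D. d \<in> X"
  by (rule countable_dense_setE) blast
 define S where "S = {-r<..<0} \<inter> range real_of_rat"
 have S: "countable S" "S \<subseteq> {-r..0}" by (auto simp: S_def)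
 have "{-r<..<0} \<subseteq> closure S"
 proof
  fix x :: real assume x: "x \<in> {-r<..<0}"
  show "x \<in> closure S" unfolding closure_approachable
  proof (intro allI impI)
   fix e :: real assume "0 < e"
   hence "max (-r) (x - e) < min 0 (x + e)" using x r by auto
   then obtain y where y: "max (-r) (x - e) < real_of_rat y" "real_of_rat y < min 0 (x + e)"
    by (metis of_rat_dense)
   thus "\<exists>y\<in>S. dist y x < e" by (intro bexI[of _ "real_of_rat y"]) (auto simp: S_def dist_real_def)
  qed
 qed
 hence "closure {-r<..<0} \<subseteq> closure S" by (rule closure_minimal) simp
 hence clS: "{-r..0} \<subseteq> closure S" using r by (simp add: closure_greaterThanLessThan)
 define A where "A = (\<lambda>(k, m, v). {\<phi>\<in>mspace (path_space r). \<forall>s\<in>S.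
  dist (\<phi> s :: real^'n) (v ! nat \<lfloor>(s + r) / r * real m\<rfloor>) \<le> 1 / real (Suc k)})"
 define I where "I = {x \<in> UNIV \<times> UNIV \<times> lists D. A x \<subseteq> U}"
 have I: "countable I" using D(1) unfolding I_def
  by (intro countable_subset[OF Collect_restrict] countable_SIGMA countable_lists) auto
 have UA: "U = (\<Union>x\<in>I. A x)"
 proof (intro equalityI subsetI)
  fix \<phi> assume p: "\<phi> \<in> U"
  have pm: "\<phi> \<in> mspace (path_space r)" using p openin_path_space_subset[OF U] by blast
  obtain \<epsilon> where e: "\<epsilon> > 0" "\<And>\<psi>. \<psi> \<in> mspace (path_space r) ==> mdist (path_space r) \<phi> \<psi> < \<epsilon> ==> \<psi> \<in> U"
   using U p unfolding openin_path_space_iff by blast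
  obtain k where k: "1 / real (Suc k) < \<epsilon> / 2" using e(1) reals_Archimedean[of "\<epsilon> / 2"] by (auto simp: inverse_eq_divide)
  have k0: "0 < 1 / real (Suc k)" by simp
  obtain m v where v: "v \<in> lists D" "\<And>s. s \<in> {-r..0} ==> dist (\<phi> s) (v ! nat \<lfloor>(s + r) / r * real m\<rfloor>) \<le> 1 / real (Suc k)"
   using path_step_cover[OF r pm k0 D(2)] by blast
  have pA: "\<phi> \<in> A (k, m, v)" using pm v(2) S(2) by (auto simp: A_def)
  have "A (k, m, v) \<subseteq> U"
  proof
   fix \<psi> assume "\<psi> \<in> A (k, m, v)"
   hence q: "\<psi> \<in> mspace (path_space r)" and qd: "\<And>s. s \<in> S ==> dist (\<psi> s) (v ! nat \<lfloor>(s + r) / r * real m\<rfloor>) \<le> 1 / real (Suc k)"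
    by (auto simp: A_def)
   have sS: "norm (\<phi> s - \<psi> s) \<le> 1 / real (Suc k) + 1 / real (Suc k)" if s: "s \<in> S" for s
   proof -
    have "s \<in> {-r..0}" using s S(2) by blast
    thus ?thesis
     using dist_triangle2[of "\<phi> s" "\<psi> s" "v ! nat \<lfloor>(s + r) / r * real m\<rfloor>"] qd[OF s] v(2)[of s]
     by (simp add: dist_norm)
   qed
   have "norm (\<phi> s - \<psi> s) \<le> 1 / real (Suc k) + 1 / real (Suc k)" if s: "s \<in> {-r..0}" for s
   proof -
    have cl: "closure S = {-r..0}" using clS S(2) closure_minimal[of S "{-r..0}"] by auto
    have c: "continuous_on (closure S) (\<lambda>s. norm (\<phi> s - \<psi> s))"
     using pm q unfolding cl by (intro continuous_intros) (auto simp: mspace_path_space)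
    have "s \<in> closure S" using s cl by simp
    thus ?thesis by (rule continuous_le_on_closure[OF c _ sS])
   qed
   hence "mdist (path_space r) \<phi> \<psi> \<le> 1 / real (Suc k) + 1 / real (Suc k)"
    by (intro mdist_path_space_le r pm q)
   thus "\<psi> \<in> U" using k by (intro e(2) q) linarith
  qed
  hence "(k, m, v) \<in> I" using v(1) by (simp add: I_def)
  thus "\<phi> \<in> (\<Union>x\<in>I. A x)" using pA by blast
 next
  fix \<phi> assume "\<phi> \<in> (\<Union>x\<in>I. A x)" thus "\<phi> \<in> U" by (auto simp: I_def)
 qed
 have mA: "f -` A x \<inter> space N \<in> sets N" for x
 proof (cases x)
  case (fields k m' v)
  have "f -` A x \<inter> space N = {w\<in>space N. \<forall>s\<in>S. dist (f w s) (v ! nat \<lfloor>(s + r) / r * real m'\<rfloor>) \<le> 1 / real (Suc k)}"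
   using sp by (auto simp: A_def fields)
  also have "\<dots> \<in> sets N"
  proof (rule sets.sets_Collect_countable_All'[OF _ S(1)])
   fix s assume "s \<in> S"
   hence [measurable]: "(\<lambda>w. f w s) \<in> borel_measurable N" using m S(2) by blast
   show "{w\<in>space N. dist (f w s) (v ! nat \<lfloor>(s + r) / r * real m'\<rfloor>) \<le> 1 / real (Suc k)} \<in> sets N" by measurable
  qed
  finally show ?thesis .
 qed
 have "f -` U \<inter> space N = (\<Union>x\<in>I. f -` A x \<inter> space N)" using UA by auto
 also have "\<dots> \<in> sets N" using I mA by (intro sets.countable_UN'')
 finally show "f -` U \<inter> space N \<in> sets N" .
qed

text \<open>The bound on the total rates enters through finite partial sums, which are the end
  points of the switching intervals; it says that all these intervals lie in
  \<open>[0, M]\<close>.\<close>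

locale switching =
 fixes r :: real and q :: "'n::finite intensities" and M :: real
 assumes r_pos: "0 < r" and M_pos: "0 < M"
  and q_nonneg: "i \<in> {1..} ==> j \<in> {1..} ==> i \<noteq> j ==> \<phi> \<in> mspace (path_space r) ==> 0 \<le> q i j \<phi>"
  and q_measurable: "i \<in> {1..} ==> j \<in> {1..} ==> i \<noteq> j ==> q i j \<in> borel_measurable (path_borel r)"
  and q_sum: "i \<in> {1..} ==> \<phi> \<in> mspace (path_space r) ==> (\<Sum>k\<in>{1..j} - {i}. q i k \<phi>) \<le> M"
begin

definition cum :: "nat => (real => real^'n) => nat => real" where
 "cum i \<phi> j = (\<Sum>k\<in>{1..j} - {i}. q i k \<phi>)"

lemma cum_mono: "i \<in> {1..} ==> \<phi> \<in> mspace (path_space r) ==> j \<le> k ==> cum i \<phi> j \<le> cum i \<phi> k"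
 unfolding cum_def by (intro sum_mono2) (auto intro!: q_nonneg)

lemma switch_interval_eq: "1 \<le> j ==> switch_interval q i j \<phi> = {cum i \<phi> (j - 1)..<cum i \<phi> j}"
 by (cases j) (auto simp: switch_interval_def cum_def atLeastLessThanSuc_atLeastAtMost)

lemma switch_interval_unique:
 assumes "i \<in> {1..}" "\<phi> \<in> mspace (path_space r)" "1 \<le> j" "1 \<le> k"
  and "z \<in> switch_interval q i j \<phi>" "z \<in> switch_interval q i k \<phi>"
 shows "j = k"
proof -
 have "\<not> j < k" if "1 \<le> j" "1 \<le> k" "z \<in> switch_interval q i j \<phi>" "z \<in> switch_interval q i k \<phi>" for j k
 proof
  assume "j < k"
  hence "cum i \<phi> j \<le> cum i \<phi> (k - 1)" by (intro cum_mono assms(1,2)) simp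
  thus False using that by (simp add: switch_interval_eq)
 qed
 thus ?thesis using assms(3-6) by (metis linorder_neqE_nat)
qed

lemma jump_height_in:
 assumes "i \<in> {1..}" "\<phi> \<in> mspace (path_space r)" "1 \<le> j" "j \<noteq> i" "z \<in> switch_interval q i j \<phi>"
 shows "jump_height q \<phi> i z = real j - real i"
  and "j \<le> n ==> (\<Sum>j\<in>{1..n} - {i}. (real j - real i) * indicator (switch_interval q i j \<phi>) z) = real j - real i"
proof -
 have z: "(real k - real i) * indicator (switch_interval q i k \<phi>) z = (if k = j then real j - real i else 0)" if "1 \<le> k" for k
 proof (cases "k = j")
  case False
  hence "z \<notin> switch_interval q i k \<phi>" using switch_interval_unique[OF assms(1,2,3) that assms(5)] by blast
  thus ?thesis using False by simp
 qed (use assms(5) in simp)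
 have "jump_height q \<phi> i z = (\<Sum>\<^sub>\<infinity>k\<in>{j}. (real k - real i) * indicator (switch_interval q i k \<phi>) z)"
  unfolding jump_height_def by (rule infsum_cong_neutral) (use assms(3,4) z in auto)
 thus "jump_height q \<phi> i z = real j - real i" using assms(5) by simp
 assume "j \<le> n"
 thus "(\<Sum>j\<in>{1..n} - {i}. (real j - real i) * indicator (switch_interval q i j \<phi>) z) = real j - real i"
  using z assms(3,4) by (subst sum.cong[OF refl z]) auto
qed

lemma jump_height_notin:
 assumes "\<And>j. 1 \<le> j ==> j \<noteq> i ==> z \<notin> switch_interval q i j \<phi>"
 shows "jump_height q \<phi> i z = 0"
  and "(\<Sum>j\<in>{1..n} - {i}. (real j - real i) * indicator (switch_interval q i j \<phi>) z) = 0"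
proof -
 show "jump_height q \<phi> i z = 0" unfolding jump_height_def by (rule infsum_0) (use assms in auto)
 show "(\<Sum>j\<in>{1..n} - {i}. (real j - real i) * indicator (switch_interval q i j \<phi>) z) = 0"
  by (rule sum.neutral) (use assms in auto)
qed

lemma jump_height_range:
 assumes "i \<in> {1..}" "\<phi> \<in> mspace (path_space r)"
 shows "\<exists>j\<in>{1..}. jump_height q \<phi> i z = real j - real i"
 using jump_height_in(1)[OF assms] jump_height_notin(1)[of i z \<phi>] assms(1) by (metis atLeast_iff diff_self)

lemma jump_height_support:
 assumes "i \<in> {1..}" "\<phi> \<in> mspace (path_space r)" "z \<notin> {0..M}"
 shows "jump_height q \<phi> i z = 0"
proof (rule jump_height_notin(1))
 fix j :: nat assume j: "1 \<le> j" "j \<noteq> i"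
 have "0 \<le> cum i \<phi> (j - 1)" unfolding cum_def by (intro sum_nonneg) (use assms in \<open>auto intro!: q_nonneg\<close>)
 moreover have "cum i \<phi> j \<le> M" unfolding cum_def by (rule q_sum[OF assms(1,2)])
 ultimately show "z \<notin> switch_interval q i j \<phi>" using assms(3) j by (auto simp: switch_interval_eq)
qed

text \<open>Needed for measurability: the unordered infinite sum becomes a limit of finite sums,
  which are eventually constant since \<open>z\<close> lies in at most one interval.\<close>

lemma jump_height_sums:
 assumes "i \<in> {1..}" "\<phi> \<in> mspace (path_space r)"
 shows "(\<lambda>n. \<Sum>j\<in>{1..n} - {i}. (real j - real i) * indicator (switch_interval q i j \<phi>) z) \<longlonglongrightarrow> jump_height q \<phi> i z"
proof (cases "\<exists>j. 1 \<le> j \<and> j \<noteq> i \<and> z \<in> switch_interval q i j \<phi>")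
 case True
 then obtain j where j: "1 \<le> j" "j \<noteq> i" "z \<in> switch_interval q i j \<phi>" by blast
 show ?thesis unfolding jump_height_in(1)[OF assms j]
  by (rule tendsto_eventually) (rule eventually_sequentiallyI[of j], rule jump_height_in(2)[OF assms j])
next
 case False
 hence *: "\<And>j. 1 \<le> j ==> j \<noteq> i ==> z \<notin> switch_interval q i j \<phi>" by blast
 have "jump_height q \<phi> i z = 0" by (rule jump_height_notin(1)) (rule *)
 moreover have "(\<Sum>j\<in>{1..n} - {i}. (real j - real i) * indicator (switch_interval q i j \<phi>) z) = 0" for n
  by (rule jump_height_notin(2)) (rule *)
 ultimately show ?thesis by (simp only: tendsto_const)
qed

text \<open>The value 0 at state 0, where no measurability of \<open>q\<close> is assumed, makes the
  height jointly measurable over all natural numbers as states.\<close>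

definition height :: "(real => real^'n) => nat => real => real" where
 "height \<phi> i z = (if 1 \<le> i then jump_height q \<phi> i z else 0)"

lemma height_measurable:
 assumes \<Phi>: "\<Phi> \<in> measurable N (path_borel r)" and i: "i \<in> measurable N (count_space UNIV)"
  and z [measurable]: "z \<in> borel_measurable N"
 shows "(\<lambda>x. height (\<Phi> x) (i x) (z x)) \<in> borel_measurable N"
proof (rule measurable_compose_countable[OF _ i, where f="\<lambda>i x. height (\<Phi> x) i (z x)"])
 fix i :: nat
 have "(\<lambda>x. jump_height q (\<Phi> x) i (z x)) \<in> borel_measurable N" if i1: "1 \<le> i"
 proof (rule borel_measurable_LIMSEQ_real)
  fix x assume "x \<in> space N"
  thus "(\<lambda>n. \<Sum>j\<in>{1..n} - {i}. (real j - real i) * indicator (switch_interval q i j (\<Phi> x)) (z x)) \<longlonglongrightarrow> jump_height q (\<Phi> x) i (z x)"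
   using measurable_space[OF \<Phi>] i1 by (intro jump_height_sums) auto
 next
  fix n
  have c [measurable]: "(\<lambda>x. cum i (\<Phi> x) j) \<in> borel_measurable N" for j
   unfolding cum_def using i1 by (intro borel_measurable_sum measurable_compose[OF \<Phi>] q_measurable) auto
  have "(\<lambda>x. (real j - real i) * indicator (switch_interval q i j (\<Phi> x)) (z x)) \<in> borel_measurable N" if "j \<in> {1..n} - {i}" for j
  proof -
   have "1 \<le> j" using that by simp
   hence "(\<lambda>x. (real j - real i) * indicator (switch_interval q i j (\<Phi> x)) (z x)) =
     (\<lambda>x. if cum i (\<Phi> x) (j - 1) \<le> z x \<and> z x < cum i (\<Phi> x) j then real j - real i else 0)"
    by (auto simp: switch_interval_eq fun_eq_iff)
   thus ?thesis by simp
  qed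
  thus "(\<lambda>x. \<Sum>j\<in>{1..n} - {i}. (real j - real i) * indicator (switch_interval q i j (\<Phi> x)) (z x)) \<in> borel_measurable N"
   by (rule borel_measurable_sum)
 qed
 thus "(\<lambda>x. height (\<Phi> x) i (z x)) \<in> borel_measurable N" by (cases "1 \<le> i") (simp_all add: height_def)
qed

end

lemma switchingI:
 fixes q :: "'n::finite intensities"
 assumes r: "0 < r"
  and q: "\<And>i j (\<phi> :: real => real^'n). i \<in> {1..} ==> j \<in> {1..} ==> i \<noteq> j ==> \<phi> \<in> mspace (path_space r) ==> 0 \<le> q i j \<phi>"
  and qm: "\<And>i j. i \<in> {1..} ==> j \<in> {1..} ==> i \<noteq> j ==> q i j \<in> borel_measurable (path_borel r)"
  and fin: "(SUP \<phi>\<in>mspace (path_space r). SUP i\<in>{1..}. total_rate q i \<phi>) < \<infinity>"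
 shows "\<exists>M. switching r q M"
proof -
 define s where "s = (SUP \<phi>\<in>mspace (path_space r). SUP i\<in>{1..}. total_rate q i \<phi>)"
 \<comment> \<open>The added 1 makes the bound strictly positive even if all rates vanish.\<close>
 have "switching r q (enn2real s + 1)"
 proof
  show "0 < r" by (rule r)
  show "0 < enn2real s + 1" by (simp add: add_nonneg_pos)
  show "0 \<le> q i j \<phi>" if "i \<in> {1..}" "j \<in> {1..}" "i \<noteq> j" "\<phi> \<in> mspace (path_space r)" for i j \<phi> by (rule q[OF that])
  show "q i j \<in> borel_measurable (path_borel r)" if "i \<in> {1..}" "j \<in> {1..}" "i \<noteq> j" for i j by (rule qm[OF that])
  fix i j :: nat and \<phi> :: "real => real^'n" assume i: "i \<in> {1..}" and p: "\<phi> \<in> mspace (path_space r)"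
  have "ennreal (\<Sum>k\<in>{1..j} - {i}. q i k \<phi>) = (\<Sum>k\<in>{1..j} - {i}. ennreal (q i k \<phi>))"
   by (rule sum_ennreal[symmetric]) (use q[OF i _ _ p] in auto)
  also have "\<dots> = (\<Sum>\<^sub>\<infinity>k\<in>{1..j} - {i}. ennreal (q i k \<phi>))" by simp
  also have "\<dots> \<le> total_rate q i \<phi>" unfolding total_rate_def
   by (rule infsum_mono_neutral) (auto intro: nonneg_summable_on_complete)
  also have "\<dots> \<le> s" unfolding s_def using i p by (intro SUP_upper2[of \<phi>] SUP_upper2[of i]) auto
  finally have "ennreal (\<Sum>k\<in>{1..j} - {i}. q i k \<phi>) \<le> s" .
  moreover have "s = ennreal (enn2real s)" using fin by (simp add: s_def)
  ultimately have "ennreal (\<Sum>k\<in>{1..j} - {i}. q i k \<phi>) \<le> ennreal (enn2real s)" by simp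
  hence "(\<Sum>k\<in>{1..j} - {i}. q i k \<phi>) \<le> enn2real s" by (subst (asm) ennreal_le_iff) auto
  thus "(\<Sum>k\<in>{1..j} - {i}. q i k \<phi>) \<le> enn2real s + 1" by simp
 qed
 thus ?thesis by blast
qed

section \<open>The Poisson random measure\<close>

lemma space_jump_intensity: "space jump_intensity = {0..} \<times> UNIV"
 by (simp add: jump_intensity_def space_restrict_space space_pair_measure)

lemma sets_jump_intensity: "sets jump_intensity = sets (restrict_space borel ({0..} \<times> UNIV))"
proof -
 have "sets ((lborel :: real measure) \<Otimes>\<^sub>M (lborel :: real measure)) = sets (borel \<Otimes>\<^sub>M borel)"
  by (rule sets_pair_measure_cong) simp_all
 also have "\<dots> = sets borel" by (simp only: borel_prod)
 finally show ?thesis unfolding jump_intensity_def by (rule sets_restrict_space_cong)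
qed

lemma Times_in_jump_intensity:
 assumes "A \<in> sets borel" "B \<in> sets borel" "A \<subseteq> {0..}"
 shows "A \<times> B \<in> sets jump_intensity"
 unfolding sets_jump_intensity using assms by (subst sets_restrict_space_iff) (auto intro!: borel_Times)

lemma emeasure_jump_intensity:
 assumes "A \<in> sets borel" "B \<in> sets borel" "A \<subseteq> {0..}"
 shows "emeasure jump_intensity (A \<times> B) = emeasure lborel A * emeasure lborel B"
proof -
 have "({0..} :: real set) \<times> (UNIV :: real set) \<in> sets (lborel \<Otimes>\<^sub>M lborel)" by (rule pair_measureI) simp_all
 hence "emeasure jump_intensity (A \<times> B) = emeasure (lborel \<Otimes>\<^sub>M lborel) (A \<times> B)"
  unfolding jump_intensity_def using assms(3) by (subst emeasure_restrict_space) (auto simp: space_pair_measure)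
 also have "\<dots> = emeasure lborel A * emeasure lborel B"
  using assms by (intro lborel.emeasure_pair_measure_Times) auto
 finally show ?thesis .
qed

lemma enat_valued_less_one:
 assumes "(x::ennreal) \<in> insert \<infinity> (range of_nat)" "x < 1"
 shows "x = 0"
proof -
 obtain k :: nat where k: "x = of_nat k" using assms by auto
 have "(of_nat k :: ennreal) < of_nat 1" using assms(2) k by simp
 hence "k < 1" by (simp only: of_nat_less_iff)
 thus ?thesis using k by simp
qed

text \<open>
 A realisation of the random measure, of which only the part with marks in \<open>[0,M]\<close> matters: finitely
 many points on bounded time intervals, and no two at the same time.
\<close>

locale point_config =
 fixes M :: real and \<mu> :: "(real \<times> real) measure"
 assumes sets_\<mu>: "sets \<mu> = sets jump_intensity"
  and nat_valued: "B \<in> sets jump_intensity ==> emeasure \<mu> B \<in> insert \<infinity> (range of_nat)"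
  and finite_box: "emeasure \<mu> ({0<..T} \<times> {0..M}) < \<infinity>"
  and simple_points: "0 < t ==> emeasure \<mu> ({t} \<times> {0..M}) \<le> 1"
begin

lemma strip_sets:
 "0 \<le> s ==> {s<..t} \<times> {0..M} \<in> sets \<mu>" "0 \<le> s ==> {s<..<t} \<times> {0..M} \<in> sets \<mu>" "0 \<le> t ==> {t} \<times> {0..M} \<in> sets \<mu>"
 "0 \<le> s ==> {s<..t} \<times> UNIV \<in> sets \<mu>"
 unfolding sets_\<mu> by (auto intro!: Times_in_jump_intensity)

lemma finite_strip: "0 \<le> s ==> A \<subseteq> {s<..t} \<times> {0..M} ==> emeasure \<mu> A < \<infinity>"
proof -
 assume "0 \<le> s" "A \<subseteq> {s<..t} \<times> {0..M}"
 hence "emeasure \<mu> A \<le> emeasure \<mu> ({0<..t} \<times> {0..M})" by (intro emeasure_mono strip_sets) auto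
 thus ?thesis using finite_box[of t] by (rule le_less_trans)
qed

text \<open>The finite masses of sets decreasing to the empty set tend to 0, and a natural number
  below 1 is 0. This replaces an enumeration of the points throughout.\<close>

lemma eventually_null:
 assumes B: "\<And>n. B n \<in> sets \<mu>" "\<And>n. B (Suc n) \<subseteq> B n" "(\<Inter>n. B n) = {}" "emeasure \<mu> (B 0) < \<infinity>"
 shows "\<exists>n::nat. emeasure \<mu> (B n) = 0"
proof -
 have d: "decseq B" by (rule decseq_SucI) (rule B(2))
 have "emeasure \<mu> (B n) \<noteq> \<infinity>" for n
 proof -
  have "emeasure \<mu> (B n) \<le> emeasure \<mu> (B 0)" using d B(1) by (intro emeasure_mono) (auto simp: decseq_def)
  thus ?thesis using B(4) by auto
 qed
 hence "(\<lambda>n. emeasure \<mu> (B n)) \<longlonglongrightarrow> emeasure \<mu> (\<Inter>n. B n)"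
  using B(1) d by (intro Lim_emeasure_decseq) auto
 hence "(\<lambda>n. emeasure \<mu> (B n)) \<longlonglongrightarrow> 0" using B(3) by simp
 hence "\<forall>\<^sub>F n in sequentially. emeasure \<mu> (B n) < 1" by (rule order_tendstoD) simp
 then obtain n where "emeasure \<mu> (B n) < 1" using eventually_happens by force
 moreover have "emeasure \<mu> (B n) \<in> insert \<infinity> (range of_nat)" using B(1) by (intro nat_valued) (simp add: sets_\<mu>)
 ultimately show ?thesis using enat_valued_less_one by blast
qed

lemma inverse_Suc_le: "inverse (real (Suc (Suc n))) \<le> inverse (real (Suc n))"
 by (simp add: field_simps)

lemma null_right:
 assumes "0 \<le> t"
 shows "\<exists>\<epsilon>>0. emeasure \<mu> ({t<..t + \<epsilon>} \<times> {0..M}) = 0"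
proof -
 define B where "B n = {t<..t + inverse (real (Suc n))} \<times> {0..M}" for n
 have "\<exists>n. emeasure \<mu> (B n) = 0"
 proof (rule eventually_null)
  show "B n \<in> sets \<mu>" for n unfolding B_def using assms by (rule strip_sets)
  show "B (Suc n) \<subseteq> B n" for n by (auto simp: B_def simp del: of_nat_Suc intro: order_trans[OF _ add_left_mono[OF inverse_Suc_le]])
  show "(\<Inter>n. B n) = {}"
  proof (rule ccontr)
   assume "(\<Inter>n. B n) \<noteq> {}"
   then obtain x where x: "\<And>n. x \<in> B n" by blast
   have "0 < fst x - t" using x[of 0] by (auto simp: B_def)
   then obtain n where "inverse (real (Suc n)) < fst x - t" using reals_Archimedean by blast
   thus False using x[of n] by (auto simp: B_def)
  qed
  show "emeasure \<mu> (B 0) < \<infinity>" unfolding B_def by (rule finite_strip[OF assms order_refl])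
 qed
 thus ?thesis unfolding B_def by (meson inverse_positive_iff_positive of_nat_0_less_iff zero_less_Suc)
qed

lemma null_left:
 assumes t: "0 < t"
 shows "\<exists>s. 0 \<le> s \<and> s < t \<and> emeasure \<mu> ({s<..<t} \<times> {0..M}) = 0"
proof -
 define s where "s n = max 0 (t - inverse (real (Suc n)))" for n
 define B where "B n = {s n<..<t} \<times> {0..M}" for n
 have s: "0 \<le> s n" "s n < t" for n using t by (auto simp: s_def)
 have "\<exists>n. emeasure \<mu> (B n) = 0"
 proof (rule eventually_null)
  show "B n \<in> sets \<mu>" for n unfolding B_def using s by (intro strip_sets)
  show "B (Suc n) \<subseteq> B n" for n by (auto simp: B_def s_def simp del: of_nat_Suc intro: le_less_trans[OF diff_left_mono[OF inverse_Suc_le]])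
  show "(\<Inter>n. B n) = {}"
  proof (rule ccontr)
   assume "(\<Inter>n. B n) \<noteq> {}"
   then obtain x where x: "\<And>n. x \<in> B n" by blast
   have "0 < t - fst x" using x[of 0] by (auto simp: B_def)
   then obtain n where "inverse (real (Suc n)) < t - fst x" using reals_Archimedean by blast
   thus False using x[of n] by (auto simp: B_def s_def)
  qed
  show "emeasure \<mu> (B 0) < \<infinity>" unfolding B_def by (rule finite_strip[OF s(1), where t=t]) auto
 qed
 thus ?thesis unfolding B_def using s by blast
qed

definition integrand :: "(real \<times> real => real) => bool" where
 "integrand g \<longleftrightarrow> (\<forall>t>0. set_borel_measurable \<mu> ({0<..t} \<times> UNIV) g) \<and> (\<forall>s z. 0 < s --> z \<notin> {0..M} --> g (s, z) = 0)"

definition J :: "(real \<times> real => real) => real => real" where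
 "J g t = (LINT x:{0<..t} \<times> UNIV|\<mu>. g x)"

lemma integrand_measurable:
 assumes "integrand g"
 shows "(\<lambda>x. indicator ({0<..t} \<times> UNIV) x * g x) \<in> borel_measurable \<mu>"
proof (cases "0 < t")
 case True
 thus ?thesis using assms by (simp add: integrand_def set_borel_measurable_def)
next
 case False
 hence "(\<lambda>x. indicator ({0<..t} \<times> UNIV) x * g x) = (\<lambda>x. 0)" by (auto simp: indicator_def)
 thus ?thesis by simp
qed

text \<open>The sets where the integrand exceeds \<open>n\<close> decrease to the empty set, so one
  of them is null: almost everywhere the integrand is bounded, and it lives on a set of finite
  measure.\<close>

lemma integrand_integrable:
 assumes g: "integrand g"
 shows "set_integrable \<mu> ({0<..t} \<times> UNIV) g"
proof -
 define f where "f x = indicator ({0<..t} \<times> UNIV) x * g x" for x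
 have f [measurable]: "f \<in> borel_measurable \<mu>" unfolding f_def by (rule integrand_measurable[OF g])
 have f0: "f x = 0" if "x \<notin> {0<..t} \<times> {0..M}" for x
  using that g by (cases x) (auto simp: f_def integrand_def indicator_def)
 define B where "B n = {x\<in>space \<mu>. real n < norm (f x)}" for n
 have Bs: "B n \<subseteq> {0<..t} \<times> {0..M}" for n
 proof
  fix x assume "x \<in> B n"
  hence "f x \<noteq> 0" by (auto simp: B_def)
  thus "x \<in> {0<..t} \<times> {0..M}" using f0 by blast
 qed
 have "\<exists>n. emeasure \<mu> (B n) = 0"
 proof (rule eventually_null)
  show "B n \<in> sets \<mu>" for n unfolding B_def by measurable
  show "B (Suc n) \<subseteq> B n" for n by (auto simp: B_def)
  show "(\<Inter>n. B n) = {}"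
  proof (rule ccontr)
   assume "(\<Inter>n. B n) \<noteq> {}"
   then obtain x where x: "\<And>n. x \<in> B n" by blast
   obtain n where "norm (f x) \<le> real n" using real_arch_simple by blast
   thus False using x[of n] by (auto simp: B_def)
  qed
  show "emeasure \<mu> (B 0) < \<infinity>" by (rule finite_strip[OF order_refl Bs])
 qed
 then obtain n where n: "emeasure \<mu> (B n) = 0" by blast
 have "B n \<in> null_sets \<mu>" using n unfolding B_def by (intro null_setsI) auto
 hence "AE x in \<mu>. \<not> real n < norm (f x)" unfolding B_def by (rule AE_I') auto
 hence "AE x in \<mu>. x \<in> {0<..t} \<times> {0..M} --> norm (f x) \<le> real n" by (auto elim!: eventually_mono)
 hence "integrable \<mu> f"
  using f0 finite_box[of t] strip_sets(1)[OF order_refl, of t] by (intro integrableI_bounded_set[where A="{0<..t} \<times> {0..M}"]) auto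
 thus ?thesis unfolding set_integrable_def f_def real_scaleR_def .
qed

lemma J_zero: "t \<le> 0 ==> J g t = 0"
 by (simp add: J_def set_lebesgue_integral_def)

lemma J_cong_AE:
 assumes "integrand g" "integrand g'" "AE x in \<mu>. indicator ({0<..s} \<times> UNIV) x * g x = indicator ({0<..t} \<times> UNIV) x * g' x"
 shows "J g s = J g' t"
 unfolding J_def set_lebesgue_integral_def real_scaleR_def
 using assms by (intro integral_cong_AE integrand_measurable)

lemma J_null:
 assumes g: "integrand g" and s: "0 \<le> s" "s \<le> t" and n: "emeasure \<mu> ({s<..t} \<times> {0..M}) = 0"
 shows "J g t = J g s"
proof (rule J_cong_AE[OF g g])
 have "{s<..t} \<times> {0..M} \<in> null_sets \<mu>" using n s by (intro null_setsI strip_sets)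
 moreover have "{x\<in>space \<mu>. \<not> indicator ({0<..t} \<times> UNIV) x * g x = indicator ({0<..s} \<times> UNIV) x * g x} \<subseteq> {s<..t} \<times> {0..M}"
  using g s by (auto simp: integrand_def indicator_def)
 ultimately show "AE x in \<mu>. indicator ({0<..t} \<times> UNIV) x * g x = indicator ({0<..s} \<times> UNIV) x * g x"
  by (rule AE_I')
qed

lemma J_right:
 assumes g: "integrand g" and t: "0 \<le> t"
 shows "\<exists>\<epsilon>>0. \<forall>u. t \<le> u --> u \<le> t + \<epsilon> --> J g u = J g t"
proof -
 obtain \<epsilon> where e: "\<epsilon> > 0" "emeasure \<mu> ({t<..t + \<epsilon>} \<times> {0..M}) = 0" using null_right[OF t] by blast
 have "J g u = J g t" if u: "t \<le> u" "u \<le> t + \<epsilon>" for u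
 proof (rule J_null[OF g t u(1)])
  have "emeasure \<mu> ({t<..u} \<times> {0..M}) \<le> emeasure \<mu> ({t<..t + \<epsilon>} \<times> {0..M})"
   using u(2) by (intro emeasure_mono strip_sets t) auto
  thus "emeasure \<mu> ({t<..u} \<times> {0..M}) = 0" using e(2) by simp
 qed
 thus ?thesis using e(1) by blast
qed

text \<open>There is at most one point at time \<open>t\<close>. Rather than locating it, its slice
  is split into the countably many level sets of the integer-valued integrand; one of them carries
  all the mass, and any element of it serves as the mark \<open>z\<close>.\<close>

lemma J_left:
 assumes g: "integrand g" and t: "0 < t"
 shows "\<exists>s\<ge>0. s < t \<and> (\<forall>u. s \<le> u --> u < t --> J g u = J g s) \<and>
  ((\<forall>z. g (t, z) \<in> \<int>) --> J g t = J g s \<or> (\<exists>z. J g t = J g s + g (t, z)))"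
proof -
 obtain s where s: "0 \<le> s" "s < t" "emeasure \<mu> ({s<..<t} \<times> {0..M}) = 0" using null_left[OF t] by blast
 have "J g u = J g s" if u: "s \<le> u" "u < t" for u
 proof (rule J_null[OF g s(1) u(1)])
  have "emeasure \<mu> ({s<..u} \<times> {0..M}) \<le> emeasure \<mu> ({s<..<t} \<times> {0..M})"
   using u s by (intro emeasure_mono strip_sets s(1)) auto
  thus "emeasure \<mu> ({s<..u} \<times> {0..M}) = 0" using s(3) by simp
 qed
 moreover have "J g t = J g s \<or> (\<exists>z. J g t = J g s + g (t, z))" if int: "\<forall>z. g (t, z) \<in> \<int>"
 proof (cases "emeasure \<mu> ({t} \<times> {0..M}) = 0")
  case True
  have "{s<..<t} \<times> {0..M} \<union> {t} \<times> {0..M} \<in> null_sets \<mu>"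
   using s True t by (intro null_sets.Un null_setsI strip_sets) auto
  moreover have "{s<..<t} \<times> {0..M} \<union> {t} \<times> {0..M} = {s<..t} \<times> {0..M}" using s(2) by auto
  ultimately have "emeasure \<mu> ({s<..t} \<times> {0..M}) = 0" by (metis null_setsD1)
  thus ?thesis using J_null[OF g s(1) less_imp_le[OF s(2)]] by blast
 next
  case False
  have ts: "{t} \<times> {0..M} \<in> sets \<mu>" using t by (intro strip_sets) simp
  define E where "E k = {x\<in>{t} \<times> {0..M}. indicator ({0<..t} \<times> UNIV) x * g x = of_int k}" for k
  have E: "E k \<in> sets \<mu>" for k
  proof -
   have "E k = {t} \<times> {0..M} \<inter> {x\<in>space \<mu>. indicator ({0<..t} \<times> UNIV) x * g x = of_int k}"
    using sets.sets_into_space[OF ts] by (auto simp: E_def)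
   moreover note [measurable] = integrand_measurable[OF g, of t]
   have "{x\<in>space \<mu>. indicator ({0<..t} \<times> UNIV) x * g x = of_int k} \<in> sets \<mu>" by measurable
   ultimately show ?thesis using ts by auto
  qed
  have "{t} \<times> {0..M} \<subseteq> (\<Union>k. E k)"
  proof
   fix x assume x: "x \<in> {t} \<times> {0..M}"
   then obtain k where "g x = of_int k" using int by (cases x) (auto elim: Ints_cases)
   thus "x \<in> (\<Union>k. E k)" using x t by (auto simp: E_def)
  qed
  hence "\<exists>k. emeasure \<mu> (E k) \<noteq> 0"
  proof (rule contrapos_pp)
   assume "\<not> (\<exists>k. emeasure \<mu> (E k) \<noteq> 0)"
   hence "(\<Union>k. E k) \<in> null_sets \<mu>" using E by (intro null_sets_UN) (auto intro: null_setsI)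
   thus "\<not> {t} \<times> {0..M} \<subseteq> (\<Union>k. E k)" using False ts null_sets_subset by blast
  qed
  then obtain k where k: "emeasure \<mu> (E k) \<noteq> 0" by blast
  have "\<not> emeasure \<mu> (E k) < 1" using k enat_valued_less_one nat_valued E sets_\<mu> by metis
  hence k1: "emeasure \<mu> ({t} \<times> {0..M}) = emeasure \<mu> (E k)" "emeasure \<mu> (E k) = 1"
   using emeasure_mono[of "E k" "{t} \<times> {0..M}" \<mu>] ts simple_points[OF t] by (auto simp: E_def)
  have "emeasure \<mu> ({t} \<times> {0..M} - E k) = 0"
   using k1 E ts by (subst emeasure_Diff) (auto simp: E_def)
  hence n1: "{t} \<times> {0..M} - E k \<in> null_sets \<mu>" using ts E by (intro null_setsI) auto
  have n2: "{s<..<t} \<times> {0..M} \<in> null_sets \<mu>" using s by (intro null_setsI strip_sets)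
  have "AE x in \<mu>. indicator ({0<..t} \<times> UNIV) x * g x - indicator ({0<..s} \<times> UNIV) x * g x = of_int k * indicator ({t} \<times> {0..M}) x"
   using AE_not_in[OF n1] AE_not_in[OF n2]
  proof (eventually_elim)
   case (elim x)
   show ?case
   proof (cases "x \<in> {t} \<times> {0..M}")
    case True
    hence "x \<in> E k" using elim by blast
    thus ?thesis using True s by (auto simp: E_def indicator_def)
   next
    case False
    thus ?thesis using elim g s t by (cases x) (auto simp: integrand_def indicator_def)
   qed
  qed
  hence "(\<integral>x. indicator ({0<..t} \<times> UNIV) x * g x - indicator ({0<..s} \<times> UNIV) x * g x \<partial>\<mu>) =
    (\<integral>x. of_int k * indicator ({t} \<times> {0..M}) x \<partial>\<mu>)"
   using integrand_measurable[OF g] ts by (intro integral_cong_AE) auto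
  also have "\<dots> = of_int k" using ts k1 sets.sets_into_space[OF ts] by (simp add: measure_def Int_absorb2)
  finally have "J g t - J g s = of_int k"
   using integrand_integrable[OF g, of t] integrand_integrable[OF g, of s]
   by (simp add: J_def set_lebesgue_integral_def set_integrable_def)
  moreover have "E k \<noteq> {}" using k by auto
  then obtain z where "g (t, z) = of_int k" using t by (auto simp: E_def)
  ultimately show ?thesis by (intro disjI2 exI[of _ z]) simp
 qed
 ultimately show ?thesis using s by blast
qed

lemma J_pwc:
 assumes "integrand g"
 shows "pwc (J g)"
 unfolding pwc_def
proof (intro conjI allI impI)
 fix t :: real assume "0 \<le> t"
 then obtain \<epsilon> where e: "\<epsilon> > 0" "\<And>u. t \<le> u ==> u \<le> t + \<epsilon> ==> J g u = J g t" using J_right[OF assms] by blast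
 have "\<forall>\<^sub>F s in at_right t. J g s = J g t"
  unfolding eventually_at_right_field using e(1) by (intro exI[of _ "t + \<epsilon>"]) (auto intro!: e(2))
 thus "\<exists>l. \<forall>\<^sub>F s in at_right t. J g s = l" by blast
next
 fix t :: real assume "0 < t"
 then obtain s where s: "s < t" "\<And>u. s \<le> u ==> u < t ==> J g u = J g s" using J_left[OF assms] by blast
 have "\<forall>\<^sub>F u in at_left t. J g u = J g s"
  unfolding eventually_at_left_field using s(1) by (intro exI[of _ s]) (auto intro!: s(2))
 thus "\<exists>l. \<forall>\<^sub>F s in at_left t. J g s = l" by blast
qed

definition cnt :: "real => ennreal" where "cnt t = emeasure \<mu> ({0<..t} \<times> {0..M})"

lemma cnt_mono: "s \<le> t ==> cnt s \<le> cnt t"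
 unfolding cnt_def by (intro emeasure_mono strip_sets) auto

lemma cnt_split:
 assumes "0 \<le> s" "s \<le> t"
 shows "cnt t = cnt s + emeasure \<mu> ({s<..t} \<times> {0..M})"
proof -
 have "{0<..t} \<times> {0..M} = {0<..s} \<times> {0..M} \<union> {s<..t} \<times> {0..M}" using assms by auto
 moreover have "({0<..s} \<times> {0..M}) \<inter> ({s<..t} \<times> {0..M}) = {}" by auto
 ultimately show ?thesis unfolding cnt_def using assms by (simp add: plus_emeasure[symmetric] strip_sets)
qed

lemma cnt_bound: "\<exists>k::nat. cnt t \<le> of_nat k"
 using nat_valued[of "{0<..t} \<times> {0..M}"] finite_box[of t] strip_sets(1)[OF order_refl, of t]
 by (auto simp: cnt_def sets_\<mu>)

text \<open>
 The integral up to \<open>t\<close> only sees the integrand at times before which fewer than \<open>N(t)\<close> points have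
 occurred.
\<close>

lemma J_cong_count:
 assumes g: "integrand g" and g': "integrand g'" and t: "cnt t < of_nat (Suc k)"
  and eq: "\<And>s z. 0 < s ==> s \<le> t ==> (\<And>u. 0 \<le> u ==> u < s ==> cnt u < of_nat k) ==> g (s, z) = g' (s, z)"
 shows "J g t = J g' t"
proof (cases "\<exists>u. 0 \<le> u \<and> u < t \<and> \<not> cnt u < of_nat k")
 case False
 show ?thesis unfolding J_def
 proof (rule set_lebesgue_integral_cong)
  show "{0<..t} \<times> UNIV \<in> sets \<mu>" by (rule strip_sets) simp
  show "\<forall>x. x \<in> {0<..t} \<times> UNIV --> g x = g' x" using False by (auto intro!: eq)
 qed
next
 case True
 define S where "S = {u. 0 \<le> u \<and> \<not> cnt u < of_nat k}"
 \<comment> \<open>The first time at which \<open>k\<close> points have occurred. Just after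
   \<sigma> there is a gap without points, so the count has reached \<open>k\<close> at \<sigma>
   itself; as fewer than \<open>k + 1\<close> points occur up to \<open>t\<close>, none is left
   after \<sigma>.\<close>
 define \<sigma> where "\<sigma> = Inf S"
 have S: "S \<noteq> {}" "bdd_below S" using True by (auto simp: S_def bdd_below_def)
 have s0: "0 \<le> \<sigma>" unfolding \<sigma>_def using S(1) by (rule cInf_greatest) (simp add: S_def)
 obtain u where u: "u \<in> S" "u < t" using True by (auto simp: S_def)
 have st: "\<sigma> \<le> t" using cInf_lower[OF u(1) S(2)] u(2) by (simp add: \<sigma>_def)
 obtain \<epsilon> where e: "\<epsilon> > 0" "emeasure \<mu> ({\<sigma><..\<sigma> + \<epsilon>} \<times> {0..M}) = 0" using null_right[OF s0] by blast
 obtain v where v: "v \<in> S" "v < \<sigma> + \<epsilon>" using cInf_lessD[OF S(1), of "\<sigma> + \<epsilon>"] e(1) by (auto simp: \<sigma>_def)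
 have "cnt v \<le> cnt (\<sigma> + \<epsilon>)" using v by (intro cnt_mono) simp
 also have "\<dots> = cnt \<sigma>" using cnt_split[OF s0, of "\<sigma> + \<epsilon>"] e by simp
 finally have "of_nat k \<le> cnt \<sigma>" using v(1) by (auto simp: S_def not_less intro: order_trans)
 hence "cnt t \<noteq> cnt \<sigma> + 1 + c" for c
 proof (intro notI)
  assume "of_nat k \<le> cnt \<sigma>" "cnt t = cnt \<sigma> + 1 + c"
  hence "of_nat (Suc k) \<le> cnt t" using add_increasing2[of c "of_nat k" "cnt \<sigma>"] by (simp add: ac_simps)
  thus False using t by simp
 qed
 hence "emeasure \<mu> ({\<sigma><..t} \<times> {0..M}) < 1"
  using cnt_split[OF s0 st] by (metis add.assoc le_iff_add not_le)
 moreover have "emeasure \<mu> ({\<sigma><..t} \<times> {0..M}) \<in> insert \<infinity> (range of_nat)"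
  using strip_sets(1)[OF s0, of t] by (intro nat_valued) (simp add: sets_\<mu>)
 ultimately have null: "emeasure \<mu> ({\<sigma><..t} \<times> {0..M}) = 0" using enat_valued_less_one by blast
 have "J g \<sigma> = J g' \<sigma>" unfolding J_def
 proof (rule set_lebesgue_integral_cong)
  show "\<forall>x. x \<in> {0<..\<sigma>} \<times> UNIV --> g x = g' x"
  proof (intro allI impI)
   fix x :: "real \<times> real" assume x: "x \<in> {0<..\<sigma>} \<times> UNIV"
   have "cnt u < of_nat k" if "0 \<le> u" "u < fst x" for u
   proof (rule ccontr)
    assume "\<not> ?thesis"
    hence "\<sigma> \<le> u" unfolding \<sigma>_def using that by (intro cInf_lower S(2)) (simp add: S_def)
    thus False using that x by auto
   qed
   hence "g (fst x, snd x) = g' (fst x, snd x)" using x st by (intro eq) auto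
   thus "g x = g' x" by simp
  qed
 qed (rule strip_sets, simp)
 thus ?thesis using J_null[OF g s0 st null] J_null[OF g' s0 st null] by simp
qed

end

section \<open>Almost sure properties and adapted integrals of the random measure\<close>

locale poisson_space = filtered_space P F for P :: "'a measure" and F +
 fixes p :: "'a => (real \<times> real) measure"
 assumes prm: "adapted_poisson_random_measure P F p"
begin

lemma prm_poisson: "poisson_random_measure P jump_intensity p"
 using prm unfolding adapted_poisson_random_measure_def by (rule conjunct1)

lemma sets_p: "w \<in> space P ==> sets (p w) = sets jump_intensity"
 using prm_poisson by (simp add: poisson_random_measure_def)

lemma p_measurable: "B \<in> sets jump_intensity ==> (\<lambda>w. emeasure (p w) B) \<in> borel_measurable P"
 using prm_poisson by (simp add: poisson_random_measure_def)

lemma p_measurable_F: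
 "0 \<le> t ==> B \<in> sets jump_intensity ==> B \<subseteq> {0..t} \<times> UNIV ==> (\<lambda>w. emeasure (p w) B) \<in> borel_measurable (F t)"
 using prm unfolding adapted_poisson_random_measure_def by blast

lemma p_nat_valued: "AE w in P. \<forall>B\<in>sets jump_intensity. emeasure (p w) B \<in> insert \<infinity> (range of_nat)"
 using prm_poisson unfolding poisson_random_measure_def by blast

lemma p_prob:
 assumes "B \<in> sets jump_intensity" "emeasure jump_intensity B < \<infinity>"
 shows "prob {w\<in>space P. emeasure (p w) B = of_nat k} = measure jump_intensity B ^ k / fact k * exp (- measure jump_intensity B)"
 using prm_poisson assms unfolding poisson_random_measure_def by blast

lemma p_level_sets:
 "B \<in> sets jump_intensity ==> {w\<in>space P. emeasure (p w) B = c} \<in> events"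
 using p_measurable[of B] by measurable

text \<open>The Poisson weights over the natural numbers already sum to 1.\<close>

lemma p_finite:
 assumes B: "B \<in> sets jump_intensity" "emeasure jump_intensity B < \<infinity>"
 shows "AE w in P. emeasure (p w) B < \<infinity>"
proof -
 define x where "x = measure jump_intensity B"
 define A where "A k = {w\<in>space P. emeasure (p w) B = of_nat k}" for k :: nat
 have A: "A k \<in> events" for k unfolding A_def by (rule p_level_sets[OF B(1)])
 have "disjoint_family A" by (auto simp: disjoint_family_on_def A_def)
 hence "(\<lambda>k. prob (A k)) sums prob (\<Union>k. A k)" using A by (intro finite_measure_UNION) auto
 moreover have "(\<lambda>k. (x ^ k /\<^sub>R fact k) * exp (- x)) sums (exp x * exp (- x))"
  by (intro sums_mult2 exp_converges)
 hence "(\<lambda>k. prob (A k)) sums 1"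
  unfolding A_def p_prob[OF B] x_def by (simp add: exp_minus divide_inverse mult.commute)
 ultimately have "prob (\<Union>k. A k) = 1" by (rule sums_unique2)
 hence "AE w in P. w \<in> (\<Union>k. A k)" by (rule AE_prob_1)
 thus ?thesis by (rule eventually_mono) (auto simp: A_def of_nat_less_top)
qed

text \<open>From \<open>exp (- x) >= 1 - x\<close> the values 0 and 1 together have probability at
  least \<open>(1 + x) * (1 - x) = 1 - x^2\<close>. The event also contains the infinite
  values.\<close>

lemma p_at_least_two:
 assumes B: "B \<in> sets jump_intensity" "emeasure jump_intensity B < \<infinity>"
 shows "prob {w\<in>space P. emeasure (p w) B \<noteq> 0 \<and> emeasure (p w) B \<noteq> 1} \<le> (measure jump_intensity B)\<^sup>2"
proof -
 define x where "x = measure jump_intensity B"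
 define A where "A k = {w\<in>space P. emeasure (p w) B = of_nat k}" for k :: nat
 have A: "A k \<in> events" for k unfolding A_def by (rule p_level_sets[OF B(1)])
 have "A 0 \<inter> A 1 = {}" by (auto simp: A_def)
 hence "prob (A 0 \<union> A 1) = prob (A 0) + prob (A 1)" using A by (intro finite_measure_Union)
 also have "\<dots> = (1 + x) * exp (- x)" unfolding A_def p_prob[OF B] x_def by (simp add: algebra_simps)
 also have "\<dots> \<ge> (1 + x) * (1 - x)"
  using exp_ge_add_one_self[of "- x"] by (intro mult_left_mono) (auto simp: x_def)
 finally have "prob (A 0 \<union> A 1) \<ge> 1 - x\<^sup>2" by (simp add: algebra_simps power2_eq_square)
 moreover have "{w\<in>space P. emeasure (p w) B \<noteq> 0 \<and> emeasure (p w) B \<noteq> 1} = space P - (A 0 \<union> A 1)" by (auto simp: A_def)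
 ultimately show ?thesis using A by (simp add: prob_compl x_def)
qed

lemma strip_intensity:
 assumes "0 \<le> s" "s \<le> t" "0 \<le> M"
 shows "{s<..t} \<times> {0..M} \<in> sets jump_intensity" "emeasure jump_intensity ({s<..t} \<times> {0..M}) < \<infinity>"
  and "measure jump_intensity ({s<..t} \<times> {0..M}) = (t - s) * M"
proof -
 show "{s<..t} \<times> {0..M} \<in> sets jump_intensity" using assms by (intro Times_in_jump_intensity) auto
 have *: "emeasure jump_intensity ({s<..t} \<times> {0..M}) = ennreal ((t - s) * M)"
  using assms by (subst emeasure_jump_intensity) (auto simp: ennreal_mult)
 thus "emeasure jump_intensity ({s<..t} \<times> {0..M}) < \<infinity>" by simp
 show "measure jump_intensity ({s<..t} \<times> {0..M}) = (t - s) * M" using * assms by (simp add: measure_def)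
qed

text \<open>
 Cut \<open>(0,T]\<close> into \<open>n\<close> strips: the probability that one of them carries two points is \<open>O(1/n)\<close>.
\<close>

lemma p_simple_until:
 assumes M: "0 \<le> M" and T: "0 < T"
 shows "AE w in P. \<forall>t. 0 < t --> t \<le> T --> emeasure (p w) ({t} \<times> {0..M}) \<le> 1"
proof -
 define S where "S n j = {T * real j / real n<..T * real (Suc j) / real n} \<times> {0..M}" for n j
 define A where "A n j = {w\<in>space P. emeasure (p w) (S n j) \<noteq> 0 \<and> emeasure (p w) (S n j) \<noteq> 1}" for n j
 have or: "0 \<le> T * real j / real n" "T * real j / real n \<le> T * real (Suc j) / real n" for n j
  using T by (auto intro!: divide_right_mono mult_left_mono)
 have S: "S n j \<in> sets jump_intensity" "emeasure jump_intensity (S n j) < \<infinity>" for n j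
  unfolding S_def by (rule strip_intensity[OF or M])+
 have mS: "measure jump_intensity (S n j) = T * M / real n" for n j
  unfolding S_def strip_intensity(3)[OF or M] by (simp add: algebra_simps diff_divide_distrib[symmetric])
 have A: "A n j \<in> events" for n j
  unfolding A_def using p_measurable[OF S(1)[of n j]] by measurable
 define B where "B n = (\<Union>j<n. A n j)" for n
 have B: "B n \<in> events" for n unfolding B_def using A by blast
 \<comment> \<open>A single \<open>n\<close> none of whose strips carries two points is enough, so
   the exceptional event is contained in every \<open>B n\<close>.\<close>
 have "prob (\<Inter>n\<in>{1..}. B n) = 0"
 proof -
  have le: "prob (\<Inter>n\<in>{1..}. B n) \<le> (T * M)\<^sup>2 / real (Suc m)" for m
  proof -
   have "(\<Inter>n\<in>{1..}. B n) \<subseteq> B (Suc m)" by auto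
   hence "prob (\<Inter>n\<in>{1..}. B n) \<le> prob (B (Suc m))" by (rule finite_measure_mono[OF _ B])
   also have "\<dots> \<le> (\<Sum>j<Suc m. prob (A (Suc m) j))"
    unfolding B_def using A by (intro finite_measure_subadditive_finite) auto
   also have "\<dots> \<le> (\<Sum>j<Suc m. (T * M / real (Suc m))\<^sup>2)"
    by (intro sum_mono order_trans[OF p_at_least_two[OF S, folded A_def]]) (simp only: mS order_refl)
   also have "\<dots> = real (Suc m) * (T * M / real (Suc m))\<^sup>2" by simp
   also have "\<dots> = (T * M)\<^sup>2 / real (Suc m)" unfolding power_divide by (simp only: power2_eq_square) (simp del: of_nat_Suc)
   finally show ?thesis .
  qed
  have "(\<lambda>m. (T * M)\<^sup>2 / real (Suc m)) \<longlonglongrightarrow> 0"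
   using tendsto_mult_right_zero[OF LIMSEQ_inverse_real_of_nat, of "(T * M)\<^sup>2"] by (simp add: divide_inverse)
  hence "prob (\<Inter>n\<in>{1..}. B n) \<le> 0" by (rule LIMSEQ_le_const) (use le in blast)
  thus ?thesis using measure_nonneg[of P "\<Inter>n\<in>{1..}. B n"] by linarith
 qed
 moreover have IB: "(\<Inter>n\<in>{1..}. B n) \<in> events" using B by (intro sets.countable_INT') auto
 ultimately have "AE w in P. w \<notin> (\<Inter>n\<in>{1..}. B n)" by (intro AE_not_in) (auto simp: null_sets_def emeasure_eq_measure)
 thus ?thesis using AE_space
 proof eventually_elim
  case (elim w)
  then obtain n where n: "1 \<le> n" "w \<notin> B n" by auto
  show ?case
  proof (intro allI impI)
   fix t assume t: "0 < t" "t \<le> T"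
   define y where "y = t * real n / T"
   have y: "0 < y" "y \<le> real n" using t T n(1) by (auto simp: y_def field_simps)
   define j where "j = nat (\<lceil>y\<rceil> - 1)"
   have j: "real j < y" "y \<le> real (Suc j)" "j < n" using y unfolding j_def by linarith+
   have ty: "t = T * y / real n" using T n(1) by (simp add: y_def)
   have "T * real j / real n < t" "t \<le> T * real (Suc j) / real n"
    unfolding ty using j(1,2) T n(1) by (auto intro!: divide_strict_right_mono divide_right_mono)
   hence "{t} \<times> {0..M} \<subseteq> S n j" by (auto simp: S_def)
   hence "emeasure (p w) ({t} \<times> {0..M}) \<le> emeasure (p w) (S n j)"
    using S(1) sets_p elim(2) by (intro emeasure_mono) auto
   also have "emeasure (p w) (S n j) = 0 \<or> emeasure (p w) (S n j) = 1" using n(2) j(3) elim(2) by (auto simp: B_def A_def)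
   hence "emeasure (p w) (S n j) \<le> 1" by (elim disjE) simp_all
   finally show "emeasure (p w) ({t} \<times> {0..M}) \<le> 1" .
  qed
 qed
qed

lemma p_point_config:
 assumes M: "0 \<le> M"
 shows "AE w in P. point_config M (p w)"
proof -
 have "AE w in P. \<forall>n::nat. emeasure (p w) ({0<..real n} \<times> {0..M}) < \<infinity>"
  unfolding AE_all_countable by (intro allI p_finite strip_intensity M) auto
 moreover have "AE w in P. \<forall>n::nat. \<forall>t. 0 < t --> t \<le> real (Suc n) --> emeasure (p w) ({t} \<times> {0..M}) \<le> 1"
  unfolding AE_all_countable by (intro allI p_simple_until M) simp
 ultimately show ?thesis using p_nat_valued AE_space
 proof eventually_elim
  case (elim w)
  show ?case
  proof
   show "sets (p w) = sets jump_intensity" by (rule sets_p[OF elim(4)])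
   show "emeasure (p w) B \<in> insert \<infinity> (range of_nat)" if "B \<in> sets jump_intensity" for B using elim(3) that by blast
   show "emeasure (p w) ({0<..T} \<times> {0..M}) < \<infinity>" for T
   proof -
    obtain n where n: "T \<le> real n" using real_arch_simple by blast
    have "emeasure (p w) ({0<..T} \<times> {0..M}) \<le> emeasure (p w) ({0<..real n} \<times> {0..M})"
     using n strip_intensity(1)[of 0 "real n" M] M sets_p[OF elim(4)] by (intro emeasure_mono) auto
    also have "\<dots> < \<infinity>" using elim(1) by blast
    finally show ?thesis .
   qed
   show "emeasure (p w) ({t} \<times> {0..M}) \<le> 1" if "0 < t" for t
   proof -
    obtain n where "t \<le> real n" using real_arch_simple by blast
    hence "t \<le> real (Suc n)" by simp
    thus ?thesis using elim(2) that by blast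
   qed
  qed
 qed
qed

text \<open>The restriction of \<open>p w\<close> to the relevant box is divided by its mass
  \<open>N w\<close> to become a subprobability kernel over \<open>F t\<close>, for which
  measurability of integrals is known, and the result is multiplied by \<open>N w\<close> again.
  This fails only where \<open>N w\<close> is infinite, a null event.\<close>

lemma nn_integral_kernel_measurable:
 fixes f :: "'a => real \<times> real => ennreal"
 assumes M: "0 \<le> M" and t: "0 \<le> t"
  and f: "(\<lambda>(w, x). f w x) \<in> borel_measurable (F t \<Otimes>\<^sub>M jump_intensity)"
  and supp: "\<And>w x. x \<notin> {0<..t} \<times> {0..M} ==> f w x = 0"
 shows "(\<lambda>w. \<integral>\<^sup>+x. f w x \<partial>p w) \<in> borel_measurable (F t)"
proof -
 define C where "C = {0<..t} \<times> {0..M}"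
 have C: "C \<in> sets jump_intensity" unfolding C_def by (rule strip_intensity[OF order_refl t M])
 have Cfin: "emeasure jump_intensity C < \<infinity>" unfolding C_def by (rule strip_intensity[OF order_refl t M])
 define N where "N w = emeasure (p w) C" for w
 have Nm [measurable]: "N \<in> borel_measurable (F t)" unfolding N_def using t C by (intro p_measurable_F) (auto simp: C_def)
 define \<kappa> where "\<kappa> w = density (p w) (\<lambda>x. inverse (N w) * indicator C x)" for w
 have dm: "(\<lambda>x. inverse (N w) * indicator C x) \<in> borel_measurable (p w)" if "w \<in> space P" for w
  using C sets_p[OF that] by (intro borel_measurable_times_ennreal borel_measurable_indicator) auto
 define \<kappa>' where "\<kappa>' w = (if N w = 0 then null_measure jump_intensity else \<kappa> w)" for w
 have em: "emeasure (\<kappa> w) A = inverse (N w) * emeasure (p w) (A \<inter> C)"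
  if w: "w \<in> space P" and A: "A \<in> sets jump_intensity" for w A
 proof -
  have "emeasure (\<kappa> w) A = (\<integral>\<^sup>+x. inverse (N w) * indicator C x * indicator A x \<partial>p w)"
   unfolding \<kappa>_def using dm[OF w] A sets_p[OF w] by (intro emeasure_density) auto
  also have "\<dots> = (\<integral>\<^sup>+x. inverse (N w) * indicator (A \<inter> C) x \<partial>p w)"
   by (intro nn_integral_cong) (auto simp: indicator_def)
  also have "\<dots> = inverse (N w) * emeasure (p w) (A \<inter> C)"
   using A C sets_p[OF w] by (intro nn_integral_cmult_indicator) auto
  finally show ?thesis .
 qed
 have kernel: "\<kappa>' \<in> measurable (F t) (subprob_algebra jump_intensity)"
 proof (rule measurable_subprob_algebra)
  fix w assume "w \<in> space (F t)"
  hence w: "w \<in> space P" using t by simp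
  have sk: "sets (\<kappa>' w) = sets jump_intensity" using sets_p[OF w] by (simp add: \<kappa>'_def \<kappa>_def)
  show "sets (\<kappa>' w) = sets jump_intensity" by (rule sk)
  show "subprob_space (\<kappa>' w)"
  proof
   have sp: "space (\<kappa>' w) = space jump_intensity" using sk by (rule sets_eq_imp_space_eq)
   show "space (\<kappa>' w) \<noteq> {}" by (simp add: sp space_jump_intensity)
   show "emeasure (\<kappa>' w) (space (\<kappa>' w)) \<le> 1"
   proof (cases "N w = 0")
    case False
    hence "emeasure (\<kappa>' w) (space (\<kappa>' w)) = inverse (N w) * emeasure (p w) (space jump_intensity \<inter> C)"
     unfolding sp using em[OF w, of "space jump_intensity"] by (simp add: \<kappa>'_def)
    also have "space jump_intensity \<inter> C = C" using sets.sets_into_space[OF C] by blast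
    also have "inverse (N w) * emeasure (p w) C \<le> 1" unfolding N_def[symmetric] using False
     using ennreal_divide_self[of "N w"] by (cases "N w = \<infinity>") (auto simp: divide_ennreal_def mult.commute less_top)
    finally show ?thesis .
   qed (simp add: \<kappa>'_def)
  qed
 next
  fix A assume A: "A \<in> sets jump_intensity"
  have [measurable]: "(\<lambda>w. emeasure (p w) (A \<inter> C)) \<in> borel_measurable (F t)"
   using A C t by (intro p_measurable_F) (auto simp: C_def)
  have "(\<lambda>w. if N w = 0 then 0 else inverse (N w) * emeasure (p w) (A \<inter> C)) \<in> borel_measurable (F t)" by measurable
  thus "(\<lambda>w. emeasure (\<kappa>' w) A) \<in> borel_measurable (F t)"
   by (rule measurable_cong[THEN iffD1, rotated]) (use em[OF _ A] t in \<open>auto simp: \<kappa>'_def\<close>)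
 qed
 have [measurable]: "(\<lambda>w. \<integral>\<^sup>+x. f w x \<partial>\<kappa>' w) \<in> borel_measurable (F t)"
  by (rule nn_integral_measurable_subprob_algebra2[OF f kernel])
 have "(\<lambda>w. N w * (\<integral>\<^sup>+x. f w x \<partial>\<kappa>' w)) \<in> borel_measurable (F t)" by measurable
 thus ?thesis
 proof (rule measurable_F_AE_cong[OF _ t])
  have "AE w in P. N w < \<infinity>" unfolding N_def by (rule p_finite[OF C Cfin])
  thus "AE w in P. N w * (\<integral>\<^sup>+x. f w x \<partial>\<kappa>' w) = (\<integral>\<^sup>+x. f w x \<partial>p w)" using AE_space
  proof eventually_elim
   case (elim w)
   have fx: "(\<lambda>x. f w x) \<in> borel_measurable (p w)"
   proof -
    have "w \<in> space (F t)" using elim(2) t by simp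
    hence "(\<lambda>x. (\<lambda>(w, x). f w x) (w, x)) \<in> borel_measurable jump_intensity"
     by (rule measurable_compose[OF measurable_Pair1' f])
    thus ?thesis by (simp add: measurable_cong_sets[OF sets_p[OF elim(2)] refl])
   qed
   show ?case
   proof (cases "N w = 0")
    case True
    have "AE x in p w. x \<notin> C" using True C sets_p[OF elim(2)] by (intro AE_not_in) (auto simp: null_sets_def N_def)
    hence "AE x in p w. f w x = 0" using supp by (auto simp: C_def elim!: eventually_mono)
    hence "(\<integral>\<^sup>+x. f w x \<partial>p w) = 0" using nn_integral_0_iff_AE[OF fx] by simp
    thus ?thesis using True by simp
   next
    case False
    have "(\<integral>\<^sup>+x. f w x \<partial>\<kappa>' w) = (\<integral>\<^sup>+x. inverse (N w) * indicator C x * f w x \<partial>p w)"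
     using False unfolding \<kappa>'_def \<kappa>_def by (simp add: nn_integral_density[OF dm[OF elim(2)] fx])
    also have "\<dots> = (\<integral>\<^sup>+x. inverse (N w) * f w x \<partial>p w)"
     by (intro nn_integral_cong) (use supp in \<open>auto simp: C_def indicator_def\<close>)
    also have "\<dots> = inverse (N w) * (\<integral>\<^sup>+x. f w x \<partial>p w)" by (rule nn_integral_cmult[OF fx])
    finally have "N w * (\<integral>\<^sup>+x. f w x \<partial>\<kappa>' w) = N w * inverse (N w) * (\<integral>\<^sup>+x. f w x \<partial>p w)" by (simp add: mult.assoc)
    also have "N w * inverse (N w) = 1" using False elim(1) ennreal_divide_self[of "N w"] by (simp add: divide_ennreal_def)
    finally show ?thesis by simp
   qed
  qed
 qed simp
qed

lemma integral_kernel_measurable: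
 fixes f :: "'a => real \<times> real => real"
 assumes M: "0 \<le> M" and t: "0 \<le> t"
  and f: "(\<lambda>(w, x). f w x) \<in> borel_measurable (F t \<Otimes>\<^sub>M jump_intensity)"
  and supp: "\<And>w x. x \<notin> {0<..t} \<times> {0..M} ==> f w x = 0"
  and int: "AE w in P. integrable (p w) (f w)"
 shows "(\<lambda>w. \<integral>x. f w x \<partial>p w) \<in> borel_measurable (F t)"
proof -
 have f': "(\<lambda>x. f (fst x) (snd x)) \<in> borel_measurable (F t \<Otimes>\<^sub>M jump_intensity)" using f by (simp add: case_prod_beta')
 have "(\<lambda>w. \<integral>\<^sup>+x. ennreal (f w x) \<partial>p w) \<in> borel_measurable (F t)"
  using f' supp by (intro nn_integral_kernel_measurable[OF M t]) (auto simp: case_prod_beta')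
 moreover have "(\<lambda>w. \<integral>\<^sup>+x. ennreal (- f w x) \<partial>p w) \<in> borel_measurable (F t)"
  using f' supp by (intro nn_integral_kernel_measurable[OF M t]) (auto simp: case_prod_beta')
 ultimately have "(\<lambda>w. enn2real (\<integral>\<^sup>+x. ennreal (f w x) \<partial>p w) - enn2real (\<integral>\<^sup>+x. ennreal (- f w x) \<partial>p w)) \<in> borel_measurable (F t)"
  by measurable
 thus ?thesis
  by (rule measurable_F_AE_cong[OF _ t]) (use int in \<open>auto simp: real_lebesgue_integral_def elim!: eventually_mono\<close>)
qed

end

section \<open>Existence\<close>

text \<open>Proof by looking at the infimum of the counterexamples. It does the work of an induction
  over successive jump times.\<close>

lemma real_induction:
 fixes Q :: "real => bool"
 assumes zero: "Q 0"
  and right: "\<And>t. 0 \<le> t ==> (\<And>s. 0 \<le> s ==> s \<le> t ==> Q s) ==> \<exists>\<epsilon>>0. \<forall>u. t \<le> u --> u \<le> t + \<epsilon> --> Q u"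
  and left: "\<And>t. 0 < t ==> (\<And>s. 0 \<le> s ==> s < t ==> Q s) ==> Q t"
  and t: "0 \<le> t"
 shows "Q t"
proof (rule ccontr)
 assume n: "\<not> Q t"
 define S where "S = {u. 0 \<le> u \<and> \<not> Q u}"
 have S: "S \<noteq> {}" "bdd_below S" using n t by (auto simp: S_def bdd_below_def)
 have i0: "0 \<le> Inf S" using S(1) by (rule cInf_greatest) (simp add: S_def)
 have below: "Q s" if "0 \<le> s" "s < Inf S" for s
  using cInf_lower[OF _ S(2), of s] that by (force simp: S_def)
 have "Q (Inf S)" using zero left[of "Inf S"] below i0 by (cases "Inf S = 0") auto
 hence "Q s" if "0 \<le> s" "s \<le> Inf S" for s using below that by (cases "s = Inf S") auto
 then obtain \<epsilon> where e: "\<epsilon> > 0" "\<And>u. Inf S \<le> u ==> u \<le> Inf S + \<epsilon> ==> Q u" using right[OF i0] by blast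
 obtain v where "v \<in> S" "v < Inf S + \<epsilon>" using cInf_lessD[OF S(1), of "Inf S + \<epsilon>"] e(1) by auto
 thus False using e(2)[of v] cInf_lower[OF _ S(2), of v] by (auto simp: S_def)
qed

lemma left_limit_eventually:
 fixes a :: "real => 'b::t2_space"
 assumes "\<forall>\<^sub>F u in at_left s. a u = v"
 shows "left_limit a s = v"
 unfolding left_limit_def by (rule tendsto_Lim) (use assms in \<open>auto intro: tendsto_eventually\<close>)

lemma left_limit_cong:
 fixes a a' :: "real => 'b::t2_space"
 assumes "0 < s" "\<And>u. 0 \<le> u ==> u < s ==> a u = a' u"
 shows "left_limit a s = left_limit a' s"
proof -
 have "\<forall>\<^sub>F u in at_left s. a u = a' u"
  unfolding eventually_at_left_field using assms by (intro exI[of _ 0]) auto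
 hence "(a \<longlongrightarrow> l) (at_left s) \<longleftrightarrow> (a' \<longlongrightarrow> l) (at_left s)" for l by (rule tendsto_cong)
 thus ?thesis by (simp add: left_limit_def Topological_Spaces.Lim_def)
qed

context switching
begin

definition jumps :: "(real => real^'n) => (real => nat) => real \<times> real => real" where
 "jumps y a x = height (segment r y (fst x)) (left_limit a (fst x)) (snd x)"

lemma segment_in_mspace: "continuous_on {-r..T} y ==> 0 \<le> s ==> s \<le> T ==> segment r y s \<in> mspace (path_space r)"
 unfolding mspace_path_space segment_def
 by (subst mem_Collect_eq, rule conjI, simp, subst continuous_on_cong[OF refl, where g="\<lambda>u. y (s + u)"])
  (auto intro!: continuous_on_compose2[of "{-r..T}" y] continuous_intros)

lemma segment_cong: "(\<And>u. -r \<le> u ==> u \<le> s ==> y u = y' u) ==> 0 \<le> s ==> segment r y s = segment r y' s"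
 unfolding segment_def by (rule restrict_ext) auto

lemma jumps_cong:
 assumes "0 < s" "\<And>u. -r \<le> u ==> u \<le> s ==> y u = y' u" "\<And>u. 0 \<le> u ==> u < s ==> a u = a' u"
 shows "jumps y a (s, z) = jumps y' a' (s, z)"
 using segment_cong[of s y y'] left_limit_cong[of s a a'] assms by (simp add: jumps_def)

lemma jumps_support:
 assumes "continuous_on {-r..s} y" "0 < s" "z \<notin> {0..M}"
 shows "jumps y a (s, z) = 0"
 using jump_height_support[OF _ segment_in_mspace[OF assms(1)] assms(3)] assms(2) by (simp add: jumps_def height_def)

lemma jumps_range:
 assumes y: "continuous_on {-r..s} y" "0 < s" and a: "left_limit a s = v" "1 \<le> v"
 shows "\<exists>j\<ge>1. jumps y a (s, z) = real j - real v"
 using jump_height_range[OF _ segment_in_mspace[OF y(1)], of v s z] y(2) a by (auto simp: jumps_def height_def)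

lemma jumps_Ints:
 assumes "continuous_on {-r..s} y" "0 < s"
 shows "jumps y a (s, z) \<in> \<int>"
proof (cases "1 \<le> left_limit a s")
 case True
 thus ?thesis using jumps_range[OF assms refl, of a z] by auto
qed (simp add: jumps_def height_def)

end

locale hybrid_space = sde_space P F W b \<sigma> L + poisson_space P F p + switching r q M
 for P :: "'a measure" and F and W :: "real => 'a => real^'d" and b :: "real^'n => nat => real^'n" and \<sigma> L p r
  and q :: "'n intensities" and M +
 fixes \<xi> :: "'a => real => real^'n" and i\<^sub>0 :: "'a => nat"
 assumes \<xi>: "\<xi> \<in> measurable (F 0) (path_borel r)" and i0: "i\<^sub>0 \<in> measurable (F 0) (count_space {1..})"
begin

text \<open>The diffusion starts at \<open>\<xi> w 0\<close> only almost surely; shifting it by its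
  initial error glues every path continuously to the initial segment, so that its segments always
  lie in the path space.\<close>

definition extend :: "(real => 'a => real^'n) => real => 'a => real^'n" where
 "extend X t w = (if t \<le> 0 then \<xi> w t else X t w - X 0 w + \<xi> w 0)"

lemma \<xi>_eval: "u \<in> {-r..0} ==> (\<lambda>w. \<xi> w u) \<in> borel_measurable (F 0)"
 by (rule measurable_compose[OF \<xi> measurable_path_evaluation[OF r_pos]])

lemma extend_measurable:
 assumes X: "cont_proc X" and t: "0 \<le> t" and u: "-r \<le> u" "u \<le> t"
 shows "extend X u \<in> borel_measurable (F t)"
proof (cases "u \<le> 0")
 case True
 hence "extend X u = (\<lambda>w. \<xi> w u)" by (auto simp: extend_def)
 thus ?thesis using measurable_F_mono[OF \<xi>_eval, of u t] True t u by simp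
next
 case False
 hence "extend X u = (\<lambda>w. X u w - X 0 w + \<xi> w 0)" by (auto simp: extend_def)
 moreover have "X u \<in> borel_measurable (F t)" "X 0 \<in> borel_measurable (F t)" "(\<lambda>w. \<xi> w 0) \<in> borel_measurable (F t)"
  using X False t u r_pos measurable_F_mono[of "X u" u borel t] measurable_F_mono[of "X 0" 0 borel t]
   measurable_F_mono[OF \<xi>_eval[of 0], of t] by (auto simp: cont_proc_def)
 ultimately show ?thesis by simp
qed

lemma extend_continuous:
 assumes X: "cont_proc X" and w: "w \<in> space P"
 shows "continuous_on {-r..} (\<lambda>t. extend X t w)"
proof -
 have "\<xi> w \<in> mspace (path_space r)" using measurable_space[OF \<xi>] w by simp
 hence "continuous_on {-r..0} (\<lambda>t. extend X t w)"
  by (subst continuous_on_cong[OF refl, where g="\<xi> w"]) (auto simp: extend_def mspace_path_space)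
 moreover have "continuous_on {0..} (\<lambda>t. X t w - X 0 w + \<xi> w 0)"
  using X by (intro continuous_intros) (simp add: cont_proc_def)
 hence "continuous_on {0..} (\<lambda>t. extend X t w)"
  by (subst continuous_on_cong[OF refl, where g="\<lambda>t. X t w - X 0 w + \<xi> w 0"]) (auto simp: extend_def)
 ultimately have "continuous_on ({-r..0} \<union> {0..}) (\<lambda>t. extend X t w)" by (intro continuous_on_closed_Un) auto
 moreover have "{-r..0} \<union> {0..} = {-r..}" using r_pos by auto
 ultimately show ?thesis by simp
qed

lemma extend_continuous_until:
 "cont_proc X ==> w \<in> space P ==> continuous_on {-r..s} (\<lambda>t. extend X t w)"
 by (rule continuous_on_subset[OF extend_continuous]) auto

lemma joint_segment_measurable:
 assumes X: "cont_proc X" and t: "0 \<le> t"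
 shows "(\<lambda>(w, s, z). segment r (\<lambda>u. extend X u w) (min t s)) \<in> measurable (F t \<Otimes>\<^sub>M jump_intensity) (path_borel r)"
proof (rule measurable_path_borelI[OF r_pos])
 fix x assume "x \<in> space (F t \<Otimes>\<^sub>M jump_intensity)"
 hence x: "fst x \<in> space P" "0 \<le> fst (snd x)" using t by (auto simp: space_pair_measure space_jump_intensity)
 show "(case x of (w, s, z) => segment r (\<lambda>u. extend X u w) (min t s)) \<in> mspace (path_space r)"
  using segment_in_mspace[OF extend_continuous_until[OF X x(1)], of "min t (fst (snd x))" t] x(2) t by (simp add: case_prod_beta)
next
 fix u assume u: "u \<in> {-r..0}"
 \<comment> \<open>Time is shifted by \<open>r\<close>, since joint measurability is available for
   processes indexed by the half-line; stopping at \<open>t\<close> keeps everything inside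
   \<open>F t\<close>.\<close>
 define Z where "Z v = extend X (min t (v - r))" for v
 have "(\<lambda>(v, w). Z (max 0 v) w) \<in> borel_measurable (borel \<Otimes>\<^sub>M F t)"
 proof (rule joint_measurable_continuous)
  show "Z v \<in> borel_measurable (F t)" if "0 \<le> v" for v
   unfolding Z_def using that t r_pos by (intro extend_measurable[OF X]) auto
  show "continuous_on {0..} (\<lambda>v. Z v w)" if "w \<in> space (F t)" for w
   unfolding Z_def using that t r_pos
   by (intro continuous_on_compose2[OF extend_continuous[OF X]] continuous_intros) auto
 qed
 hence "(\<lambda>x. (\<lambda>(v, w). Z (max 0 v) w) (min t (fst (snd x)) + u + r, fst x)) \<in> borel_measurable (F t \<Otimes>\<^sub>M jump_intensity)"
 proof (rule measurable_compose[rotated])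
  have "fst \<in> borel_measurable jump_intensity"
   by (subst measurable_cong_sets[OF sets_jump_intensity refl]) (intro measurable_restrict_space1 borel_measurable_continuous_onI continuous_intros)
  thus "(\<lambda>x. (min t (fst (snd x)) + u + r, fst x)) \<in> measurable (F t \<Otimes>\<^sub>M jump_intensity) (borel \<Otimes>\<^sub>M F t)"
   by measurable
 qed
 thus "(\<lambda>x. (case x of (w, s, z) => segment r (\<lambda>u. extend X u w) (min t s)) u) \<in> borel_measurable (F t \<Otimes>\<^sub>M jump_intensity)"
 proof (rule measurable_cong[THEN iffD1, rotated])
  fix x assume "x \<in> space (F t \<Otimes>\<^sub>M jump_intensity)"
  hence "0 \<le> fst (snd x)" by (auto simp: space_pair_measure space_jump_intensity)
  hence "min t (max 0 (min t (fst (snd x)) + u + r) - r) = min t (fst (snd x)) + u" using u t by auto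
  thus "(\<lambda>(v, w). Z (max 0 v) w) (min t (fst (snd x)) + u + r, fst x) =
    (case x of (w, s, z) => segment r (\<lambda>u. extend X u w) (min t s)) u"
   using u by (simp add: case_prod_beta segment_def Z_def)
 qed
qed

definition switching_proc :: "(real => 'a => nat) => bool" where
 "switching_proc a \<longleftrightarrow> (\<forall>t\<ge>0. a t \<in> measurable (F t) (count_space UNIV)) \<and> (\<forall>w. pwc (\<lambda>t. a t w))"

abbreviation jumps_of :: "(real => 'a => real^'n) => (real => 'a => nat) => 'a => real \<times> real => real" where
 "jumps_of X a w \<equiv> jumps (\<lambda>u. extend X u w) (\<lambda>u. a u w)"

text \<open>The left limit of the switching path is the eventual value at the left dyadic points,
  where the process is read at countably many times only. The remaining arguments enter through the
  jointly measurable segment.\<close>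

lemma jumps_measurable:
 assumes X: "cont_proc X" and a: "switching_proc a" and t: "0 \<le> t"
 shows "(\<lambda>(w, x). indicator ({0<..t} \<times> UNIV) x * jumps_of X a w x) \<in> borel_measurable (F t \<Otimes>\<^sub>M jump_intensity)"
proof -
 let ?N = "F t \<Otimes>\<^sub>M jump_intensity"
 have m1 [measurable]: "fst \<in> borel_measurable jump_intensity" and m2 [measurable]: "snd \<in> borel_measurable jump_intensity"
  by (subst measurable_cong_sets[OF sets_jump_intensity refl], intro measurable_restrict_space1 borel_measurable_continuous_onI continuous_intros)+
 have C [measurable]: "{0<..t} \<times> UNIV \<in> sets jump_intensity" by (rule Times_in_jump_intensity) auto
 \<comment> \<open>Both arguments are stopped at \<open>t\<close> for measurability in
   \<open>F t\<close>; the indicator confines \<open>f k\<close> to times at which the stopping does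
   nothing.\<close>
 define f where "f k x = indicator ({0<..t} \<times> UNIV) (snd x) *
  height (segment r (\<lambda>u. extend X u (fst x)) (min t (fst (snd x)))) (a (min t (left_point k (fst (snd x)))) (fst x)) (snd (snd x))" for k and x :: "'a \<times> real \<times> real"
 have fm: "f k \<in> borel_measurable ?N" for k
 proof -
  have s: "(\<lambda>x. segment r (\<lambda>u. extend X u (fst x)) (min t (fst (snd x)))) \<in> measurable ?N (path_borel r)"
   using joint_segment_measurable[OF X t] by (simp add: case_prod_beta')
  have "(\<lambda>(u, w). a (min t (left_point k u)) w) \<in> measurable (borel \<Otimes>\<^sub>M F t) (count_space UNIV)"
  proof (rule joint_measurable_left_point)
   show "a (min t v) \<in> measurable (F t) (count_space UNIV)" if "0 \<le> v" for v
    using a t that measurable_F_mono[of "a (min t v)" "min t v" "count_space UNIV" t] by (auto simp: switching_proc_def)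
  qed
  hence "(\<lambda>x. (\<lambda>(u, w). a (min t (left_point k u)) w) (fst (snd x), fst x)) \<in> measurable ?N (count_space UNIV)"
   by (rule measurable_compose[rotated]) measurable
  hence am: "(\<lambda>x. a (min t (left_point k (fst (snd x)))) (fst x)) \<in> measurable ?N (count_space UNIV)" by simp
  have "(\<lambda>x. height (segment r (\<lambda>u. extend X u (fst x)) (min t (fst (snd x)))) (a (min t (left_point k (fst (snd x)))) (fst x)) (snd (snd x))) \<in> borel_measurable ?N"
   by (rule height_measurable[OF s am]) measurable
  thus ?thesis unfolding f_def by measurable
 qed
 have "(\<lambda>x. indicator ({0<..t} \<times> UNIV) (snd x) * jumps_of X a (fst x) (snd x)) \<in> borel_measurable ?N"
 proof (rule borel_measurable_LIMSEQ_real[OF _ fm])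
  fix x :: "'a \<times> real \<times> real"
  show "(\<lambda>k. f k x) \<longlonglongrightarrow> indicator ({0<..t} \<times> UNIV) (snd x) * jumps_of X a (fst x) (snd x)"
  proof (cases "0 < fst (snd x) \<and> fst (snd x) \<le> t")
   case True
   define s where "s = fst (snd x)"
   have "pwc (\<lambda>u. a u (fst x))" using a by (simp add: switching_proc_def)
   then obtain l where l: "\<forall>\<^sub>F u in at_left s. a u (fst x) = l" using True unfolding pwc_def s_def by blast
   moreover have "\<forall>\<^sub>F u in at_left s. u < s" unfolding eventually_at_left_field by (intro exI[of _ "s - 1"]) simp
   ultimately have "\<forall>\<^sub>F u in at_left s. a u (fst x) = l \<and> u < s" by eventually_elim simp
   hence "\<forall>\<^sub>F k in sequentially. a (left_point k s) (fst x) = l \<and> left_point k s < s"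
    using left_point_tendsto[of s] True by (auto simp: filterlim_iff s_def)
   hence "\<forall>\<^sub>F k in sequentially. f k x = indicator ({0<..t} \<times> UNIV) (snd x) * jumps_of X a (fst x) (snd x)"
    by eventually_elim (use True l in \<open>auto simp: f_def jumps_def s_def[symmetric] left_limit_eventually\<close>)
   thus ?thesis by (rule tendsto_eventually)
  next
   case False
   hence "snd x \<notin> {0<..t} \<times> UNIV" by (cases x) auto
   thus ?thesis by (simp add: f_def)
  qed
 qed
 thus ?thesis by (simp add: case_prod_beta')
qed

lemma jumps_integrand:
 assumes X: "cont_proc X" and a: "switching_proc a" and w: "w \<in> space P" "point_config M (p w)"
 shows "point_config.integrand M (p w) (jumps_of X a w)"
 unfolding point_config.integrand_def[OF w(2)]
proof (intro conjI allI impI)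
 fix t :: real assume t: "0 < t"
 have "w \<in> space (F t)" using w t by simp
 hence "(\<lambda>x. (\<lambda>(w, x). indicator ({0<..t} \<times> UNIV) x * jumps_of X a w x) (w, x)) \<in> borel_measurable jump_intensity"
  by (rule measurable_compose[OF measurable_Pair1' jumps_measurable[OF X a less_imp_le[OF t]]])
 thus "set_borel_measurable (p w) ({0<..t} \<times> UNIV) (jumps_of X a w)"
  by (simp add: set_borel_measurable_def measurable_cong_sets[OF sets_p[OF w(1)] refl])
next
 fix s z :: real assume "0 < s" "z \<notin> {0..M}"
 thus "jumps_of X a w (s, z) = 0" by (intro jumps_support extend_continuous_until[OF X w(1)])
qed

definition jump_integral :: "(real => 'a => real^'n) => (real => 'a => nat) => real => 'a => real" where
 "jump_integral X a t w = (LINT x:{0<..t} \<times> UNIV|p w. jumps_of X a w x)"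

lemma jump_integral_measurable:
 assumes X: "cont_proc X" and a: "switching_proc a" and t: "0 \<le> t"
 shows "jump_integral X a t \<in> borel_measurable (F t)"
proof -
 define f where "f w x = indicator ({0<..t} \<times> {0..M}) x * (indicator ({0<..t} \<times> UNIV) x * jumps_of X a w x)" for w x
 have f: "f w x = indicator ({0<..t} \<times> UNIV) x * jumps_of X a w x" if "w \<in> space P" for w x
  using jumps_support[OF extend_continuous_until[OF X that]] by (cases x) (auto simp: f_def indicator_def)
 have C: "{0<..t} \<times> {0..M} \<in> sets jump_intensity" by (rule Times_in_jump_intensity) auto
 have "(\<lambda>w. \<integral>x. f w x \<partial>p w) \<in> borel_measurable (F t)"
 proof (rule integral_kernel_measurable[OF less_imp_le[OF M_pos] t])
  show "(\<lambda>(w, x). f w x) \<in> borel_measurable (F t \<Otimes>\<^sub>M jump_intensity)"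
   unfolding f_def using jumps_measurable[OF X a t] C by (simp add: case_prod_beta')
  show "f w x = 0" if "x \<notin> {0<..t} \<times> {0..M}" for w x using that by (simp add: f_def)
  show "AE w in P. integrable (p w) (f w)"
   using p_point_config[OF less_imp_le[OF M_pos]] AE_space
  proof eventually_elim
   case (elim w)
   have "set_integrable (p w) ({0<..t} \<times> UNIV) (jumps_of X a w)"
    by (rule point_config.integrand_integrable[OF elim(1) jumps_integrand[OF X a elim(2,1)]])
   moreover have "f w = (\<lambda>x. indicator ({0<..t} \<times> UNIV) x * jumps_of X a w x)" using f[OF elim(2)] by (rule ext)
   ultimately show ?case by (simp add: set_integrable_def)
  qed
 qed
 thus ?thesis
  by (rule measurable_cong[THEN iffD1, rotated]) (use f t in \<open>auto simp: jump_integral_def set_lebesgue_integral_def\<close>)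
qed

text \<open>If \<open>a\<close> is not a solution, the jumps \<open>j - a(s-)\<close> start from the
  wrong state and may add up to something below 1; \<open>max 1\<close> keeps the iterates among the
  positive integers. The default on bad configurations does so for every outcome.\<close>

definition switch :: "(real => 'a => real^'n) => (real => 'a => nat) => real => 'a => nat" where
 "switch X a t w = (if w \<in> space P \<and> point_config M (p w) then nat \<lfloor>max 1 (real (i\<^sub>0 w) + jump_integral X a t w)\<rfloor> else 1)"

lemma jump_integral_J: "point_config M (p w) ==> jump_integral X a t w = point_config.J (p w) (jumps_of X a w) t"
 by (simp add: jump_integral_def point_config.J_def)

lemma switch_ge_1: "1 \<le> switch X a t w"
 by (simp add: switch_def le_nat_iff)

lemma i0_measurable: "0 \<le> t ==> i\<^sub>0 \<in> measurable (F t) (count_space UNIV)"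
 by (rule measurable_compose[OF measurable_F_mono[OF i0 order_refl], where g="\<lambda>x. x"]) simp_all

lemma switching_proc_switch:
 assumes X: "cont_proc X" and a: "switching_proc a"
 shows "switching_proc (switch X a)"
 unfolding switching_proc_def
proof (intro conjI allI impI)
 fix t :: real assume t: "0 \<le> t"
 have G: "{w\<in>space P. point_config M (p w)} \<in> sets (F t)" by (rule AE_in_sets_F[OF p_point_config t]) (use M_pos in simp)
 note [measurable] = jump_integral_measurable[OF X a t] i0_measurable[OF t]
 have "(\<lambda>w. real (i\<^sub>0 w)) \<in> borel_measurable (F t)" by measurable
 hence "(\<lambda>w. if w \<in> {w\<in>space P. point_config M (p w)} then nat \<lfloor>max 1 (real (i\<^sub>0 w) + jump_integral X a t w)\<rfloor> else 1)
   \<in> measurable (F t) (count_space UNIV)"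
 proof (intro measurable_If_set)
  show "{w\<in>space P. point_config M (p w)} \<inter> space (F t) \<in> sets (F t)" using G by (rule sets.Int) simp
 qed measurable
 thus "switch X a t \<in> measurable (F t) (count_space UNIV)" by (simp add: switch_def[abs_def])
next
 fix w
 show "pwc (\<lambda>t. switch X a t w)"
 proof (cases "w \<in> space P \<and> point_config M (p w)")
  case True
  hence "pwc (point_config.J (p w) (jumps_of X a w))"
   by (intro point_config.J_pwc[of M] jumps_integrand X a) auto
  hence "pwc (\<lambda>t. nat \<lfloor>max 1 (real (i\<^sub>0 w) + point_config.J (p w) (jumps_of X a w) t)\<rfloor>)" by (rule pwc_comp)
  thus ?thesis using True by (simp add: switch_def jump_integral_J)
 next
  case False
  hence "(\<lambda>t. switch X a t w) = (\<lambda>t. 1)" by (auto simp: switch_def fun_eq_iff)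
  thus ?thesis by (simp add: pwc_def)
 qed
qed

text \<open>One version is picked by choice; by \<open>flow_local\<close> another choice would
  differ from it on a null event only.\<close>

definition flow :: "(real => 'a => nat) => real => 'a => real^'n" where
 "flow a = (SOME X. cont_proc X \<and> (\<exists>Y. picard_step a (\<lambda>w. \<xi> w 0) X Y X))"

lemma flow:
 assumes "switching_proc a"
 shows "cont_proc (flow a)" "\<exists>Y. picard_step a (\<lambda>w. \<xi> w 0) (flow a) Y (flow a)"
proof -
 have "\<exists>X Y. cont_proc X \<and> picard_step a (\<lambda>w. \<xi> w 0) X Y X"
 proof (rule sde_exists)
  show "(\<lambda>w. \<xi> w 0) \<in> borel_measurable (F 0)" by (rule \<xi>_eval) (use r_pos in simp)
 qed (use assms in \<open>auto simp: switching_proc_def\<close>)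
 hence "\<exists>X. cont_proc X \<and> (\<exists>Y. picard_step a (\<lambda>w. \<xi> w 0) X Y X)" by blast
 from someI_ex[OF this] show "cont_proc (flow a)" "\<exists>Y. picard_step a (\<lambda>w. \<xi> w 0) (flow a) Y (flow a)"
  by (simp_all add: flow_def)
qed

lemma flow_init: "switching_proc a ==> AE w in P. flow a 0 w = \<xi> w 0"
 using flow picard_fixpoint(1) by blast

lemma flow_sde: "switching_proc a ==> 0 < T ==> sde_on T a (flow a)"
 using flow picard_fixpoint(2) by blast

text \<open>Agreement strictly before \<open>t\<close> gives equality at \<open>t\<close> as well;
  this gain of the end point is what allows the comparison to pass through a jump.\<close>

lemma flow_local:
 assumes a: "switching_proc a" and a': "switching_proc a'"
 shows "AE w in P. \<forall>t\<ge>0. (\<forall>s. 0 \<le> s --> s < t --> a s w = a' s w) --> extend (flow a) t w = extend (flow a') t w"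
proof -
 have "AE w in P. \<forall>n. \<forall>t\<in>{0..real (Suc n)}. flow a 0 w = flow a' 0 w -->
  (\<forall>s. 0 \<le> s --> s < t --> a s w = a' s w) --> flow a t w = flow a' t w"
  unfolding AE_all_countable
 proof
  fix n
  have n: "0 < real (Suc n)" by simp
  show "AE w in P. \<forall>t\<in>{0..real (Suc n)}. flow a 0 w = flow a' 0 w -->
   (\<forall>s. 0 \<le> s --> s < t --> a s w = a' s w) --> flow a t w = flow a' t w"
   by (rule sde_local_uniqueness[OF n flow_sde[OF a n] flow_sde[OF a' n]])
    (use a a' in \<open>auto simp: switching_proc_def intro!: pwc_stopped\<close>)
 qed
 thus ?thesis using flow_init[OF a] flow_init[OF a']
 proof eventually_elim
  case (elim w)
  show ?case
  proof (intro allI impI)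
   fix t :: real assume t: "0 \<le> t" and eq: "\<forall>s. 0 \<le> s --> s < t --> a s w = a' s w"
   obtain n where "t \<le> real n" using real_arch_simple by blast
   hence "t \<in> {0..real (Suc n)}" using t by simp
   hence "flow a t w = flow a' t w" using elim eq by metis
   thus "extend (flow a) t w = extend (flow a') t w" using elim by (simp add: extend_def)
  qed
 qed
qed

end

lemma pwc_locally:
 assumes "\<And>T. \<exists>a'. pwc a' \<and> (\<forall>u. 0 \<le> u --> u \<le> T --> a u = a' u)"
 shows "pwc a"
 unfolding pwc_def
proof (intro conjI allI impI)
 fix t :: real assume t: "0 \<le> t"
 obtain a' where a': "pwc a'" "\<And>u. 0 \<le> u ==> u \<le> t + 1 ==> a u = a' u" using assms[of "t + 1"] by blast
 obtain l where "\<forall>\<^sub>F s in at_right t. a' s = l" using a'(1) t unfolding pwc_def by blast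
 moreover have "\<forall>\<^sub>F s in at_right t. a s = a' s"
  unfolding eventually_at_right_field using t by (intro exI[of _ "t + 1"]) (auto intro!: a'(2))
 ultimately have "\<forall>\<^sub>F s in at_right t. a s = l" by eventually_elim simp
 thus "\<exists>l. \<forall>\<^sub>F s in at_right t. a s = l" by blast
next
 fix t :: real assume t: "0 < t"
 obtain a' where a': "pwc a'" "\<And>u. 0 \<le> u ==> u \<le> t ==> a u = a' u" using assms[of t] by blast
 obtain l where "\<forall>\<^sub>F s in at_left t. a' s = l" using a'(1) t unfolding pwc_def by blast
 moreover have "\<forall>\<^sub>F s in at_left t. a s = a' s"
  unfolding eventually_at_left_field using t by (intro exI[of _ 0]) (auto intro!: a'(2))
 ultimately have "\<forall>\<^sub>F s in at_left t. a s = l" by eventually_elim simp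
 thus "\<exists>l. \<forall>\<^sub>F s in at_left t. a s = l" by blast
qed

lemma (in filtered_space) ito_integral_on_cong:
 assumes eq: "\<And>t w. t \<in> {0..T} ==> w \<in> space P ==> H t w = H' t w" and H: "ito_integral_on P F W T H Y"
 shows "ito_integral_on P F W T H' Y"
 unfolding ito_integral_on_def
proof (intro conjI)
 show "\<forall>t\<in>{0..T}. H' t \<in> borel_measurable (F t)"
 proof
  fix t assume t: "t \<in> {0..T}"
  hence "H t \<in> borel_measurable (F t)" using H unfolding ito_integral_on_def by blast
  thus "H' t \<in> borel_measurable (F t)" by (rule measurable_cong[THEN iffD1, rotated]) (use t eq in auto)
 qed
 have b: "set_borel_measurable lborel {0..T} (\<lambda>s. H s w) = set_borel_measurable lborel {0..T} (\<lambda>s. H' s w)" if "w \<in> space P" for w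
 proof -
  have "(\<lambda>s. indicator {0..T} s *\<^sub>R H s w) = (\<lambda>s. indicator {0..T} s *\<^sub>R H' s w)"
   using eq that by (auto simp: fun_eq_iff indicator_def)
  thus ?thesis by (simp add: set_borel_measurable_def)
 qed
 have n: "(tint T (\<lambda>s. f s (H s w))) = (tint T (\<lambda>s. f s (H' s w)))" if "w \<in> space P" for w f
  by (rule nn_integral_cong) (use eq that in \<open>auto simp: indicator_def\<close>)
 have "AE w in P. set_borel_measurable lborel {0..T} (\<lambda>s. H s w) \<and> (tint T (\<lambda>s. sqnorm (H s w))) < \<infinity>"
  using H unfolding ito_integral_on_def by blast
 thus "AE w in P. set_borel_measurable lborel {0..T} (\<lambda>s. H' s w) \<and> (tint T (\<lambda>s. sqnorm (H' s w))) < \<infinity>"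
  using AE_space by eventually_elim (simp add: b n[of _ "\<lambda>s h. sqnorm h"])
 show "\<forall>t\<in>{0..T}. Y t \<in> borel_measurable (F t)" "AE w in P. continuous_on {0..T} (\<lambda>t. Y t w)"
  using H unfolding ito_integral_on_def by blast+
 obtain m \<tau> \<eta> where A: "\<forall>k. simple_process P F (m k) (\<tau> k) (\<eta> k)"
  and B: "tends_to_zero_in_probability P (\<lambda>k w. \<integral>\<^sup>+s\<in>{0..T}. sqnorm (simple_value (m k) (\<tau> k) (\<eta> k) s w - H s w) \<partial>lborel)"
  and C: "tends_to_zero_in_probability P (\<lambda>k w. SUP t\<in>{0..T}. ennreal (norm (simple_integral W (m k) (\<tau> k) (\<eta> k) t w - Y t w)))"
  using H unfolding ito_integral_on_def by blast
 have cong: "tends_to_zero_in_probability P Z'" if Z: "tends_to_zero_in_probability P Z" and e: "\<And>k w. w \<in> space P ==> Z k w = Z' k w" for Z Z' :: "nat => 'a => ennreal"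
 proof -
  have "Z k \<in> borel_measurable P \<longleftrightarrow> Z' k \<in> borel_measurable P" for k using e by (rule measurable_cong)
  moreover have "{w\<in>space P. Z k w > ennreal \<epsilon>} = {w\<in>space P. Z' k w > ennreal \<epsilon>}" for k \<epsilon> using e by auto
  ultimately show ?thesis using Z by (simp add: tends_to_zero_in_probability_def)
 qed
 have "tends_to_zero_in_probability P (\<lambda>k w. \<integral>\<^sup>+s\<in>{0..T}. sqnorm (simple_value (m k) (\<tau> k) (\<eta> k) s w - H' s w) \<partial>lborel)"
  proof (rule cong[OF B])
  fix k w assume "w \<in> space P"
  thus "(tint T (\<lambda>s. sqnorm (simple_value (m k) (\<tau> k) (\<eta> k) s w - H s w))) =
    (tint T (\<lambda>s. sqnorm (simple_value (m k) (\<tau> k) (\<eta> k) s w - H' s w)))"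
   by (rule n[of _ "\<lambda>s h. sqnorm (simple_value (m k) (\<tau> k) (\<eta> k) s w - h)"])
 qed
 thus "\<exists>m \<tau> \<eta>. (\<forall>k. simple_process P F (m k) (\<tau> k) (\<eta> k)) \<and>
   tends_to_zero_in_probability P (\<lambda>k w. \<integral>\<^sup>+s\<in>{0..T}. sqnorm (simple_value (m k) (\<tau> k) (\<eta> k) s w - H' s w) \<partial>lborel) \<and>
   tends_to_zero_in_probability P (\<lambda>k w. SUP t\<in>{0..T}. ennreal (norm (simple_integral W (m k) (\<tau> k) (\<eta> k) t w - Y t w)))"
  using A C by blast
qed

section \<open>The iteration and its limit\<close>

context hybrid_space
begin

abbreviation N :: "real => 'a => ennreal" where "N t w \<equiv> emeasure (p w) ({0<..t} \<times> {0..M})"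

lemma good_config: "AE w in P. point_config M (p w)"
 using M_pos by (intro p_point_config) simp

lemma jumps_flow_cong:
 assumes "\<forall>t\<ge>0. (\<forall>s. 0 \<le> s --> s < t --> a s w = a' s w) --> extend (flow a) t w = extend (flow a') t w"
  and s: "0 < s" and eq: "\<And>u. 0 \<le> u ==> u < s ==> a u w = a' u w"
 shows "jumps_of (flow a) a w (s, z) = jumps_of (flow a') a' w (s, z)"
proof (rule jumps_cong[OF s _ eq])
 fix u assume u: "-r \<le> u" "u \<le> s"
 show "extend (flow a) u w = extend (flow a') u w"
 proof (cases "u \<le> 0")
  case False
  thus ?thesis using assms(1) u eq by auto
 qed (simp add: extend_def)
qed

primrec iter :: "nat => real => 'a => nat" where
 "iter 0 = (\<lambda>t w. max 1 (i\<^sub>0 w))"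
| "iter (Suc k) = switch (flow (iter k)) (iter k)"

lemma switching_proc_iter: "switching_proc (iter k)"
proof (induction k)
 case 0
 have "(\<lambda>w. max 1 (i\<^sub>0 w)) \<in> measurable (F t) (count_space UNIV)" if "0 \<le> t" for t
  by (rule measurable_compose[OF i0_measurable[OF that]]) simp
 thus ?case by (simp add: switching_proc_def pwc_def)
next
 case (Suc k)
 thus ?case by (simp add: switching_proc_switch flow)
qed

lemma iter_ge_1: "1 \<le> iter k t w"
 by (cases k) (simp_all add: switch_ge_1[simplified])

lemma i0_ge_1: "w \<in> space P ==> 1 \<le> i\<^sub>0 w"
 using measurable_space[OF i0, of w] by simp

lemma iter_stable:
 "AE w in P. \<forall>k. \<forall>t\<ge>0. N t w < of_nat (Suc k) --> iter (Suc k) t w = iter k t w"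
proof -
 have "AE w in P. \<forall>k. \<forall>t\<ge>0. (\<forall>s. 0 \<le> s --> s < t --> iter (Suc k) s w = iter k s w) -->
   extend (flow (iter (Suc k))) t w = extend (flow (iter k)) t w"
  unfolding AE_all_countable by (intro allI flow_local switching_proc_iter)
 with good_config show ?thesis using AE_space
 proof eventually_elim
  case (elim w)
  interpret \<mu>: point_config M "p w" by (rule elim(1))
  have J: "iter (Suc k) t w = nat \<lfloor>max 1 (real (i\<^sub>0 w) + \<mu>.J (jumps_of (flow (iter k)) (iter k) w) t)\<rfloor>" for k t
   using elim by (simp add: switch_def jump_integral_J)
  have g: "\<mu>.integrand (jumps_of (flow (iter k)) (iter k) w)" for k
   by (intro jumps_integrand flow switching_proc_iter elim)
  have "\<forall>t\<ge>0. N t w < of_nat (Suc k) --> iter (Suc k) t w = iter k t w" for k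
  proof (induction k)
   case 0
   show ?case
   proof (intro allI impI)
    fix t :: real assume t: "0 \<le> t" "N t w < of_nat (Suc 0)"
    have "N t w \<in> insert \<infinity> (range of_nat)"
     using \<mu>.strip_sets(1)[OF order_refl, of t] by (intro \<mu>.nat_valued) (simp add: \<mu>.sets_\<mu>)
    hence "N t w = 0" using t(2) by (intro enat_valued_less_one) simp_all
    hence "\<mu>.J (jumps_of (flow (iter 0)) (iter 0) w) t = 0"
     using \<mu>.J_null[OF g order_refl t(1)] \<mu>.J_zero by (simp del: iter.simps)
    thus "iter (Suc 0) t w = iter 0 t w" unfolding J using i0_ge_1[OF elim(3)] by simp
   qed
  next
   case (Suc k)
   show ?case
   proof (intro allI impI)
    fix t :: real assume t: "0 \<le> t" "N t w < of_nat (Suc (Suc k))"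
    \<comment> \<open>The integrand at \<open>s\<close> uses the switching path before
      \<open>s\<close> and the diffusion up to \<open>s\<close>. Agreement before the point number
      \<open>k + 1\<close> therefore makes the integrands agree at that point too, and the integrals
      agree until the next one.\<close>
    have "\<mu>.J (jumps_of (flow (iter (Suc k))) (iter (Suc k)) w) t = \<mu>.J (jumps_of (flow (iter k)) (iter k) w) t"
    proof (rule \<mu>.J_cong_count[OF g g, of _ "Suc k"])
     show "\<mu>.cnt t < of_nat (Suc (Suc k))" using t(2) by (simp only: \<mu>.cnt_def)
     fix s z assume s: "0 < s" "s \<le> t" and c: "\<And>u. 0 \<le> u ==> u < s ==> \<mu>.cnt u < of_nat (Suc k)"
     have e: "iter (Suc k) u w = iter k u w" if "0 \<le> u" "u < s" for u
      using Suc.IH c[OF that] that(1) unfolding \<mu>.cnt_def by blast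
     show "jumps_of (flow (iter (Suc k))) (iter (Suc k)) w (s, z) = jumps_of (flow (iter k)) (iter k) w (s, z)"
      by (rule jumps_flow_cong[where a="iter (Suc k)" and a'="iter k", OF _ s(1) e]) (use elim(2) in blast)
    qed
    thus "iter (Suc (Suc k)) t w = iter (Suc k) t w" by (simp only: J)
   qed
  qed
  thus ?case by blast
 qed
qed

text \<open>For a finite integer-valued count this is the number of points up to \<open>t\<close>,
  the index from which on the iteration no longer changes at \<open>t\<close>.\<close>

definition level :: "real => 'a => nat" where "level t w = (LEAST k. N t w < of_nat (Suc k))"

text \<open>The default 1 makes every path piecewise constant with positive values, as required of a
  switching process for all outcomes.\<close>

definition limit_switch :: "real => 'a => nat" where
 "limit_switch t w = (if pwc (\<lambda>t. iter (level t w) t w) then iter (level t w) t w else 1)"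

lemma limit_switch_ge_1: "1 \<le> limit_switch t w"
 using iter_ge_1 by (simp add: limit_switch_def)

lemma limit_switch_iter:
 "AE w in P. pwc (\<lambda>t. iter (level t w) t w) \<and>
   (\<forall>t\<ge>0. \<exists>k. N t w < of_nat (Suc k) \<and> (\<forall>u. 0 \<le> u --> u \<le> t --> limit_switch u w = iter k u w))"
 using good_config iter_stable
proof eventually_elim
 case (elim w)
 interpret \<mu>: point_config M "p w" by (rule elim(1))
 have fin: "\<exists>k::nat. N t w < of_nat (Suc k)" for t
 proof -
  obtain k :: nat where "N t w \<le> of_nat k" using \<mu>.cnt_bound[of t] unfolding \<mu>.cnt_def by blast
  also have "(of_nat k :: ennreal) < of_nat (Suc k)" by (simp only: of_nat_less_iff)
  finally show ?thesis by blast
 qed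
 have lv: "N t w < of_nat (Suc (level t w))" for t unfolding level_def by (rule LeastI_ex[OF fin])
 have st: "iter k t w = iter (level t w) t w" if t: "0 \<le> t" and k: "N t w < of_nat (Suc k)" for k t
 proof -
  have "level t w \<le> k" unfolding level_def using k by (rule Least_le)
  thus ?thesis
  proof (induction rule: dec_induct)
   case (step m)
   have "N t w < of_nat (Suc m)" using lv[of t] step(1) by (metis Suc_le_mono of_nat_le_iff order_less_le_trans)
   thus ?case using elim(2) t step(3) by metis
  qed simp
 qed
 have loc: "iter (level u w) u w = iter (level t w) u w" if "0 \<le> u" "u \<le> t" for u t
 proof -
  have "N u w \<le> N t w" using \<mu>.cnt_mono[OF that(2)] by (simp add: \<mu>.cnt_def)
  thus ?thesis using st[OF that(1), of "level t w"] lv[of t] by (metis order_le_less_trans)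
 qed
 have pw: "pwc (\<lambda>t. iter (level t w) t w)"
 proof (rule pwc_locally)
  fix T
  have "pwc (\<lambda>t. iter (level T w) t w)" using switching_proc_iter by (simp add: switching_proc_def)
  thus "\<exists>a'. pwc a' \<and> (\<forall>u. 0 \<le> u --> u \<le> T --> iter (level u w) u w = a' u)" using loc by blast
 qed
 moreover have "\<exists>k. N t w < of_nat (Suc k) \<and> (\<forall>u. 0 \<le> u --> u \<le> t --> limit_switch u w = iter k u w)" for t
  using lv[of t] loc pw unfolding limit_switch_def by auto
 ultimately show ?case by blast
qed

lemma switching_proc_limit: "switching_proc limit_switch"
 unfolding switching_proc_def
proof (intro conjI allI impI)
 fix t :: real assume t: "0 \<le> t"
 have Nm [measurable]: "N t \<in> borel_measurable (F t)"
  using M_pos by (intro p_measurable_F[OF t] Times_in_jump_intensity) auto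
 have lv: "level t \<in> measurable (F t) (count_space UNIV)" unfolding level_def by measurable
 have m: "(\<lambda>w. iter (level t w) t w) \<in> measurable (F t) (count_space UNIV)"
  by (rule measurable_compose_countable[OF _ lv, where f="\<lambda>k w. iter k t w"])
   (use switching_proc_iter t in \<open>simp add: switching_proc_def\<close>)
 show "limit_switch t \<in> measurable (F t) (count_space UNIV)"
  by (rule measurable_F_AE_cong[OF m t])
   (use limit_switch_iter in \<open>auto simp: limit_switch_def elim!: eventually_mono\<close>)
next
 fix w
 show "pwc (\<lambda>t. limit_switch t w)"
  by (cases "pwc (\<lambda>t. iter (level t w) t w)") (simp_all add: limit_switch_def, simp add: pwc_def)
qed

lemma limit_switch_rounded:
 "AE w in P. \<forall>t\<ge>0. limit_switch t w =
   nat \<lfloor>max 1 (real (i\<^sub>0 w) + jump_integral (flow limit_switch) limit_switch t w)\<rfloor>"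
proof -
 have "AE w in P. \<forall>k. \<forall>t\<ge>0. (\<forall>s. 0 \<le> s --> s < t --> iter k s w = limit_switch s w) -->
   extend (flow (iter k)) t w = extend (flow limit_switch) t w"
  unfolding AE_all_countable by (intro allI flow_local switching_proc_iter switching_proc_limit)
 thus ?thesis using good_config iter_stable limit_switch_iter AE_space
 proof eventually_elim
  case (elim w)
  interpret \<mu>: point_config M "p w" by (rule elim(2))
  show ?case
  proof (intro allI impI)
   fix t :: real assume t: "0 \<le> t"
   obtain k where k: "N t w < of_nat (Suc k)" "\<And>u. 0 \<le> u ==> u \<le> t ==> limit_switch u w = iter k u w"
    using elim(4) t by blast
   have "jump_integral (flow (iter k)) (iter k) t w = jump_integral (flow limit_switch) limit_switch t w"
    unfolding jump_integral_def
   proof (rule set_lebesgue_integral_cong)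
    show "{0<..t} \<times> UNIV \<in> sets (p w)" by (rule \<mu>.strip_sets) simp
    show "\<forall>x. x \<in> {0<..t} \<times> UNIV --> jumps_of (flow (iter k)) (iter k) w x = jumps_of (flow limit_switch) limit_switch w x"
    proof (intro allI impI)
     fix x :: "real \<times> real" assume x: "x \<in> {0<..t} \<times> UNIV"
     have "jumps_of (flow (iter k)) (iter k) w (fst x, snd x) = jumps_of (flow limit_switch) limit_switch w (fst x, snd x)"
     proof (rule jumps_flow_cong)
      show "\<forall>t\<ge>0. (\<forall>s. 0 \<le> s --> s < t --> iter k s w = limit_switch s w) -->
       extend (flow (iter k)) t w = extend (flow limit_switch) t w" using elim(1) by blast
     qed (use x k(2) in auto)
     thus "jumps_of (flow (iter k)) (iter k) w x = jumps_of (flow limit_switch) limit_switch w x" by simp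
    qed
   qed
   moreover have "limit_switch t w = iter (Suc k) t w" using k(2)[OF t order_refl] elim(3) t k(1) by metis
   ultimately show "limit_switch t w = nat \<lfloor>max 1 (real (i\<^sub>0 w) + jump_integral (flow limit_switch) limit_switch t w)\<rfloor>"
    using elim(2,5) by (simp add: switch_def)
  qed
 qed
qed

text \<open>
 The truncation and rounding in \<^const>\<open>switch\<close> are inactive: started from a positive integer \<open>v\<close>,
 the integral only jumps by some \<open>j - v\<close> with \<open>j \<ge> 1\<close>.
\<close>

lemma limit_switch_equation:
 "AE w in P. \<forall>t\<ge>0. real (limit_switch t w) = real (i\<^sub>0 w) + jump_integral (flow limit_switch) limit_switch t w"
 using limit_switch_rounded good_config AE_space
proof eventually_elim
 case (elim w)
 interpret \<mu>: point_config M "p w" by (rule elim(2))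
 define g where "g = jumps_of (flow limit_switch) limit_switch w"
 have X: "cont_proc (flow limit_switch)" by (rule flow[OF switching_proc_limit])
 have g: "\<mu>.integrand g" unfolding g_def by (rule jumps_integrand[OF X switching_proc_limit elim(3,2)])
 have cont: "continuous_on {-r..s} (\<lambda>u. extend (flow limit_switch) u w)" for s
  by (rule extend_continuous_until[OF X elim(3)])
 have JJ: "jump_integral (flow limit_switch) limit_switch t w = \<mu>.J g t" for t
  by (simp add: jump_integral_J[OF elim(2)] g_def)
 have round: "limit_switch t w = nat \<lfloor>max 1 (real (i\<^sub>0 w) + \<mu>.J g t)\<rfloor>" if "0 \<le> t" for t
  using elim(1) that by (simp add: JJ)
 define Q where "Q t \<longleftrightarrow> (\<exists>v\<ge>1. real (i\<^sub>0 w) + \<mu>.J g t = real v)" for t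
 have Qv: "limit_switch t w = v" if "0 \<le> t" "1 \<le> v" "real (i\<^sub>0 w) + \<mu>.J g t = real v" for t v
  using round[OF that(1)] that(2,3) by simp
 have "Q t" if "0 \<le> t" for t
 proof (rule real_induction[where Q=Q, OF _ _ _ that])
  show "Q 0" unfolding Q_def using i0_ge_1[OF elim(3)] by (auto simp: \<mu>.J_zero)
 next
  fix t :: real assume t: "0 \<le> t" and *: "\<And>s. 0 \<le> s ==> s \<le> t ==> Q s"
  obtain \<epsilon> where "\<epsilon> > 0" "\<And>u. t \<le> u ==> u \<le> t + \<epsilon> ==> \<mu>.J g u = \<mu>.J g t" using \<mu>.J_right[OF g t] by blast
  thus "\<exists>\<epsilon>>0. \<forall>u. t \<le> u --> u \<le> t + \<epsilon> --> Q u" using *[OF t order_refl] unfolding Q_def by metis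
 next
  fix t :: real assume t: "0 < t" and *: "\<And>s. 0 \<le> s ==> s < t ==> Q s"
  obtain s where s: "0 \<le> s" "s < t" "\<And>u. s \<le> u ==> u < t ==> \<mu>.J g u = \<mu>.J g s"
    and jump: "(\<forall>z. g (t, z) \<in> \<int>) ==> \<mu>.J g t = \<mu>.J g s \<or> (\<exists>z. \<mu>.J g t = \<mu>.J g s + g (t, z))"
   using \<mu>.J_left[OF g t] by blast
  obtain v where v: "1 \<le> v" "real (i\<^sub>0 w) + \<mu>.J g s = real v" using *[OF s(1,2)] by (auto simp: Q_def)
  have "\<forall>\<^sub>F u in at_left t. limit_switch u w = v"
   unfolding eventually_at_left_field
  proof (intro exI[of _ s] conjI allI impI s(2))
   fix u assume u: "s < u" "u < t"
   have "\<mu>.J g u = \<mu>.J g s" by (rule s(3)) (use u in simp_all)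
   thus "limit_switch u w = v" using u s(1) v by (intro Qv) simp_all
  qed
  hence ll: "left_limit (\<lambda>u. limit_switch u w) t = v" by (rule left_limit_eventually)
  have "\<forall>z. g (t, z) \<in> \<int>" unfolding g_def using jumps_Ints[OF cont t] by blast
  then consider "\<mu>.J g t = \<mu>.J g s" | z where "\<mu>.J g t = \<mu>.J g s + g (t, z)" using jump by blast
  thus "Q t"
  proof cases
   case 1
   thus ?thesis using v by (auto simp: Q_def)
  next
   case (2 z)
   obtain j where "1 \<le> j" "g (t, z) = real j - real v"
    using jumps_range[OF cont t ll v(1), of z] unfolding g_def by blast
   thus ?thesis using 2 v by (auto simp: Q_def)
  qed
 qed
 thus ?case unfolding JJ using Qv by (metis Q_def)
qed

text \<open>At nonnegative times this is literally the flow, so its integral equations carry over;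
  it agrees almost surely with \<open>extend\<close>, whose paths are continuous across time
  0.\<close>

definition solution :: "real => 'a => real^'n" where
 "solution t w = (if t < 0 then \<xi> w t else flow limit_switch t w)"

lemma solution_extend: "AE w in P. \<forall>t. solution t w = extend (flow limit_switch) t w"
 using flow_init[OF switching_proc_limit]
 by (rule eventually_mono) (auto simp: solution_def extend_def less_eq_real_def)

lemma strong_solution_exists: "strong_solution P F W p r b \<sigma> q \<xi> i\<^sub>0 solution limit_switch"
 unfolding strong_solution_def
proof (intro allI impI)
 fix T :: real assume T: "0 < T"
 have X: "cont_proc (flow limit_switch)" by (rule flow[OF switching_proc_limit])
 obtain Y where Y: "picard_step limit_switch (\<lambda>w. \<xi> w 0) (flow limit_switch) Y (flow limit_switch)"
  using flow(2)[OF switching_proc_limit] by blast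
 have a: "\<And>t. 0 \<le> t ==> limit_switch t \<in> measurable (F t) (count_space UNIV)" "\<And>w. pwc (\<lambda>t. limit_switch t w)"
  using switching_proc_limit by (auto simp: switching_proc_def)
 have sol: "solution t w = flow limit_switch t w" if "0 \<le> t" for t w using that by (simp add: solution_def)
 show "strong_solution_on P F W p r b \<sigma> q \<xi> i\<^sub>0 T solution limit_switch"
  unfolding strong_solution_on_def
 proof (intro conjI)
  show "\<forall>t\<in>{0..T}. solution t \<in> borel_measurable (F t)"
  proof
   fix t assume "t \<in> {0..T}"
   hence "solution t = flow limit_switch t" "flow limit_switch t \<in> borel_measurable (F t)"
    using X by (auto simp: fun_eq_iff sol cont_proc_def)
   thus "solution t \<in> borel_measurable (F t)" by simp
  qed
  show "\<forall>t\<in>{0..T}. limit_switch t \<in> measurable (F t) (count_space {1..})"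
  proof
   fix t assume "t \<in> {0..T}"
   hence "limit_switch t \<in> measurable (F t) (count_space UNIV)" by (intro a) simp
   thus "limit_switch t \<in> measurable (F t) (count_space {1..})"
    using limit_switch_ge_1[of t] unfolding measurable_def by (auto simp: subset_iff)
  qed
  show "AE w in P. continuous_on {-r..T} (\<lambda>t. solution t w)"
   using solution_extend AE_space
  proof eventually_elim
   case (elim w)
   thus ?case using extend_continuous_until[OF X elim(2), of T] by simp
  qed
  show "AE w in P. cadlag_on T (\<lambda>t. limit_switch t w)"
   using limit_switch_equation good_config AE_space
  proof eventually_elim
   case (elim w)
   interpret \<mu>: point_config M "p w" by (rule elim(2))
   have g: "\<mu>.integrand (jumps_of (flow limit_switch) limit_switch w)"
    by (rule jumps_integrand[OF X switching_proc_limit elim(3,2)])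
   show ?case unfolding cadlag_on_def
   proof (intro conjI ballI)
    fix t assume "t \<in> {0..<T}"
    hence t: "0 \<le> t" by simp
    obtain \<epsilon> where e: "\<epsilon> > 0" "\<And>u. t \<le> u ==> u \<le> t + \<epsilon> ==>
      \<mu>.J (jumps_of (flow limit_switch) limit_switch w) u = \<mu>.J (jumps_of (flow limit_switch) limit_switch w) t"
     using \<mu>.J_right[OF g t] by blast
    have "limit_switch u w = limit_switch t w" if "t < u" "u < t + \<epsilon>" for u
    proof -
     have "real (limit_switch u w) = real (limit_switch t w)"
      using elim(1) e(2)[of u] t that by (simp add: jump_integral_J[OF elim(2)])
     thus ?thesis by simp
    qed
    hence "\<forall>\<^sub>F u in at_right t. limit_switch u w = limit_switch t w"
     unfolding eventually_at_right_field using e(1) by (intro exI[of _ "t + \<epsilon>"]) simp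
    thus "((\<lambda>t. limit_switch t w) \<longlongrightarrow> limit_switch t w) (at_right t)" by (rule tendsto_eventually)
   next
    fix t assume "t \<in> {0<..T}"
    hence t: "0 < t" by simp
    obtain l where "\<forall>\<^sub>F s in at_left t. limit_switch s w = l" using a(2)[of w] t unfolding pwc_def by blast
    hence "((\<lambda>t. limit_switch t w) \<longlongrightarrow> l) (at_left t)" by (rule tendsto_eventually)
    thus "\<exists>l. ((\<lambda>t. limit_switch t w) \<longlongrightarrow> l) (at_left t)" by (rule exI)
   qed
  qed
  show "AE w in P. \<forall>t\<in>{-r..0}. solution t w = \<xi> w t"
   using solution_extend by (rule eventually_mono) (simp add: extend_def)
  show "AE w in P. limit_switch 0 w = i\<^sub>0 w"
   using limit_switch_equation by (rule eventually_mono) (auto simp: jump_integral_def set_lebesgue_integral_def dest: spec[of _ 0])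
  have "AE w in P. reg_path (\<lambda>t. b (flow limit_switch t w) (limit_switch t w))"
   using regular_coeff(2)[OF X a(1)] a(2) unfolding regular_def by simp
  thus "AE w in P. set_integrable lborel {0..T} (\<lambda>s. b (solution s w) (limit_switch s w))"
  proof eventually_elim
   case (elim w)
   have "set_integrable lborel {0..T} (\<lambda>t. b (flow limit_switch t w) (limit_switch t w))"
    by (rule reg_path_set_integrable[OF elim])
   thus ?case by (rule set_integrable_cong[THEN iffD1, rotated -1]) (simp_all add: sol)
  qed
  show "\<exists>Y. ito_integral_on P F W T (\<lambda>s w. \<sigma> (solution s w) (limit_switch s w)) Y \<and>
    (AE w in P. \<forall>t\<in>{0..T}. solution t w = solution 0 w +
     drift solution limit_switch t w + Y t w)"
  proof (intro exI conjI)
   have "ito_integral_on P F W T (\<lambda>s w. \<sigma> (flow limit_switch s w) (limit_switch s w)) Y"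
    using Y T unfolding picard_step_def by blast
   thus "ito_integral_on P F W T (\<lambda>s w. \<sigma> (solution s w) (limit_switch s w)) Y"
    by (rule ito_integral_on_cong[rotated]) (simp add: sol)
   have "AE w in P. \<forall>t\<ge>0. flow limit_switch t w = \<xi> w 0 + (LINT s:{0..t}|lborel. b (flow limit_switch s w) (limit_switch s w)) + Y t w"
    using Y unfolding picard_step_def by blast
   thus "AE w in P. \<forall>t\<in>{0..T}. solution t w = solution 0 w +
     drift solution limit_switch t w + Y t w"
    using flow_init[OF switching_proc_limit]
   proof eventually_elim
    case (elim w)
    have "drift solution limit_switch t w =
      (LINT s:{0..t}|lborel. b (flow limit_switch s w) (limit_switch s w))" for t
     by (rule set_lebesgue_integral_cong) (simp_all add: sol)
    thus ?case using elim by (simp add: sol)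
   qed
  qed
  show "AE w in P. let g = (\<lambda>(s, z). jump_height q (segment r (\<lambda>u. solution u w) s) (left_limit (\<lambda>u. limit_switch u w) s) z)
    in set_integrable (p w) ({0<..T} \<times> UNIV) g \<and>
      (\<forall>t\<in>{0..T}. real (limit_switch t w) = real (limit_switch 0 w) + (LINT x:{0<..t} \<times> UNIV|p w. g x))"
   using limit_switch_equation good_config AE_space solution_extend
  proof eventually_elim
   case (elim w)
   interpret \<mu>: point_config M "p w" by (rule elim(2))
   define G where "G = jumps_of (flow limit_switch) limit_switch w"
   define g where "g = (\<lambda>(s, z). jump_height q (segment r (\<lambda>u. solution u w) s) (left_limit (\<lambda>u. limit_switch u w) s) z)"
   have eq: "g x = G x" if x: "0 < fst x" for x
   proof -
    obtain l where l: "\<forall>\<^sub>F s in at_left (fst x). limit_switch s w = l" using a(2)[of w] x unfolding pwc_def by blast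
    have "1 \<le> l" using eventually_happens[OF l] limit_switch_ge_1 by (auto simp: trivial_limit_at_left_real)
    thus ?thesis using elim(4) left_limit_eventually[OF l]
     by (simp add: g_def G_def jumps_def height_def case_prod_beta)
   qed
   have s: "{0<..t} \<times> UNIV \<in> sets (p w)" for t by (rule \<mu>.strip_sets) simp
   have G: "\<mu>.integrand G" unfolding G_def by (rule jumps_integrand[OF X switching_proc_limit elim(3,2)])
   have "set_integrable (p w) ({0<..T} \<times> UNIV) g"
    by (rule set_integrable_cong[THEN iffD1, OF _ _ _ \<mu>.integrand_integrable[OF G, of T]]) (auto simp: eq)
   moreover have "(LINT x:{0<..t} \<times> UNIV|p w. g x) = jump_integral (flow limit_switch) limit_switch t w" for t
    unfolding jump_integral_def by (rule set_lebesgue_integral_cong[OF s]) (auto simp: eq G_def)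
   moreover have "real (limit_switch 0 w) = real (i\<^sub>0 w)"
    using elim(1) by (auto simp: jump_integral_def set_lebesgue_integral_def dest: spec[of _ 0])
   ultimately show ?case using elim(1) unfolding g_def[symmetric] Let_def by simp
  qed
 qed
qed

end

section \<open>Uniqueness\<close>

lemma pwc_cadlag:
 fixes a :: "real => nat"
 assumes a: "cadlag_on T a"
 shows "pwc (\<lambda>t. a (min t T))"
proof (rule pwc_stoppedI)
 show "\<exists>l. \<forall>\<^sub>F s in at_right t. a s = l" if "0 \<le> t" "t < T" for t
  using a that unfolding cadlag_on_def by (auto simp: tendsto_discrete)
 show "\<exists>l. \<forall>\<^sub>F s in at_left t. a s = l" if "0 < t" "t \<le> T" for t
  using a that unfolding cadlag_on_def by (auto simp: tendsto_discrete)
qed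

text \<open>The switching component of a solution is at least 1 everywhere on the space. The
  coefficients may therefore be replaced at index 0, where no Lipschitz condition is given, by ones
  that satisfy the locale assumptions for all indices.\<close>

lemma (in filtered_space) strong_solution_on_cong:
 fixes b b' :: "real^'n => nat => real^'n" and \<sigma> \<sigma>' :: "real^'n => nat => real^'d^'n"
 assumes eq: "\<And>x i. 1 \<le> i ==> b x i = b' x i" "\<And>x i. 1 \<le> i ==> \<sigma> x i = \<sigma>' x i"
  and S: "strong_solution_on P F W p r b \<sigma> q \<xi> i\<^sub>0 T X a"
 shows "strong_solution_on P F W p r b' \<sigma>' q \<xi> i\<^sub>0 T X a"
proof -
 have a1: "1 \<le> a t w" if "t \<in> {0..T}" "w \<in> space P" for t w
 proof -
  have "a t \<in> measurable (F t) (count_space {1..})" using S that(1) unfolding strong_solution_on_def by blast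
  from measurable_space[OF this, of w] that show ?thesis by simp
 qed
 have "AE w in P. set_integrable lborel {0..T} (\<lambda>s. b (X s w) (a s w))"
  using S unfolding strong_solution_on_def by blast
 hence b': "AE w in P. set_integrable lborel {0..T} (\<lambda>s. b' (X s w) (a s w))"
  using AE_space
 proof eventually_elim
  case (elim w)
  show ?case
   by (rule set_integrable_cong[THEN iffD1, OF refl refl _ elim(1)]) (use a1 elim(2) eq in auto)
 qed
 obtain Y where Y: "ito_integral_on P F W T (\<lambda>s w. \<sigma> (X s w) (a s w)) Y"
  "AE w in P. \<forall>t\<in>{0..T}. X t w = X 0 w + (LINT s:{0..t}|lborel. b (X s w) (a s w)) + Y t w"
  using S unfolding strong_solution_on_def by blast
 have "ito_integral_on P F W T (\<lambda>s w. \<sigma>' (X s w) (a s w)) Y"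
  by (rule ito_integral_on_cong[OF _ Y(1)]) (use a1 eq in auto)
 moreover have "AE w in P. \<forall>t\<in>{0..T}. X t w = X 0 w + (LINT s:{0..t}|lborel. b' (X s w) (a s w)) + Y t w"
  using Y(2) AE_space
 proof eventually_elim
  case (elim w)
  have I: "(LINT s:{0..t}|lborel. b (X s w) (a s w)) = (LINT s:{0..t}|lborel. b' (X s w) (a s w))" if "t \<in> {0..T}" for t
   by (rule set_lebesgue_integral_cong) (use that a1 elim(2) eq in auto)
  show ?case
  proof
   fix t assume t: "t \<in> {0..T}"
   show "X t w = X 0 w + (LINT s:{0..t}|lborel. b' (X s w) (a s w)) + Y t w"
    using bspec[OF elim(1) t] unfolding I[OF t] .
  qed
 qed
 ultimately have "\<exists>Y. ito_integral_on P F W T (\<lambda>s w. \<sigma>' (X s w) (a s w)) Y \<and>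
   (AE w in P. \<forall>t\<in>{0..T}. X t w = X 0 w + (LINT s:{0..t}|lborel. b' (X s w) (a s w)) + Y t w)" by blast
 thus ?thesis using S b' unfolding strong_solution_on_def by blast
qed

context hybrid_space
begin

lemma strong_solution_sde:
 assumes S: "strong_solution P F W p r b \<sigma> q \<xi> i\<^sub>0 X a" and T: "0 < T"
 shows "sde_on T a X" "t \<in> {0..T} ==> a t \<in> measurable (F t) (count_space UNIV)" "AE w in P. pwc (\<lambda>t. a (min t T) w)"
proof -
 have S': "strong_solution_on P F W p r b \<sigma> q \<xi> i\<^sub>0 T X a" using S T by (simp add: strong_solution_def)
 have "AE w in P. continuous_on {-r..T} (\<lambda>t. X t w)" using S' unfolding strong_solution_on_def by blast
 hence "AE w in P. continuous_on {0..T} (\<lambda>t. X t w)"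
  by (rule eventually_mono) (use r_pos in \<open>auto elim: continuous_on_subset\<close>)
 thus "sde_on T a X" using S' unfolding strong_solution_on_def sde_on_def by blast
 show "a t \<in> measurable (F t) (count_space UNIV)" if "t \<in> {0..T}"
 proof (rule measurable_compose[where g="\<lambda>x. x"])
  show "a t \<in> measurable (F t) (count_space {1..})" using S' that unfolding strong_solution_on_def by blast
 qed simp
 have "AE w in P. cadlag_on T (\<lambda>t. a t w)" using S' unfolding strong_solution_on_def by blast
 thus "AE w in P. pwc (\<lambda>t. a (min t T) w)" by (rule eventually_mono) (rule pwc_cadlag)
qed

text \<open>The definition, given for each horizon separately, becomes one pathwise statement for
  all times. Left limits of the switching path at positive times are at least 1, where
  \<open>height\<close> and \<open>jump_height\<close> coincide.\<close>

lemma strong_solution_paths: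
 assumes S: "strong_solution P F W p r b \<sigma> q \<xi> i\<^sub>0 X a"
 shows "AE w in P. (\<forall>t\<in>{-r..0}. X t w = \<xi> w t) \<and> a 0 w = i\<^sub>0 w \<and>
  point_config.integrand M (p w) (jumps (\<lambda>u. X u w) (\<lambda>u. a u w)) \<and>
  (\<forall>t\<ge>0. real (a t w) = real (a 0 w) + point_config.J (p w) (jumps (\<lambda>u. X u w) (\<lambda>u. a u w)) t)"
proof -
 have S': "strong_solution_on P F W p r b \<sigma> q \<xi> i\<^sub>0 (real (Suc n)) X a" for n
  using S unfolding strong_solution_def by simp
 have "AE w in P. \<forall>n. continuous_on {-r..real (Suc n)} (\<lambda>t. X t w)"
  unfolding AE_all_countable using S' unfolding strong_solution_on_def by blast
 moreover have "AE w in P. \<forall>n. cadlag_on (real (Suc n)) (\<lambda>t. a t w)"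
  unfolding AE_all_countable using S' unfolding strong_solution_on_def by blast
 moreover have "AE w in P. \<forall>t\<in>{-r..0}. X t w = \<xi> w t" "AE w in P. a 0 w = i\<^sub>0 w"
  using S' unfolding strong_solution_on_def by blast+
 moreover define g where "g w = (\<lambda>(s, z). jump_height q (segment r (\<lambda>u. X u w) s) (left_limit (\<lambda>u. a u w) s) z)" for w
 have "AE w in P. \<forall>n. set_integrable (p w) ({0<..real (Suc n)} \<times> UNIV) (g w) \<and>
   (\<forall>t\<in>{0..real (Suc n)}. real (a t w) = real (a 0 w) + (LINT x:{0<..t} \<times> UNIV|p w. g w x))"
  unfolding AE_all_countable using S' unfolding strong_solution_on_def Let_def g_def by blast
 ultimately show ?thesis using good_config AE_space
 proof eventually_elim
  case (elim w)
  interpret \<mu>: point_config M "p w" by (rule elim(6))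
  define G where "G = jumps (\<lambda>u. X u w) (\<lambda>u. a u w)"
  have a1: "1 \<le> a t w" if "0 \<le> t" for t
  proof -
   obtain n where "t \<le> real n" using real_arch_simple by blast
   hence "t \<in> {0..real (Suc n)}" using that by simp
   hence "a t \<in> measurable (F t) (count_space {1..})" using S' unfolding strong_solution_on_def by blast
   from measurable_space[OF this, of w] that elim(7) show ?thesis by simp
  qed
  have eq: "g w x = G x" if x: "0 < fst x" for x
  proof -
   define s where "s = fst x"
   obtain n where "s \<le> real n" using real_arch_simple by blast
   hence "s \<in> {0<..real (Suc n)}" using x by (simp add: s_def)
   then obtain l where "((\<lambda>u. a u w) \<longlongrightarrow> l) (at_left s)" using elim(2) unfolding cadlag_on_def by blast
   hence l: "\<forall>\<^sub>F u in at_left s. a u w = l" by (simp add: tendsto_discrete)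
   moreover have "\<forall>\<^sub>F u in at_left s. 0 < u" unfolding eventually_at_left_field using x by (auto simp: s_def)
   ultimately have "\<forall>\<^sub>F u in at_left s. 1 \<le> l" by eventually_elim (use a1 in \<open>auto simp: less_imp_le\<close>)
   hence "1 \<le> l" by (simp add: trivial_limit_at_left_real)
   thus ?thesis using left_limit_eventually[OF l]
    by (simp add: g_def G_def jumps_def height_def case_prod_beta s_def)
  qed
  have s: "{0<..t} \<times> UNIV \<in> sets (p w)" for t by (rule \<mu>.strip_sets) simp
  have G: "\<mu>.integrand G" unfolding \<mu>.integrand_def
  proof (intro conjI allI impI)
   fix t :: real assume t: "0 < t"
   obtain n where "t \<le> real n" using real_arch_simple by blast
   hence "{0<..t} \<times> (UNIV :: real set) \<subseteq> {0<..real (Suc n)} \<times> UNIV" by auto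
   hence "set_integrable (p w) ({0<..t} \<times> UNIV) (g w)" using elim(5) s by (blast intro: set_integrable_subset)
   hence "set_integrable (p w) ({0<..t} \<times> UNIV) G"
    by (rule set_integrable_cong[THEN iffD1, OF refl refl, rotated]) (auto simp: eq)
   thus "set_borel_measurable (p w) ({0<..t} \<times> UNIV) G"
    unfolding set_integrable_def set_borel_measurable_def by (rule borel_measurable_integrable)
  next
   fix t z :: real assume t: "0 < t" and z: "z \<notin> {0..M}"
   obtain n where n: "t \<le> real n" using real_arch_simple by blast
   have "continuous_on {-r..t} (\<lambda>u. X u w)"
    by (rule continuous_on_subset[OF spec[OF elim(1), of n]]) (use n in auto)
   thus "G (t, z) = 0" unfolding G_def using t z by (rule jumps_support)
  qed
  have "real (a t w) = real (a 0 w) + \<mu>.J G t" if "0 \<le> t" for t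
  proof -
   obtain n where "t \<le> real n" using real_arch_simple by blast
   hence "t \<in> {0..real (Suc n)}" using that by simp
   hence "real (a t w) = real (a 0 w) + (LINT x:{0<..t} \<times> UNIV|p w. g w x)" using elim(5) by blast
   also have "(LINT x:{0<..t} \<times> UNIV|p w. g w x) = \<mu>.J G t"
    unfolding \<mu>.J_def by (rule set_lebesgue_integral_cong[OF s]) (auto simp: eq)
   finally show ?thesis .
  qed
  thus ?case using elim(3,4) G unfolding G_def by blast
 qed
qed

text \<open>Real induction on the equality of the switching paths: just after \<open>t\<close> both
  jump integrals stand still, and equality before \<open>t\<close> is carried to \<open>t\<close> by
  comparing integrands. The diffusions follow.\<close>

lemma strong_solution_unique:
 assumes S: "strong_solution P F W p r b \<sigma> q \<xi> i\<^sub>0 X a" and S': "strong_solution P F W p r b \<sigma> q \<xi> i\<^sub>0 X' a'"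
 shows "AE w in P. (\<forall>t\<ge>-r. X' t w = X t w) \<and> (\<forall>t\<ge>0. a' t w = a t w)"
proof -
 have "AE w in P. \<forall>n. \<forall>t\<in>{0..real (Suc n)}. X 0 w = X' 0 w -->
  (\<forall>s. 0 \<le> s --> s < t --> a s w = a' s w) --> X t w = X' t w"
  unfolding AE_all_countable
 proof
  fix n
  have n: "0 < real (Suc n)" by simp
  show "AE w in P. \<forall>t\<in>{0..real (Suc n)}. X 0 w = X' 0 w -->
   (\<forall>s. 0 \<le> s --> s < t --> a s w = a' s w) --> X t w = X' t w"
   by (rule sde_local_uniqueness[OF n strong_solution_sde(1)[OF S n] strong_solution_sde(1)[OF S' n]
      strong_solution_sde(2,3)[OF S n] strong_solution_sde(2,3)[OF S' n]])
 qed
 thus ?thesis using strong_solution_paths[OF S] strong_solution_paths[OF S'] good_config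
 proof eventually_elim
  case (elim w)
  interpret \<mu>: point_config M "p w" by (rule elim(4))
  define g where "g = jumps (\<lambda>u. X u w) (\<lambda>u. a u w)"
  define g' where "g' = jumps (\<lambda>u. X' u w) (\<lambda>u. a' u w)"
  have init: "X t w = X' t w" if "-r \<le> t" "t \<le> 0" for t using elim(2,3) that by simp
  have X: "X t w = X' t w" if t: "-r \<le> t" and e: "\<And>s. 0 \<le> s ==> s < t ==> a s w = a' s w" for t
  proof (cases "t \<le> 0")
   case False
   obtain n where "t \<le> real n" using real_arch_simple by blast
   hence "t \<in> {0..real (Suc n)}" using False by simp
   moreover have "X 0 w = X' 0 w" using init r_pos by simp
   ultimately show ?thesis using elim(1) e by blast
  qed (rule init[OF t])
  have g: "\<mu>.integrand g" "\<mu>.integrand g'" using elim(2,3) by (simp_all add: g_def g'_def)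
  have a: "real (a t w) = real (i\<^sub>0 w) + \<mu>.J g t" "real (a' t w) = real (i\<^sub>0 w) + \<mu>.J g' t" if "0 \<le> t" for t
   using elim(2,3) that by (simp_all add: g_def g'_def)
  have eq: "a t w = a' t w" if "0 \<le> t" for t
  proof (rule real_induction[where Q="\<lambda>t. a t w = a' t w", OF _ _ _ that])
   show "a 0 w = a' 0 w" using elim(2,3) by simp
  next
   fix t :: real assume t: "0 \<le> t" and *: "\<And>s. 0 \<le> s ==> s \<le> t ==> a s w = a' s w"
   obtain \<epsilon> where e: "\<epsilon> > 0" "\<And>u. t \<le> u ==> u \<le> t + \<epsilon> ==> \<mu>.J g u = \<mu>.J g t" using \<mu>.J_right[OF g(1) t] by blast
   obtain \<epsilon>' where e': "\<epsilon>' > 0" "\<And>u. t \<le> u ==> u \<le> t + \<epsilon>' ==> \<mu>.J g' u = \<mu>.J g' t" using \<mu>.J_right[OF g(2) t] by blast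
   have "a u w = a' u w" if u: "t \<le> u" "u \<le> t + min \<epsilon> \<epsilon>'" for u
   proof -
    have "0 \<le> u" "u \<le> t + \<epsilon>" "u \<le> t + \<epsilon>'" using u t by auto
    hence "real (a u w) = real (a' u w)"
     using a(1)[of u] a(2)[of u] a(1)[OF t] a(2)[OF t] e(2)[OF u(1)] e'(2)[OF u(1)] *[OF t order_refl] by simp
    thus ?thesis by simp
   qed
   thus "\<exists>\<epsilon>>0. \<forall>u. t \<le> u --> u \<le> t + \<epsilon> --> a u w = a' u w"
    using e(1) e'(1) by (intro exI[of _ "min \<epsilon> \<epsilon>'"]) simp
  next
   fix t :: real assume t: "0 < t" and *: "\<And>s. 0 \<le> s ==> s < t ==> a s w = a' s w"
   \<comment> \<open>The case \<open>s = t\<close> is included: the diffusions agree at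
     \<open>t\<close> because the switching paths agree before \<open>t\<close>, and only left
     limits of the latter enter.\<close>
   have gg: "g (s, z) = g' (s, z)" if s: "0 < s" "s \<le> t" for s z
    unfolding g_def g'_def
   proof (rule jumps_cong[OF s(1)])
    show "X u w = X' u w" if "-r \<le> u" "u \<le> s" for u by (rule X[OF that(1)]) (use * that s in auto)
    show "a u w = a' u w" if "0 \<le> u" "u < s" for u by (rule *) (use that s in auto)
   qed
   have "\<mu>.J g t = \<mu>.J g' t" unfolding \<mu>.J_def
    by (rule set_lebesgue_integral_cong) (auto intro!: \<mu>.strip_sets gg)
   thus "a t w = a' t w" using a(1)[of t] a(2)[of t] t by simp
  qed
  have "X t w = X' t w" if "-r \<le> t" for t by (rule X[OF that eq])
  thus ?case using eq by simp
 qed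
qed

end

theorem theorem3p1:
  fixes r :: real
    and P :: "'a measure"
    and F :: "real \<Rightarrow> 'a measure"
    and W :: "real \<Rightarrow> 'a \<Rightarrow> real ^ 'd"
    and p :: "'a \<Rightarrow> (real \<times> real) measure"
    and b :: "real ^ 'n \<Rightarrow> nat \<Rightarrow> real ^ 'n"
    and \<sigma> :: "real ^ 'n \<Rightarrow> nat \<Rightarrow> real ^ 'd ^ 'n"
    and q :: "nat \<Rightarrow> nat \<Rightarrow> (real \<Rightarrow> real ^ 'n) \<Rightarrow> real"
    and \<xi> :: "'a \<Rightarrow> real \<Rightarrow> real ^ 'n"
    and i\<^sub>0 :: "'a \<Rightarrow> nat"
  assumes "r > 0"
    and "usual_conditions P F"
    and "brownian_motion P F W"
    and "adapted_poisson_random_measure P F p"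
    and "independent_noises P W p"
    and "\<And>i j \<phi>. i \<in> {1..} \<Longrightarrow> j \<in> {1..} \<Longrightarrow> i \<noteq> j \<Longrightarrow> \<phi> \<in> mspace (path_space r) \<Longrightarrow> 0 \<le> q i j \<phi>"
    and "\<And>i. i \<in> {1..} \<Longrightarrow>
      \<exists>L>0. \<forall>x y. norm (b x i - b y i) + norm (\<sigma> x i - \<sigma> y i) \<le> L * norm (x - y)"
    and "\<And>i j. i \<in> {1..} \<Longrightarrow> j \<in> {1..} \<Longrightarrow> i \<noteq> j \<Longrightarrow> q i j \<in> borel_measurable (path_borel r)"
    and "(SUP \<phi>\<in>mspace (path_space r). SUP i\<in>{1..}. total_rate q i \<phi>) < \<infinity>"
    and "\<xi> \<in> measurable (F 0) (path_borel r)"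
    and "i\<^sub>0 \<in> measurable (F 0) (count_space {1..})"
  shows "\<exists>X \<alpha>. strong_solution P F W p r b \<sigma> q \<xi> i\<^sub>0 X \<alpha> \<and>
    (\<forall>X' \<alpha>'. strong_solution P F W p r b \<sigma> q \<xi> i\<^sub>0 X' \<alpha>' \<longrightarrow>
      (AE \<omega> in P. (\<forall>t\<ge>-r. X' t \<omega> = X t \<omega>) \<and> (\<forall>t\<ge>0. \<alpha>' t \<omega> = \<alpha> t \<omega>)))"
proof -
 have "prob_space P" using assms(2) unfolding usual_conditions_def by blast
 then interpret prob_space P .
 interpret filtered_space P F by unfold_locales (rule assms(2))
 obtain M where "switching r q M" using switchingI[OF assms(1,6,8,9)] by blast
 then interpret switching r q M .
 have "\<exists>L. i \<in> {1..} --> (0 < L \<and> (\<forall>x y. norm (b x i - b y i) + norm (\<sigma> x i - \<sigma> y i) \<le> L * norm (x - y)))" for i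
  using assms(7)[of i] by blast
 then obtain L where L: "\<And>i. 1 \<le> i ==> 0 < L i"
   "\<And>i x y. 1 \<le> i ==> norm (b x i - b y i) + norm (\<sigma> x i - \<sigma> y i) \<le> L i * norm (x - y)"
  by (metis atLeast_iff)
 \<comment> \<open>Zero coefficients at index 0 make the Lipschitz conditions hold for all natural
   numbers.\<close>
 define b' where "b' x i = (if 1 \<le> i then b x i else 0)" for x i
 define \<sigma>' where "\<sigma>' x i = (if 1 \<le> i then \<sigma> x i else 0)" for x i
 \<comment> \<open>The sizes at the origin are added to the Lipschitz constant, since
   \<open>sde_space\<close> bounds them by the same function.\<close>
 define K where "K i = (if 1 \<le> i then L i + norm (b 0 i) + norm (\<sigma> 0 i) else 0)" for i
 have LK: "norm (b x i - b y i) + norm (\<sigma> x i - \<sigma> y i) \<le> K i * norm (x - y)" if "1 \<le> i" for x y i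
  by (rule order_trans[OF L(2)[OF that, of x y] mult_right_mono]) (use that in \<open>simp_all add: K_def\<close>)
 have LK': "norm (b x i - b y i) \<le> K i * norm (x - y)" "norm (\<sigma> x i - \<sigma> y i) \<le> K i * norm (x - y)" if "1 \<le> i" for x y i
  using LK[OF that, of x y] norm_ge_zero[of "b x i - b y i"] norm_ge_zero[of "\<sigma> x i - \<sigma> y i"] by linarith+
 interpret hybrid_space P F W b' \<sigma>' K p r q M \<xi> i\<^sub>0
 proof
  show "brownian_motion P F W" by (rule assms(3))
  show "norm (b' x i - b' y i) \<le> K i * norm (x - y)" for x y i
   using LK'(1)[of i x y] by (cases "1 \<le> i") (simp_all add: b'_def K_def)
  show "norm (\<sigma>' x i - \<sigma>' y i) \<le> K i * norm (x - y)" for x y i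
   using LK'(2)[of i x y] by (cases "1 \<le> i") (simp_all add: \<sigma>'_def K_def)
  show "norm (b' 0 i) \<le> K i" for i using L(1)[of i] by (auto simp: b'_def K_def)
  show "norm (\<sigma>' 0 i) \<le> K i" for i using L(1)[of i] by (auto simp: \<sigma>'_def K_def)
 qed (rule assms)+
 have to: "strong_solution P F W p r b' \<sigma>' q \<xi> i\<^sub>0 X \<alpha>" if "strong_solution P F W p r b \<sigma> q \<xi> i\<^sub>0 X \<alpha>" for X \<alpha>
  unfolding strong_solution_def
 proof (intro allI impI)
  fix T :: real assume "0 < T"
  hence "strong_solution_on P F W p r b \<sigma> q \<xi> i\<^sub>0 T X \<alpha>" using that unfolding strong_solution_def by blast
  thus "strong_solution_on P F W p r b' \<sigma>' q \<xi> i\<^sub>0 T X \<alpha>"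
   by (rule strong_solution_on_cong[rotated 2]) (simp_all add: b'_def \<sigma>'_def)
 qed
 have "strong_solution P F W p r b \<sigma> q \<xi> i\<^sub>0 solution limit_switch"
  unfolding strong_solution_def
 proof (intro allI impI)
  fix T :: real assume "0 < T"
  hence "strong_solution_on P F W p r b' \<sigma>' q \<xi> i\<^sub>0 T solution limit_switch"
   using strong_solution_exists unfolding strong_solution_def by blast
  thus "strong_solution_on P F W p r b \<sigma> q \<xi> i\<^sub>0 T solution limit_switch"
   by (rule strong_solution_on_cong[rotated 2]) (simp_all add: b'_def \<sigma>'_def)
 qed
 thus ?thesis using strong_solution_unique[OF strong_solution_exists to] by blast
qed

end
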